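(* Let $M\subset\mathbb{C}^N$ be a smooth generic submanifold of codimension $d$ through the origin, let $\gamma$ be a Segre variety mapping of $M$ at $0$, let $v^j$, $j\ge1$, be the iterated Segre mappings of $M$ at $0$ relative to $\gamma$, and let $k_0$ be the integer, $1\le k_0\le d+1$, such that $\mathrm{Rk}\, v^j=\mathrm{Rk}\, v^{j+1}$ for $j\ge k_0$ and $\mathrm{Rk}\, v^j<\mathrm{Rk}\, v^{j+1}$ for $1\le j\le k_0-1$. Let $e=2N-d-\dim_{\mathbb{C}}\mathfrak{g}_M(0)$. Then $$\mathrm{Rk}\, v^{k_0}=N-e.$$
   Context: Let $M\subset\mathbb{C}^N$ be a smooth ($C^\infty$) real submanifold of (real) codimension $d$ with $0\in M$, defined near $0$ by $r=0$, where $r=(r_1,\dots,r_d)$ are smooth real-valued functions with $dr_1,\dots,dr_d$ linearly independent at $0$. $M$ is generic (near the origin) if the complex differentials $\partial r_1,\dots,\partial r_d$ (the $dZ$-parts of the differentials) are also linearly independent at $0$. Put $n=N-d$. Let $\rho_j(Z,\bar Z)$ be the Taylor series of $r_j$ at $0$; regard $\rho_j(Z,\zeta)$ as a formal power series in $2N$ indeterminates $(Z,\zeta)$, and write $\rho=(\rho_1,\dots,\rho_d)$. A formal mapping $F\colon(\mathbb{C}^k,0)\to(\mathbb{C}^p,0)$ is a $p$-tuple $F(x)=(F_1(x),\dots,F_p(x))$, $x=(x_1,\dots,x_k)$, of formal power series $F_j\in\mathbb{C}[[x]]$ without constant terms. Its rank $\mathrm{Rk}\,F$ is the rank of the Jacobian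 matrix $\partial F/\partial x$ over the field of fractions of $\mathbb{C}[[x]]$. For a formal mapping $F$, $\bar F(x):=\overline{F(\bar x)}$, i.e. the coefficients are replaced by their complex conjugates. A Segre variety mapping of $M$ at $0$ is a formal mapping $\gamma(\zeta,t)\colon(\mathbb{C}^N\times\mathbb{C}^n,0)\to(\mathbb{C}^N,0)$ such that $\rho(\gamma(\zeta,t),\zeta)=0$ and the matrix $\frac{\partial\gamma}{\partial t}(0,0)$ has rank $n$. The iterated Segre mappings $v^j\colon(\mathbb{C}^{nj},0)\to(\mathbb{C}^N,0)$ relative to $\gamma$ are defined inductively, with $t^i=(t^i_1,\dots,t^i_n)$, by $$v^1(t^1):=\gamma(0,t^1),\qquad v^{j+1}(t^1,\dots,t^{j+1}):=\gamma(\bar v^{j}(t^1,\dots,t^j),t^{j+1}).$$ An integer $k_0$ with the stated properties exists and is unique. Let $\mathfrak{g}_M$ be the Lie algebra generated by the smooth $(1,0)$ and $(0,1)$ vector fields tangent to $M$ near $0$, and let $\mathfrak{g}_M(0)$ be the subspace of the complexified tangent space $\mathbb{C}T_0M$ obtained by evaluating the vector fields in $\mathfrak{g}_M$ at $0$. *)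

theory Defs
  imports
    "HOL-Analysis.Analysis"
    "HOL-Library.Poly_Mapping"
    "HOL-Library.Groups_Big_Fun"
    "HOL-Computational_Algebra.Fraction_Field"
begin

section \<open>Formal power series over the complex numbers in variables indexed by a type\<close>

text \<open>
  A monomial is a finitely supported exponent vector \<open>'v \<Rightarrow>\<^sub>0 nat\<close>, and a series is an arbitrary
  family of coefficients.  The variable type may be infinite; the ring of power series in a
  set \<open>X\<close> of variables is the subring of all \<open>f\<close> with \<open>mfps_in X f\<close> (below).
\<close>

typedef 'v mfps = "UNIV :: (('v \<Rightarrow>\<^sub>0 nat) \<Rightarrow> complex) set"
  morphisms mcoeff Abs_mfps ..

setup_lifting type_definition_mfps

lemma mfps_eqI: "(\<And>m. mcoeff f m = mcoeff g m) \<Longrightarrow> f = g"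
  by transfer blast

lemma mcoeff_Abs_mfps [simp]: "mcoeff (Abs_mfps c) = c"
  by (simp add: Abs_mfps_inverse)

lemma finite_monomials_le: "finite {a :: 'v \<Rightarrow>\<^sub>0 nat. \<forall>v. Poly_Mapping.lookup a v \<le> Poly_Mapping.lookup m v}"
proof -
  let ?S = "{a :: 'v \<Rightarrow>\<^sub>0 nat. \<forall>v. Poly_Mapping.lookup a v \<le> Poly_Mapping.lookup m v}"
  let ?K = "Max (insert 0 (Poly_Mapping.lookup m ` Poly_Mapping.keys m))"
  have "Poly_Mapping.lookup ` ?S \<subseteq> {f. \<forall>x. (x \<in> Poly_Mapping.keys m \<longrightarrow> f x \<in> {..?K}) \<and> (x \<notin> Poly_Mapping.keys m \<longrightarrow> f x = 0)}"
  proof clarsimp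
    fix a :: "'v \<Rightarrow>\<^sub>0 nat" and x
    assume a: "\<forall>v. Poly_Mapping.lookup a v \<le> Poly_Mapping.lookup m v"
    have "Poly_Mapping.lookup a x \<le> ?K" if "x \<in> Poly_Mapping.keys m"
    proof -
      have "Poly_Mapping.lookup m x \<le> ?K" using that by (intro Max_ge) auto
      with a show ?thesis by (meson le_trans)
    qed
    moreover have "Poly_Mapping.lookup a x = 0" if "x \<notin> Poly_Mapping.keys m"
      using a that by (metis in_keys_iff le_zero_eq)
    ultimately show "(x \<in> Poly_Mapping.keys m \<longrightarrow> Poly_Mapping.lookup a x \<le> ?K) \<and> (x \<notin> Poly_Mapping.keys m \<longrightarrow> Poly_Mapping.lookup a x = 0)"
      by blast
  qed
  moreover have "finite {f. \<forall>x. (x \<in> Poly_Mapping.keys m \<longrightarrow> f x \<in> {..?K}) \<and> (x \<notin> Poly_Mapping.keys m \<longrightarrow> f x = (0::nat))}"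
    by (rule finite_set_of_finite_funs) auto
  ultimately have "finite (Poly_Mapping.lookup ` ?S)" by (rule finite_subset)
  then show ?thesis
    by (rule finite_imageD) (auto intro: inj_onI poly_mapping_eqI)
qed

lemma finite_splits [simp, intro]: "finite {(a, b). a + b = (m :: 'v \<Rightarrow>\<^sub>0 nat)}"
proof -
  have "{(a, b). a + b = m} \<subseteq> (\<lambda>a. (a, m - a)) ` {a. \<forall>v. Poly_Mapping.lookup a v \<le> Poly_Mapping.lookup m v}"
    by (auto simp: image_iff lookup_add)
  then show ?thesis
    using finite_monomials_le finite_surj by blast
qed

instantiation mfps :: (type) "{zero, one, plus, minus, uminus, times}"
begin

lift_definition zero_mfps :: "'v mfps" is "\<lambda>_. 0" .

lift_definition one_mfps :: "'v mfps" is "\<lambda>m. if m = 0 then 1 else 0" .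

lift_definition plus_mfps :: "'v mfps \<Rightarrow> 'v mfps \<Rightarrow> 'v mfps" is "\<lambda>f g m. f m + g m" .

lift_definition minus_mfps :: "'v mfps \<Rightarrow> 'v mfps \<Rightarrow> 'v mfps" is "\<lambda>f g m. f m - g m" .

lift_definition uminus_mfps :: "'v mfps \<Rightarrow> 'v mfps" is "\<lambda>f m. - f m" .

lift_definition times_mfps :: "'v mfps \<Rightarrow> 'v mfps \<Rightarrow> 'v mfps"
  is "\<lambda>f g m. \<Sum>(a, b) \<in> {(a, b). a + b = m}. f a * g b" .

instance ..

end

lemma sum_splits_assoc:
  fixes F :: "('v \<Rightarrow>\<^sub>0 nat) \<Rightarrow> ('v \<Rightarrow>\<^sub>0 nat) \<Rightarrow> ('v \<Rightarrow>\<^sub>0 nat) \<Rightarrow> complex"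
  shows "(\<Sum>(p, c) \<in> {(p, c). p + c = m}. \<Sum>(a, b) \<in> {(a, b). a + b = p}. F a b c) =
         (\<Sum>(a, q) \<in> {(a, q). a + q = m}. \<Sum>(b, c) \<in> {(b, c). b + c = q}. F a b c)"
proof -
  have "(\<Sum>(p, c) \<in> {(p, c). p + c = m}. \<Sum>(a, b) \<in> {(a, b). a + b = p}. F a b c) =
        (\<Sum>x \<in> {(p, c). p + c = m}. \<Sum>y \<in> {(a, b). a + b = fst x}. F (fst y) (snd y) (snd x))"
    by (simp add: case_prod_unfold)
  also have "\<dots> = (\<Sum>(x, y) \<in> (SIGMA x : {(p, c). p + c = m}. {(a, b). a + b = fst x}).
                     F (fst y) (snd y) (snd x))"
    by (rule sum.Sigma) auto
  also have "\<dots> = (\<Sum>(x, y) \<in> (SIGMA x : {(a, q). a + q = m}. {(b, c). b + c = snd x}).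
                     F (fst x) (fst y) (snd y))"
    by (rule sum.reindex_bij_witness
          [where i = "\<lambda>((a, q), (b, c)). ((a + b, c), (a, b))"
             and j = "\<lambda>((p, c), (a, b)). ((a, b + c), (b, c))"])
       (auto simp: add.assoc)
  also have "\<dots> = (\<Sum>x \<in> {(a, q). a + q = m}. \<Sum>y \<in> {(b, c). b + c = snd x}.
                     F (fst x) (fst y) (snd y))"
    by (rule sum.Sigma [symmetric]) auto
  also have "\<dots> = (\<Sum>(a, q) \<in> {(a, q). a + q = m}. \<Sum>(b, c) \<in> {(b, c). b + c = q}. F a b c)"
    by (simp add: case_prod_unfold)
  finally show ?thesis .
qed

instance mfps :: (type) comm_ring_1
proof
  fix f g h :: "'v mfps"
  show "f + g + h = f + (g + h)" by transfer (simp add: add.assoc)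
  show "f + g = g + f" by transfer (simp add: add.commute)
  show "0 + f = f" by transfer simp
  show "- f + f = 0" by transfer simp
  show "f - g = f + - g" by transfer simp
  show "f * g * h = f * (g * h)"
  proof (rule mfps_eqI)
    fix m
    have "mcoeff (f * g * h) m =
        (\<Sum>(p, c) \<in> {(p, c). p + c = m}. \<Sum>(a, b) \<in> {(a, b). a + b = p}. mcoeff f a * mcoeff g b * mcoeff h c)"
      by (simp add: times_mfps.rep_eq case_prod_unfold sum_distrib_right)
    also have "\<dots> =
        (\<Sum>(a, q) \<in> {(a, q). a + q = m}. \<Sum>(b, c) \<in> {(b, c). b + c = q}. mcoeff f a * mcoeff g b * mcoeff h c)"
      by (rule sum_splits_assoc)
    also have "\<dots> = mcoeff (f * (g * h)) m"
      by (simp add: times_mfps.rep_eq case_prod_unfold sum_distrib_left mult.assoc)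
    finally show "mcoeff (f * g * h) m = mcoeff (f * (g * h)) m" .
  qed
  show "f * g = g * f"
  proof (rule mfps_eqI)
    fix m
    have "(\<Sum>(a, b) \<in> {(a, b). a + b = m}. mcoeff f a * mcoeff g b) =
          (\<Sum>(a, b) \<in> {(a, b). a + b = m}. mcoeff g a * mcoeff f b)"
      by (rule sum.reindex_bij_witness [where i = prod.swap and j = prod.swap])
         (auto simp: add.commute mult.commute)
    then show "mcoeff (f * g) m = mcoeff (g * f) m"
      by (simp add: times_mfps.rep_eq)
  qed
  show "1 * f = f"
  proof (rule mfps_eqI)
    fix m
    have "(\<Sum>(a, b) \<in> {(a, b). a + b = m}. mcoeff (1 :: 'v mfps) a * mcoeff f b) =
          (\<Sum>(a, b) \<in> {(0, m)}. mcoeff (1 :: 'v mfps) a * mcoeff f b)"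
      by (rule sum.mono_neutral_right) (auto simp: one_mfps.rep_eq split: if_splits)
    then show "mcoeff (1 * f) m = mcoeff f m"
      by (simp add: times_mfps.rep_eq one_mfps.rep_eq)
  qed
  show "(f + g) * h = f * h + g * h"
    by (rule mfps_eqI)
       (simp add: times_mfps.rep_eq plus_mfps.rep_eq case_prod_unfold distrib_right sum.distrib)
  show "(0 :: 'v mfps) \<noteq> 1"
    by (metis one_mfps.rep_eq zero_mfps.rep_eq zero_neq_one)
qed

lemma mfps_leading_monomial:
  fixes f :: "'v mfps" and \<phi> :: "('v \<Rightarrow>\<^sub>0 nat) \<Rightarrow> 'b :: linorder"
  assumes V: "finite V" and m0: "mcoeff f m0 \<noteq> 0" "Poly_Mapping.keys m0 \<subseteq> V"
  defines "D \<equiv> \<lambda>m. \<Sum>v\<in>V. Poly_Mapping.lookup m v"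
  obtains a where "mcoeff f a \<noteq> 0" "Poly_Mapping.keys a \<subseteq> V"
    "\<And>p. mcoeff f p \<noteq> 0 \<Longrightarrow> Poly_Mapping.keys p \<subseteq> V \<Longrightarrow> D a \<le> D p"
    "\<And>p. mcoeff f p \<noteq> 0 \<Longrightarrow> Poly_Mapping.keys p \<subseteq> V \<Longrightarrow> D p = D a \<Longrightarrow> \<phi> a \<le> \<phi> p"
proof -
  define P where "P = (\<lambda>d. \<exists>m. mcoeff f m \<noteq> 0 \<and> Poly_Mapping.keys m \<subseteq> V \<and> D m = d)"
  define d where "d = (LEAST d. P d)"
  define T where "T = {m. mcoeff f m \<noteq> 0 \<and> Poly_Mapping.keys m \<subseteq> V \<and> D m = d}"
  have "P (D m0)" using m0 by (auto simp: P_def)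
  then have "P d" unfolding d_def by (rule LeastI)
  then have ne: "T \<noteq> {}" by (auto simp: P_def T_def)
  have dmin: "d \<le> D p" if "mcoeff f p \<noteq> 0" "Poly_Mapping.keys p \<subseteq> V" for p
    unfolding d_def using that by (intro Least_le) (auto simp: P_def)
  have "Poly_Mapping.lookup ` T \<subseteq> {g. \<forall>x. (x \<in> V \<longrightarrow> g x \<in> {..d}) \<and> (x \<notin> V \<longrightarrow> g x = 0)}"
  proof clarsimp
    fix m x assume m: "m \<in> T"
    then have k: "Poly_Mapping.keys m \<subseteq> V" and Dm: "D m = d" by (auto simp: T_def)
    have "Poly_Mapping.lookup m x \<le> d" if "x \<in> V"
      unfolding Dm [symmetric] D_def by (rule member_le_sum) (use that V in auto)
    moreover have "Poly_Mapping.lookup m x = 0" if "x \<notin> V"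
      using k that by (meson in_keys_iff subsetD)
    ultimately show "(x \<in> V \<longrightarrow> Poly_Mapping.lookup m x \<le> d) \<and> (x \<notin> V \<longrightarrow> Poly_Mapping.lookup m x = 0)" by blast
  qed
  moreover have "finite {g. \<forall>x. (x \<in> V \<longrightarrow> g x \<in> {..d}) \<and> (x \<notin> V \<longrightarrow> g x = (0::nat))}"
    by (rule finite_set_of_finite_funs) (use V in auto)
  ultimately have "finite (Poly_Mapping.lookup ` T)" by (rule finite_subset)
  then have fin: "finite T"
    by (rule finite_imageD) (auto intro: inj_onI poly_mapping_eqI)
  have "Min (\<phi> ` T) \<in> \<phi> ` T" using fin ne by (intro Min_in) auto
  then obtain a where a: "a \<in> T" "\<phi> a = Min (\<phi> ` T)" by auto
  have "\<phi> a \<le> \<phi> p" if "p \<in> T" for p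
    unfolding a(2) using fin that by (intro Min_le) auto
  then show thesis
    using a(1) dmin by (intro that [of a]) (auto simp: T_def)
qed

instance mfps :: (type) idom
proof
  fix f g :: "'v mfps"
  assume "f \<noteq> 0" "g \<noteq> 0"
  then obtain m0 m1 where m0: "mcoeff f m0 \<noteq> 0" and m1: "mcoeff g m1 \<noteq> 0"
    by (metis mfps_eqI zero_mfps.rep_eq)
  define V where "V = Poly_Mapping.keys m0 \<union> Poly_Mapping.keys m1"
  have V: "finite V" by (simp add: V_def)
  obtain e :: "'v \<Rightarrow> nat" where e: "inj_on e V"
    using V finite_imp_inj_to_nat_seg by blast
  define D where "D = (\<lambda>m :: 'v \<Rightarrow>\<^sub>0 nat. \<Sum>v\<in>V. Poly_Mapping.lookup m v)"
  define \<phi> where "\<phi> = (\<lambda>m :: 'v \<Rightarrow>\<^sub>0 nat. \<Sum>v\<in>V. Poly_Mapping.single (e v) (Poly_Mapping.lookup m v))"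
  have D_add: "D (p + q) = D p + D q" for p q
    by (simp add: D_def lookup_add sum.distrib)
  have \<phi>_add: "\<phi> (p + q) = \<phi> p + \<phi> q" for p q
    by (simp add: \<phi>_def lookup_add single_add sum.distrib)
  have \<phi>_lookup: "Poly_Mapping.lookup (\<phi> p) (e v) = Poly_Mapping.lookup p v" if "v \<in> V" for p v
  proof -
    have "Poly_Mapping.lookup (\<phi> p) (e v) = (\<Sum>w\<in>V. Poly_Mapping.lookup (Poly_Mapping.single (e w) (Poly_Mapping.lookup p w)) (e v))"
      by (simp add: \<phi>_def lookup_sum)
    also have "\<dots> = (\<Sum>w\<in>V. if w = v then Poly_Mapping.lookup p w else 0)"
      by (rule sum.cong) (use e that in \<open>auto simp: lookup_single when_def dest: inj_onD\<close>)
    finally show ?thesis using V that by simp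
  qed
  have \<phi>_inj: "p = q" if "\<phi> p = \<phi> q" "Poly_Mapping.keys p \<subseteq> V" "Poly_Mapping.keys q \<subseteq> V" for p q
  proof (rule poly_mapping_eqI)
    fix v show "Poly_Mapping.lookup p v = Poly_Mapping.lookup q v"
      using that \<phi>_lookup by (cases "v \<in> V") (metis, metis in_keys_iff subsetD)
  qed
  obtain a where a: "mcoeff f a \<noteq> 0" "Poly_Mapping.keys a \<subseteq> V"
    "\<And>p. mcoeff f p \<noteq> 0 \<Longrightarrow> Poly_Mapping.keys p \<subseteq> V \<Longrightarrow> D a \<le> D p"
    "\<And>p. mcoeff f p \<noteq> 0 \<Longrightarrow> Poly_Mapping.keys p \<subseteq> V \<Longrightarrow> D p = D a \<Longrightarrow> \<phi> a \<le> \<phi> p"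
    using mfps_leading_monomial [of V f m0 \<phi>] V m0 unfolding D_def V_def by blast
  obtain b where b: "mcoeff g b \<noteq> 0" "Poly_Mapping.keys b \<subseteq> V"
    "\<And>p. mcoeff g p \<noteq> 0 \<Longrightarrow> Poly_Mapping.keys p \<subseteq> V \<Longrightarrow> D b \<le> D p"
    "\<And>p. mcoeff g p \<noteq> 0 \<Longrightarrow> Poly_Mapping.keys p \<subseteq> V \<Longrightarrow> D p = D b \<Longrightarrow> \<phi> b \<le> \<phi> p"
    using mfps_leading_monomial [of V g m1 \<phi>] V m1 unfolding D_def V_def by blast
  have uniq: "p = a \<and> q = b" if pq: "p + q = a + b" and nz: "mcoeff f p \<noteq> 0" "mcoeff g q \<noteq> 0" for p q
  proof -
    have "Poly_Mapping.keys p \<union> Poly_Mapping.keys q \<subseteq> Poly_Mapping.keys (p + q)"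
      by (auto simp: in_keys_iff lookup_add)
    also have "\<dots> \<subseteq> V"
      unfolding pq using a(2) b(2) Poly_Mapping.keys_add [of a b] by blast
    finally have k: "Poly_Mapping.keys p \<subseteq> V" "Poly_Mapping.keys q \<subseteq> V" by auto
    have "D p + D q = D a + D b" by (metis D_add pq)
    then have D: "D p = D a" "D q = D b"
      using a(3) [OF nz(1) k(1)] b(3) [OF nz(2) k(2)] by linarith+
    have le: "\<phi> a \<le> \<phi> p" "\<phi> b \<le> \<phi> q"
      using a(4) b(4) nz k D by auto
    have eq: "\<phi> p + \<phi> q = \<phi> a + \<phi> b" by (metis \<phi>_add pq)
    have "\<phi> p = \<phi> a"
    proof (rule ccontr)
      assume "\<phi> p \<noteq> \<phi> a"
      with le(1) have "\<phi> a < \<phi> p" by simp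
      then have "\<phi> a + \<phi> b < \<phi> p + \<phi> q" using le(2) by (rule add_less_le_mono)
      with eq show False by simp
    qed
    then have "p = a" using \<phi>_inj k a(2) by blast
    with pq show ?thesis by simp
  qed
  have "mcoeff (f * g) (a + b) = (\<Sum>(p, q) \<in> {(a, b)}. mcoeff f p * mcoeff g q)"
    unfolding times_mfps.rep_eq
    by (rule sum.mono_neutral_right) (use uniq in auto)
  then have "mcoeff (f * g) (a + b) \<noteq> 0" using a(1) b(1) by simp
  then show "f * g \<noteq> 0" by (auto simp: zero_mfps.rep_eq)
qed

definition mfps_in :: "'v set \<Rightarrow> 'v mfps \<Rightarrow> bool"
  where "mfps_in X f \<longleftrightarrow> (\<forall>m. mcoeff f m \<noteq> 0 \<longrightarrow> Poly_Mapping.keys m \<subseteq> X)"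

definition mvar :: "'v \<Rightarrow> 'v mfps"
  where "mvar v = Abs_mfps (\<lambda>m. if m = Poly_Mapping.single v 1 then 1 else 0)"

definition mderiv :: "'v \<Rightarrow> 'v mfps \<Rightarrow> 'v mfps"
  where "mderiv v f =
    Abs_mfps (\<lambda>m. of_nat (Poly_Mapping.lookup m v + 1) * mcoeff f (m + Poly_Mapping.single v 1))"

definition mcnj :: "'v mfps \<Rightarrow> 'v mfps"
  where "mcnj f = Abs_mfps (\<lambda>m. cnj (mcoeff f m))"

definition mpower :: "('v \<Rightarrow> 'w mfps) \<Rightarrow> ('v \<Rightarrow>\<^sub>0 nat) \<Rightarrow> 'w mfps"
  where "mpower F \<alpha> = (\<Prod>v\<in>Poly_Mapping.keys \<alpha>. F v ^ Poly_Mapping.lookup \<alpha> v)"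

text \<open>
  Composition \<open>g(F)\<close>.  If \<open>g\<close> only involves finitely many variables and the series substituted for
  them have no constant term, then for every \<open>m\<close> only finitely many \<open>\<alpha>\<close> contribute, so that
  \<^const>\<open>Sum_any\<close> is the actual sum (it is \<open>0\<close> by convention for infinitely many
  nonzero summands).
\<close>

definition mcomp :: "'v mfps \<Rightarrow> ('v \<Rightarrow> 'w mfps) \<Rightarrow> 'w mfps"
  where "mcomp g F = Abs_mfps (\<lambda>m. Sum_any (\<lambda>\<alpha>. mcoeff g \<alpha> * mcoeff (mpower F \<alpha>) m))"

definition formal_mapping :: "'v set \<Rightarrow> ('p \<Rightarrow> 'v mfps) \<Rightarrow> bool"
  where "formal_mapping X F \<longleftrightarrow> (\<forall>i. mfps_in X (F i) \<and> mcoeff (F i) 0 = 0)"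

text \<open>
  The rank of the Jacobian matrix \<open>\<partial>F/\<partial>x\<close>, \<open>x = (x\<^sub>v)\<close> with \<open>v \<in> X\<close>, as the dimension of
  its column space over the field of fractions of the power series ring.  That field contains
  the field of fractions of the power series in the variables \<open>X\<close> alone; the rank of a matrix with
  entries in the latter does not depend on which of the two fields is used.
\<close>

definition formal_rank :: "'v set \<Rightarrow> ('p :: finite \<Rightarrow> 'v mfps) \<Rightarrow> nat"
  where "formal_rank X F =
    vec.dim ((\<lambda>v. (\<chi> i. Fract (mderiv v (F i)) 1) :: ('v mfps fract) ^ 'p) ` X)"

section \<open>Smooth functions and Wirtinger derivatives on \<open>\<complex>\<^sup>N\<close>\<close>

fun Ck_on :: "nat \<Rightarrow> 'a :: real_normed_vector set \<Rightarrow> ('a \<Rightarrow> 'b :: real_normed_vector) \<Rightarrow> bool"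
  where
    "Ck_on 0 U f \<longleftrightarrow> continuous_on U f"
  | "Ck_on (Suc k) U f \<longleftrightarrow>
       (\<forall>p\<in>U. f differentiable (at p)) \<and>
       (\<forall>h. Ck_on k U (\<lambda>p. frechet_derivative f (at p) h))"

text \<open>The set \<open>U\<close> is always open below.\<close>

definition smooth_on :: "'a :: real_normed_vector set \<Rightarrow> ('a \<Rightarrow> 'b :: real_normed_vector) \<Rightarrow> bool"
  where "smooth_on U f \<longleftrightarrow> (\<forall>k. Ck_on k U f)"

text \<open>
  \<open>'N\<close> indexes the coordinates \<open>Z\<close>.  In \<open>'N + 'N\<close>, the index \<open>Inl i\<close> stands for \<open>Z\<^sub>i\<close>, and \<open>Inr i\<close>
  for the conjugate of \<open>Z\<^sub>i\<close> (or for \<open>\<zeta>\<^sub>i\<close>, after complexification).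
\<close>

fun wirtinger :: "'N + 'N \<Rightarrow> (complex ^ 'N :: finite \<Rightarrow> complex) \<Rightarrow> complex ^ 'N \<Rightarrow> complex"
  where
    "wirtinger (Inl i) f p =
       (frechet_derivative f (at p) (axis i 1) - \<i> * frechet_derivative f (at p) (axis i \<i>)) / 2"
  | "wirtinger (Inr i) f p =
       (frechet_derivative f (at p) (axis i 1) + \<i> * frechet_derivative f (at p) (axis i \<i>)) / 2"

definition iterated_wirtinger ::
    "('N + 'N) list \<Rightarrow> (complex ^ 'N :: finite \<Rightarrow> complex) \<Rightarrow> complex ^ 'N \<Rightarrow> complex"
  where "iterated_wirtinger vs f = foldr wirtinger vs f"

text \<open>
  The Taylor series at \<open>0\<close> in \<open>Z\<close> and its conjugate, read as a formal power series in \<open>(Z, \<zeta>)\<close>.  The list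
  \<open>vs\<close> fixes an order in which to differentiate; for smooth \<open>f\<close> the order does not matter.
\<close>

definition taylor_series :: "(complex ^ 'N :: finite \<Rightarrow> complex) \<Rightarrow> ('N + 'N) mfps"
  where "taylor_series f = Abs_mfps (\<lambda>\<alpha>.
    iterated_wirtinger (SOME vs. \<forall>v. count_list vs v = Poly_Mapping.lookup \<alpha> v) f 0
      / (\<Prod>v\<in>UNIV. fact (Poly_Mapping.lookup \<alpha> v)))"

section \<open>Generic submanifolds\<close>

text \<open>
  Near \<open>p\<close>, i.e. in \<open>U\<close>, the set \<open>M\<close> is given by \<open>r\<^sub>0 = \<dots> = r\<^sub>d\<^sub>-\<^sub>1 = 0\<close>, and
  the differentials of the \<open>r\<^sub>j\<close> are linearly independent at \<open>p\<close>.
\<close>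

definition local_defining ::
    "(complex ^ 'N :: finite) set \<Rightarrow> nat \<Rightarrow> complex ^ 'N \<Rightarrow> (complex ^ 'N) set \<Rightarrow>
      (nat \<Rightarrow> complex ^ 'N \<Rightarrow> real) \<Rightarrow> bool"
  where "local_defining M d p U r \<longleftrightarrow>
    open U \<and> p \<in> U \<and>
    (\<forall>j<d. smooth_on U (r j)) \<and>
    M \<inter> U = {Z \<in> U. \<forall>j<d. r j Z = 0} \<and>
    (\<forall>c :: nat \<Rightarrow> real.
       (\<forall>h. (\<Sum>j<d. c j * frechet_derivative (r j) (at p) h) = 0) \<longrightarrow> (\<forall>j<d. c j = 0))"

definition smooth_submanifold :: "nat \<Rightarrow> (complex ^ 'N :: finite) set \<Rightarrow> bool"
  where "smooth_submanifold d M \<longleftrightarrow> (\<forall>p\<in>M. \<exists>U r. local_defining M d p U r)"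

definition cplx :: "(complex ^ 'N :: finite \<Rightarrow> real) \<Rightarrow> complex ^ 'N \<Rightarrow> complex"
  where "cplx f = (\<lambda>Z. complex_of_real (f Z))"

text \<open>Linear independence over \<open>\<complex>\<close> of the forms
  \<open>\<partial>r\<^sub>j = \<Sum>\<^sub>i (\<partial>r\<^sub>j/\<partial>Z\<^sub>i) dZ\<^sub>i\<close> at \<open>0\<close>.\<close>

definition generic_at_0 :: "nat \<Rightarrow> (nat \<Rightarrow> complex ^ 'N :: finite \<Rightarrow> real) \<Rightarrow> bool"
  where "generic_at_0 d r \<longleftrightarrow>
    (\<forall>c :: nat \<Rightarrow> complex.
       (\<forall>i. (\<Sum>j<d. c j * wirtinger (Inl i) (cplx (r j)) 0) = 0) \<longrightarrow> (\<forall>j<d. c j = 0))"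

section \<open>Segre variety mappings and iterated Segre mappings\<close>

text \<open>
  A Segre variety mapping is a family \<open>\<gamma>\<close> of \<open>N\<close> series in the variables \<open>\<zeta>\<^sub>i\<close>, encoded as \<open>Inl i\<close>, and
  \<open>t\<^sub>a\<close> for \<open>a < n = N - d\<close>, encoded as \<open>Inr a\<close>.
\<close>

definition segre_variety_mapping ::
    "nat \<Rightarrow> (nat \<Rightarrow> complex ^ 'N :: finite \<Rightarrow> real) \<Rightarrow> ('N \<Rightarrow> ('N + nat) mfps) \<Rightarrow> bool"
  where "segre_variety_mapping d r \<gamma> \<longleftrightarrow>
    (let n = CARD('N) - d in
      formal_mapping (range Inl \<union> Inr ` {..<n}) \<gamma> \<and>
      (\<forall>j<d. mcomp (taylor_series (cplx (r j))) (case_sum \<gamma> (\<lambda>i. mvar (Inl i))) = 0) \<and>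
      vec.dim ((\<lambda>a. (\<chi> i. mcoeff (mderiv (Inr a) (\<gamma> i)) 0) :: complex ^ 'N) ` {..<n}) = n)"

text \<open>
  The variable \<open>t\<^sup>l\<^sub>a\<close> is encoded as \<open>(l, a)\<close>, with \<open>l = 1, \<dots>, j\<close> and \<open>a < n\<close> for \<open>v\<^sup>j\<close>.
  Setting \<open>v\<^sup>0 = 0\<close> makes \<open>v\<^sup>1 = \<gamma>(0, t\<^sup>1)\<close> an instance of the general recursion.
\<close>

primrec segre_iter :: "('N \<Rightarrow> ('N + nat) mfps) \<Rightarrow> nat \<Rightarrow> 'N \<Rightarrow> (nat \<times> nat) mfps"
  where
    "segre_iter \<gamma> 0 = (\<lambda>i. 0)"
  | "segre_iter \<gamma> (Suc j) =
       (\<lambda>i. mcomp (\<gamma> i) (case_sum (\<lambda>k. mcnj (segre_iter \<gamma> j k)) (\<lambda>a. mvar (Suc j, a))))"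

definition segre_rank :: "nat \<Rightarrow> ('N :: finite \<Rightarrow> ('N + nat) mfps) \<Rightarrow> nat \<Rightarrow> nat"
  where "segre_rank d \<gamma> j = formal_rank ({1..j} \<times> {..<CARD('N) - d}) (segre_iter \<gamma> j)"

section \<open>The Lie algebra generated by the CR vector fields\<close>

text \<open>
  A complex vector field is represented by its components with respect to the frame
  \<open>\<partial>/\<partial>Z\<^sub>i\<close> (index \<open>Inl i\<close>) and its conjugate (index \<open>Inr i\<close>) of the complexified tangent
  bundle of \<open>\<complex>\<^sup>N\<close>.
\<close>

type_synonym 'N cvf = "complex ^ 'N \<Rightarrow> complex ^ ('N + 'N)"

definition vf_apply :: "('N :: finite) cvf \<Rightarrow> (complex ^ 'N \<Rightarrow> complex) \<Rightarrow> complex ^ 'N \<Rightarrow> complex"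
  where "vf_apply X f p = (\<Sum>v\<in>UNIV. X p $ v * wirtinger v f p)"

definition lie_bracket :: "('N :: finite) cvf \<Rightarrow> 'N cvf \<Rightarrow> 'N cvf"
  where "lie_bracket X Y =
    (\<lambda>p. \<chi> v. vf_apply X (\<lambda>q. Y q $ v) p - vf_apply Y (\<lambda>q. X q $ v) p)"

text \<open>
  Vector fields on \<open>M\<close> near \<open>0\<close> are represented by smooth extensions to a neighbourhood \<open>V\<close> of \<open>0\<close> in
  \<open>\<complex>\<^sup>N\<close>, with tangency and type required along \<open>M\<close>.  For fields tangent to \<open>M\<close>, the bracket
  along \<open>M\<close> does not depend on the extensions.  Values outside \<open>V\<close> are irrelevant.
\<close>

definition CR_field_10 ::
    "(complex ^ 'N :: finite) set \<Rightarrow> nat \<Rightarrow> (nat \<Rightarrow> complex ^ 'N \<Rightarrow> real) \<Rightarrow> 'N cvf \<Rightarrow> bool"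
  where "CR_field_10 M d r X \<longleftrightarrow>
    (\<exists>V. open V \<and> 0 \<in> V \<and> smooth_on V X \<and>
      (\<forall>p\<in>M \<inter> V. (\<forall>j<d. vf_apply X (cplx (r j)) p = 0) \<and> (\<forall>i. X p $ Inr i = 0)))"

definition CR_field_01 ::
    "(complex ^ 'N :: finite) set \<Rightarrow> nat \<Rightarrow> (nat \<Rightarrow> complex ^ 'N \<Rightarrow> real) \<Rightarrow> 'N cvf \<Rightarrow> bool"
  where "CR_field_01 M d r X \<longleftrightarrow>
    (\<exists>V. open V \<and> 0 \<in> V \<and> smooth_on V X \<and>
      (\<forall>p\<in>M \<inter> V. (\<forall>j<d. vf_apply X (cplx (r j)) p = 0) \<and> (\<forall>i. X p $ Inl i = 0)))"

inductive_set CR_lie_algebra ::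
    "(complex ^ 'N :: finite) set \<Rightarrow> nat \<Rightarrow> (nat \<Rightarrow> complex ^ 'N \<Rightarrow> real) \<Rightarrow> 'N cvf set"
  for M d r
  where
    gen_10: "CR_field_10 M d r X \<Longrightarrow> X \<in> CR_lie_algebra M d r"
  | gen_01: "CR_field_01 M d r X \<Longrightarrow> X \<in> CR_lie_algebra M d r"
  | add: "X \<in> CR_lie_algebra M d r \<Longrightarrow> Y \<in> CR_lie_algebra M d r \<Longrightarrow>
      (\<lambda>p. X p + Y p) \<in> CR_lie_algebra M d r"
  | scale: "X \<in> CR_lie_algebra M d r \<Longrightarrow> (\<lambda>p. c *s X p) \<in> CR_lie_algebra M d r"
  | bracket: "X \<in> CR_lie_algebra M d r \<Longrightarrow> Y \<in> CR_lie_algebra M d r \<Longrightarrow>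
      lie_bracket X Y \<in> CR_lie_algebra M d r"

definition CR_lie_dim ::
    "(complex ^ 'N :: finite) set \<Rightarrow> nat \<Rightarrow> (nat \<Rightarrow> complex ^ 'N \<Rightarrow> real) \<Rightarrow> nat"
  where "CR_lie_dim M d r = vec.dim ((\<lambda>X. X 0) ` CR_lie_algebra M d r)"

end

theory Submission
  imports Defs
begin

text \<open>
  Let \<open>g\<close> be the Lie algebra of the CR fields, \<open>m = dim g(0)\<close> and \<open>n = N - d\<close>; the claim is
  \<open>Rk v\<^sup>k = m - n\<close> as soon as \<open>Rk v\<^sup>k = Rk v\<^sup>k\<^sup>+\<^sup>1\<close>.  Taking Taylor series turns \<open>g\<close> into a Lie algebra of
  formal vector fields on the complexification of \<open>M\<close>, which is the image of \<open>(\<zeta>, t) \<mapsto> (\<gamma>(\<zeta>, t), \<zeta>)\<close>.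

  Lower bound.  The map \<open>\<Phi> = (v\<^sup>k\<^sup>+\<^sup>1, cnj v\<^sup>k)\<close> into the complexification has rank \<open>Rk v\<^sup>k + n\<close>.
  Comparing its two projections, the stability of the ranks forces all \<open>(1,0)\<close> and \<open>(0,1)\<close> tangent
  vectors along \<open>\<Phi>\<close> to be tangent to the image of \<open>\<Phi>\<close>.  Tangency to an image is stable under
  brackets, so all of \<open>g\<close> is tangent to it, and fields that are independent at \<open>0\<close> are
  independent along \<open>\<Phi>\<close>.  Hence \<open>m \<le> Rk v\<^sup>k + n\<close>.

  Upper bound.  By a formal version of Nagano's theorem, the series all of whose derivatives along
  \<open>g\<close> vanish at \<open>0\<close> have enough independent differentials to cut out a formal submanifold of
  dimension \<open>m\<close>.  Their ideal is real and closed under \<open>\<partial>/\<partial>t\<close>, so induction on \<open>k\<close> shows that its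
  members depending on \<open>\<zeta>\<close> only vanish on \<open>cnj v\<^sup>k\<close>.  The projection of \<open>g(0)\<close> to the \<open>\<zeta>\<close>-space
  has dimension at most \<open>m - n\<close>, and so has the image of \<open>v\<^sup>k\<close>.
\<close>

section \<open>Formal power series\<close>

text \<open>The functions \<open>r j\<close> are only smooth, so their Taylor series need not
  converge, and the complexification of M exists only through formal maps that satisfy its
  equations. Leaves and the implicit function theorem are therefore replaced by statements on
  coefficients: a series is zero if it vanishes to every order, and linear systems over series are
  solved by iterating a matrix without constant terms. Smooth geometry enters mainly through one
  fact: a field tangent to M maps functions vanishing on M to such functions. It makes the Lie
  algebra formal, although its fields are tangent to M, and its generators of pure type, only along
  M. The upper bound needs two descriptions of the orbit ideal. In the coordinates (\<zeta>, t) the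
  derivations along t are available, so t can be set to 0 without leaving the ideal. Conjugation
  exchanges Z and \<zeta> and is visible only in (Z, \<zeta>). The induction alternates between the
  two, because the Segre recursion conjugates once in each step.\<close>

abbreviation mlookup :: "('v \<Rightarrow>\<^sub>0 nat) \<Rightarrow> 'v \<Rightarrow> nat"
  where "mlookup \<equiv> Poly_Mapping.lookup"

abbreviation mkeys :: "('v \<Rightarrow>\<^sub>0 nat) \<Rightarrow> 'v set"
  where "mkeys \<equiv> Poly_Mapping.keys"

definition unit_exp :: "'v \<Rightarrow> ('v \<Rightarrow>\<^sub>0 nat)"
  where "unit_exp v = Poly_Mapping.single v 1"

definition mdeg :: "('v \<Rightarrow>\<^sub>0 nat) \<Rightarrow> nat"
  where "mdeg m = (\<Sum>v\<in>mkeys m. mlookup m v)"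

lemma lookup_unit_exp [simp]: "mlookup (unit_exp v) w = (if v = w then 1 else 0)"
  by (simp add: unit_exp_def lookup_single when_def)

lemma keys_unit_exp [simp]: "mkeys (unit_exp v) = {v}"
  by (simp add: unit_exp_def)

lemma mkeys_add [simp]: "mkeys (a + b) = mkeys a \<union> mkeys b"
  by (auto simp: in_keys_iff lookup_add)

lemma mdeg_superset: "finite A \<Longrightarrow> mkeys m \<subseteq> A \<Longrightarrow> mdeg m = (\<Sum>v\<in>A. mlookup m v)"
  unfolding mdeg_def by (rule sum.mono_neutral_left) (auto simp: in_keys_iff)

lemma mdeg_add [simp]: "mdeg (a + b) = mdeg a + mdeg b"
proof -
  let ?A = "mkeys a \<union> mkeys b"
  have "mdeg (a + b) = (\<Sum>v\<in>?A. mlookup (a + b) v)" by (rule mdeg_superset) auto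
  also have "\<dots> = mdeg a + mdeg b"
    by (simp add: lookup_add sum.distrib mdeg_superset [of ?A])
  finally show ?thesis .
qed

lemma mdeg_zero [simp]: "mdeg 0 = 0"
  by (simp add: mdeg_def)

lemma mdeg_unit_exp [simp]: "mdeg (unit_exp v) = 1"
  by (simp add: mdeg_def)

lemma mdeg_eq_0_iff [simp]: "mdeg m = 0 \<longleftrightarrow> m = 0"
proof
  assume "mdeg m = 0"
  then have "\<forall>v\<in>mkeys m. mlookup m v = 0" by (simp add: mdeg_def)
  then show "m = 0" by (auto intro!: poly_mapping_eqI simp: in_keys_iff)
qed simp

lemma unit_exp_decomp:
  assumes "v \<in> mkeys m"
  obtains m' where "m = m' + unit_exp v"
proof
  show "m = (m - unit_exp v) + unit_exp v"
    using assms by (intro poly_mapping_eqI) (auto simp: lookup_add lookup_minus in_keys_iff)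
qed

lemma mdeg_pos_decomp:
  assumes "m \<noteq> 0"
  obtains m' v where "m = m' + unit_exp v" "mdeg m' < mdeg m"
proof -
  from assms obtain v where "v \<in> mkeys m" by (metis all_not_in_conv keys_eq_empty)
  then obtain m' where "m = m' + unit_exp v" by (rule unit_exp_decomp)
  then show thesis by (intro that [of m' v]) auto
qed

lemma add_unit_exp_neq_0 [simp]: "m + unit_exp v \<noteq> 0" "unit_exp v + m \<noteq> 0" "unit_exp v \<noteq> 0"
  by (metis add_eq_0_iff_both_eq_0 keys_unit_exp insert_not_empty keys_zero mkeys_add Un_empty)+

lemma finite_mdeg_le: "finite X \<Longrightarrow> finite {m. mkeys m \<subseteq> X \<and> mdeg m \<le> d}"
proof -
  assume X: "finite X"
  let ?S = "{m. mkeys m \<subseteq> X \<and> mdeg m \<le> d}"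
  have "mlookup ` ?S \<subseteq> {f. \<forall>x. (x \<in> X \<longrightarrow> f x \<in> {..d}) \<and> (x \<notin> X \<longrightarrow> f x = 0)}"
  proof clarsimp
    fix m :: "'a \<Rightarrow>\<^sub>0 nat" and x assume m: "mkeys m \<subseteq> X" "mdeg m \<le> d"
    have "mlookup m x \<le> mdeg m" if "x \<in> X"
      unfolding mdeg_superset [OF X m(1)] using X that by (intro member_le_sum) auto
    with m show "(x \<in> X \<longrightarrow> mlookup m x \<le> d) \<and> (x \<notin> X \<longrightarrow> mlookup m x = 0)"
      by (auto simp: in_keys_iff subset_iff)
  qed
  moreover have "finite {f. \<forall>x. (x \<in> X \<longrightarrow> f x \<in> {..d}) \<and> (x \<notin> X \<longrightarrow> f x = (0::nat))}"
    by (rule finite_set_of_finite_funs) (use X in auto)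
  ultimately have "finite (mlookup ` ?S)" by (rule finite_subset)
  then show ?thesis by (rule finite_imageD) (auto intro: inj_onI poly_mapping_eqI)
qed

section \<open>Coefficients, constants, variables and partial derivatives\<close>

lemma mcoeff_zero [simp]: "mcoeff 0 m = 0" by (simp add: zero_mfps.rep_eq)
lemma mcoeff_one: "mcoeff 1 m = (if m = 0 then 1 else 0)" by (simp add: one_mfps.rep_eq)
lemma mcoeff_add [simp]: "mcoeff (f + g) m = mcoeff f m + mcoeff g m" by (simp add: plus_mfps.rep_eq)
lemma mcoeff_diff [simp]: "mcoeff (f - g) m = mcoeff f m - mcoeff g m" by (simp add: minus_mfps.rep_eq)
lemma mcoeff_uminus [simp]: "mcoeff (- f) m = - mcoeff f m" by (simp add: uminus_mfps.rep_eq)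
lemma mcoeff_sum [simp]: "mcoeff (sum f A) m = (\<Sum>x\<in>A. mcoeff (f x) m)"
  by (induction A rule: infinite_finite_induct) auto

lemma mcoeff_mult: "mcoeff (f * g) m = (\<Sum>(a, b)\<in>{(a, b). a + b = m}. mcoeff f a * mcoeff g b)"
  by (simp add: times_mfps.rep_eq)

lemma add_exp_eq_0: "a + b = (0 :: 'v \<Rightarrow>\<^sub>0 nat) \<Longrightarrow> a = 0" "a + b = (0 :: 'v \<Rightarrow>\<^sub>0 nat) \<Longrightarrow> b = 0"
  by (metis add_is_0 mdeg_add mdeg_eq_0_iff)+

lemma splits_zero: "{(a, b). a + b = (0 :: 'v \<Rightarrow>\<^sub>0 nat)} = {(0, 0)}"
  by (auto intro: add_exp_eq_0)

lemma mcoeff_mult_0 [simp]: "mcoeff (f * g) 0 = mcoeff f 0 * mcoeff g 0"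
  by (simp add: mcoeff_mult splits_zero)

lemma mcoeff_one_0 [simp]: "mcoeff 1 0 = 1" by (simp add: mcoeff_one)

definition mconst :: "complex \<Rightarrow> 'v mfps"
  where "mconst c = Abs_mfps (\<lambda>m. if m = 0 then c else 0)"

lemma mcoeff_mconst: "mcoeff (mconst c) m = (if m = 0 then c else 0)"
  by (simp add: mconst_def)

lemma mcoeff_mconst_0 [simp]: "mcoeff (mconst c) 0 = c"
  by (simp add: mconst_def)

lemma mcoeff_mconst_mult [simp]:
  fixes f :: "'v mfps"
  shows "mcoeff (mconst c * f) m = c * mcoeff f m"
proof -
  have "(\<Sum>(a, b)\<in>{(a, b). a + b = m}. mcoeff (mconst c) a * mcoeff f b)
      = (\<Sum>(a, b)\<in>{(0 :: 'v \<Rightarrow>\<^sub>0 nat, m)}. mcoeff (mconst c) a * mcoeff f b)"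
    by (rule sum.mono_neutral_right) (auto simp: mcoeff_mconst split: if_splits)
  then show ?thesis by (simp add: mcoeff_mult)
qed

lemma mconst_0 [simp]: "mconst 0 = 0" and mconst_1 [simp]: "mconst 1 = 1"
  by (auto intro!: mfps_eqI simp: mcoeff_mconst mcoeff_one)

lemma mconst_add: "mconst (a + b) = mconst a + mconst b"
  and mconst_uminus: "mconst (- a) = - mconst a"
  by (auto intro!: mfps_eqI simp: mcoeff_mconst)

lemma mconst_mult: "mconst (a * b) = mconst a * mconst b"
  by (auto intro!: mfps_eqI simp: mcoeff_mconst)

lemma mconst_sum: "mconst (sum f A) = (\<Sum>x\<in>A. mconst (f x))"
  by (auto intro!: mfps_eqI simp: mcoeff_mconst)

lemma mcoeff_mvar: "mcoeff (mvar v) m = (if m = unit_exp v then 1 else 0)"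
  by (simp add: mvar_def unit_exp_def)

lemma mcoeff_mvar_0 [simp]: "mcoeff (mvar v) 0 = 0"
  using add_unit_exp_neq_0(3) [of v] by (metis mcoeff_mvar)

lemma mcoeff_mvar_mult:
  "mcoeff (mvar v * f) (m + unit_exp v) = mcoeff f m"
  "v \<notin> mkeys m \<Longrightarrow> mcoeff (mvar v * f) m = 0"
proof -
  have "(\<Sum>(a, b)\<in>{(a, b). a + b = m + unit_exp v}. mcoeff (mvar v) a * mcoeff f b)
      = (\<Sum>(a, b)\<in>{(unit_exp v, m)}. mcoeff (mvar v) a * mcoeff f b)"
    by (rule sum.mono_neutral_right) (auto simp: mcoeff_mvar add.commute split: if_splits)
  then show "mcoeff (mvar v * f) (m + unit_exp v) = mcoeff f m" by (simp add: mcoeff_mult mcoeff_mvar)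
next
  assume "v \<notin> mkeys m"
  then show "mcoeff (mvar v * f) m = 0"
    unfolding mcoeff_mult by (intro sum.neutral) (auto simp: mcoeff_mvar)
qed

lemma mcoeff_mderiv: "mcoeff (mderiv v f) m = of_nat (mlookup m v + 1) * mcoeff f (m + unit_exp v)"
  by (simp add: mderiv_def unit_exp_def)

lemma mderiv_add [simp]: "mderiv v (f + g) = mderiv v f + mderiv v g"
  and mderiv_diff [simp]: "mderiv v (f - g) = mderiv v f - mderiv v g"
  and mderiv_uminus [simp]: "mderiv v (- f) = - mderiv v f"
  and mderiv_0 [simp]: "mderiv v 0 = 0"
  by (auto intro!: mfps_eqI simp: mcoeff_mderiv algebra_simps)

lemma mderiv_sum: "mderiv v (sum f A) = (\<Sum>x\<in>A. mderiv v (f x))"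
  by (induction A rule: infinite_finite_induct) auto

lemma mderiv_mconst [simp]: "mderiv v (mconst c) = 0"
  by (auto intro!: mfps_eqI simp: mcoeff_mderiv mcoeff_mconst)

lemma mderiv_one [simp]: "mderiv v 1 = 0"
  using mderiv_mconst [of v 1] by simp

lemma mderiv_mvar: "mderiv v (mvar w) = (if v = w then 1 else 0)"
proof (rule mfps_eqI)
  fix m :: "'a \<Rightarrow>\<^sub>0 nat"
  have "m + unit_exp v = unit_exp w \<longleftrightarrow> m = 0 \<and> v = w"
  proof
    assume eq: "m + unit_exp v = unit_exp w"
    then have "mdeg m + 1 = 1" by (metis mdeg_add mdeg_unit_exp)
    then have "m = 0" by simp
    moreover from eq this have "v = w" by (metis add_0 keys_unit_exp singleton_inject)
    ultimately show "m = 0 \<and> v = w" by simp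
  qed simp
  then show "mcoeff (mderiv v (mvar w)) m = mcoeff (if v = w then 1 else 0) m"
    by (auto simp: mcoeff_mderiv mcoeff_mvar mcoeff_one)
qed

lemma mderiv_commute: "mderiv v (mderiv w f) = mderiv w (mderiv v f)"
  by (rule mfps_eqI) (simp add: mcoeff_mderiv lookup_add add_ac mult_ac)

text \<open>The half of the Leibniz rule in which the first factor is differentiated: splittings
  with \<open>mlookup a v = 0\<close> contribute nothing, and in all others one unit of
  \<open>v\<close> can be taken off \<open>a\<close>.\<close>

lemma sum_splits_unit_exp:
  "(\<Sum>(a, b)\<in>{(a, b). a + b = m + unit_exp v}. of_nat (mlookup a v) * H a b) =
   (\<Sum>(a, b)\<in>{(a, b). a + b = m}. of_nat (mlookup a v + 1) * (H (a + unit_exp v) b :: complex))"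
proof -
  let ?T = "{(a, b). a + b = m + unit_exp v}" and ?T' = "{(a, b). a + b = m + unit_exp v \<and> v \<in> mkeys a}"
  have "(\<Sum>(a, b)\<in>?T. of_nat (mlookup a v) * H a b) = (\<Sum>(a, b)\<in>?T'. of_nat (mlookup a v) * H a b)"
    by (rule sum.mono_neutral_right) (auto simp: in_keys_iff)
  also have "\<dots> = (\<Sum>(a, b)\<in>{(a, b). a + b = m}. of_nat (mlookup a v + 1) * H (a + unit_exp v) b)"
  proof (rule sum.reindex_bij_witness [where i = "\<lambda>(a, b). (a + unit_exp v, b)"
        and j = "\<lambda>(a, b). (a - unit_exp v, b)"])
    fix x assume "x \<in> ?T'"
    then obtain a b where x: "x = (a, b)" "a + b = m + unit_exp v" "v \<in> mkeys a" by auto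
    from x(3) obtain a' where a': "a = a' + unit_exp v" by (rule unit_exp_decomp)
    have m: "a' + b = m" using x(2) unfolding a' by (simp add: add.assoc add.commute [of "unit_exp v"]) (metis add.assoc add_right_cancel)
    show "(case case x of (a, b) \<Rightarrow> (a - unit_exp v, b) of (a, b) \<Rightarrow> (a + unit_exp v, b)) = x"
      "(case x of (a, b) \<Rightarrow> (a - unit_exp v, b)) \<in> {(a, b). a + b = m}"
      using x a' m by auto
    show "(case case x of (a, b) \<Rightarrow> (a - unit_exp v, b) of (a, b) \<Rightarrow> of_nat (mlookup a v + 1) * H (a + unit_exp v) b)
      = (case x of (a, b) \<Rightarrow> of_nat (mlookup a v) * H a b)"
      using x a' by (simp add: lookup_add)
  qed (auto simp: add_ac)
  finally show ?thesis .
qed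

lemma mderiv_mult [simp]: "mderiv v (f * g) = mderiv v f * g + f * mderiv v g"
proof (rule mfps_eqI)
  fix m
  let ?T = "{(a, b). a + b = m + unit_exp v}"
  have "mcoeff (mderiv v (f * g)) m = (\<Sum>(a, b)\<in>?T. of_nat (mlookup (m + unit_exp v) v) * (mcoeff f a * mcoeff g b))"
    by (simp add: mcoeff_mderiv mcoeff_mult sum_distrib_left lookup_add case_prod_unfold)
  \<comment> \<open>The exponent of \<open>v\<close> splits between the two factors, which separates
    the two Leibniz terms.\<close>
  also have "\<dots> = (\<Sum>(a, b)\<in>?T. of_nat (mlookup a v) * (mcoeff f a * mcoeff g b)
      + of_nat (mlookup b v) * (mcoeff f a * mcoeff g b))"
  proof (rule sum.cong [OF refl], safe)
    fix a b assume "a + b = m + unit_exp v"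
    then have "mlookup (m + unit_exp v) v = mlookup a v + mlookup b v" by (metis lookup_add)
    then show "of_nat (mlookup (m + unit_exp v) v) * (mcoeff f a * mcoeff g b) =
      of_nat (mlookup a v) * (mcoeff f a * mcoeff g b) + of_nat (mlookup b v) * (mcoeff f a * mcoeff g b)"
      by (simp only: of_nat_add distrib_right)
  qed
  also have "\<dots> = (\<Sum>(a, b)\<in>?T. of_nat (mlookup a v) * (mcoeff f a * mcoeff g b))
      + (\<Sum>(a, b)\<in>?T. of_nat (mlookup b v) * (mcoeff f a * mcoeff g b))"
    by (simp add: case_prod_unfold sum.distrib)
  also have "(\<Sum>(a, b)\<in>?T. of_nat (mlookup b v) * (mcoeff f a * mcoeff g b))
      = (\<Sum>(a, b)\<in>?T. of_nat (mlookup a v) * (mcoeff g a * mcoeff f b))"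
    by (rule sum.reindex_bij_witness [where i = prod.swap and j = prod.swap])
       (auto simp: add.commute mult.commute)
  finally show "mcoeff (mderiv v (f * g)) m = mcoeff (mderiv v f * g + f * mderiv v g) m"
    unfolding sum_splits_unit_exp
    by (simp add: mult.commute [of f] mcoeff_mult mcoeff_mderiv case_prod_unfold mult.assoc)
qed

lemma mcoeff_mcnj [simp]: "mcoeff (mcnj f) m = cnj (mcoeff f m)"
  by (simp add: mcnj_def)

lemma mcnj_simps [simp]:
  "mcnj (f + g) = mcnj f + mcnj g" "mcnj (f - g) = mcnj f - mcnj g" "mcnj (- f) = - mcnj f"
  "mcnj 0 = 0" "mcnj 1 = 1" "mcnj (mcnj f) = f" "mcnj (mvar v) = mvar v" "mcnj (mconst c) = mconst (cnj c)"
  "mderiv v (mcnj f) = mcnj (mderiv v f)"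
  by (auto intro!: mfps_eqI simp: mcoeff_one mcoeff_mvar mcoeff_mconst mcoeff_mderiv)

lemma mcnj_mult [simp]: "mcnj (f * g) = mcnj f * mcnj g"
  by (rule mfps_eqI) (simp add: mcoeff_mult case_prod_unfold)

lemma mcnj_sum: "mcnj (sum f A) = (\<Sum>x\<in>A. mcnj (f x))"
  by (induction A rule: infinite_finite_induct) auto

lemma mcnj_eq_0_iff [simp]: "mcnj f = 0 \<longleftrightarrow> f = 0"
  by (metis mcnj_simps(4,6))

section \<open>Series in a given set of variables\<close>

lemma mfps_in_mono: "mfps_in X f \<Longrightarrow> X \<subseteq> Y \<Longrightarrow> mfps_in Y f"
  unfolding mfps_in_def by blast

lemma mfps_in_UNIV [simp]: "mfps_in UNIV f"
  by (simp add: mfps_in_def)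

lemma mfps_in_0 [simp]: "mfps_in X 0" and mfps_in_1 [simp]: "mfps_in X 1"
  and mfps_in_mconst [simp]: "mfps_in X (mconst c)"
  by (auto simp: mfps_in_def mcoeff_one mcoeff_mconst)

lemma mfps_in_add: "mfps_in X f \<Longrightarrow> mfps_in X g \<Longrightarrow> mfps_in X (f + g)"
  and mfps_in_diff: "mfps_in X f \<Longrightarrow> mfps_in X g \<Longrightarrow> mfps_in X (f - g)"
  and mfps_in_uminus: "mfps_in X f \<Longrightarrow> mfps_in X (- f)"
  and mfps_in_mcnj: "mfps_in X f \<Longrightarrow> mfps_in X (mcnj f)"
  and mfps_in_mvar: "v \<in> X \<Longrightarrow> mfps_in X (mvar v)"
     apply (auto simp: mfps_in_def mcoeff_mvar)
  apply (metis add.right_neutral add_0 subset_iff)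
  apply (metis diff_zero diff_self subset_iff)
  done

lemma mfps_in_sum: "(\<And>x. x \<in> A \<Longrightarrow> mfps_in X (f x)) \<Longrightarrow> mfps_in X (sum f A)"
  by (induction A rule: infinite_finite_induct) (auto intro: mfps_in_add)

lemma mfps_in_mult:
  assumes "mfps_in X f" "mfps_in X g"
  shows "mfps_in X (f * g)"
  unfolding mfps_in_def
proof (intro allI impI)
  fix m assume nz: "mcoeff (f * g) m \<noteq> 0"
  show "mkeys m \<subseteq> X"
  proof (rule ccontr)
    assume m: "\<not> mkeys m \<subseteq> X"
    have "mcoeff f a * mcoeff g b = 0" if "a + b = m" for a b
    proof -
      have "\<not> mkeys a \<subseteq> X \<or> \<not> mkeys b \<subseteq> X" using m that by auto
      then show ?thesis using assms by (auto simp: mfps_in_def)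
    qed
    then have "mcoeff (f * g) m = 0" unfolding mcoeff_mult by (intro sum.neutral) auto
    with nz show False by simp
  qed
qed

lemma mfps_in_power: "mfps_in X f \<Longrightarrow> mfps_in X (f ^ n)"
  by (induction n) (auto intro: mfps_in_mult)

lemma mfps_in_prod: "(\<And>x. x \<in> A \<Longrightarrow> mfps_in X (f x)) \<Longrightarrow> mfps_in X (prod f A)"
  by (induction A rule: infinite_finite_induct) (auto intro: mfps_in_mult)

lemma mfps_in_mderiv: "mfps_in X f \<Longrightarrow> mfps_in X (mderiv v f)"
  unfolding mfps_in_def
proof (intro allI impI)
  fix m assume "\<forall>m. mcoeff f m \<noteq> 0 \<longrightarrow> mkeys m \<subseteq> X" "mcoeff (mderiv v f) m \<noteq> 0"
  then have "mkeys (m + unit_exp v) \<subseteq> X" unfolding mcoeff_mderiv by (metis mult_zero_right)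
  then show "mkeys m \<subseteq> X" by simp
qed

lemma mderiv_eq_0: "mfps_in X f \<Longrightarrow> v \<notin> X \<Longrightarrow> mderiv v f = 0"
  by (rule mfps_eqI) (auto simp: mfps_in_def mcoeff_mderiv)

lemmas mfps_in_intros = mfps_in_add mfps_in_diff mfps_in_uminus mfps_in_mcnj mfps_in_mvar
  mfps_in_sum mfps_in_mult mfps_in_power mfps_in_prod mfps_in_mderiv

section \<open>Order of vanishing, and powers of the substituted series\<close>

definition mord_ge :: "nat \<Rightarrow> 'v mfps \<Rightarrow> bool"
  where "mord_ge k f \<longleftrightarrow> (\<forall>m. mdeg m < k \<longrightarrow> mcoeff f m = 0)"

lemma mord_ge_0 [simp]: "mord_ge 0 f" and mord_ge_zero [simp]: "mord_ge k 0"
  by (simp_all add: mord_ge_def)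

lemma mord_ge_1_iff: "mord_ge 1 f \<longleftrightarrow> mcoeff f 0 = 0"
  by (auto simp: mord_ge_def)

lemma mord_ge_mono: "mord_ge k f \<Longrightarrow> l \<le> k \<Longrightarrow> mord_ge l f"
  by (auto simp: mord_ge_def)

lemma mord_ge_add: "mord_ge k f \<Longrightarrow> mord_ge k g \<Longrightarrow> mord_ge k (f + g)"
  and mord_ge_diff: "mord_ge k f \<Longrightarrow> mord_ge k g \<Longrightarrow> mord_ge k (f - g)"
  by (auto simp: mord_ge_def)

lemma mord_ge_sum: "(\<And>x. x \<in> A \<Longrightarrow> mord_ge k (f x)) \<Longrightarrow> mord_ge k (sum f A)"
  by (induction A rule: infinite_finite_induct) (auto intro: mord_ge_add)

lemma mord_ge_mult:
  assumes "mord_ge j f" "mord_ge k g" shows "mord_ge (j + k) (f * g)"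
  unfolding mord_ge_def mcoeff_mult
proof (intro allI impI sum.neutral ballI, clarify)
  fix a b :: "'a \<Rightarrow>\<^sub>0 nat" assume "mdeg (a + b) < j + k"
  then have "mdeg a < j \<or> mdeg b < k" by auto
  then show "mcoeff f a * mcoeff g b = 0" using assms by (auto simp: mord_ge_def)
qed

lemma mord_ge_mderiv: "mord_ge (Suc k) f \<Longrightarrow> mord_ge k (mderiv v f)"
  by (auto simp: mord_ge_def mcoeff_mderiv)

lemma mord_ge_all: "(\<And>k. mord_ge k f) \<Longrightarrow> f = 0"
  by (rule mfps_eqI) (auto simp: mord_ge_def)

lemma mpower_superset:
  "finite A \<Longrightarrow> mkeys \<alpha> \<subseteq> A \<Longrightarrow> mpower F \<alpha> = (\<Prod>v\<in>A. F v ^ mlookup \<alpha> v)"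
  unfolding mpower_def by (rule prod.mono_neutral_left) (auto simp: in_keys_iff)

lemma mpower_add: "mpower F (\<alpha> + \<beta>) = mpower F \<alpha> * mpower F \<beta>"
proof -
  let ?A = "mkeys \<alpha> \<union> mkeys \<beta>"
  show ?thesis
    by (simp add: mpower_superset [of ?A] lookup_add power_add prod.distrib)
qed

lemma mpower_0 [simp]: "mpower F 0 = 1"
  by (simp add: mpower_def)

lemma mpower_unit_exp [simp]: "mpower F (unit_exp v) = F v"
  by (simp add: mpower_def)

lemma mfps_in_mpower: "(\<And>v. v \<in> mkeys \<alpha> \<Longrightarrow> mfps_in X (F v)) \<Longrightarrow> mfps_in X (mpower F \<alpha>)"
  unfolding mpower_def by (intro mfps_in_prod mfps_in_power) auto

lemma mord_ge_mpower:
  "(\<And>v. v \<in> mkeys \<alpha> \<Longrightarrow> mcoeff (F v) 0 = 0) \<Longrightarrow> mord_ge (mdeg \<alpha>) (mpower F \<alpha>)"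
proof (induction "mdeg \<alpha>" arbitrary: \<alpha>)
  case (Suc k)
  then have "\<alpha> \<noteq> 0" by auto
  then obtain \<beta> v where \<beta>: "\<alpha> = \<beta> + unit_exp v" by (metis mdeg_pos_decomp)
  have "mord_ge (mdeg \<beta> + 1) (mpower F \<beta> * F v)"
    using Suc.prems Suc.hyps \<beta> by (intro mord_ge_mult) (auto simp: mord_ge_1_iff simp del: One_nat_def)
  then show ?case by (simp add: \<beta> mpower_add)
qed simp

section \<open>Composition\<close>

text \<open>Monomials of degree above \<open>mdeg m\<close> have powers of too high an order to
  reach \<open>m\<close>, so the defining sum is finite. The bound \<open>D\<close> is kept free so
  that coefficients of different degrees can be expanded over one index set.\<close>

lemma mcoeff_mcomp:
  assumes X: "finite X" "mfps_in X g" and F: "\<And>v. v \<in> X \<Longrightarrow> mcoeff (F v) 0 = 0" and D: "mdeg m \<le> D"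
  shows "mcoeff (mcomp g F) m = (\<Sum>\<alpha> | mkeys \<alpha> \<subseteq> X \<and> mdeg \<alpha> \<le> D. mcoeff g \<alpha> * mcoeff (mpower F \<alpha>) m)"
proof -
  let ?I = "{\<alpha>. mkeys \<alpha> \<subseteq> X \<and> mdeg \<alpha> \<le> D}"
  have sub: "{\<alpha>. mcoeff g \<alpha> * mcoeff (mpower F \<alpha>) m \<noteq> 0} \<subseteq> ?I"
  proof (clarsimp)
    fix \<alpha> assume nz: "mcoeff g \<alpha> \<noteq> 0" "mcoeff (mpower F \<alpha>) m \<noteq> 0"
    then have k: "mkeys \<alpha> \<subseteq> X" using X by (auto simp: mfps_in_def)
    then have "mord_ge (mdeg \<alpha>) (mpower F \<alpha>)" using F by (intro mord_ge_mpower) auto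
    with nz(2) have "mdeg \<alpha> \<le> mdeg m" by (auto simp: mord_ge_def not_less [symmetric])
    with k D show "mkeys \<alpha> \<subseteq> X \<and> mdeg \<alpha> \<le> D" by auto
  qed
  show ?thesis
    unfolding mcomp_def mcoeff_Abs_mfps using finite_mdeg_le [OF X(1), of D] sub
    by (rule Sum_any.expand_superset)
qed

lemma mcomp_cong: "mfps_in X g \<Longrightarrow> (\<And>v. v \<in> X \<Longrightarrow> F v = G v) \<Longrightarrow> mcomp g F = mcomp g G"
  unfolding mcomp_def
proof (rule arg_cong [where f = Abs_mfps], rule ext, rule arg_cong [where f = Sum_any], rule ext)
  fix m \<alpha> assume g: "mfps_in X g" and FG: "\<And>v. v \<in> X \<Longrightarrow> F v = G v"
  show "mcoeff g \<alpha> * mcoeff (mpower F \<alpha>) m = mcoeff g \<alpha> * mcoeff (mpower G \<alpha>) m"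
  proof (cases "mcoeff g \<alpha> = 0")
    case False
    then have "mkeys \<alpha> \<subseteq> X" using g by (auto simp: mfps_in_def)
    then have "mpower F \<alpha> = mpower G \<alpha>" unfolding mpower_def using FG by (intro prod.cong) auto
    then show ?thesis by simp
  qed simp
qed

locale msubst =
  fixes X :: "'v set" and F :: "'v \<Rightarrow> 'w mfps"
  assumes fin: "finite X" and F0: "\<And>v. v \<in> X \<Longrightarrow> mcoeff (F v) 0 = 0"
begin

lemma mcomp_0_coeff [simp]: "mfps_in X g \<Longrightarrow> mcoeff (mcomp g F) 0 = mcoeff g 0"
proof -
  assume g: "mfps_in X g"
  have "{\<alpha>. mkeys \<alpha> \<subseteq> X \<and> mdeg \<alpha> \<le> 0} = {0}" by auto
  then show ?thesis using mcoeff_mcomp [OF fin g F0, where m = 0 and D = 0] by simp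
qed

lemma mcomp_add: "mfps_in X g \<Longrightarrow> mfps_in X h \<Longrightarrow> mcomp (g + h) F = mcomp g F + mcomp h F"
  by (rule mfps_eqI)
     (simp add: mcoeff_mcomp [OF fin _ F0 order_refl] mfps_in_add distrib_right sum.distrib)

lemma mcomp_uminus: "mfps_in X g \<Longrightarrow> mcomp (- g) F = - mcomp g F"
  by (rule mfps_eqI)
     (simp add: mcoeff_mcomp [OF fin _ F0 order_refl] mfps_in_uminus sum_negf)

lemma mcomp_diff: "mfps_in X g \<Longrightarrow> mfps_in X h \<Longrightarrow> mcomp (g - h) F = mcomp g F - mcomp h F"
  by (metis mcomp_add mcomp_uminus mfps_in_uminus diff_conv_add_uminus)

lemma mcomp_0 [simp]: "mcomp 0 F = 0"
  by (rule mfps_eqI) (simp add: mcoeff_mcomp [OF fin _ F0 order_refl])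

lemma mcomp_sum: "(\<And>x. x \<in> A \<Longrightarrow> mfps_in X (g x)) \<Longrightarrow> mcomp (sum g A) F = (\<Sum>x\<in>A. mcomp (g x) F)"
  by (induction A rule: infinite_finite_induct) (auto simp: mcomp_add mfps_in_sum)

lemma mcomp_mconst [simp]: "mcomp (mconst c) F = mconst c"
proof (rule mfps_eqI)
  fix m :: "'w \<Rightarrow>\<^sub>0 nat"
  have "(\<Sum>\<alpha> | mkeys \<alpha> \<subseteq> X \<and> mdeg \<alpha> \<le> mdeg m. mcoeff (mconst c) \<alpha> * mcoeff (mpower F \<alpha>) m)
    = (\<Sum>\<alpha>\<in>{0}. mcoeff (mconst c) \<alpha> * mcoeff (mpower F \<alpha>) m)"
    using finite_mdeg_le [OF fin] by (intro sum.mono_neutral_right) (auto simp: mcoeff_mconst split: if_splits)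
  then show "mcoeff (mcomp (mconst c) F) m = mcoeff (mconst c) m"
    by (simp add: mcoeff_mcomp [OF fin _ F0 order_refl] mcoeff_one mcoeff_mconst)
qed

lemma mcomp_1 [simp]: "mcomp 1 F = 1"
  using mcomp_mconst [of 1] by simp

lemma mcomp_mvar: "v \<in> X \<Longrightarrow> mcomp (mvar v) F = F v"
proof (rule mfps_eqI)
  fix m :: "'w \<Rightarrow>\<^sub>0 nat" assume v: "v \<in> X"
  have "(\<Sum>\<alpha> | mkeys \<alpha> \<subseteq> X \<and> mdeg \<alpha> \<le> mdeg m + 1. mcoeff (mvar v) \<alpha> * mcoeff (mpower F \<alpha>) m)
    = (\<Sum>\<alpha>\<in>{unit_exp v}. mcoeff (mvar v) \<alpha> * mcoeff (mpower F \<alpha>) m)"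
    using finite_mdeg_le [OF fin] v by (intro sum.mono_neutral_right) (auto simp: mcoeff_mvar split: if_splits)
  then show "mcoeff (mcomp (mvar v) F) m = mcoeff (F v) m"
    using v by (simp add: mcoeff_mcomp [OF fin _ F0, where m = m and D = "mdeg m + 1"] mfps_in_mvar mcoeff_mvar)
qed

lemma mcomp_mult: 
  assumes g: "mfps_in X g" and h: "mfps_in X h"
  shows "mcomp (g * h) F = mcomp g F * mcomp h F"
proof (rule mfps_eqI)
  fix m :: "'w \<Rightarrow>\<^sub>0 nat"
  define D where "D = mdeg m"
  define I where "I = {\<alpha>. mkeys \<alpha> \<subseteq> X \<and> mdeg \<alpha> \<le> D}"
  have finI: "finite I" unfolding I_def by (rule finite_mdeg_le [OF fin])
  let ?t = "\<lambda>\<alpha> \<beta>. mcoeff g \<alpha> * mcoeff h \<beta> * mcoeff (mpower F (\<alpha> + \<beta>)) m"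
  have "mcoeff (mcomp g F * mcomp h F) m = (\<Sum>(p, q)\<in>{(p, q). p + q = m}.
      (\<Sum>\<alpha>\<in>I. mcoeff g \<alpha> * mcoeff (mpower F \<alpha>) p) * (\<Sum>\<beta>\<in>I. mcoeff h \<beta> * mcoeff (mpower F \<beta>) q))"
    unfolding mcoeff_mult
  proof (rule sum.cong [OF refl], clarify)
    fix p q assume "m = p + q"
    then have "mdeg p \<le> D" "mdeg q \<le> D" by (auto simp: D_def)
    then show "mcoeff (mcomp g F) p * mcoeff (mcomp h F) q =
       (\<Sum>\<alpha>\<in>I. mcoeff g \<alpha> * mcoeff (mpower F \<alpha>) p) * (\<Sum>\<beta>\<in>I. mcoeff h \<beta> * mcoeff (mpower F \<beta>) q)"
      by (simp add: mcoeff_mcomp [OF fin g F0] mcoeff_mcomp [OF fin h F0] I_def)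
  qed
  also have "\<dots> = (\<Sum>z\<in>{(p, q). p + q = m}. \<Sum>\<alpha>\<in>I. \<Sum>\<beta>\<in>I.
      mcoeff g \<alpha> * mcoeff h \<beta> * (mcoeff (mpower F \<alpha>) (fst z) * mcoeff (mpower F \<beta>) (snd z)))"
    by (simp add: sum_product case_prod_unfold mult_ac)
  also have "\<dots> = (\<Sum>\<alpha>\<in>I. \<Sum>\<beta>\<in>I. \<Sum>z\<in>{(p, q). p + q = m}.
      mcoeff g \<alpha> * mcoeff h \<beta> * (mcoeff (mpower F \<alpha>) (fst z) * mcoeff (mpower F \<beta>) (snd z)))"
    by (subst sum.swap, rule sum.cong [OF refl], subst sum.swap, rule refl)
  also have "\<dots> = (\<Sum>\<alpha>\<in>I. \<Sum>\<beta>\<in>I. ?t \<alpha> \<beta>)"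
    by (simp add: mpower_add mcoeff_mult case_prod_unfold sum_distrib_left)
  also have "\<dots> = (\<Sum>(\<alpha>, \<beta>)\<in>I \<times> I. ?t \<alpha> \<beta>)"
    by (rule sum.cartesian_product)
  \<comment> \<open>The square of indices is cut down to a triangle: if the degree of
    \<open>\<alpha> + \<beta>\<close> exceeds \<open>D\<close>, the power has no coefficient at
    \<open>m\<close>.\<close>
  also have "\<dots> = (\<Sum>(\<alpha>, \<beta>)\<in>{(\<alpha>, \<beta>). \<alpha> + \<beta> \<in> I}. ?t \<alpha> \<beta>)"
  proof (rule sum.mono_neutral_right)
    show "finite (I \<times> I)" using finI by auto
    show "{(\<alpha>, \<beta>). \<alpha> + \<beta> \<in> I} \<subseteq> I \<times> I" by (auto simp: I_def)
    show "\<forall>i\<in>I \<times> I - {(\<alpha>, \<beta>). \<alpha> + \<beta> \<in> I}. (case i of (\<alpha>, \<beta>) \<Rightarrow> ?t \<alpha> \<beta>) = 0"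
    proof
      fix i assume "i \<in> I \<times> I - {(\<alpha>, \<beta>). \<alpha> + \<beta> \<in> I}"
      then obtain \<alpha> \<beta> where a: "i = (\<alpha>, \<beta>)" "\<alpha> \<in> I" "\<beta> \<in> I" "\<alpha> + \<beta> \<notin> I" by auto
      then have "mdeg m < mdeg (\<alpha> + \<beta>)" by (auto simp: I_def D_def)
      moreover have "mord_ge (mdeg (\<alpha> + \<beta>)) (mpower F (\<alpha> + \<beta>))"
        using a by (intro mord_ge_mpower F0) (auto simp: I_def)
      ultimately show "(case i of (\<alpha>, \<beta>) \<Rightarrow> ?t \<alpha> \<beta>) = 0" using a(1) by (auto simp: mord_ge_def)
    qed
  qed
  also have "\<dots> = (\<Sum>(\<gamma>, \<alpha>, \<beta>)\<in>(SIGMA \<gamma>:I. {(\<alpha>, \<beta>). \<alpha> + \<beta> = \<gamma>}). ?t \<alpha> \<beta>)"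
    by (rule sum.reindex_bij_witness [where i = snd and j = "\<lambda>(\<alpha>, \<beta>). (\<alpha> + \<beta>, \<alpha>, \<beta>)"]) auto
  also have "\<dots> = (\<Sum>\<gamma>\<in>I. \<Sum>(\<alpha>, \<beta>)\<in>{(\<alpha>, \<beta>). \<alpha> + \<beta> = \<gamma>}. ?t \<alpha> \<beta>)"
    using finI by (subst sum.Sigma) auto
  also have "\<dots> = (\<Sum>\<gamma>\<in>I. mcoeff (g * h) \<gamma> * mcoeff (mpower F \<gamma>) m)"
    by (auto simp: mcoeff_mult sum_distrib_right intro!: sum.cong)
  also have "\<dots> = mcoeff (mcomp (g * h) F) m"
    by (simp add: mcoeff_mcomp [OF fin mfps_in_mult [OF g h] F0 order_refl] I_def D_def)
  finally show "mcoeff (mcomp (g * h) F) m = mcoeff (mcomp g F * mcomp h F) m" by simp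
qed

lemma mfps_in_mcomp:
  assumes g: "mfps_in X g" and F: "\<And>v. v \<in> X \<Longrightarrow> mfps_in Y (F v)"
  shows "mfps_in Y (mcomp g F)"
  unfolding mfps_in_def
proof (intro allI impI)
  fix m :: "'w \<Rightarrow>\<^sub>0 nat" assume nz: "mcoeff (mcomp g F) m \<noteq> 0"
  show "mkeys m \<subseteq> Y"
  proof (rule ccontr)
    assume m: "\<not> mkeys m \<subseteq> Y"
    have "mcoeff (mpower F \<alpha>) m = 0" if "mkeys \<alpha> \<subseteq> X" for \<alpha>
      using mfps_in_mpower [of \<alpha> Y F] F that m by (auto simp: mfps_in_def)
    then have "mcoeff (mcomp g F) m = 0"
      by (simp add: mcoeff_mcomp [OF fin g F0 order_refl])
    with nz show False by simp
  qed
qed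

end

text \<open>Hadamard's lemma for series. Every nonconstant monomial is charged to a single one of
  its variables, chosen by \<open>w\<close>, so that no coefficient is counted twice.\<close>

lemma mfps_decomp:
  assumes "finite X" "mfps_in X g"
  obtains h where "\<And>v. v \<in> X \<Longrightarrow> mfps_in X (h v)" "g = mconst (mcoeff g 0) + (\<Sum>v\<in>X. mvar v * h v)"
proof -
  define w where "w = (\<lambda>\<alpha> :: 'a \<Rightarrow>\<^sub>0 nat. SOME v. v \<in> mkeys \<alpha>)"
  have w: "w \<alpha> \<in> mkeys \<alpha>" if "\<alpha> \<noteq> 0" for \<alpha>
  proof -
    have "\<exists>v. v \<in> mkeys \<alpha>" using that by (metis all_not_in_conv keys_eq_empty)
    then show ?thesis unfolding w_def by (rule someI_ex)
  qed
  define h where "h = (\<lambda>v. Abs_mfps (\<lambda>\<beta>. if w (\<beta> + unit_exp v) = v then mcoeff g (\<beta> + unit_exp v) else 0))"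
  have h: "mfps_in X (h v)" for v
    unfolding mfps_in_def
  proof (intro allI impI)
    fix m assume "mcoeff (h v) m \<noteq> 0"
    then have "mcoeff g (m + unit_exp v) \<noteq> 0" by (auto simp: h_def split: if_splits)
    then have "mkeys (m + unit_exp v) \<subseteq> X" using assms(2) unfolding mfps_in_def by blast
    then show "mkeys m \<subseteq> X" by simp
  qed
  have "mcoeff g \<alpha> = mcoeff (mconst (mcoeff g 0) + (\<Sum>v\<in>X. mvar v * h v)) \<alpha>" for \<alpha>
  proof (cases "\<alpha> = 0")
    case False
    have c: "mcoeff (mvar v * h v) \<alpha> = (if v = w \<alpha> then mcoeff g \<alpha> else 0)" for v
    proof (cases "v \<in> mkeys \<alpha>")
      case True
      then obtain \<beta> where "\<alpha> = \<beta> + unit_exp v" by (rule unit_exp_decomp)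
      then show ?thesis by (simp add: mcoeff_mvar_mult h_def)
    next
      case nv: False
      then show ?thesis using w [OF False] by (auto simp: mcoeff_mvar_mult)
    qed
    have "(\<Sum>v\<in>X. mcoeff (mvar v * h v) \<alpha>) = (if w \<alpha> \<in> X then mcoeff g \<alpha> else 0)"
      using assms(1) by (simp add: c)
    also have "\<dots> = mcoeff g \<alpha>"
      using w [OF False] assms(2) by (auto simp: mfps_in_def)
    finally show ?thesis using False by (simp add: mcoeff_mconst)
  qed simp
  then have "g = mconst (mcoeff g 0) + (\<Sum>v\<in>X. mvar v * h v)" by (rule mfps_eqI)
  with h show thesis by (rule that)
qed

text \<open>Such a \<open>\<Delta>\<close> measures the failure of an identity that is compatible with
  multiplication by variables; each variable split off raises the order.\<close>

lemma mfps_ext_by_vars: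
  fixes \<Delta> :: "'v mfps \<Rightarrow> 'w mfps"
  assumes X: "finite X" and add: "\<And>f g. mfps_in X f \<Longrightarrow> mfps_in X g \<Longrightarrow> \<Delta> (f + g) = \<Delta> f + \<Delta> g"
    and const: "\<And>c. \<Delta> (mconst c) = 0"
    and var: "\<And>v g. v \<in> X \<Longrightarrow> mfps_in X g \<Longrightarrow> \<exists>u. mcoeff u 0 = 0 \<and> \<Delta> (mvar v * g) = u * \<Delta> g"
    and g: "mfps_in X g"
  shows "\<Delta> g = 0"
proof -
  have sum: "\<Delta> (sum f A) = (\<Sum>x\<in>A. \<Delta> (f x))" if "\<And>x. x \<in> A \<Longrightarrow> mfps_in X (f x)" for f and A :: "'v set"
    using that const [of 0] by (induction A rule: infinite_finite_induct) (auto simp: add mfps_in_sum)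
  have "mord_ge k (\<Delta> g)" if "mfps_in X g" for k g
    using that
  proof (induction k arbitrary: g)
    case (Suc k)
    obtain h where h: "\<And>v. v \<in> X \<Longrightarrow> mfps_in X (h v)"
      "g = mconst (mcoeff g 0) + (\<Sum>v\<in>X. mvar v * h v)"
      using mfps_decomp [OF X Suc.prems] by blast
    have "\<Delta> g = (\<Sum>v\<in>X. \<Delta> (mvar v * h v))"
      using h(1) by (subst h(2)) (simp add: add const sum mfps_in_intros)
    moreover have "mord_ge (1 + k) (\<Delta> (mvar v * h v))" if v: "v \<in> X" for v
    proof -
      obtain u where "mcoeff u 0 = 0" "\<Delta> (mvar v * h v) = u * \<Delta> (h v)"
        using var [OF v h(1) [OF v]] by blast
      then show ?thesis using Suc.IH [OF h(1) [OF v]] mord_ge_1_iff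
        by (metis mord_ge_mult)
    qed
    ultimately show ?case by (auto intro: mord_ge_sum)
  qed simp
  then show ?thesis using g by (intro mord_ge_all) auto
qed

context msubst
begin

text \<open>Chain rule, by \<open>mfps_ext_by_vars\<close>: on \<open>mvar v * g\<close> the
  derivative of \<open>mvar v\<close> accounts for the derivative of \<open>F v\<close>, and the
  defect that remains is \<open>F v\<close> times the defect of \<open>g\<close>.\<close>

lemma mderiv_mcomp:
  assumes g: "mfps_in X g"
  shows "mderiv u (mcomp g F) = (\<Sum>v\<in>X. mcomp (mderiv v g) F * mderiv u (F v))"
proof -
  let ?\<Delta> = "\<lambda>g. mderiv u (mcomp g F) - (\<Sum>v\<in>X. mcomp (mderiv v g) F * mderiv u (F v))"
  have "?\<Delta> g = 0"
  proof (rule mfps_ext_by_vars [where X = X and \<Delta> = ?\<Delta>])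
    fix f g assume "mfps_in X f" "mfps_in X g"
    then show "?\<Delta> (f + g) = ?\<Delta> f + ?\<Delta> g"
      by (simp add: mcomp_add mfps_in_mderiv distrib_right sum.distrib)
  next
    fix v g assume v: "v \<in> X" and g: "mfps_in X g"
    have "(\<Sum>w\<in>X. mcomp (mderiv w (mvar v * g)) F * mderiv u (F w))
      = (\<Sum>w\<in>X. (if w = v then mcomp g F * mderiv u (F w) else 0) + F v * (mcomp (mderiv w g) F * mderiv u (F w)))"
      using v g by (intro sum.cong)
        (auto simp: mderiv_mvar mcomp_add mcomp_mult mcomp_mvar mfps_in_intros algebra_simps)
    also have "\<dots> = mcomp g F * mderiv u (F v) + F v * (\<Sum>w\<in>X. mcomp (mderiv w g) F * mderiv u (F w))"
      using v fin by (simp add: sum.distrib sum_distrib_left)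
    finally have "?\<Delta> (mvar v * g) = F v * ?\<Delta> g"
      using v g by (simp add: mcomp_mult mcomp_mvar mfps_in_intros algebra_simps)
    then show "\<exists>h. mcoeff h 0 = 0 \<and> ?\<Delta> (mvar v * g) = h * ?\<Delta> g" using F0 [OF v] by blast
  qed (use fin g in auto)
  then show ?thesis by simp
qed

lemma mcnj_mcomp:
  assumes g: "mfps_in X g"
  shows "mcnj (mcomp g F) = mcomp (mcnj g) (\<lambda>v. mcnj (F v))"
proof -
  interpret C: msubst X "\<lambda>v. mcnj (F v)" by unfold_locales (auto simp: fin F0)
  let ?\<Delta> = "\<lambda>g. mcnj (mcomp g F) - mcomp (mcnj g) (\<lambda>v. mcnj (F v))"
  have "?\<Delta> g = 0"
  proof (rule mfps_ext_by_vars [where X = X and \<Delta> = ?\<Delta>])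
    fix v g assume v: "v \<in> X" and g: "mfps_in X g"
    then have "?\<Delta> (mvar v * g) = mcnj (F v) * ?\<Delta> g"
      by (simp add: mcomp_mult C.mcomp_mult mcomp_mvar C.mcomp_mvar mfps_in_intros algebra_simps)
    then show "\<exists>h. mcoeff h 0 = 0 \<and> ?\<Delta> (mvar v * g) = h * ?\<Delta> g" using F0 [OF v]
      by (metis C.F0 v)
  qed (use fin g in \<open>auto simp: mcomp_add C.mcomp_add mfps_in_intros\<close>)
  then show ?thesis by simp
qed

lemma mcomp_assoc:
  assumes Y: "finite Y" and G0: "\<And>w. w \<in> Y \<Longrightarrow> mcoeff (G w) 0 = 0"
    and FY: "\<And>v. v \<in> X \<Longrightarrow> mfps_in Y (F v)" and g: "mfps_in X g"
  shows "mcomp (mcomp g F) G = mcomp g (\<lambda>v. mcomp (F v) G)"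
proof -
  interpret G: msubst Y G by unfold_locales (use Y G0 in auto)
  interpret C: msubst X "\<lambda>v. mcomp (F v) G"
    by unfold_locales (use fin F0 FY in auto)
  note [simp] = mfps_in_mcomp [OF _ FY]
  let ?\<Delta> = "\<lambda>g. mcomp (mcomp g F) G - mcomp g (\<lambda>v. mcomp (F v) G)"
  have "?\<Delta> g = 0"
  proof (rule mfps_ext_by_vars [where X = X and \<Delta> = ?\<Delta>])
    fix v g assume v: "v \<in> X" and g: "mfps_in X g"
    then have "?\<Delta> (mvar v * g) = mcomp (F v) G * ?\<Delta> g"
      by (simp add: mcomp_mult C.mcomp_mult G.mcomp_mult mcomp_mvar C.mcomp_mvar mfps_in_intros FY algebra_simps)
    then show "\<exists>h. mcoeff h 0 = 0 \<and> ?\<Delta> (mvar v * g) = h * ?\<Delta> g"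
      using C.F0 [OF v] by blast
  qed (use fin g in \<open>auto simp: mcomp_add C.mcomp_add G.mcomp_add\<close>)
  then show ?thesis by simp
qed

end

lemma mcomp_mvar_id:
  assumes "finite X" "mfps_in X g" shows "mcomp g mvar = g"
proof -
  interpret msubst X mvar by unfold_locales (use assms in auto)
  let ?\<Delta> = "\<lambda>g :: 'a mfps. mcomp g mvar - g"
  have "?\<Delta> g = 0"
  proof (rule mfps_ext_by_vars [where X = X and \<Delta> = ?\<Delta>])
    fix v g assume v: "v \<in> X" and g: "mfps_in X g"
    then have "?\<Delta> (mvar v * g) = mvar v * ?\<Delta> g"
      by (simp add: mcomp_mult mcomp_mvar mfps_in_intros algebra_simps)
    then show "\<exists>h. mcoeff h 0 = 0 \<and> ?\<Delta> (mvar v * g) = h * ?\<Delta> g" using F0 [OF v]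
      by blast
  qed (use assms in \<open>auto simp: mcomp_add\<close>)
  then show ?thesis by simp
qed

section \<open>Formal vector fields\<close>

definition vderiv :: "'v set \<Rightarrow> ('v \<Rightarrow> 'v mfps) \<Rightarrow> 'v mfps \<Rightarrow> 'v mfps"
  where "vderiv X y f = (\<Sum>s\<in>X. y s * mderiv s f)"

definition vbracket :: "'v set \<Rightarrow> ('v \<Rightarrow> 'v mfps) \<Rightarrow> ('v \<Rightarrow> 'v mfps) \<Rightarrow> 'v \<Rightarrow> 'v mfps"
  where "vbracket X y z = (\<lambda>s. vderiv X y (z s) - vderiv X z (y s))"

definition viter :: "'v set \<Rightarrow> ('v \<Rightarrow> 'v mfps) list \<Rightarrow> 'v mfps \<Rightarrow> 'v mfps"
  where "viter X ys f = foldr (vderiv X) ys f"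

lemma viter_simps [simp]:
  "viter X [] f = f" "viter X (y # ys) f = vderiv X y (viter X ys f)"
  "viter X (ys @ zs) f = viter X ys (viter X zs f)"
  by (simp_all add: viter_def)

lemma vderiv_add [simp]: "vderiv X y (f + g) = vderiv X y f + vderiv X y g"
  and vderiv_diff [simp]: "vderiv X y (f - g) = vderiv X y f - vderiv X y g"
  and vderiv_0 [simp]: "vderiv X y 0 = 0"
  by (simp_all add: vderiv_def algebra_simps sum.distrib sum_subtractf)

lemma vderiv_sum: "vderiv X y (sum f A) = (\<Sum>x\<in>A. vderiv X y (f x))"
  by (induction A rule: infinite_finite_induct) auto

lemma vderiv_mult: "vderiv X y (f * g) = vderiv X y f * g + f * vderiv X y g"
  by (simp add: vderiv_def algebra_simps sum.distrib sum_distrib_left)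

lemma vderiv_mconst_mult [simp]: "vderiv X y (mconst c * f) = mconst c * vderiv X y f"
  by (simp add: vderiv_mult) (simp add: vderiv_def)

lemma mfps_in_vderiv:
  "(\<And>s. s \<in> X \<Longrightarrow> mfps_in Y (y s)) \<Longrightarrow> mfps_in Y f \<Longrightarrow> mfps_in Y (vderiv X y f)"
  unfolding vderiv_def by (intro mfps_in_intros) auto

text \<open>The bracket, defined by components, is the commutator of derivations: the second-order
  terms are symmetric in \<open>y\<close> and \<open>z\<close> because partial derivatives
  commute.\<close>

lemma vderiv_vbracket:
  assumes "finite X"
  shows "vderiv X (vbracket X y z) f = vderiv X y (vderiv X z f) - vderiv X z (vderiv X y f)"
proof -
  have *: "vderiv X y (vderiv X z f) = (\<Sum>s\<in>X. vderiv X y (z s) * mderiv s f)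
      + (\<Sum>s\<in>X. \<Sum>t\<in>X. z s * y t * mderiv t (mderiv s f))" for y z
    unfolding vderiv_def [of X z f]
    by (simp add: vderiv_sum vderiv_mult sum.distrib)
       (simp add: vderiv_def sum_distrib_left mult.assoc)
  have "(\<Sum>s\<in>X. \<Sum>t\<in>X. z s * y t * mderiv t (mderiv s f)) = (\<Sum>s\<in>X. \<Sum>t\<in>X. y s * z t * mderiv t (mderiv s f))"
    by (subst sum.swap) (simp add: mult_ac mderiv_commute)
  then show ?thesis
    unfolding * vderiv_def [of X "vbracket X y z"] unfolding vbracket_def
    by (simp add: left_diff_distrib sum_subtractf)
qed

lemma mord_ge_vderiv: "mord_ge (Suc k) f \<Longrightarrow> mord_ge k (vderiv X y f)"
  unfolding vderiv_def using mord_ge_mult [of 0 _ k] by (intro mord_ge_sum) (auto intro: mord_ge_mderiv)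

lemma mord_ge_viter: "mord_ge (k + length ys) f \<Longrightarrow> mord_ge k (viter X ys f)"
  by (induction ys arbitrary: k) (auto intro: mord_ge_vderiv)

lemma mcoeff_viter_0: "mord_ge (Suc (length ys)) f \<Longrightarrow> mcoeff (viter X ys f) 0 = 0"
  using mord_ge_viter [of 1 ys f X] by (simp add: mord_ge_def)

lemma viter_add: "viter X ys (f + g) = viter X ys f + viter X ys g"
  and viter_diff: "viter X ys (f - g) = viter X ys f - viter X ys g"
  and viter_0 [simp]: "viter X ys 0 = 0"
  and viter_mconst_mult: "viter X ys (mconst c * f) = mconst c * viter X ys f"
  by (induction ys) auto

lemma viter_sum: "viter X ys (sum f A) = (\<Sum>x\<in>A. viter X ys (f x))"
  by (induction A rule: infinite_finite_induct) (auto simp: viter_add)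

lemma mcoeff_vderiv_0: "mcoeff (vderiv X y f) 0 = (\<Sum>s\<in>X. mcoeff (y s) 0 * mcoeff (mderiv s f) 0)"
  by (simp add: vderiv_def)

section \<open>Words of partial derivatives and Taylor coefficients\<close>

definition exp_of_list :: "'v list \<Rightarrow> ('v \<Rightarrow>\<^sub>0 nat)"
  where "exp_of_list ss = sum_list (map unit_exp ss)"

lemma exp_of_list_simps [simp]:
  "exp_of_list [] = 0" "exp_of_list (s # ss) = unit_exp s + exp_of_list ss"
  by (simp_all add: exp_of_list_def)

lemma lookup_exp_of_list: "mlookup (exp_of_list ss) v = count (mset ss) v"
  by (induction ss) (auto simp: lookup_add)

lemma mdeg_exp_of_list [simp]: "mdeg (exp_of_list ss) = length ss"
  and mkeys_exp_of_list [simp]: "mkeys (exp_of_list ss) = set ss"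
  by (induction ss) auto

lemma exp_of_list_eqD: "exp_of_list ss = exp_of_list ts \<Longrightarrow> mset ss = mset ts"
  by (metis lookup_exp_of_list multiset_eqI)

lemma ex_exp_of_list: "\<exists>ss. exp_of_list ss = \<alpha>"
proof (induction "mdeg \<alpha>" arbitrary: \<alpha> rule: less_induct)
  case less
  show ?case
  proof (cases "\<alpha> = 0")
    case True then show ?thesis by (intro exI [of _ "[]"]) simp
  next
    case False
    then obtain \<beta> v where \<beta>: "\<alpha> = \<beta> + unit_exp v" "mdeg \<beta> < mdeg \<alpha>" by (rule mdeg_pos_decomp)
    then obtain ss where "exp_of_list ss = \<beta>" using less by blast
    then show ?thesis using \<beta>(1) by (intro exI [of _ "v # ss"]) (simp add: add.commute)
  qed
qed

definition mderivs :: "'v list \<Rightarrow> 'v mfps \<Rightarrow> 'v mfps"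
  where "mderivs ss f = foldr mderiv ss f"

lemma mderivs_simps [simp]: "mderivs [] f = f" "mderivs (s # ss) f = mderiv s (mderivs ss f)"
  by (simp_all add: mderivs_def)

lemma mord_ge_mderivs: "mord_ge (k + length ss) f \<Longrightarrow> mord_ge k (mderivs ss f)"
  by (induction ss arbitrary: k) (auto intro: mord_ge_mderiv)

definition mfact :: "'v set \<Rightarrow> ('v \<Rightarrow>\<^sub>0 nat) \<Rightarrow> complex"
  where "mfact X m = (\<Prod>v\<in>X. fact (mlookup m v))"

lemma mfact_neq_0 [simp]: "mfact X m \<noteq> 0"
  by (cases "finite X") (auto simp: mfact_def)

lemma mfact_0 [simp]: "mfact X 0 = 1"
  by (simp add: mfact_def)

lemma mfact_add_unit_exp:
  assumes "finite X" "s \<in> X"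
  shows "mfact X (m + unit_exp s) = of_nat (mlookup m s + 1) * mfact X m"
proof -
  have "mfact X (m + unit_exp s) = fact (mlookup m s + 1) * (\<Prod>v\<in>X - {s}. fact (mlookup m v))"
    unfolding mfact_def prod.remove [OF assms]
    by (intro arg_cong2 [where f = "(*)"] prod.cong) (auto simp: lookup_add)
  also have "\<dots> = of_nat (mlookup m s + 1) * mfact X m"
    unfolding mfact_def prod.remove [OF assms] by (simp add: algebra_simps)
  finally show ?thesis .
qed

lemma mcoeff_mderivs:
  assumes "finite X" "set ss \<subseteq> X"
  shows "mfact X m * mcoeff (mderivs ss f) m = mfact X (m + exp_of_list ss) * mcoeff f (m + exp_of_list ss)"
  using assms(2)
proof (induction ss arbitrary: m)
  case (Cons s ss)
  have "mfact X m * mcoeff (mderivs (s # ss) f) m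
    = mfact X (m + unit_exp s) * mcoeff (mderivs ss f) (m + unit_exp s)"
    using Cons.prems by (simp add: mcoeff_mderiv mfact_add_unit_exp assms(1))
  also have "\<dots> = mfact X (m + exp_of_list (s # ss)) * mcoeff f (m + exp_of_list (s # ss))"
    using Cons by (simp add: add.assoc)
  finally show ?case .
qed simp

lemma mcoeff_mderivs_0:
  assumes "finite X" "set ss \<subseteq> X"
  shows "mcoeff (mderivs ss f) 0 = mfact X (exp_of_list ss) * mcoeff f (exp_of_list ss)"
  using mcoeff_mderivs [OF assms, of 0] by simp

section \<open>A formal version of Nagano's theorem\<close>

locale formal_lie_algebra =
  fixes X :: "'v set" and LL :: "('v \<Rightarrow> 'v mfps) set"
  assumes finX: "finite X"
    and LL_in: "\<And>y s. y \<in> LL \<Longrightarrow> s \<in> X \<Longrightarrow> mfps_in X (y s)"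
    and LL_bracket: "\<And>y z. y \<in> LL \<Longrightarrow> z \<in> LL \<Longrightarrow> vbracket X y z \<in> LL"
begin

text \<open>The finite stage of vanishing on the orbit; the construction in Nagano's theorem raises
  \<open>l\<close> by one at a time.\<close>

definition vanish_upto :: "nat \<Rightarrow> 'v mfps \<Rightarrow> bool"
  where "vanish_upto l f \<longleftrightarrow> (\<forall>ys. set ys \<subseteq> LL \<longrightarrow> length ys \<le> l \<longrightarrow> mcoeff (viter X ys f) 0 = 0)"

text \<open>The two words differ by the word with the bracket in place of \<open>y\<close>,
  \<open>z\<close>. The bracket is again in \<open>LL\<close>, so this word has length at most
  \<open>l\<close> and gives 0.\<close>

lemma viter_swap:
  assumes f: "vanish_upto l f" and l: "length as + length bs + 2 \<le> Suc l"
    and LL: "set as \<subseteq> LL" "set bs \<subseteq> LL" "y \<in> LL" "z \<in> LL"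
  shows "mcoeff (viter X (as @ y # z # bs) f) 0 = mcoeff (viter X (as @ z # y # bs) f) 0"
proof -
  have "viter X (as @ y # z # bs) f - viter X (as @ z # y # bs) f = viter X (as @ vbracket X y z # bs) f"
    by (simp add: vderiv_vbracket finX viter_diff)
  moreover have "mcoeff (viter X (as @ vbracket X y z # bs) f) 0 = 0"
    using f l LL LL_bracket unfolding vanish_upto_def by (auto simp del: viter_simps)
  ultimately show ?thesis by (metis eq_iff_diff_eq_0 mcoeff_diff)
qed

lemma viter_move:
  assumes f: "vanish_upto l f" and l: "length ps + length as + length bs < Suc l"
    and LL: "set ps \<subseteq> LL" "set as \<subseteq> LL" "set bs \<subseteq> LL" "y \<in> LL"
  shows "mcoeff (viter X (ps @ y # as @ bs) f) 0 = mcoeff (viter X (ps @ as @ y # bs) f) 0"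
  using l LL
proof (induction as arbitrary: ps)
  case (Cons a as)
  have "mcoeff (viter X (ps @ y # (a # as) @ bs) f) 0 = mcoeff (viter X (ps @ a # y # (as @ bs)) f) 0"
    using viter_swap [OF f, of ps "as @ bs" y a] Cons.prems by simp
  also have "\<dots> = mcoeff (viter X ((ps @ [a]) @ y # as @ bs) f) 0" by simp
  also have "\<dots> = mcoeff (viter X ((ps @ [a]) @ as @ y # bs) f) 0"
    using Cons.prems by (intro Cons.IH) auto
  finally show ?case by simp
qed simp

text \<open>At length \<open>Suc l\<close> the value at 0 is thus a symmetric function of the
  fields, like the derivatives of a homogeneous polynomial. This is what allows a polynomial to
  correct \<open>f\<close> at the next order.\<close>

lemma viter_perm:
  assumes f: "vanish_upto l f" and l: "length ps + length as \<le> Suc l"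
    and LL: "set ps \<subseteq> LL" "set as \<subseteq> LL" and eq: "mset as = mset bs"
  shows "mcoeff (viter X (ps @ as) f) 0 = mcoeff (viter X (ps @ bs) f) 0"
  using l LL eq
proof (induction as arbitrary: ps bs)
  case (Cons a as)
  have "a \<in> set bs" using Cons.prems by (metis list.set_intros(1) mset_eq_setD)
  then obtain b1 b2 where b: "bs = b1 @ a # b2" by (meson split_list)
  have m: "mset as = mset (b1 @ b2)" using Cons.prems(4) unfolding b by simp
  have set: "set b1 \<subseteq> LL" "set b2 \<subseteq> LL" "a \<in> LL"
    using Cons.prems(3) mset_eq_setD [OF Cons.prems(4)] unfolding b by auto
  have len: "length as = length b1 + length b2" using mset_eq_length [OF m] by simp
  have "mcoeff (viter X (ps @ a # as) f) 0 = mcoeff (viter X ((ps @ [a]) @ as) f) 0" by simp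
  also have "\<dots> = mcoeff (viter X ((ps @ [a]) @ (b1 @ b2)) f) 0"
    using Cons.prems m by (intro Cons.IH) auto
  also have "\<dots> = mcoeff (viter X (ps @ a # b1 @ b2) f) 0" by simp
  also have "\<dots> = mcoeff (viter X (ps @ b1 @ a # b2) f) 0"
    using Cons.prems len set by (intro viter_move [OF f]) auto
  finally show ?case by (simp add: b)
qed simp

end

text \<open>The constant terms of \<open>P\<close> form the matrix of a projection onto the span of
  the values of \<open>LL\<close> at 0. A projection, unlike a basis of that span, is indexed by the
  variables themselves, so a monomial in \<open>X\<close> determines a word of fields.\<close>

locale formal_lie_algebra_frame = formal_lie_algebra +
  fixes P :: "'a \<Rightarrow> 'a \<Rightarrow> 'a mfps"
  assumes P_LL: "\<And>s. s \<in> X \<Longrightarrow> P s \<in> LL"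
    and P_proj: "\<And>y t. y \<in> LL \<Longrightarrow> t \<in> X \<Longrightarrow>
      mcoeff (y t) 0 = (\<Sum>s\<in>X. mcoeff (y s) 0 * mcoeff (P s t) 0)"
begin

text \<open>Moved to the front, \<open>y\<close> is applied last, and then only its value at 0
  counts. That value is expressed through the frame, whose fields are moved back.\<close>

lemma viter_slot:
  assumes f: "vanish_upto l f" and l: "length as + length bs \<le> l"
    and LL: "set as \<subseteq> LL" "set bs \<subseteq> LL" "y \<in> LL"
  shows "mcoeff (viter X (as @ y # bs) f) 0 = (\<Sum>s\<in>X. mcoeff (y s) 0 * mcoeff (viter X (as @ P s # bs) f) 0)"
proof -
  let ?D = "\<lambda>t. mcoeff (mderiv t (viter X (as @ bs) f)) 0"
  have front: "mcoeff (viter X (as @ z # bs) f) 0 = (\<Sum>t\<in>X. mcoeff (z t) 0 * ?D t)" if "z \<in> LL" for z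
  proof -
    have "mcoeff (viter X (as @ z # bs) f) 0 = mcoeff (viter X ([] @ z # as @ bs) f) 0"
      using l LL that by (subst viter_move [OF f]) auto
    then show ?thesis by (simp add: mcoeff_vderiv_0)
  qed
  have "mcoeff (viter X (as @ y # bs) f) 0 = (\<Sum>t\<in>X. (\<Sum>s\<in>X. mcoeff (y s) 0 * mcoeff (P s t) 0) * ?D t)"
    unfolding front [OF LL(3)] using P_proj [OF LL(3)] by (intro sum.cong) auto
  also have "\<dots> = (\<Sum>s\<in>X. mcoeff (y s) 0 * (\<Sum>t\<in>X. mcoeff (P s t) 0 * ?D t))"
    by (simp add: sum_distrib_left sum_distrib_right mult.assoc) (rule sum.swap)
  also have "\<dots> = (\<Sum>s\<in>X. mcoeff (y s) 0 * mcoeff (viter X (as @ P s # bs) f) 0)"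
    by (intro sum.cong refl) (simp only: front P_LL)
  finally show ?thesis .
qed

text \<open>\<open>q\<close> is the homogeneous polynomial of degree \<open>Suc l\<close> whose
  partial derivatives at 0 reproduce the derivatives of \<open>f\<close> along the frame. Words of
  length at most \<open>l\<close> do not see it, so only the top order changes.\<close>

lemma vanish_upto_step:
  assumes f: "vanish_upto l f"
  obtains q where "mfps_in X q" "mord_ge (Suc l) q" "vanish_upto (Suc l) (f - q)"
proof -
  define lst where "lst = (\<lambda>\<alpha>. SOME ss :: 'a list. exp_of_list ss = \<alpha>)"
  have lst: "exp_of_list (lst \<alpha>) = \<alpha>" for \<alpha>
    unfolding lst_def using ex_exp_of_list by (rule someI_ex)
  define q where "q = Abs_mfps (\<lambda>\<alpha>. if mkeys \<alpha> \<subseteq> X \<and> mdeg \<alpha> = Suc l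
    then mcoeff (viter X (map P (lst \<alpha>)) f) 0 / mfact X \<alpha> else 0)"
  have q_in: "mfps_in X q" by (auto simp: q_def mfps_in_def)
  have q_ord: "mord_ge (Suc l) q" by (auto simp: q_def mord_ge_def)
  have q_deriv: "mcoeff (mderivs ss q) 0 = mcoeff (viter X (map P ss) f) 0"
    if ss: "set ss \<subseteq> X" "length ss = Suc l" for ss
  proof -
    have "mset (lst (exp_of_list ss)) = mset ss" by (rule exp_of_list_eqD) (rule lst)
    moreover from this have "set (lst (exp_of_list ss)) = set ss" "length (lst (exp_of_list ss)) = length ss"
      by (auto dest: mset_eq_setD mset_eq_length)
    ultimately have "mcoeff (viter X ([] @ map P (lst (exp_of_list ss))) f) 0 = mcoeff (viter X ([] @ map P ss) f) 0"
      using ss P_LL by (intro viter_perm [OF f]) auto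
    then show ?thesis using ss by (simp add: mcoeff_mderivs_0 [OF finX ss(1)]) (simp add: q_def)
  qed
  \<comment> \<open>Induction over the fields in \<open>bs\<close>, innermost first. Only the
    constant part of \<open>b\<close> acts on the leading part of \<open>q\<close>, the rest
    \<open>?r\<close> having too high an order; \<open>viter_slot\<close> then recombines the frame
    fields into \<open>b\<close>.\<close>
  have main: "mcoeff (viter X bs (mderivs ss q)) 0 = mcoeff (viter X (bs @ map P ss) f) 0"
    if "set bs \<subseteq> LL" "set ss \<subseteq> X" "length bs + length ss = Suc l" for bs ss
    using that
  proof (induction bs arbitrary: ss rule: rev_induct)
    case Nil then show ?case using q_deriv by simp
  next
    case (snoc b bs)
    let ?g = "mderivs ss q"
    have "mord_ge (Suc (length bs)) ?g"
      using snoc.prems q_ord by (intro mord_ge_mderivs) simp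
    then have g: "mord_ge (length bs) (mderiv s ?g)" for s by (rule mord_ge_mderiv)
    have "vderiv X b ?g = (\<Sum>s\<in>X. (mconst (mcoeff (b s) 0) + (b s - mconst (mcoeff (b s) 0))) * mderiv s ?g)"
      by (simp add: vderiv_def)
    also have "\<dots> = (\<Sum>s\<in>X. mconst (mcoeff (b s) 0) * mderivs (s # ss) q)
        + (\<Sum>s\<in>X. (b s - mconst (mcoeff (b s) 0)) * mderiv s ?g)" (is "_ = _ + ?r")
      by (simp only: distrib_right sum.distrib mderivs_simps)
    finally have v: "vderiv X b ?g = (\<Sum>s\<in>X. mconst (mcoeff (b s) 0) * mderivs (s # ss) q) + ?r" .
    have "mord_ge (1 + length bs) ?r"
      by (intro mord_ge_sum mord_ge_mult g) (simp only: mord_ge_1_iff mcoeff_diff mcoeff_mconst_0 diff_self)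
    then have "mcoeff (viter X bs ?r) 0 = 0" by (intro mcoeff_viter_0) simp
    then have "mcoeff (viter X (bs @ [b]) ?g) 0
      = (\<Sum>s\<in>X. mcoeff (b s) 0 * mcoeff (viter X bs (mderivs (s # ss) q)) 0)"
      by (simp only: viter_simps v viter_add viter_sum viter_mconst_mult mcoeff_add mcoeff_sum mcoeff_mconst_mult) simp
    also have "\<dots> = (\<Sum>s\<in>X. mcoeff (b s) 0 * mcoeff (viter X (bs @ P s # map P ss) f) 0)"
      using snoc.prems by (intro sum.cong refl) (subst snoc.IH, auto)
    also have "\<dots> = mcoeff (viter X (bs @ b # map P ss) f) 0"
      using snoc.prems P_LL by (intro viter_slot [OF f, symmetric]) auto
    finally show ?case by simp
  qed
  have "vanish_upto (Suc l) (f - q)"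
    unfolding vanish_upto_def
  proof (intro allI impI)
    fix ys assume ys: "set ys \<subseteq> LL" "length ys \<le> Suc l"
    show "mcoeff (viter X ys (f - q)) 0 = 0"
    proof (cases "length ys = Suc l")
      case True
      then show ?thesis using main [of ys "[]"] ys by (simp add: viter_diff)
    next
      case False
      then have "mcoeff (viter X ys f) 0 = 0" using f ys by (auto simp: vanish_upto_def)
      moreover have "mcoeff (viter X ys q) 0 = 0"
        using False ys by (intro mcoeff_viter_0 mord_ge_mono [OF q_ord]) auto
      ultimately show ?thesis by (simp add: viter_diff)
    qed
  qed
  with q_in q_ord show thesis by (rule that)
qed

theorem formal_nagano:
  assumes \<theta>: "\<And>y. y \<in> LL \<Longrightarrow> (\<Sum>s\<in>X. \<theta> s * mcoeff (y s) 0) = 0"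
  obtains f where "mfps_in X f" "mcoeff f 0 = 0" "\<And>s. s \<in> X \<Longrightarrow> mcoeff (mderiv s f) 0 = \<theta> s"
    "\<And>ys. set ys \<subseteq> LL \<Longrightarrow> mcoeff (viter X ys f) 0 = 0"
proof -
  \<comment> \<open>The linear form with differential \<open>\<theta>\<close> is killed by words of
    length at most 1, which is the assumption on \<open>\<theta>\<close>.\<close>
  define f1 where "f1 = (\<Sum>s\<in>X. mconst (\<theta> s) * mvar s)"
  have f1_in: "mfps_in X f1" unfolding f1_def by (intro mfps_in_intros) auto
  have f1_0: "mcoeff f1 0 = 0" by (simp add: f1_def)
  have f1_d: "mcoeff (mderiv s f1) 0 = \<theta> s" if "s \<in> X" for s
  proof -
    have "mcoeff (mderiv s f1) 0 = (\<Sum>t\<in>X. if t = s then \<theta> t else 0)"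
      by (auto simp: f1_def mderiv_sum mderiv_mvar intro!: sum.cong)
    then show ?thesis using that finX by simp
  qed
  have f1_v: "vanish_upto 1 f1"
    unfolding vanish_upto_def
  proof (intro allI impI)
    fix ys assume ys: "set ys \<subseteq> LL" "length ys \<le> 1"
    then consider "ys = []" | y where "ys = [y]" "y \<in> LL"
      by (cases ys) auto
    then show "mcoeff (viter X ys f1) 0 = 0"
    proof cases
      case 2
      then have "mcoeff (viter X ys f1) 0 = (\<Sum>s\<in>X. \<theta> s * mcoeff (y s) 0)"
        by (simp add: mcoeff_vderiv_0 f1_d mult.commute)
      with \<theta> 2 show ?thesis by simp
    qed (simp add: f1_0)
  qed
  have "\<exists>F. \<forall>n. (mfps_in X (F n) \<and> vanish_upto (Suc n) (F n) \<and> mord_ge 2 (F n - f1)) \<and> mord_ge (n + 2) (F n - F (Suc n))"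
  proof (rule dependent_nat_choice)
    show "\<exists>f. mfps_in X f \<and> vanish_upto (Suc 0) f \<and> mord_ge 2 (f - f1)"
      using f1_in f1_v by (intro exI [of _ f1]) simp
  next
    fix f n assume f: "mfps_in X f \<and> vanish_upto (Suc n) f \<and> mord_ge 2 (f - f1)"
    then obtain q where q: "mfps_in X q" "mord_ge (Suc (Suc n)) q" "vanish_upto (Suc (Suc n)) (f - q)"
      using vanish_upto_step by blast
    have "mord_ge 2 ((f - f1) - q)" using f mord_ge_mono [OF q(2), of 2] by (intro mord_ge_diff [of 2 "f - f1"]) auto
    then show "\<exists>g. (mfps_in X g \<and> vanish_upto (Suc (Suc n)) g \<and> mord_ge 2 (g - f1)) \<and> mord_ge (n + 2) (f - g)"
      using f q by (intro exI [of _ "f - q"]) (auto simp: mfps_in_diff algebra_simps)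
  qed
  then obtain F where F_in: "\<And>n. mfps_in X (F n)" and F_v: "\<And>n. vanish_upto (Suc n) (F n)"
    and F_2: "\<And>n. mord_ge 2 (F n - f1)" and F_s: "\<And>n. mord_ge (n + 2) (F n - F (Suc n))" by blast
  have F_stable: "mord_ge (n + 2) (F n - F (n + k))" for n k
  proof (induction k)
    case (Suc k)
    have "mord_ge (n + 2) ((F n - F (n + k)) + (F (n + k) - F (Suc (n + k))))"
      by (intro mord_ge_add Suc mord_ge_mono [OF F_s [of "n + k"]]) simp
    then show ?case by simp
  qed simp
  \<comment> \<open>Stages from \<open>n\<close> on agree in degrees below \<open>n + 2\<close>, so
    the coefficients of degree \<open>k\<close> are final at stage \<open>k\<close>.\<close>
  define f where "f = Abs_mfps (\<lambda>\<alpha>. mcoeff (F (mdeg \<alpha>)) \<alpha>)"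
  have f_F: "mord_ge (n + 2) (f - F n)" for n
    unfolding mord_ge_def
  proof (intro allI impI)
    fix m :: "'a \<Rightarrow>\<^sub>0 nat" assume m: "mdeg m < n + 2"
    have "mcoeff (F (mdeg m)) m = mcoeff (F n) m"
    proof (cases "mdeg m \<le> n")
      case True
      then obtain k where "n = mdeg m + k" by (metis le_add_diff_inverse)
      then show ?thesis using F_stable [of "mdeg m" k] by (auto simp: mord_ge_def)
    next
      case False
      then show ?thesis using F_stable [of n "mdeg m - n"] m by (auto simp: mord_ge_def)
    qed
    then show "mcoeff (f - F n) m = 0" by (simp add: f_def)
  qed
  have f_f1: "mord_ge 2 (f - f1)"
    using mord_ge_add [of 2 "f - F 0" "F 0 - f1"] f_F [of 0] F_2 [of 0] by (simp add: numeral_2_eq_2)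
  show thesis
  proof
    show "mfps_in X f" using F_in by (auto simp: f_def mfps_in_def)
    show "mcoeff f 0 = 0" using f_f1 f1_0 by (simp add: mord_ge_def)
    show "mcoeff (mderiv s f) 0 = \<theta> s" if "s \<in> X" for s
      using f_f1 f1_d [OF that] by (simp add: mord_ge_def mcoeff_mderiv)
    show "mcoeff (viter X ys f) 0 = 0" if "set ys \<subseteq> LL" for ys
    proof -
      have "mcoeff (viter X ys (f - F (length ys))) 0 = 0"
        by (intro mcoeff_viter_0 mord_ge_mono [OF f_F]) simp
      moreover have "mcoeff (viter X ys (F (length ys))) 0 = 0"
        using F_v [of "length ys"] that by (auto simp: vanish_upto_def)
      ultimately show ?thesis by (simp add: viter_diff)
    qed
  qed
qed

end

section \<open>The ideal of the formal orbit\<close>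

context formal_lie_algebra
begin

text \<open>The series that vanish, in the formal sense, on the orbit of \<open>LL\<close> through
  0. The empty word is included, so they have no constant term.\<close>

definition orbit_ideal :: "'v mfps set"
  where "orbit_ideal = {f. mfps_in X f \<and> (\<forall>ys. set ys \<subseteq> LL \<longrightarrow> mcoeff (viter X ys f) 0 = 0)}"

lemma orbit_ideal_vderiv: "f \<in> orbit_ideal \<Longrightarrow> y \<in> LL \<Longrightarrow> vderiv X y f \<in> orbit_ideal"
  unfolding orbit_ideal_def
proof (intro CollectI conjI allI impI; elim CollectE conjE)
  fix ys assume "\<forall>ys. set ys \<subseteq> LL \<longrightarrow> mcoeff (viter X ys f) 0 = 0" "y \<in> LL" "set ys \<subseteq> LL"
  then have "mcoeff (viter X (ys @ [y]) f) 0 = 0" by (auto simp del: viter_simps)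
  then show "mcoeff (viter X ys (vderiv X y f)) 0 = 0" by simp
qed (auto intro: mfps_in_vderiv dest: LL_in)

lemma orbit_ideal_add: "f \<in> orbit_ideal \<Longrightarrow> g \<in> orbit_ideal \<Longrightarrow> f + g \<in> orbit_ideal"
  by (auto simp: orbit_ideal_def viter_add mfps_in_add)

lemma orbit_ideal_coeff_0: "f \<in> orbit_ideal \<Longrightarrow> mcoeff f 0 = 0"
  unfolding orbit_ideal_def by (auto dest: spec [of _ "[]"])

text \<open>The Leibniz rule at the innermost field leaves two products of the same kind and one
  field less; hence the induction from the right, with both factors arbitrary.\<close>

lemma orbit_ideal_mult: "f \<in> orbit_ideal \<Longrightarrow> mfps_in X a \<Longrightarrow> a * f \<in> orbit_ideal"
proof -
  have "mcoeff (viter X ys (a * f)) 0 = 0" if "set ys \<subseteq> LL" "f \<in> orbit_ideal" "mfps_in X a" for ys a f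
    using that
  proof (induction ys arbitrary: a f rule: rev_induct)
    case Nil then show ?case by (simp add: orbit_ideal_coeff_0)
  next
    case (snoc y ys)
    have "mcoeff (viter X ys (vderiv X y a * f)) 0 = 0" "mcoeff (viter X ys (a * vderiv X y f)) 0 = 0"
      using snoc.prems by (auto intro!: snoc.IH orbit_ideal_vderiv intro: mfps_in_vderiv dest: LL_in)
    then show ?case by (simp add: vderiv_mult viter_add)
  qed
  moreover assume "f \<in> orbit_ideal" "mfps_in X a"
  ultimately show ?thesis by (auto simp: orbit_ideal_def intro: mfps_in_mult)
qed

text \<open>Each defining condition sees only finitely many orders, so the ideal is closed under
  approximation to every order.\<close>

lemma orbit_ideal_closed:
  assumes "mfps_in X f" "\<And>k. \<exists>g\<in>orbit_ideal. mord_ge k (f - g)"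
  shows "f \<in> orbit_ideal"
  unfolding orbit_ideal_def
proof (intro CollectI conjI allI impI)
  fix ys assume ys: "set ys \<subseteq> LL"
  obtain g where g: "g \<in> orbit_ideal" "mord_ge (Suc (length ys)) (f - g)" using assms(2) by blast
  have "mcoeff (viter X ys (f - g)) 0 = 0" "mcoeff (viter X ys g) 0 = 0"
    using g ys by (auto intro: mcoeff_viter_0 simp: orbit_ideal_def)
  then show "mcoeff (viter X ys f) 0 = 0" by (simp add: viter_diff)
qed fact

end

text \<open>Substitution of 0 for \<open>b\<close>, written on coefficients so that no finite set of
  variables has to be named.\<close>

definition mset0 :: "'v \<Rightarrow> 'v mfps \<Rightarrow> 'v mfps"
  where "mset0 b f = Abs_mfps (\<lambda>m. if mlookup m b = 0 then mcoeff f m else 0)"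

lemma mcoeff_mset0: "mcoeff (mset0 b f) m = (if mlookup m b = 0 then mcoeff f m else 0)"
  by (simp add: mset0_def)

lemma mfps_in_mset0: "mfps_in X f \<Longrightarrow> mfps_in (X - {b}) (mset0 b f)"
  by (auto simp: mfps_in_def mcoeff_mset0 in_keys_iff)

lemma mderiv_mset0: "mderiv b (mset0 b f) = 0"
  by (rule mfps_eqI) (simp add: mcoeff_mderiv mcoeff_mset0 lookup_add)

context formal_lie_algebra
begin

text \<open>Setting the variable \<open>b\<close> to 0 is a Taylor expansion whose increment is
  minus that variable. The partial sums stay in the ideal, which contains all derivatives of
  \<open>f\<close> along \<open>b\<close>, and they approximate \<open>mset0 b f\<close> to every
  order.\<close>

lemma orbit_ideal_mset0:
  assumes f: "f \<in> orbit_ideal" and b: "b \<in> X" "(\<lambda>s. if s = b then 1 else 0) \<in> LL"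
  shows "mset0 b f \<in> orbit_ideal"
proof -
  have vb: "vderiv X (\<lambda>s. if s = b then 1 else 0) g = mderiv b g" for g :: "'v mfps"
  proof -
    have "vderiv X (\<lambda>s. if s = b then 1 else 0) g = (\<Sum>s\<in>X. if s = b then mderiv s g else 0)"
      unfolding vderiv_def by (intro sum.cong) auto
    then show ?thesis using finX b(1) by simp
  qed
  have D: "mderiv b g \<in> orbit_ideal" if "g \<in> orbit_ideal" for g
    using orbit_ideal_vderiv [OF that b(2)] by (simp add: vb)
  have Dk: "(mderiv b ^^ k) f \<in> orbit_ideal" for k
    by (induction k) (auto intro: f D)
  have f_in: "mfps_in X f" using f by (auto simp: orbit_ideal_def)
  \<comment> \<open>\<open>T l\<close> is the Taylor polynomial of \<open>f\<close> at \<open>x\<^sub>b\<close>, evaluated at increment \<open>-x\<^sub>b\<close>.\<close>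
  define c where "c = (\<lambda>k. mconst ((- 1) ^ k / fact k) * mvar b ^ k :: 'v mfps)"
  define T where "T = (\<lambda>l. \<Sum>k<l. c k * (mderiv b ^^ k) f)"
  have c_in: "mfps_in X (c k)" for k
    unfolding c_def using b by (intro mfps_in_intros mfps_in_mconst)
  have T_J: "T l \<in> orbit_ideal" for l
  proof (induction l)
    case 0 show ?case using orbit_ideal_mult [OF f, of 0] by (simp add: T_def)
  next
    case (Suc l) then show ?case
      by (simp add: T_def orbit_ideal_add orbit_ideal_mult Dk c_in)
  qed
  have dpow: "mderiv b (mvar b ^ Suc k) = mconst (of_nat (Suc k)) * (mvar b :: 'v mfps) ^ k" for k
  proof (induction k)
    case (Suc k)
    define c :: "'v mfps" where "c = mconst (of_nat (Suc k))"
    have c: "mconst (of_nat (Suc (Suc k))) = 1 + c"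
      unfolding c_def by (metis mconst_1 mconst_add of_nat_Suc)
    have "mderiv b (mvar b ^ Suc (Suc k)) = mvar b ^ Suc k + mvar b * mderiv b ((mvar b :: 'v mfps) ^ Suc k)"
      by (subst power_Suc) (simp only: mderiv_mult mderiv_mvar, simp)
    then show ?case unfolding Suc.IH c unfolding c_def [symmetric] by (simp add: algebra_simps)
  qed (simp add: mderiv_mvar)
  have dc: "mderiv b (c (Suc k)) = - c k" for k
  proof -
    have "(- 1) ^ Suc k / fact (Suc k) * of_nat (Suc k) = - ((- 1) ^ k / fact k :: complex)"
      by (simp add: fact_Suc del: of_nat_Suc)
    then show ?thesis
      unfolding c_def by (simp only: mderiv_mult mderiv_mconst dpow mult_zero_left add_0
        mult.assoc [symmetric] mconst_mult [symmetric]) (simp only: mconst_uminus mult_minus_left)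
  qed
  \<comment> \<open>The sum telescopes, and only its last term is left.\<close>
  have dT: "mderiv b (mset0 b f - T (Suc l)) = - (c l * (mderiv b ^^ Suc l) f)" for l
  proof (induction l)
    case 0
    show ?case by (simp add: T_def mderiv_mset0 c_def)
  next
    case (Suc l)
    have "mset0 b f - T (Suc (Suc l)) = (mset0 b f - T (Suc l)) - c (Suc l) * (mderiv b ^^ Suc l) f"
      by (simp add: T_def algebra_simps)
    then have "mderiv b (mset0 b f - T (Suc (Suc l)))
      = mderiv b (mset0 b f - T (Suc l)) - mderiv b (c (Suc l) * (mderiv b ^^ Suc l) f)"
      by (metis mderiv_diff)
    then show ?case unfolding Suc.IH mderiv_mult dc by simp
  qed
  have low: "mcoeff (mvar b ^ k * g) m = 0" if "mlookup m b < k" for k m and g :: "'v mfps"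
    using that
  proof (induction k arbitrary: m)
    case (Suc k)
    show ?case
    proof (cases "b \<in> mkeys m")
      case True
      then obtain m' where m: "m = m' + unit_exp b" by (rule unit_exp_decomp)
      then show ?thesis using Suc by (simp add: mcoeff_mvar_mult lookup_add mult.assoc)
    next
      case False then show ?thesis by (simp add: mcoeff_mvar_mult mult.assoc)
    qed
  qed simp
  have lowc: "mcoeff (c k * g) m = 0" if "mlookup m b < k" for k m and g :: "'v mfps"
    using low [OF that] by (simp add: c_def mult.assoc)
  have T0: "mcoeff (mset0 b f - T (Suc l)) m = 0" if "mlookup m b = 0" for l m
  proof -
    have "mcoeff (T (Suc l)) m = mcoeff f m"
    proof (induction l)
      case (Suc l) then show ?case using lowc [of m "Suc l"] that by (simp add: T_def)
    qed (simp add: T_def c_def)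
    then show ?thesis using that by (simp add: mcoeff_mset0)
  qed
  \<comment> \<open>Coefficients without \<open>b\<close> agree by \<open>T0\<close>. A coefficient
    with \<open>b\<close> can be read off the derivative of the remainder, which by
    \<open>dT\<close> is divisible by \<open>mvar b ^ l\<close>.\<close>
  have R: "mcoeff (mset0 b f - T (Suc l)) m = 0" if m: "mlookup m b < Suc l" for l m
  proof (cases "b \<in> mkeys m")
    case True
    then obtain m' where m': "m = m' + unit_exp b" by (rule unit_exp_decomp)
    have "mcoeff (mderiv b (mset0 b f - T (Suc l))) m' = 0"
      unfolding dT using lowc [of m' l] m m' by (simp add: lookup_add)
    moreover have "complex_of_nat (mlookup m' b + 1) \<noteq> 0" by (metis Suc_eq_plus1 of_nat_neq_0)
    ultimately show ?thesis unfolding m' mcoeff_mderiv by simp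
  next
    case False then show ?thesis by (intro T0) (simp add: in_keys_iff)
  qed
  show ?thesis
  proof (rule orbit_ideal_closed)
    show "mfps_in X (mset0 b f)" using mfps_in_mset0 [OF f_in, of b] by (rule mfps_in_mono) auto
    fix k
    have "mlookup m b \<le> mdeg m" for m
      by (cases "b \<in> mkeys m") (auto simp: mdeg_def in_keys_iff intro: member_le_sum)
    then have "mord_ge k (mset0 b f - T (Suc k))" unfolding mord_ge_def by (meson R le_less_trans less_SucI)
    then show "\<exists>g\<in>orbit_ideal. mord_ge k (mset0 b f - g)" using T_J by blast
  qed
qed

end

section \<open>Smooth functions\<close>

lemma frechet_derivative_cong_open:
  assumes "open U" "p \<in> U" "\<And>q. q \<in> U \<Longrightarrow> f q = g q"
  shows "frechet_derivative f (at p) = frechet_derivative g (at p)"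
    and "f differentiable (at p) \<longleftrightarrow> g differentiable (at p)"
proof -
  have "(f has_derivative f') (at p) \<longleftrightarrow> (g has_derivative f') (at p)" for f'
    using assms by (metis has_derivative_transform_within_open)
  then show "frechet_derivative f (at p) = frechet_derivative g (at p)"
    "f differentiable (at p) \<longleftrightarrow> g differentiable (at p)"
    unfolding frechet_derivative_def differentiable_def by simp_all
qed

lemma Ck_on_cong:
  assumes "open U" "\<And>q. q \<in> U \<Longrightarrow> f q = g q" "Ck_on k U f"
  shows "Ck_on k U g"
  using assms(2,3)
proof (induction k arbitrary: f g)
  case 0
  then show ?case by (simp cong: continuous_on_cong)
next
  case (Suc k)
  have "Ck_on k U (\<lambda>p. frechet_derivative g (at p) h)" for h
  proof (rule Suc.IH)
    show "Ck_on k U (\<lambda>p. frechet_derivative f (at p) h)" using Suc.prems by simp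
    show "frechet_derivative f (at q) h = frechet_derivative g (at q) h" if "q \<in> U" for q
      using frechet_derivative_cong_open(1) [OF assms(1) that Suc.prems(1)] by simp
  qed
  then show ?case
    using Suc.prems frechet_derivative_cong_open(2) [OF assms(1) _ Suc.prems(1)] by auto
qed

lemma Ck_on_subset: "Ck_on k U f \<Longrightarrow> V \<subseteq> U \<Longrightarrow> Ck_on k V f"
  by (induction k arbitrary: f) (auto intro: continuous_on_subset)

lemma Ck_on_Suc: "Ck_on (Suc k) U f \<Longrightarrow> Ck_on k U f"
proof (induction k arbitrary: f)
  case 0
  then show ?case
    by (auto intro!: continuous_at_imp_continuous_on differentiable_imp_continuous_within)
next
  case (Suc k)
  then show ?case by (metis Ck_on.simps(2))
qed

lemma Ck_on_const: "Ck_on k U (\<lambda>p. c)"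
  by (induction k arbitrary: c) (auto simp: frechet_derivative_const)

lemma Ck_on_add:
  assumes "open U" "Ck_on k U f" "Ck_on k U g"
  shows "Ck_on k U (\<lambda>p. f p + g p)"
  using assms(2,3)
proof (induction k arbitrary: f g)
  case (Suc k)
  have D: "((\<lambda>p. f p + g p) has_derivative
      (\<lambda>h. frechet_derivative f (at p) h + frechet_derivative g (at p) h)) (at p)" if "p \<in> U" for p
    using Suc.prems that by (intro has_derivative_add) (auto simp: frechet_derivative_works [symmetric])
  have "Ck_on k U (\<lambda>p. frechet_derivative (\<lambda>p. f p + g p) (at p) h)" for h
  proof (rule Ck_on_cong [OF assms(1)])
    show "Ck_on k U (\<lambda>p. frechet_derivative f (at p) h + frechet_derivative g (at p) h)"
      using Suc by simp
    show "frechet_derivative f (at p) h + frechet_derivative g (at p) h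
      = frechet_derivative (\<lambda>p. f p + g p) (at p) h" if "p \<in> U" for p
      using frechet_derivative_at [OF D [OF that]] by metis
  qed
  then show ?case using D by (auto simp: differentiable_def)
qed (auto intro: continuous_intros)

lemma Ck_on_bounded_linear:
  assumes "open U" "bounded_linear L" "Ck_on k U f"
  shows "Ck_on k U (\<lambda>p. L (f p))"
  using assms(3)
proof (induction k arbitrary: f)
  case 0
  then show ?case using bounded_linear.continuous_on [OF assms(2)] by simp
next
  case (Suc k)
  have D: "((\<lambda>p. L (f p)) has_derivative (\<lambda>h. L (frechet_derivative f (at p) h))) (at p)" if "p \<in> U" for p
    using Suc.prems that by (intro bounded_linear.has_derivative [OF assms(2)]) (auto simp: frechet_derivative_works)
  have "Ck_on k U (\<lambda>p. frechet_derivative (\<lambda>p. L (f p)) (at p) h)" for h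
  proof (rule Ck_on_cong [OF assms(1)])
    show "Ck_on k U (\<lambda>p. L (frechet_derivative f (at p) h))" using Suc by simp
    show "L (frechet_derivative f (at p) h) = frechet_derivative (\<lambda>p. L (f p)) (at p) h" if "p \<in> U" for p
      using frechet_derivative_at [OF D [OF that]] by metis
  qed
  then show ?case using D by (auto simp: differentiable_def)
qed

lemma Ck_on_bounded_bilinear:
  assumes "open U" "bounded_bilinear B" "Ck_on k U f" "Ck_on k U g"
  shows "Ck_on k U (\<lambda>p. B (f p) (g p))"
  using assms(3,4)
proof (induction k arbitrary: f g)
  case 0
  then show ?case using bounded_bilinear.continuous_on [OF assms(2)] by simp
next
  case (Suc k)
  have D: "((\<lambda>p. B (f p) (g p)) has_derivative
      (\<lambda>h. B (f p) (frechet_derivative g (at p) h) + B (frechet_derivative f (at p) h) (g p))) (at p)" if "p \<in> U" for p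
    using Suc.prems that by (intro bounded_bilinear.FDERIV [OF assms(2)]) (auto simp: frechet_derivative_works [symmetric])
  have "Ck_on k U (\<lambda>p. frechet_derivative (\<lambda>p. B (f p) (g p)) (at p) h)" for h
  proof (rule Ck_on_cong [OF assms(1)])
    show "Ck_on k U (\<lambda>p. B (f p) (frechet_derivative g (at p) h) + B (frechet_derivative f (at p) h) (g p))"
      using Suc.prems Ck_on_Suc [OF Suc.prems(1)] Ck_on_Suc [OF Suc.prems(2)]
      by (intro Ck_on_add [OF assms(1)] Suc.IH) auto
    show "B (f p) (frechet_derivative g (at p) h) + B (frechet_derivative f (at p) h) (g p)
      = frechet_derivative (\<lambda>p. B (f p) (g p)) (at p) h" if "p \<in> U" for p
      using frechet_derivative_at [OF D [OF that]] by metis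
  qed
  then show ?case using D by (auto simp: differentiable_def)
qed

lemma Ck_on_inverse:
  fixes f :: "'a :: real_normed_vector \<Rightarrow> 'b :: real_normed_field"
  assumes "open U" "\<And>p. p \<in> U \<Longrightarrow> f p \<noteq> 0" "Ck_on k U f"
  shows "Ck_on k U (\<lambda>p. inverse (f p))"
  using assms(3)
proof (induction k)
  case 0
  then show ?case using assms(2) by (auto intro: continuous_intros)
next
  case (Suc k)
  have inv: "Ck_on k U (\<lambda>p. inverse (f p))" using Suc Ck_on_Suc by blast
  have D: "((\<lambda>p. inverse (f p)) has_derivative
      (\<lambda>h. - (inverse (f p) * frechet_derivative f (at p) h * inverse (f p)))) (at p)" if "p \<in> U" for p
    using Suc.prems that assms(2) by (intro Deriv.has_derivative_inverse) (auto simp: frechet_derivative_works [symmetric])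
  have "Ck_on k U (\<lambda>p. frechet_derivative (\<lambda>p. inverse (f p)) (at p) h)" for h
  proof (rule Ck_on_cong [OF assms(1)])
    have "Ck_on k U (\<lambda>p. frechet_derivative f (at p) h)" using Suc.prems by simp
    then have "Ck_on k U (\<lambda>p. inverse (f p) * frechet_derivative f (at p) h * inverse (f p))"
      by (intro Ck_on_bounded_bilinear [OF assms(1) bounded_bilinear_mult] inv)
    then show "Ck_on k U (\<lambda>p. - (inverse (f p) * frechet_derivative f (at p) h * inverse (f p)))"
      by (rule Ck_on_bounded_linear [OF assms(1) bounded_linear_minus [OF bounded_linear_ident]])
    show "- (inverse (f p) * frechet_derivative f (at p) h * inverse (f p))
      = frechet_derivative (\<lambda>p. inverse (f p)) (at p) h" if "p \<in> U" for p
      using frechet_derivative_at [OF D [OF that]] by metis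
  qed
  then show ?case using D by (auto simp: differentiable_def)
qed

lemma smooth_on_subset: "smooth_on U f \<Longrightarrow> V \<subseteq> U \<Longrightarrow> smooth_on V f"
  unfolding smooth_on_def using Ck_on_subset by blast

lemma smooth_on_const [simp]: "smooth_on U (\<lambda>p. c)"
  by (simp add: smooth_on_def Ck_on_const)

lemma smooth_on_add: "open U \<Longrightarrow> smooth_on U f \<Longrightarrow> smooth_on U g \<Longrightarrow> smooth_on U (\<lambda>p. f p + g p)"
  by (simp add: smooth_on_def Ck_on_add)

lemma smooth_on_linear: "open U \<Longrightarrow> bounded_linear L \<Longrightarrow> smooth_on U f \<Longrightarrow> smooth_on U (\<lambda>p. L (f p))"
  by (simp add: smooth_on_def Ck_on_bounded_linear)

lemma smooth_on_mult:
  fixes f :: "'a :: real_normed_vector \<Rightarrow> 'b :: real_normed_algebra"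
  shows "open U \<Longrightarrow> smooth_on U f \<Longrightarrow> smooth_on U g \<Longrightarrow> smooth_on U (\<lambda>p. f p * g p)"
  by (simp add: smooth_on_def Ck_on_bounded_bilinear bounded_bilinear_mult)

lemma smooth_on_inverse:
  fixes f :: "'a :: real_normed_vector \<Rightarrow> 'b :: real_normed_field"
  shows "open U \<Longrightarrow> (\<And>p. p \<in> U \<Longrightarrow> f p \<noteq> 0) \<Longrightarrow> smooth_on U f \<Longrightarrow> smooth_on U (\<lambda>p. inverse (f p))"
  by (simp add: smooth_on_def Ck_on_inverse)

lemma smooth_on_divide:
  fixes f :: "'a :: real_normed_vector \<Rightarrow> 'b :: real_normed_field"
  shows "open U \<Longrightarrow> smooth_on U f \<Longrightarrow> (\<And>p. p \<in> U \<Longrightarrow> g p \<noteq> 0) \<Longrightarrow> smooth_on U g \<Longrightarrow> smooth_on U (\<lambda>p. f p / g p)"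
  unfolding divide_inverse by (intro smooth_on_mult smooth_on_inverse) auto

lemma smooth_on_uminus: "open U \<Longrightarrow> smooth_on U f \<Longrightarrow> smooth_on U (\<lambda>p. - f p)"
  by (rule smooth_on_linear [OF _ bounded_linear_minus [OF bounded_linear_ident]])

lemma smooth_on_diff: "open U \<Longrightarrow> smooth_on U f \<Longrightarrow> smooth_on U g \<Longrightarrow> smooth_on U (\<lambda>p. f p - g p)"
  using smooth_on_add [of U f "\<lambda>p. - g p"] smooth_on_uminus by fastforce

lemma smooth_on_sum: "open U \<Longrightarrow> (\<And>i. i \<in> A \<Longrightarrow> smooth_on U (f i)) \<Longrightarrow> smooth_on U (\<lambda>p. \<Sum>i\<in>A. f i p)"
  by (induction A rule: infinite_finite_induct) (auto intro: smooth_on_add)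

lemma smooth_on_prod:
  fixes f :: "'i \<Rightarrow> 'a :: real_normed_vector \<Rightarrow> 'b :: {real_normed_algebra, comm_monoid_mult}"
  shows "open U \<Longrightarrow> (\<And>i. i \<in> A \<Longrightarrow> smooth_on U (f i)) \<Longrightarrow> smooth_on U (\<lambda>p. \<Prod>i\<in>A. f i p)"
  by (induction A rule: infinite_finite_induct) (auto intro: smooth_on_mult)

lemma bounded_linear_axis: "bounded_linear (\<lambda>c :: complex. axis i c :: complex ^ 'n)"
  by (intro linear_conv_bounded_linear [THEN iffD1] linearI) (auto simp: vec_eq_iff axis_def)

lemma smooth_on_vec:
  fixes f :: "'a :: real_normed_vector \<Rightarrow> complex ^ 'n"
  assumes U: "open U"
  shows "smooth_on U f \<longleftrightarrow> (\<forall>i. smooth_on U (\<lambda>p. f p $ i))"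
proof
  assume "smooth_on U f"
  then show "\<forall>i. smooth_on U (\<lambda>p. f p $ i)"
    using smooth_on_linear [OF U bounded_linear_vec_nth] by blast
next
  assume "\<forall>i. smooth_on U (\<lambda>p. f p $ i)"
  then have "smooth_on U (\<lambda>p. \<Sum>i\<in>UNIV. axis i (f p $ i))"
    by (intro smooth_on_sum U smooth_on_linear [OF U bounded_linear_axis]) auto
  moreover have "(\<Sum>i\<in>UNIV. axis i (f p $ i)) = f p" for p
    by (simp add: vec_eq_iff axis_def if_distrib cong: if_cong)
  ultimately show "smooth_on U f" by simp
qed

lemma smooth_on_differentiable: "smooth_on U f \<Longrightarrow> p \<in> U \<Longrightarrow> f differentiable (at p)"
  unfolding smooth_on_def by (metis Ck_on.simps(2))

lemma smooth_on_frechet: "smooth_on U f \<Longrightarrow> smooth_on U (\<lambda>p. frechet_derivative f (at p) h)"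
  unfolding smooth_on_def by (metis Ck_on.simps(2))

lemma smooth_on_continuous: "smooth_on U f \<Longrightarrow> continuous_on U f"
  unfolding smooth_on_def by (metis Ck_on.simps(1))

lemma smooth_on_has_derivative:
  "smooth_on U f \<Longrightarrow> p \<in> U \<Longrightarrow> (f has_derivative frechet_derivative f (at p)) (at p)"
  using smooth_on_differentiable frechet_derivative_works by blast

text \<open>The second difference is symmetric in \<open>h\<close> and \<open>k\<close>. The mean
  value theorem is applied twice: along \<open>h\<close> to a difference of two values of
  \<open>f\<close>, then along \<open>k\<close> to the derivative so obtained.\<close>

lemma second_difference_mvt:
  fixes f :: "'a :: real_normed_vector \<Rightarrow> real"
  assumes f: "smooth_on U f" and t: "t > 0"
    and inU: "\<And>a b. 0 \<le> a \<Longrightarrow> a \<le> t \<Longrightarrow> 0 \<le> b \<Longrightarrow> b \<le> t \<Longrightarrow> p + a *\<^sub>R h + b *\<^sub>R k \<in> U"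
  obtains a b where "0 \<le> a" "a \<le> t" "0 \<le> b" "b \<le> t"
    "f (p + t *\<^sub>R h + t *\<^sub>R k) - f (p + t *\<^sub>R h) - f (p + t *\<^sub>R k) + f p
      = t * t * frechet_derivative (\<lambda>q. frechet_derivative f (at q) h) (at (p + a *\<^sub>R h + b *\<^sub>R k)) k"
proof -
  let ?Dh = "\<lambda>q. frechet_derivative f (at q) h"
  have line: "((\<lambda>s. F (q + s *\<^sub>R w)) has_real_derivative frechet_derivative F (at (q + s *\<^sub>R w)) w) (at s)"
    if "smooth_on U F" "q + s *\<^sub>R w \<in> U" for F :: "'a \<Rightarrow> real" and q w s
  proof -
    let ?D = "frechet_derivative F (at (q + s *\<^sub>R w))"
    have "(F has_derivative ?D) (at (q + s *\<^sub>R w))" using that by (rule smooth_on_has_derivative)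
    moreover have "((\<lambda>s. q + s *\<^sub>R w) has_derivative (\<lambda>x. x *\<^sub>R w)) (at s)"
      by (auto intro!: derivative_eq_intros)
    ultimately have "((\<lambda>s. F (q + s *\<^sub>R w)) has_derivative (\<lambda>x. ?D (x *\<^sub>R w))) (at s)"
      by (rule has_derivative_compose [rotated])
    moreover have "linear ?D" using smooth_on_differentiable [OF that] by (rule linear_frechet_derivative)
    ultimately show ?thesis unfolding has_field_derivative_def
      by (simp add: linear_scale mult.commute [of _ "?D w"] ext)
  qed
  define g where "g = (\<lambda>s. f ((p + t *\<^sub>R k) + s *\<^sub>R h) - f (p + s *\<^sub>R h))"
  have "\<exists>z>0. z < t \<and> g t - g 0 = (t - 0) * (?Dh ((p + t *\<^sub>R k) + z *\<^sub>R h) - ?Dh (p + z *\<^sub>R h))"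
  proof (rule MVT2 [OF t])
    fix s assume "0 \<le> s" "s \<le> t"
    then show "(g has_real_derivative ?Dh ((p + t *\<^sub>R k) + s *\<^sub>R h) - ?Dh (p + s *\<^sub>R h)) (at s)"
      unfolding g_def using inU [of s t] inU [of s 0] t
      by (intro DERIV_diff line f) (auto simp: algebra_simps)
  qed
  then obtain a where a: "0 < a" "a < t" "g t - g 0 = t * (?Dh ((p + t *\<^sub>R k) + a *\<^sub>R h) - ?Dh (p + a *\<^sub>R h))" by auto
  define G where "G = (\<lambda>s. ?Dh ((p + a *\<^sub>R h) + s *\<^sub>R k))"
  have "\<exists>z>0. z < t \<and> G t - G 0 = (t - 0) * frechet_derivative ?Dh (at ((p + a *\<^sub>R h) + z *\<^sub>R k)) k"
  proof (rule MVT2 [OF t])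
    fix s assume "0 \<le> s" "s \<le> t"
    then show "(G has_real_derivative frechet_derivative ?Dh (at ((p + a *\<^sub>R h) + s *\<^sub>R k)) k) (at s)"
      unfolding G_def using inU [of a s] a by (intro line smooth_on_frechet f) auto
  qed
  then obtain b where b: "0 < b" "b < t" "G t - G 0 = t * frechet_derivative ?Dh (at ((p + a *\<^sub>R h) + b *\<^sub>R k)) k" by auto
  have "g t - g 0 = t * (G t - G 0)" using a(3) by (simp add: G_def algebra_simps)
  then have "g t - g 0 = t * t * frechet_derivative ?Dh (at (p + a *\<^sub>R h + b *\<^sub>R k)) k" using b(3) by simp
  then show thesis using a b by (intro that [of a b]) (auto simp: g_def algebra_simps)
qed

text \<open>Schwarz's theorem: the second difference is \<open>t * t\<close> times either mixed
  derivative at some nearby point, and both mixed derivatives are continuous at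
  \<open>p\<close>.\<close>

lemma frechet_derivative_commute_real:
  fixes f :: "'a :: real_normed_vector \<Rightarrow> real"
  assumes U: "open U" "p \<in> U" and f: "smooth_on U f"
  shows "frechet_derivative (\<lambda>q. frechet_derivative f (at q) h) (at p) k
       = frechet_derivative (\<lambda>q. frechet_derivative f (at q) k) (at p) h"
proof -
  define A where "A = (\<lambda>q. frechet_derivative (\<lambda>q. frechet_derivative f (at q) h) (at q) k)"
  define B where "B = (\<lambda>q. frechet_derivative (\<lambda>q. frechet_derivative f (at q) k) (at q) h)"
  have contA: "continuous (at p) A" and contB: "continuous (at p) B"
    using U smooth_on_continuous [OF smooth_on_frechet [OF smooth_on_frechet [OF f]]]
    by (simp_all add: A_def B_def continuous_on_eq_continuous_at)
  have "\<bar>A p - B p\<bar> \<le> e" if e: "e > 0" for e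
  proof -
    obtain d1 where d1: "d1 > 0" "\<And>q. dist q p < d1 \<Longrightarrow> dist (A q) (A p) < e / 2"
      using contA e unfolding continuous_at_eps_delta by (metis half_gt_zero)
    obtain d2 where d2: "d2 > 0" "\<And>q. dist q p < d2 \<Longrightarrow> dist (B q) (B p) < e / 2"
      using contB e unfolding continuous_at_eps_delta by (metis half_gt_zero)
    obtain d3 where d3: "d3 > 0" "\<And>q. dist q p < d3 \<Longrightarrow> q \<in> U"
      using U by (metis open_dist)
    define d where "d = min d1 (min d2 d3)"
    have d: "d > 0" using d1 d2 d3 by (simp add: d_def)
    \<comment> \<open>Small enough to keep all points of the parallelogram within \<open>d\<close>
      of \<open>p\<close>; the summand 1 excludes a zero denominator.\<close>
    define t where "t = d / (2 * (norm h + norm k + 1))"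
    have t: "t > 0" using d by (simp add: t_def add_nonneg_pos)
    have tt: "t * (norm h + norm k + 1) = d / 2"
    proof -
      have *: "d / (2 * x) * x = d / 2" if "x \<noteq> 0" for x :: real using that by simp
      show ?thesis unfolding t_def by (rule *) (smt (verit) norm_ge_zero)
    qed
    have near: "dist (p + a *\<^sub>R h + b *\<^sub>R k) p < d" if "0 \<le> a" "a \<le> t" "0 \<le> b" "b \<le> t" for a b
    proof -
      have "dist (p + a *\<^sub>R h + b *\<^sub>R k) p = norm (a *\<^sub>R h + b *\<^sub>R k)" by (simp add: dist_norm)
      also have "\<dots> \<le> a * norm h + b * norm k" using that by (intro norm_triangle_le) simp
      also have "\<dots> \<le> t * norm h + t * norm k" using that by (intro add_mono mult_right_mono) auto
      also have "\<dots> < d" using tt d t by (simp add: algebra_simps)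
      finally show ?thesis .
    qed
    obtain a b where ab: "0 \<le> a" "a \<le> t" "0 \<le> b" "b \<le> t"
      "f (p + t *\<^sub>R h + t *\<^sub>R k) - f (p + t *\<^sub>R h) - f (p + t *\<^sub>R k) + f p = t * t * A (p + a *\<^sub>R h + b *\<^sub>R k)"
      unfolding A_def using near d3 by (rule_tac second_difference_mvt [OF f t, of p h k]) (auto simp: d_def)
    obtain a' b' where ab': "0 \<le> a'" "a' \<le> t" "0 \<le> b'" "b' \<le> t"
      "f (p + t *\<^sub>R k + t *\<^sub>R h) - f (p + t *\<^sub>R k) - f (p + t *\<^sub>R h) + f p = t * t * B (p + a' *\<^sub>R k + b' *\<^sub>R h)"
    proof (rule second_difference_mvt [OF f t, of p k h])
      show "p + a *\<^sub>R k + b *\<^sub>R h \<in> U" if "0 \<le> a" "a \<le> t" "0 \<le> b" "b \<le> t" for a b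
        using near [of b a] that d3 by (auto simp: d_def algebra_simps)
    qed (auto simp: B_def)
    have "t * t * A (p + a *\<^sub>R h + b *\<^sub>R k) = t * t * B (p + a' *\<^sub>R k + b' *\<^sub>R h)"
      using ab(5) ab'(5) by (simp add: algebra_simps)
    then have eq: "A (p + a *\<^sub>R h + b *\<^sub>R k) = B (p + b' *\<^sub>R h + a' *\<^sub>R k)" using t by (simp add: algebra_simps)
    have "dist (A (p + a *\<^sub>R h + b *\<^sub>R k)) (A p) < e / 2" using near [of a b] ab d1 by (simp add: d_def)
    moreover have "dist (B (p + b' *\<^sub>R h + a' *\<^sub>R k)) (B p) < e / 2" using near [of b' a'] ab' d2 by (simp add: d_def)
    ultimately show ?thesis unfolding eq by (auto simp: dist_real_def abs_if split: if_splits)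
  qed
  then have "\<bar>A p - B p\<bar> \<le> 0" by (rule field_le_epsilon) simp
  then show ?thesis by (simp add: A_def B_def)
qed

lemma frechet_derivative_linear_comp:
  assumes "bounded_linear L" "f differentiable (at p)"
  shows "frechet_derivative (\<lambda>q. L (f q)) (at p) h = L (frechet_derivative f (at p) h)"
  using frechet_derivative_at [OF bounded_linear.has_derivative [OF assms(1) assms(2) [unfolded frechet_derivative_works]]]
  by metis

lemma frechet_derivative_commute:
  fixes f :: "'a :: real_normed_vector \<Rightarrow> complex"
  assumes U: "open U" "p \<in> U" and f: "smooth_on U f"
  shows "frechet_derivative (\<lambda>q. frechet_derivative f (at q) h) (at p) k
       = frechet_derivative (\<lambda>q. frechet_derivative f (at q) k) (at p) h"
proof -
  have *: "L (frechet_derivative (\<lambda>q. frechet_derivative f (at q) h) (at p) k)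
      = frechet_derivative (\<lambda>q. frechet_derivative (\<lambda>q. L (f q)) (at q) h) (at p) k"
    if L: "bounded_linear L" for L :: "complex \<Rightarrow> real" and h k
  proof -
    have "frechet_derivative (\<lambda>q. frechet_derivative (\<lambda>q. L (f q)) (at q) h) (at p) k
      = frechet_derivative (\<lambda>q. L (frechet_derivative f (at q) h)) (at p) k"
      using frechet_derivative_cong_open(1) [OF U, of "\<lambda>q. frechet_derivative (\<lambda>q. L (f q)) (at q) h"
          "\<lambda>q. L (frechet_derivative f (at q) h)"]
        frechet_derivative_linear_comp [OF L smooth_on_differentiable [OF f]] by simp
    also have "\<dots> = L (frechet_derivative (\<lambda>q. frechet_derivative f (at q) h) (at p) k)"
      by (rule frechet_derivative_linear_comp [OF L smooth_on_differentiable [OF smooth_on_frechet [OF f] U(2)]])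
    finally show ?thesis ..
  qed
  have "L (frechet_derivative (\<lambda>q. frechet_derivative f (at q) h) (at p) k)
      = L (frechet_derivative (\<lambda>q. frechet_derivative f (at q) k) (at p) h)"
    if L: "bounded_linear L" for L :: "complex \<Rightarrow> real"
    unfolding * [OF L] by (rule frechet_derivative_commute_real [OF U smooth_on_linear [OF U(1) L f]])
  from this [OF bounded_linear_Re] this [OF bounded_linear_Im] show ?thesis by (simp add: complex_eq_iff)
qed

section \<open>Wirtinger derivatives and Taylor series\<close>

declare wirtinger.simps [simp del]

text \<open>Used with the function generalised: the coefficient at \<open>m + unit_exp v\<close> is,
  up to a factor, the coefficient at \<open>m\<close> of the derivative, and the derivative of a
  Taylor series is the Taylor series of a Wirtinger derivative.\<close>

lemma mfps_coeff_induct [case_names zero deriv]: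
  assumes "P 0" and "\<And>m v. P m \<Longrightarrow> P (m + unit_exp v)"
  shows "P (m :: 'v \<Rightarrow>\<^sub>0 nat)"
proof (induction "mdeg m" arbitrary: m rule: less_induct)
  case less
  show ?case
  proof (cases "m = 0")
    case False
    then obtain m' v where "m = m' + unit_exp v" "mdeg m' < mdeg m" by (rule mdeg_pos_decomp)
    with less assms(2) show ?thesis by blast
  qed (use assms(1) in simp)
qed

lemma mcoeff_add_unit_exp:
  "mcoeff f (m + unit_exp v) = mcoeff (mderiv v f) m / of_nat (mlookup m v + 1)"
proof -
  have "complex_of_nat (mlookup m v + 1) \<noteq> 0" by (metis Suc_eq_plus1 of_nat_neq_0)
  then show ?thesis by (simp add: mcoeff_mderiv)
qed

definition conj_index :: "'a + 'a \<Rightarrow> 'a + 'a"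
  where "conj_index = case_sum Inr Inl"

lemma conj_index_simps [simp]: "conj_index (Inl i) = Inr i" "conj_index (Inr i) = Inl i"
  "conj_index (conj_index v) = v" "conj_index u = conj_index v \<longleftrightarrow> u = v"
  by (cases v; cases u; simp add: conj_index_def)+

lemma sum_conj_index: "(\<Sum>v\<in>UNIV. f (conj_index v)) = (\<Sum>v\<in>UNIV. f (v :: 'a :: finite + 'a))"
  by (rule sum.reindex_bij_witness [where i = conj_index and j = conj_index]) auto

lemma sum_UNIV_Plus: "(\<Sum>v\<in>UNIV. f v) = (\<Sum>i\<in>UNIV. f (Inl i)) + (\<Sum>i\<in>UNIV. f (Inr i))"
  for f :: "'a :: finite + 'b :: finite \<Rightarrow> 'c :: comm_monoid_add"
  unfolding UNIV_sum by (subst sum.union_disjoint) (auto simp: sum.reindex)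

lemma wirtinger_has_derivative:
  assumes "(f has_derivative f') (at p)"
  shows "wirtinger (Inl i) f p = (f' (axis i 1) - \<i> * f' (axis i \<i>)) / 2"
    and "wirtinger (Inr i) f p = (f' (axis i 1) + \<i> * f' (axis i \<i>)) / 2"
  using frechet_derivative_at [OF assms] by (simp_all add: wirtinger.simps)

lemma wirtinger_cong:
  "open U \<Longrightarrow> p \<in> U \<Longrightarrow> (\<And>q. q \<in> U \<Longrightarrow> f q = g q) \<Longrightarrow> wirtinger v f p = wirtinger v g p"
  using frechet_derivative_cong_open(1) [of U p f g] by (cases v) (auto simp: wirtinger.simps)

lemma wirtinger_const [simp]: "wirtinger v (\<lambda>p. c) p = 0"
  by (cases v) (auto simp: wirtinger.simps)

lemma wirtinger_add:
  assumes "f differentiable (at p)" "g differentiable (at p)"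
  shows "wirtinger v (\<lambda>p. f p + g p) p = wirtinger v f p + wirtinger v g p"
  using assms by (cases v)
    (simp_all add: wirtinger_has_derivative [OF has_derivative_add] frechet_derivative_works wirtinger_has_derivative algebra_simps add_divide_distrib diff_divide_distrib)

lemma wirtinger_mult:
  assumes "f differentiable (at p)" "g differentiable (at p)"
  shows "wirtinger v (\<lambda>p. f p * g p) p = wirtinger v f p * g p + f p * wirtinger v g p"
  using assms by (cases v)
    (simp_all add: wirtinger_has_derivative [OF has_derivative_mult] frechet_derivative_works wirtinger_has_derivative algebra_simps add_divide_distrib diff_divide_distrib)

lemma wirtinger_cmult:
  assumes "f differentiable (at p)"
  shows "wirtinger v (\<lambda>p. c * f p) p = c * wirtinger v f p"
  using wirtinger_mult [OF differentiable_const [of c] assms, of v] by simp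

lemma wirtinger_cnj:
  assumes "f differentiable (at p)"
  shows "wirtinger v (\<lambda>p. cnj (f p)) p = cnj (wirtinger (conj_index v) f p)"
  using assms by (cases v)
    (simp_all add: wirtinger_has_derivative [OF has_derivative_cnj] frechet_derivative_works wirtinger_has_derivative)

lemma wirtinger_diff:
  assumes "f differentiable (at p)" "g differentiable (at p)"
  shows "wirtinger v (\<lambda>p. f p - g p) p = wirtinger v f p - wirtinger v g p"
  using wirtinger_add [OF assms(1) differentiable_cmult_left_iff [THEN iffD2], of "- 1" g v]
    wirtinger_cmult [OF assms(2), of v "- 1"] assms(2) by simp

lemma wirtinger_sum:
  assumes "\<And>i. i \<in> A \<Longrightarrow> f i differentiable (at p)"
  shows "wirtinger v (\<lambda>p. \<Sum>i\<in>A. f i p) p = (\<Sum>i\<in>A. wirtinger v (f i) p)"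
  using assms by (induction A rule: infinite_finite_induct) (simp_all add: wirtinger_add)

lemma smooth_on_wirtinger:
  assumes U: "open U" and f: "smooth_on U f"
  shows "smooth_on U (wirtinger v f)"
proof (cases v)
  case (Inl i)
  have "smooth_on U (\<lambda>p. (frechet_derivative f (at p) (axis i 1) - \<i> * frechet_derivative f (at p) (axis i \<i>)) / 2)"
    by (intro smooth_on_divide smooth_on_diff smooth_on_mult smooth_on_frechet f U) auto
  then show ?thesis unfolding Inl wirtinger.simps [abs_def] .
next
  case (Inr i)
  have "smooth_on U (\<lambda>p. (frechet_derivative f (at p) (axis i 1) + \<i> * frechet_derivative f (at p) (axis i \<i>)) / 2)"
    by (intro smooth_on_divide smooth_on_add smooth_on_mult smooth_on_frechet f U) auto
  then show ?thesis unfolding Inr wirtinger.simps [abs_def] .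
qed

lemma wirtinger_commute:
  assumes U: "open U" "p \<in> U" and f: "smooth_on U f"
  shows "wirtinger u (wirtinger v f) p = wirtinger v (wirtinger u f) p"
proof -
  define D where "D = (\<lambda>h q. frechet_derivative f (at q) h)"
  have dif: "D h differentiable (at p)" for h
    unfolding D_def by (rule smooth_on_differentiable [OF smooth_on_frechet [OF f] U(2)])
  have comm: "frechet_derivative (D h) (at p) k = frechet_derivative (D k) (at p) h" for h k
    unfolding D_def by (rule frechet_derivative_commute [OF U f])
  define W where "W = (\<lambda>s i q. (D (axis i 1) q + s * D (axis i \<i>) q) / 2)"
  have W: "(W s i has_derivative (\<lambda>h. (frechet_derivative (D (axis i 1)) (at p) h
      + s * frechet_derivative (D (axis i \<i>)) (at p) h) / 2)) (at p)" for s i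
    unfolding W_def using dif by (auto intro!: derivative_eq_intros simp: frechet_derivative_works)
  \<comment> \<open>Sign and coordinate of an index, so that all combinations of holomorphic and
    antiholomorphic derivatives become one computation.\<close>
  define sg where "sg = (\<lambda>v :: 'a + 'a. case v of Inl i \<Rightarrow> - \<i> | Inr i \<Rightarrow> \<i>)"
  define ix where "ix = (\<lambda>v :: 'a + 'a. case v of Inl i \<Rightarrow> i | Inr i \<Rightarrow> i)"
  have w: "wirtinger v f = W (sg v) (ix v)" for v
    by (cases v) (auto simp: W_def D_def sg_def ix_def fun_eq_iff wirtinger.simps)
  have W2: "wirtinger u (W s i) p = ((frechet_derivative (D (axis i 1)) (at p) (axis (ix u) 1)
      + s * frechet_derivative (D (axis i \<i>)) (at p) (axis (ix u) 1))
      + sg u * (frechet_derivative (D (axis i 1)) (at p) (axis (ix u) \<i>)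
      + s * frechet_derivative (D (axis i \<i>)) (at p) (axis (ix u) \<i>))) / 4" for u s i
    by (cases u) (simp_all add: wirtinger_has_derivative [OF W] sg_def ix_def field_simps)
  show ?thesis unfolding w W2
    by (simp add: comm [of "axis (ix u) x" "axis (ix v) y" for x y] algebra_simps)
qed

lemma iterated_wirtinger_simps [simp]:
  "iterated_wirtinger [] f = f" "iterated_wirtinger (v # vs) f = wirtinger v (iterated_wirtinger vs f)"
  "iterated_wirtinger (us @ vs) f = iterated_wirtinger us (iterated_wirtinger vs f)"
  by (simp_all add: iterated_wirtinger_def)

lemma smooth_on_iterated_wirtinger: "open U \<Longrightarrow> smooth_on U f \<Longrightarrow> smooth_on U (iterated_wirtinger vs f)"
  by (induction vs) (auto intro: smooth_on_wirtinger)

lemma iterated_wirtinger_cong: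
  "open U \<Longrightarrow> p \<in> U \<Longrightarrow> (\<And>q. q \<in> U \<Longrightarrow> f q = g q) \<Longrightarrow> iterated_wirtinger vs f p = iterated_wirtinger vs g p"
  by (induction vs arbitrary: p) (auto intro: wirtinger_cong)

lemma iterated_wirtinger_move:
  assumes U: "open U" and p: "p \<in> U" and f: "smooth_on U f"
  shows "iterated_wirtinger (us @ [v]) f p = iterated_wirtinger (v # us) f p"
  using p
proof (induction us arbitrary: p)
  case (Cons u us)
  have "iterated_wirtinger ((u # us) @ [v]) f p = wirtinger u (iterated_wirtinger (v # us) f) p"
    unfolding append_Cons iterated_wirtinger_simps(2)
    by (rule wirtinger_cong [OF U Cons.prems], unfold iterated_wirtinger_simps(2) [symmetric], rule Cons.IH)
  also have "\<dots> = iterated_wirtinger (v # u # us) f p"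
    using wirtinger_commute [OF U Cons.prems smooth_on_iterated_wirtinger [OF U f]] by simp
  finally show ?case by simp
qed simp

lemma iterated_wirtinger_perm:
  assumes U: "open U" and p: "p \<in> U" and f: "smooth_on U f" and m: "mset us = mset vs"
  shows "iterated_wirtinger us f p = iterated_wirtinger vs f p"
  using p m
proof (induction us arbitrary: vs p)
  case (Cons u us)
  have "u \<in> set vs" using Cons.prems by (metis list.set_intros(1) mset_eq_setD)
  then obtain as bs where vs: "vs = as @ u # bs" by (meson split_list)
  have "iterated_wirtinger (u # us) f p = wirtinger u (iterated_wirtinger (as @ bs) f) p"
    unfolding iterated_wirtinger_simps(2)
    by (rule wirtinger_cong [OF U Cons.prems(1)], rule Cons.IH) (use Cons.prems(2) vs in auto)
  also have "\<dots> = iterated_wirtinger (u # as) (iterated_wirtinger bs f) p" by simp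
  also have "\<dots> = iterated_wirtinger (as @ [u]) (iterated_wirtinger bs f) p"
    by (rule iterated_wirtinger_move [OF U Cons.prems(1) smooth_on_iterated_wirtinger [OF U f], symmetric])
  finally show ?case by (simp add: vs)
qed simp

section \<open>Taylor expansion as a ring homomorphism compatible with derivatives\<close>

locale nbhd =
  fixes U :: "(complex ^ 'N :: finite) set"
  assumes openU: "open U" and zeroU: "0 \<in> U"
begin

text \<open>The list chosen in \<open>taylor_series\<close> is a permutation of \<open>vs\<close>,
  and the derivatives of a smooth function commute.\<close>

lemma mcoeff_taylor:
  assumes f: "smooth_on U f"
  shows "mcoeff (taylor_series f) (exp_of_list vs) = iterated_wirtinger vs f 0 / mfact UNIV (exp_of_list vs)"
proof -
  let ?P = "\<lambda>us. \<forall>v. count_list us v = mlookup (exp_of_list vs) v"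
  have eq: "?P us \<longleftrightarrow> mset us = mset vs" for us
    by (simp add: lookup_exp_of_list multiset_eq_iff count_mset)
  have "mset (SOME us. ?P us) = mset vs"
    unfolding eq [symmetric] by (rule someI [of ?P vs]) (simp add: eq)
  from iterated_wirtinger_perm [OF openU zeroU f this] show ?thesis
    by (simp add: taylor_series_def mfact_def)
qed

lemma mcoeff_taylor_0: "smooth_on U f \<Longrightarrow> mcoeff (taylor_series f) 0 = f 0"
  using mcoeff_taylor [of f "[]"] by simp

text \<open>The new derivative is put innermost, at the end of the list, where it can be absorbed
  into the function.\<close>

lemma mderiv_taylor:
  assumes f: "smooth_on U f"
  shows "mderiv v (taylor_series f) = taylor_series (wirtinger v f)"
proof (rule mfps_eqI)
  fix m :: "'N + 'N \<Rightarrow>\<^sub>0 nat"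
  obtain vs where vs: "exp_of_list vs = m" using ex_exp_of_list by blast
  have m: "m + unit_exp v = exp_of_list (vs @ [v])"
    by (simp add: exp_of_list_def flip: vs)
  have "complex_of_nat (mlookup m v + 1) \<noteq> 0" by (metis Suc_eq_plus1 of_nat_neq_0)
  then have "mcoeff (mderiv v (taylor_series f)) m = iterated_wirtinger vs (wirtinger v f) 0 / mfact UNIV m"
    unfolding mcoeff_mderiv m mcoeff_taylor [OF f]
    by (simp add: m [symmetric] mfact_add_unit_exp)
  then show "mcoeff (mderiv v (taylor_series f)) m = mcoeff (taylor_series (wirtinger v f)) m"
    using mcoeff_taylor [OF smooth_on_wirtinger [OF openU f]] vs by auto
qed

lemma taylor_cong:
  assumes "\<And>q. q \<in> U \<Longrightarrow> f q = g q" shows "taylor_series f = taylor_series g"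
  unfolding taylor_series_def using iterated_wirtinger_cong [OF openU zeroU assms] by simp

lemma wirtinger_smooth:
  assumes "smooth_on U f" "smooth_on U g" "p \<in> U"
  shows "wirtinger v (\<lambda>p. f p + g p) p = wirtinger v f p + wirtinger v g p"
    and "wirtinger v (\<lambda>p. f p - g p) p = wirtinger v f p - wirtinger v g p"
    and "wirtinger v (\<lambda>p. f p * g p) p = wirtinger v f p * g p + f p * wirtinger v g p"
  using assms by (auto intro: wirtinger_add wirtinger_diff wirtinger_mult smooth_on_differentiable)

lemma taylor_add:
  assumes "smooth_on U f" "smooth_on U g"
  shows "taylor_series (\<lambda>p. f p + g p) = taylor_series f + taylor_series g"
proof (rule mfps_eqI)
  fix m
  show "mcoeff (taylor_series (\<lambda>p. f p + g p)) m = mcoeff (taylor_series f + taylor_series g) m"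
    using assms
  proof (induction m arbitrary: f g rule: mfps_coeff_induct)
    case zero then show ?case by (simp add: mcoeff_taylor_0 smooth_on_add openU)
  next
    case (deriv m v)
    have "mderiv v (taylor_series (\<lambda>p. f p + g p)) = taylor_series (\<lambda>p. wirtinger v f p + wirtinger v g p)"
      using deriv.prems by (simp add: mderiv_taylor smooth_on_add openU) (rule taylor_cong, simp add: wirtinger_smooth)
    then show ?case using deriv
      by (simp add: mcoeff_add_unit_exp mderiv_taylor smooth_on_wirtinger openU del: of_nat_add)
  qed
qed

lemma taylor_const: "taylor_series (\<lambda>p :: complex ^ 'N. c) = mconst c"
proof (rule mfps_eqI)
  fix m
  show "mcoeff (taylor_series (\<lambda>p :: complex ^ 'N. c)) m = mcoeff (mconst c) m"
  proof (induction m arbitrary: c rule: mfps_coeff_induct)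
    case zero then show ?case by (simp add: mcoeff_taylor_0)
  next
    case (deriv m v)
    have "wirtinger v (\<lambda>p :: complex ^ 'N. c) = (\<lambda>p. 0)" by (rule ext) simp
    then show ?case using deriv [of 0] by (simp add: mcoeff_add_unit_exp mderiv_taylor)
  qed
qed

lemma taylor_mult:
  assumes "smooth_on U f" "smooth_on U g"
  shows "taylor_series (\<lambda>p. f p * g p) = taylor_series f * taylor_series g"
proof (rule mfps_eqI)
  fix m
  show "mcoeff (taylor_series (\<lambda>p. f p * g p)) m = mcoeff (taylor_series f * taylor_series g) m"
    using assms
  proof (induction m arbitrary: f g rule: mfps_coeff_induct)
    case zero then show ?case by (simp add: mcoeff_taylor_0 smooth_on_mult openU)
  next
    case (deriv m v)
    have "mderiv v (taylor_series (\<lambda>p. f p * g p)) = taylor_series (\<lambda>p. wirtinger v f p * g p + f p * wirtinger v g p)"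
      using deriv.prems by (simp add: mderiv_taylor smooth_on_mult openU) (rule taylor_cong, simp add: wirtinger_smooth)
    also have "\<dots> = taylor_series (\<lambda>p. wirtinger v f p * g p) + taylor_series (\<lambda>p. f p * wirtinger v g p)"
      using deriv.prems by (intro taylor_add smooth_on_mult smooth_on_wirtinger openU)
    finally show ?case using deriv
      by (simp add: mcoeff_add_unit_exp mderiv_taylor smooth_on_wirtinger openU del: of_nat_add)
  qed
qed

lemma taylor_sum:
  assumes "\<And>i. i \<in> A \<Longrightarrow> smooth_on U (f i)"
  shows "taylor_series (\<lambda>p. \<Sum>i\<in>A. f i p) = (\<Sum>i\<in>A. taylor_series (f i))"
  using assms by (induction A rule: infinite_finite_induct)
    (simp_all add: taylor_const taylor_add smooth_on_sum openU)

lemma taylor_uminus: "smooth_on U f \<Longrightarrow> taylor_series (\<lambda>p. - f p) = - taylor_series f"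
  using taylor_mult [of "\<lambda>p. - 1" f] by (simp add: taylor_const mconst_uminus)

lemma taylor_diff:
  "smooth_on U f \<Longrightarrow> smooth_on U g \<Longrightarrow> taylor_series (\<lambda>p. f p - g p) = taylor_series f - taylor_series g"
  using taylor_add [of f "\<lambda>p. - g p"] by (simp add: taylor_uminus smooth_on_uminus openU)

end

text \<open>The conjugation of series corresponding to complex conjugation of functions: it conjugates
  coefficients and exchanges \<open>Z\<close> with \<open>\<zeta>\<close>.\<close>

definition mstar :: "('N :: finite + 'N) mfps \<Rightarrow> ('N + 'N) mfps"
  where "mstar f = mcnj (mcomp f (\<lambda>v. mvar (conj_index v)))"

interpretation conj_subst: msubst UNIV "\<lambda>v :: 'N :: finite + 'N. mvar (conj_index v)"
  by unfold_locales simp_all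

lemma mstar_add [simp]: "mstar (f + g) = mstar f + mstar g"
  and mstar_mult [simp]: "mstar (f * g) = mstar f * mstar g"
  and mstar_0 [simp]: "mstar 0 = 0"
  and mcoeff_mstar_0 [simp]: "mcoeff (mstar f) 0 = cnj (mcoeff f 0)"
  by (simp_all add: mstar_def conj_subst.mcomp_add conj_subst.mcomp_mult conj_subst.mcomp_mvar)

lemma mstar_sum: "mstar (sum f A) = (\<Sum>x\<in>A. mstar (f x))"
  by (induction A rule: infinite_finite_induct) auto

lemma mderiv_mstar: "mderiv v (mstar f) = mstar (mderiv (conj_index v) f)"
proof -
  have "(\<Sum>w\<in>UNIV. mcomp (mderiv w f) (\<lambda>v. mvar (conj_index v)) * mderiv v (mvar (conj_index w) :: ('a + 'a) mfps))
    = (\<Sum>w\<in>UNIV. if w = conj_index v then mcomp (mderiv w f) (\<lambda>v. mvar (conj_index v)) else 0)"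
    by (intro sum.cong) (auto simp: mderiv_mvar)
  then show ?thesis
    by (simp add: mstar_def conj_subst.mderiv_mcomp)
qed

lemma vderiv_mstar:
  "vderiv UNIV (\<lambda>v. mstar (y (conj_index v))) (mstar f) = mstar (vderiv UNIV y f)"
proof -
  have "vderiv UNIV (\<lambda>v. mstar (y (conj_index v))) (mstar f)
    = (\<Sum>v\<in>UNIV. mstar (y (conj_index v) * mderiv (conj_index v) f))"
    by (simp add: vderiv_def mderiv_mstar)
  also have "\<dots> = mstar (vderiv UNIV y f)"
    unfolding vderiv_def mstar_sum by (rule sum_conj_index)
  finally show ?thesis .
qed

lemma (in nbhd) taylor_cnj:
  assumes "smooth_on U f"
  shows "taylor_series (\<lambda>p. cnj (f p)) = mstar (taylor_series f)"
proof (rule mfps_eqI)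
  fix m
  show "mcoeff (taylor_series (\<lambda>p. cnj (f p))) m = mcoeff (mstar (taylor_series f)) m"
    using assms
  proof (induction m arbitrary: f rule: mfps_coeff_induct)
    case zero then show ?case by (simp add: mcoeff_taylor_0 smooth_on_linear [OF openU bounded_linear_cnj])
  next
    case (deriv m v)
    have "mderiv v (taylor_series (\<lambda>p. cnj (f p))) = taylor_series (\<lambda>p. cnj (wirtinger (conj_index v) f p))"
      using deriv.prems by (simp add: mderiv_taylor smooth_on_linear [OF openU bounded_linear_cnj])
        (rule taylor_cong, simp add: wirtinger_cnj smooth_on_differentiable)
    then show ?case using deriv
      by (simp add: mcoeff_add_unit_exp mderiv_taylor smooth_on_wirtinger openU mderiv_mstar del: of_nat_add)
  qed
qed

section \<open>Complex vector fields\<close>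

definition taylor_vf :: "('N :: finite) cvf \<Rightarrow> 'N + 'N \<Rightarrow> ('N + 'N) mfps"
  where "taylor_vf X v = taylor_series (\<lambda>p. X p $ v)"

definition conj_vf :: "('N :: finite) cvf \<Rightarrow> 'N cvf"
  where "conj_vf X = (\<lambda>p. \<chi> v. cnj (X p $ conj_index v))"

lemma frechet_derivative_wirtinger:
  fixes f :: "complex ^ 'N :: finite \<Rightarrow> complex"
  assumes "f differentiable (at p)"
  shows "frechet_derivative f (at p) h =
    (\<Sum>i\<in>UNIV. wirtinger (Inl i) f p * h $ i) + (\<Sum>i\<in>UNIV. wirtinger (Inr i) f p * cnj (h $ i))"
proof -
  define D where "D = frechet_derivative f (at p)"
  have lin: "linear D" unfolding D_def using assms by (rule linear_frechet_derivative)
  have "h = (\<Sum>i\<in>UNIV. Re (h $ i) *\<^sub>R axis i 1 + Im (h $ i) *\<^sub>R axis i \<i>)"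
    by (auto simp: vec_eq_iff axis_def complex_eq_iff if_distrib cong: if_cong)
  then have "D h = D (\<Sum>i\<in>UNIV. Re (h $ i) *\<^sub>R axis i 1 + Im (h $ i) *\<^sub>R axis i \<i>)" by simp
  also have "\<dots> = (\<Sum>i\<in>UNIV. Re (h $ i) *\<^sub>R D (axis i 1) + Im (h $ i) *\<^sub>R D (axis i \<i>))"
    by (simp only: linear_sum [OF lin] linear_add [OF lin] linear_scale [OF lin])
  also have "\<dots> = (\<Sum>i\<in>UNIV. wirtinger (Inl i) f p * h $ i + wirtinger (Inr i) f p * cnj (h $ i))"
  proof (rule sum.cong [OF refl])
    fix i
    show "Re (h $ i) *\<^sub>R D (axis i 1) + Im (h $ i) *\<^sub>R D (axis i \<i>)
      = wirtinger (Inl i) f p * h $ i + wirtinger (Inr i) f p * cnj (h $ i)"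
      unfolding wirtinger.simps D_def [symmetric]
      by (simp add: complex_eq_iff field_simps)
  qed
  finally show ?thesis by (simp add: D_def sum.distrib)
qed

text \<open>The components of \<open>h1\<close> and \<open>h2\<close> solve \<open>h1 + \<i> h2 = a\<close> and
  \<open>cnj h1 + \<i> cnj h2 = b\<close>.\<close>

lemma vf_apply_real_directions:
  fixes w :: "complex ^ ('N :: finite + 'N)"
  obtains h1 h2 where "\<And>f :: complex ^ 'N \<Rightarrow> complex. \<And>p. f differentiable (at p) \<Longrightarrow>
    (\<Sum>v\<in>UNIV. w $ v * wirtinger v f p) = frechet_derivative f (at p) h1 + \<i> * frechet_derivative f (at p) h2"
proof
  fix f :: "complex ^ 'N \<Rightarrow> complex" and p
  assume f: "f differentiable (at p)"
  define h1 :: "complex ^ 'N" where "h1 = (\<chi> i. (w $ Inl i + cnj (w $ Inr i)) / 2)"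
  define h2 :: "complex ^ 'N" where "h2 = (\<chi> i. (w $ Inl i - cnj (w $ Inr i)) / (2 * \<i>))"
  have "w $ Inl i = h1 $ i + \<i> * h2 $ i" "w $ Inr i = cnj (h1 $ i) + \<i> * cnj (h2 $ i)" for i
    by (simp_all add: h1_def h2_def field_simps)
  then show "(\<Sum>v\<in>UNIV. w $ v * wirtinger v f p)
      = frechet_derivative f (at p) (\<chi> i. (w $ Inl i + cnj (w $ Inr i)) / 2)
      + \<i> * frechet_derivative f (at p) (\<chi> i. (w $ Inl i - cnj (w $ Inr i)) / (2 * \<i>))"
    unfolding h1_def [symmetric] h2_def [symmetric] frechet_derivative_wirtinger [OF f]
    by (simp add: sum_UNIV_Plus sum.distrib sum_distrib_left algebra_simps)
qed

context nbhd
begin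

lemma smooth_on_vf_apply:
  assumes "smooth_on U X" "smooth_on U f" shows "smooth_on U (vf_apply X f)"
proof -
  have "smooth_on U (\<lambda>p. \<Sum>v\<in>UNIV. X p $ v * wirtinger v f p)"
    using assms smooth_on_vec [OF openU, of X]
    by (intro smooth_on_sum smooth_on_mult smooth_on_wirtinger openU) auto
  then show ?thesis by (simp add: vf_apply_def [abs_def])
qed

lemma taylor_vf_apply:
  assumes X: "smooth_on U X" and f: "smooth_on U f"
  shows "taylor_series (vf_apply X f) = vderiv UNIV (taylor_vf X) (taylor_series f)"
proof -
  have Xv: "smooth_on U (\<lambda>p. X p $ v)" for v using X smooth_on_vec [OF openU] by blast
  have "taylor_series (vf_apply X f) = taylor_series (\<lambda>p. \<Sum>v\<in>UNIV. X p $ v * wirtinger v f p)"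
    by (simp add: vf_apply_def [abs_def])
  also have "\<dots> = (\<Sum>v\<in>UNIV. taylor_series (\<lambda>p. X p $ v * wirtinger v f p))"
    by (intro taylor_sum smooth_on_mult smooth_on_wirtinger openU f Xv)
  also have "\<dots> = vderiv UNIV (taylor_vf X) (taylor_series f)"
    unfolding vderiv_def taylor_vf_def
    by (intro sum.cong refl) (simp add: taylor_mult Xv smooth_on_wirtinger openU f mderiv_taylor)
  finally show ?thesis .
qed

lemma smooth_on_lie_bracket:
  assumes "smooth_on U X" "smooth_on U Y" shows "smooth_on U (lie_bracket X Y)"
proof -
  have "smooth_on U (\<lambda>p. X p $ v)" "smooth_on U (\<lambda>p. Y p $ v)" for v
    using assms smooth_on_vec [OF openU] by blast+
  then show ?thesis
    using assms by (subst smooth_on_vec [OF openU])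
      (auto simp: lie_bracket_def intro!: smooth_on_diff smooth_on_vf_apply openU)
qed

lemma taylor_lie_bracket:
  assumes X: "smooth_on U X" and Y: "smooth_on U Y"
  shows "taylor_vf (lie_bracket X Y) = vbracket UNIV (taylor_vf X) (taylor_vf Y)"
proof
  fix v
  have Xv: "smooth_on U (\<lambda>p. X p $ v)" and Yv: "smooth_on U (\<lambda>p. Y p $ v)"
    using X Y smooth_on_vec [OF openU] by blast+
  have "taylor_vf (lie_bracket X Y) v
    = taylor_series (\<lambda>p. vf_apply X (\<lambda>q. Y q $ v) p - vf_apply Y (\<lambda>q. X q $ v) p)"
    by (simp add: taylor_vf_def lie_bracket_def)
  also have "\<dots> = taylor_series (vf_apply X (\<lambda>q. Y q $ v)) - taylor_series (vf_apply Y (\<lambda>q. X q $ v))"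
    by (intro taylor_diff smooth_on_vf_apply X Y Xv Yv)
  also have "\<dots> = vbracket UNIV (taylor_vf X) (taylor_vf Y) v"
    by (simp add: taylor_vf_apply X Y Xv Yv vbracket_def) (simp add: taylor_vf_def)
  finally show "taylor_vf (lie_bracket X Y) v = vbracket UNIV (taylor_vf X) (taylor_vf Y) v" .
qed

lemma vf_apply_lie_bracket:
  assumes X: "smooth_on U X" and Y: "smooth_on U Y" and f: "smooth_on U f" and p: "p \<in> U"
  shows "vf_apply (lie_bracket X Y) f p = vf_apply X (vf_apply Y f) p - vf_apply Y (vf_apply X f) p"
proof -
  have *: "vf_apply X (vf_apply Y f) p = (\<Sum>v\<in>UNIV. vf_apply X (\<lambda>q. Y q $ v) p * wirtinger v f p)
      + (\<Sum>u\<in>UNIV. \<Sum>v\<in>UNIV. X p $ u * Y p $ v * wirtinger u (wirtinger v f) p)"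
    if X: "smooth_on U X" and Y: "smooth_on U Y" for X Y
  proof -
    have Yv: "smooth_on U (\<lambda>p. Y p $ v)" for v using Y smooth_on_vec [OF openU] by blast
    have "wirtinger u (vf_apply Y f) p = (\<Sum>v\<in>UNIV. wirtinger u (\<lambda>q. Y q $ v) p * wirtinger v f p
        + Y p $ v * wirtinger u (wirtinger v f) p)" for u
    proof -
      have "wirtinger u (vf_apply Y f) p = wirtinger u (\<lambda>p. \<Sum>v\<in>UNIV. Y p $ v * wirtinger v f p) p"
        by (simp add: vf_apply_def [abs_def])
      also have "\<dots> = (\<Sum>v\<in>UNIV. wirtinger u (\<lambda>p. Y p $ v * wirtinger v f p) p)"
        using p by (intro wirtinger_sum smooth_on_differentiable [of U] smooth_on_mult smooth_on_wirtinger openU f Yv)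
      finally show ?thesis
        using p by (simp add: wirtinger_smooth(3) [OF Yv smooth_on_wirtinger [OF openU f]])
    qed
    then have "vf_apply X (vf_apply Y f) p = (\<Sum>u\<in>UNIV. \<Sum>v\<in>UNIV. X p $ u * wirtinger u (\<lambda>q. Y q $ v) p * wirtinger v f p)
        + (\<Sum>u\<in>UNIV. \<Sum>v\<in>UNIV. X p $ u * Y p $ v * wirtinger u (wirtinger v f) p)"
      by (simp add: vf_apply_def [of X] sum_distrib_left sum.distrib [symmetric] algebra_simps)
    also have "(\<Sum>u\<in>UNIV. \<Sum>v\<in>UNIV. X p $ u * wirtinger u (\<lambda>q. Y q $ v) p * wirtinger v f p)
        = (\<Sum>v\<in>UNIV. vf_apply X (\<lambda>q. Y q $ v) p * wirtinger v f p)"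
      by (subst sum.swap) (simp add: vf_apply_def sum_distrib_right)
    finally show ?thesis .
  qed
  have "(\<Sum>u\<in>UNIV. \<Sum>v\<in>UNIV. X p $ u * Y p $ v * wirtinger u (wirtinger v f) p)
      = (\<Sum>u\<in>UNIV. \<Sum>v\<in>UNIV. Y p $ u * X p $ v * wirtinger u (wirtinger v f) p)"
    by (subst sum.swap) (simp add: wirtinger_commute [OF openU p f] mult_ac)
  then show ?thesis
    unfolding * [OF X Y] * [OF Y X]
    unfolding vf_apply_def [of "lie_bracket X Y"] unfolding lie_bracket_def
    by (simp add: left_diff_distrib sum_subtractf)
qed

lemma smooth_on_conj_vf: "smooth_on U X \<Longrightarrow> smooth_on U (conj_vf X)"
  unfolding smooth_on_vec [OF openU] conj_vf_def
  by (auto intro: smooth_on_linear [OF openU bounded_linear_cnj])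

lemma vf_apply_conj_vf:
  assumes "f differentiable (at p)"
  shows "vf_apply (conj_vf X) (\<lambda>p. cnj (f p)) p = cnj (vf_apply X f p)"
proof -
  have "vf_apply (conj_vf X) (\<lambda>p. cnj (f p)) p = (\<Sum>v\<in>UNIV. cnj (X p $ conj_index v * wirtinger (conj_index v) f p))"
    by (simp add: vf_apply_def conj_vf_def wirtinger_cnj [OF assms])
  also have "\<dots> = cnj (vf_apply X f p)"
    by (subst sum_conj_index) (simp add: vf_apply_def)
  finally show ?thesis .
qed

lemma taylor_conj_vf: "smooth_on U X \<Longrightarrow> taylor_vf (conj_vf X) v = mstar (taylor_vf X (conj_index v))"
  unfolding smooth_on_vec [OF openU] by (simp add: taylor_vf_def conj_vf_def taylor_cnj)

end

section \<open>Frames of CR vector fields\<close>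

lemma smooth_on_det:
  fixes B :: "'a :: real_normed_vector \<Rightarrow> complex ^ 'n ^ 'n"
  assumes "open U" "\<And>i j. smooth_on U (\<lambda>p. B p $ i $ j)"
  shows "smooth_on U (\<lambda>p. det (B p))"
  unfolding det_def using assms by (intro smooth_on_sum smooth_on_mult smooth_on_prod) auto

text \<open>By Cramer's rule the entries of the inverse are quotients of determinants, hence smooth
  wherever the determinant is not 0.\<close>

lemma local_matrix_inverse:
  fixes B :: "'a :: real_normed_vector \<Rightarrow> complex ^ 'n ^ 'n"
  assumes U: "open U" "p0 \<in> U" and B: "\<And>i j. smooth_on U (\<lambda>p. B p $ i $ j)" and inv: "invertible (B p0)"
  obtains V C where "open V" "p0 \<in> V" "V \<subseteq> U" "\<And>i j. smooth_on V (\<lambda>p. C p $ i $ j)"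
    "\<And>p. p \<in> V \<Longrightarrow> B p ** C p = mat 1" "\<And>p. p \<in> V \<Longrightarrow> C p ** B p = mat 1"
proof -
  define V where "V = {p \<in> U. det (B p) \<noteq> 0}"
  have sm: "smooth_on U (\<lambda>p. det (B p))" by (rule smooth_on_det [OF U(1) B])
  have "open V"
  proof -
    have "open ((\<lambda>p. det (B p)) -` (- {0}) \<inter> U)"
      using smooth_on_continuous [OF sm] U(1) continuous_on_open_vimage by blast
    moreover have "(\<lambda>p. det (B p)) -` (- {0}) \<inter> U = V" by (auto simp: V_def)
    ultimately show ?thesis by simp
  qed
  moreover have "p0 \<in> V" using inv U(2) by (simp add: V_def invertible_det_nz)
  moreover have VU: "V \<subseteq> U" by (auto simp: V_def)
  moreover
  define E where "E = (\<lambda>p i j. (\<chi> a b. if b = i then (axis j 1 :: complex ^ 'n) $ a else B p $ a $ b) :: complex ^ 'n ^ 'n)"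
  define C where "C = (\<lambda>p. (\<chi> i j. det (E p i j) / det (B p)) :: complex ^ 'n ^ 'n)"
  have "smooth_on V (\<lambda>p. C p $ i $ j)" for i j
  proof -
    have "smooth_on V (\<lambda>p. E p i j $ a $ b)" for a b
      using smooth_on_subset [OF B VU] by (cases "b = i") (auto simp: E_def)
    then have "smooth_on V (\<lambda>p. det (E p i j) / det (B p))"
      by (intro smooth_on_divide smooth_on_det \<open>open V\<close> smooth_on_subset [OF sm VU]) (auto simp: V_def)
    then show ?thesis by (simp add: C_def)
  qed
  moreover have BC: "B p ** C p = mat 1" if "p \<in> V" for p
  proof -
    have "B p *v (\<chi> i. C p $ i $ j) = axis j 1" for j
      using that cramer [of "B p" "\<chi> i. C p $ i $ j" "axis j 1"] by (simp add: V_def C_def E_def)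
    then have "(B p *v (\<chi> i. C p $ i $ j)) $ l = axis j 1 $ l" for j l by simp
    then show ?thesis
      by (auto simp: matrix_matrix_mult_def matrix_vector_mult_def vec_eq_iff mat_def axis_def)
  qed
  moreover have "C p ** B p = mat 1" if "p \<in> V" for p
    using BC [OF that] matrix_left_right_inverse by blast
  ultimately show thesis by (rule that)
qed

text \<open>Column \<open>a\<close> of \<open>C p\<close>, for \<open>a \<in> A\<close>, is a \<open>(1,0)\<close> vector tangent to \<open>M\<close>, and these columns
  are dual to the constant covectors \<open>u a\<close>.  Column \<open>k j\<close> is dual to \<open>\<partial>r\<^sub>j\<close>.  So \<open>C p\<close> is the inverse of the
  matrix formed by the \<open>\<partial>r\<^sub>j\<close> and the \<open>u a\<close>.\<close>

locale CR_frame =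
  fixes M :: "(complex ^ 'N :: finite) set" and d :: nat and r :: "nat \<Rightarrow> complex ^ 'N \<Rightarrow> real"
    and V :: "(complex ^ 'N) set" and C :: "complex ^ 'N \<Rightarrow> complex ^ 'N ^ 'N"
    and A :: "'N set" and k :: "nat \<Rightarrow> 'N" and u :: "'N \<Rightarrow> complex ^ 'N"
  assumes openV: "open V" and zeroV: "0 \<in> V" and zeroM: "0 \<in> M"
    and smooth_r: "\<And>j. j < d \<Longrightarrow> smooth_on V (r j)"
    and M_V: "M \<inter> V = {Z \<in> V. \<forall>j<d. r j Z = 0}"
    and smooth_C: "\<And>i l. smooth_on V (\<lambda>p. C p $ i $ l)"
    and k_inj: "inj_on k {..<d}" and A_def: "A = - k ` {..<d}"
    and rC: "\<And>p j l. p \<in> V \<Longrightarrow> j < d \<Longrightarrow>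
      (\<Sum>i\<in>UNIV. wirtinger (Inl i) (cplx (r j)) p * C p $ i $ l) = (if l = k j then 1 else 0)"
    and uC: "\<And>p a l. p \<in> V \<Longrightarrow> a \<in> A \<Longrightarrow> (\<Sum>i\<in>UNIV. u a $ i * C p $ i $ l) = (if l = a then 1 else 0)"
    and CB: "\<And>p i m. p \<in> V \<Longrightarrow> (\<Sum>a\<in>A. C p $ i $ a * u a $ m)
      + (\<Sum>j<d. C p $ i $ k j * wirtinger (Inl m) (cplx (r j)) p) = (if i = m then 1 else 0)"

lemma smooth_on_cplx: "open U \<Longrightarrow> smooth_on U f \<Longrightarrow> smooth_on U (cplx f)"
  unfolding cplx_def by (rule smooth_on_linear [OF _ bounded_linear_of_real])

text \<open>Genericity makes the covectors \<partial>r_j independent over \<complex> at 0, so they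
  extend to a basis. Only the rows belonging to the \<partial>r_j vary with the point, and
  invertibility at 0 persists near 0.\<close>

lemma ex_CR_frame:
  fixes M :: "(complex ^ 'N :: finite) set"
  assumes ld: "local_defining M d 0 U r" and gen: "generic_at_0 d r" and M0: "0 \<in> M"
  obtains V C A k u where "CR_frame M d r V C A k u"
proof -
  have U: "open U" "0 \<in> U" and sm: "\<And>j. j < d \<Longrightarrow> smooth_on U (r j)"
    and MU: "M \<inter> U = {Z \<in> U. \<forall>j<d. r j Z = 0}"
    using ld by (auto simp: local_defining_def)
  define g where "g = (\<lambda>j p. (\<chi> i. wirtinger (Inl i) (cplx (r j)) p) :: complex ^ 'N)"
  define G where "G = (\<lambda>j. g j 0)"
  have indep: "\<forall>j<d. c j = 0" if "(\<Sum>j<d. c j *s G j) = 0" for c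
  proof -
    have "(\<Sum>j<d. c j * wirtinger (Inl i) (cplx (r j)) 0) = (\<Sum>j<d. c j *s G j) $ i" for i
      by (simp add: G_def g_def)
    then show ?thesis using gen that unfolding generic_at_0_def by (metis zero_index)
  qed
  have Ginj: "inj_on G {..<d}"
  proof (rule inj_onI)
    fix i j assume ij: "i \<in> {..<d}" "j \<in> {..<d}" "G i = G j"
    show "i = j"
    proof (rule ccontr)
      assume ne: "i \<noteq> j"
      define c where "c = (\<lambda>l. if l = i then 1 else if l = j then - 1 else 0 :: complex)"
      have "(\<Sum>l<d. c l *s G l) = (\<Sum>l\<in>{i, j}. c l *s G l)"
        using ij by (intro sum.mono_neutral_right) (auto simp: c_def)
      also have "\<dots> = 0" using ne ij by (simp add: c_def)
      finally have "c i = 0" using indep ij by blast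
      then show False by (simp add: c_def)
    qed
  qed
  let ?S = "G ` {..<d}"
  have indS: "vec.independent ?S"
  proof (subst vec.independent_explicit_finite_subsets, intro allI impI ballI)
    fix T q v assume T: "T \<subseteq> ?S" "finite T" "(\<Sum>v\<in>T. q v *s v) = 0" "v \<in> T"
    define c where "c = (\<lambda>j. if G j \<in> T then q (G j) else 0)"
    have "(\<Sum>j<d. c j *s G j) = (\<Sum>v\<in>?S. (if v \<in> T then q v else 0) *s v)"
      by (simp add: sum.reindex [OF Ginj] c_def)
    also have "\<dots> = (\<Sum>v\<in>T. q v *s v)"
      using T(1) by (intro sum.mono_neutral_cong_right) auto
    finally have "\<forall>j<d. c j = 0" using T(3) by (intro indep) simp
    moreover obtain j where "j < d" "v = G j" using T by auto
    ultimately show "q v = 0" using T(4) by (auto simp: c_def)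
  qed
  obtain Bs where Bs: "?S \<subseteq> Bs" "vec.independent Bs" "vec.span Bs = UNIV"
    using vec.maximal_independent_subset_extend [of ?S UNIV] indS by (metis subset_UNIV top.extremum_uniqueI)
  have finBs: "finite Bs" using Bs(2) vec.finiteI_independent by blast
  have "card Bs = CARD('N)" using vec.dim_eq_card [of Bs UNIV] Bs vec_dim_card
    by (metis vec.span_UNIV)
  \<comment> \<open>Rows are indexed by \<open>'N\<close>, so the basis is enumerated by
    \<open>'N\<close>; \<open>k j\<close> is the place that \<partial>r_j receives in this
    enumeration.\<close>
  then obtain h where h: "bij_betw h (UNIV :: 'N set) Bs"
    using finBs by (metis bij_betw_iff_card finite_class.finite_UNIV)
  define k where "k = (\<lambda>j. inv_into UNIV h (G j))"
  have hk: "h (k j) = G j" if "j < d" for j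
    unfolding k_def using h Bs(1) that by (intro f_inv_into_f) (auto simp: bij_betw_def)
  have kinj: "inj_on k {..<d}" using Ginj hk by (metis inj_onD inj_onI lessThan_iff)
  define A where "A = - k ` {..<d}"
  define ix where "ix = inv_into {..<d} k"
  have ixk: "ix (k j) = j" if "j < d" for j unfolding ix_def using kinj that by simp
  have kix: "k (ix l) = l" "ix l < d" if "l \<notin> A" for l
    using that f_inv_into_f [of l k "{..<d}"] inv_into_into [of l k "{..<d}"] by (auto simp: A_def ix_def)
  define B where "B = (\<lambda>p. (\<chi> l. if l \<in> A then h l else g (ix l) p) :: complex ^ 'N ^ 'N)"
  have smB: "smooth_on U (\<lambda>p. B p $ i $ j)" for i j
    using smooth_on_wirtinger [OF U(1) smooth_on_cplx [OF U(1) sm [OF kix(2)]]]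
    by (cases "i \<in> A") (auto simp: B_def g_def)
  have B0: "B 0 $ l = h l" for l
    using hk [of "ix l"] kix [of l] by (auto simp: B_def G_def)
  have "rows (B 0) = Bs" using h by (auto simp: rows_def row_def B0 bij_betw_def)
  then have "invertible (B 0)"
    using Bs(3) matrix_left_invertible_span_rows_gen [of "B 0"] invertible_left_inverse by blast
  then obtain V C where VC: "open V" "0 \<in> V" "V \<subseteq> U" "\<And>i j. smooth_on V (\<lambda>p. C p $ i $ j)"
    "\<And>p. p \<in> V \<Longrightarrow> B p ** C p = mat 1" "\<And>p. p \<in> V \<Longrightarrow> C p ** B p = mat 1"
    using local_matrix_inverse [OF U smB] by blast
  have BC: "(\<Sum>i\<in>UNIV. B p $ l $ i * C p $ i $ m) = (if l = m then 1 else 0)" if "p \<in> V" for p l m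
    using VC(5) [OF that] by (auto simp: matrix_matrix_mult_def vec_eq_iff mat_def)
  have CB: "(\<Sum>l\<in>UNIV. C p $ i $ l * B p $ l $ m) = (if i = m then 1 else 0)" if "p \<in> V" for p i m
    using VC(6) [OF that] by (auto simp: matrix_matrix_mult_def vec_eq_iff mat_def)
  have "CR_frame M d r V C A k h"
  proof
    show "M \<inter> V = {Z \<in> V. \<forall>j<d. r j Z = 0}" using MU VC(3) by blast
    show "smooth_on V (r j)" if "j < d" for j using smooth_on_subset [OF sm [OF that] VC(3)] .
    show "(\<Sum>i\<in>UNIV. wirtinger (Inl i) (cplx (r j)) p * C p $ i $ l) = (if l = k j then 1 else 0)"
      if "p \<in> V" "j < d" for p j l
      using BC [OF that(1), of "k j" l] that by (auto simp: B_def A_def ixk g_def)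
    show "(\<Sum>i\<in>UNIV. h a $ i * C p $ i $ l) = (if l = a then 1 else 0)" if "p \<in> V" "a \<in> A" for p a l
      using BC [OF that(1), of a l] that by (auto simp: B_def)
    show "(\<Sum>a\<in>A. C p $ i $ a * h a $ m) + (\<Sum>j<d. C p $ i $ k j * wirtinger (Inl m) (cplx (r j)) p)
      = (if i = m then 1 else 0)" if "p \<in> V" for p i m
    proof -
      have "(\<Sum>l\<in>UNIV. C p $ i $ l * B p $ l $ m)
        = (\<Sum>l\<in>A. C p $ i $ l * B p $ l $ m) + (\<Sum>l\<in>k ` {..<d}. C p $ i $ l * B p $ l $ m)"
        by (subst sum.union_disjoint [symmetric]) (auto simp: A_def Compl_partition2)
      also have "(\<Sum>l\<in>A. C p $ i $ l * B p $ l $ m) = (\<Sum>a\<in>A. C p $ i $ a * h a $ m)"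
        by (intro sum.cong) (auto simp: B_def)
      also have "(\<Sum>l\<in>k ` {..<d}. C p $ i $ l * B p $ l $ m)
        = (\<Sum>j<d. C p $ i $ k j * wirtinger (Inl m) (cplx (r j)) p)"
        by (subst sum.reindex [OF kinj]) (auto simp: B_def A_def ixk g_def intro!: sum.cong)
      finally show ?thesis using CB [OF that, of i m] by simp
    qed
  qed (use VC M0 kinj in \<open>auto simp: A_def\<close>)
  then show thesis by (rule that)
qed

context CR_frame
begin

abbreviation R :: "nat \<Rightarrow> complex ^ 'N \<Rightarrow> complex" where "R j \<equiv> cplx (r j)"

lemma smooth_R: "j < d \<Longrightarrow> smooth_on V (R j)"
  using smooth_on_cplx [OF openV smooth_r] .

lemma card_A: "card A = CARD('N) - d" and d_le: "d \<le> CARD('N)" and finite_A: "finite A"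
proof -
  show "finite A" by simp
  have "card (k ` {..<d}) = d" using card_image [OF k_inj] by simp
  then show "card A = CARD('N) - d" "d \<le> CARD('N)"
    unfolding A_def Compl_eq_Diff_UNIV
    using card_Diff_subset [of "k ` {..<d}" UNIV] card_mono [of UNIV "k ` {..<d}"] by auto
qed

lemma wirtinger_R_conj: "j < d \<Longrightarrow> p \<in> V \<Longrightarrow> wirtinger (conj_index v) (R j) p = cnj (wirtinger v (R j) p)"
  using wirtinger_cnj [OF smooth_on_differentiable [OF smooth_R], of j p "conj_index v"] by (simp add: cplx_def)

lemma frechet_R: 
  assumes "j < d" "p \<in> V"
  shows "frechet_derivative (R j) (at p) h = of_real (frechet_derivative (r j) (at p) h)"
  unfolding cplx_def
  by (rule frechet_derivative_linear_comp [OF bounded_linear_of_real smooth_on_differentiable [OF smooth_r [OF assms(1)] assms(2)]])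

text \<open>The real differential of \<open>r i\<close> is twice the real part of \<partial>r_i,
  hence the factor 1/2.\<close>

lemma dual_vectors:
  assumes p: "p \<in> V" and ij: "i < d" "j < d"
  shows "frechet_derivative (r i) (at p) (\<chi> l. C p $ l $ k j / 2) = (if i = j then 1 else 0)"
proof -
  let ?w = "\<chi> l. C p $ l $ k j / 2"
  have s: "(\<Sum>l\<in>UNIV. wirtinger (Inl l) (R i) p * ?w $ l) = (if i = j then 1/2 else 0)"
    using rC [OF p ij(1), of "k j"] k_inj ij by (auto simp: sum_divide_distrib [symmetric] inj_on_def)
  have "(\<Sum>l\<in>UNIV. wirtinger (Inr l) (R i) p * cnj (?w $ l)) = cnj (\<Sum>l\<in>UNIV. wirtinger (Inl l) (R i) p * ?w $ l)"
    using wirtinger_R_conj [OF ij(1) p, of "Inl _"] by simp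
  then have "frechet_derivative (R i) (at p) ?w = (if i = j then 1 else 0)"
    unfolding frechet_derivative_wirtinger [OF smooth_on_differentiable [OF smooth_R [OF ij(1)] p]] s by simp
  then show ?thesis unfolding frechet_R [OF ij(1) p] by (metis of_real_eq_1_iff of_real_eq_0_iff)
qed

text \<open>The map \<open>F\<close> below has derivative \<open>id\<close> at \<open>p\<close> and straightens \<open>M\<close>:
  \<open>r i x\<close> is the derivative of \<open>r i\<close> at \<open>p\<close> in the direction \<open>F x - p\<close>.\<close>

lemma derivative_vanishes_on_tangent:
  fixes f :: "complex ^ 'N \<Rightarrow> complex"
  assumes W: "open W" "W \<subseteq> V" and p: "p \<in> M" "p \<in> W"
    and f: "f differentiable (at p)" and f0: "\<And>q. q \<in> M \<inter> W \<Longrightarrow> f q = 0"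
    and h: "\<And>j. j < d \<Longrightarrow> frechet_derivative (r j) (at p) h = 0"
  shows "frechet_derivative f (at p) h = 0"
proof -
  have pV: "p \<in> V" using p W by blast
  define w where "w = (\<lambda>j. (\<chi> l. C p $ l $ k j / 2) :: complex ^ 'N)"
  define D where "D = (\<lambda>j q. frechet_derivative (r j) (at q))"
  have Dw: "D i p (w j) = (if i = j then 1 else 0)" if "i < d" "j < d" for i j
    unfolding D_def w_def by (rule dual_vectors [OF pV that])
  have D: "(r j has_derivative D j q) (at q)" if "j < d" "q \<in> V" for j q
    unfolding D_def using smooth_on_has_derivative [OF smooth_r [OF that(1)] that(2)] .
  have Dlin: "linear (D j q)" "bounded_linear (D j q)" if "j < d" "q \<in> V" for j q
    using D [OF that] has_derivative_linear has_derivative_bounded_linear by blast+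
  define F where "F = (\<lambda>x. x + (\<Sum>j<d. (r j x - D j p (x - p)) *\<^sub>R w j))"
  define F' where "F' = (\<lambda>q. Blinfun (\<lambda>x. x + (\<Sum>j<d. (D j q x - D j p x) *\<^sub>R w j)))"
  have blF: "bounded_linear (\<lambda>x. x + (\<Sum>j<d. (D j q x - D j p x) *\<^sub>R w j))" if "q \<in> V" for q
    using Dlin(2) that pV
    by (intro bounded_linear_add bounded_linear_ident bounded_linear_sum
        bounded_linear_compose [OF bounded_linear_scaleR_left] bounded_linear_sub) auto
  have F'app: "blinfun_apply (F' q) = (\<lambda>x. x + (\<Sum>j<d. (D j q x - D j p x) *\<^sub>R w j))" if "q \<in> V" for q
    unfolding F'_def using blF [OF that] by (rule bounded_linear_Blinfun_apply)
  have derF: "(F has_derivative blinfun_apply (F' q)) (at q)" if "q \<in> W" for q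
  proof -
    have qV: "q \<in> V" using that W by blast
    have "((\<lambda>x. D j p (x - p)) has_derivative (\<lambda>x. D j p x)) (at q)" if "j < d" for j
      by (rule bounded_linear.has_derivative [OF Dlin(2) [OF that pV]]) (auto intro!: derivative_eq_intros)
    then show ?thesis
      unfolding F_def F'app [OF qV]
      by (intro has_derivative_add has_derivative_ident has_derivative_sum has_derivative_scaleR_left
          has_derivative_diff D) (use qV in auto)
  qed
  have contF': "continuous_on W F'"
  proof (rule continuous_on_blinfun_componentwise)
    fix b :: "complex ^ 'N"
    have "continuous_on W (\<lambda>q. b + (\<Sum>j<d. (D j q b - D j p b) *\<^sub>R w j))"
    proof (intro continuous_intros)
      fix j assume "j \<in> {..<d}"
      then show "continuous_on W (\<lambda>q. D j q b)"
        unfolding D_def using smooth_on_continuous [OF smooth_on_frechet [OF smooth_r]] W(2) continuous_on_subset by blast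
    qed
    then show "continuous_on W (\<lambda>q. blinfun_apply (F' q) b)"
      by (rule continuous_on_eq) (use F'app W(2) in auto)
  qed
  have F'p: "blinfun_apply (F' p) = id" using F'app [OF pV] by auto
  then have F'p': "F' p = id_blinfun" by (intro blinfun_eqI) simp
  have Fp: "F p = p"
  proof -
    have "r j p = 0" if "j < d" for j using M_V p pV that by blast
    moreover have "D j p 0 = 0" if "j < d" for j using Dlin(1) [OF that pV] by (rule linear_0)
    ultimately show ?thesis by (simp add: F_def)
  qed
  have rF: "r i x = D i p (F x - p)" if "i < d" for i x
  proof -
    note lin = Dlin(1) [OF that pV]
    have "D i p (F x - p) = D i p ((x - p) + (\<Sum>j<d. (r j x - D j p (x - p)) *\<^sub>R w j))"
      by (simp add: F_def algebra_simps)
    also have "\<dots> = D i p (x - p) + (\<Sum>j<d. (r j x - D j p (x - p)) * D i p (w j))"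
      by (simp add: linear_add [OF lin] linear_sum [OF lin] linear_scale [OF lin])
    also have "(\<Sum>j<d. (r j x - D j p (x - p)) * D i p (w j)) = (\<Sum>j<d. if j = i then r j x - D j p (x - p) else 0)"
      using that by (intro sum.cong) (auto simp: Dw)
    finally show ?thesis using that by simp
  qed
  have invF: "id_blinfun o\<^sub>L F' p = id_blinfun"
    unfolding F'p' by (intro blinfun_eqI) simp
  obtain U' V' g g' where inv: "open U'" "U' \<subseteq> W" "p \<in> U'" "open V'" "F p \<in> V'" "homeomorphism U' V' F g"
    "\<And>y. y \<in> V' \<Longrightarrow> (g has_derivative g' y) (at y)"
    "\<And>y. y \<in> V' \<Longrightarrow> g' y = Hilbert_Choice.inv (blinfun_apply (F' (g y)))"
    "\<And>y. y \<in> V' \<Longrightarrow> bij (blinfun_apply (F' (g y)))"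
    by (rule inverse_function_theorem [OF W(1) derF contF' p(2) invF]) (assumption | rule that)+
  have gp: "g p = p" using homeomorphism_apply1 [OF inv(6,3)] Fp by simp
  have g': "(g has_derivative id) (at p)"
    using inv(7) [of p] inv(8) [of p] inv(5) by (simp add: Fp gp F'p)
  \<comment> \<open>A curve with velocity \<open>h\<close> at \<open>p\<close> that stays in M for
    small parameters, so \<open>f\<close> is 0 along it.\<close>
  define c where "c = (\<lambda>t :: real. g (p + t *\<^sub>R h))"
  have c': "(c has_derivative (\<lambda>t. t *\<^sub>R h)) (at 0)"
  proof -
    have "((\<lambda>t. p + t *\<^sub>R h) has_derivative (\<lambda>t. t *\<^sub>R h)) (at (0 :: real))"
      by (auto intro!: derivative_eq_intros)
    moreover have "(g has_derivative id) (at (p + 0 *\<^sub>R h))" using g' by simp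
    ultimately have "((\<lambda>t. g (p + t *\<^sub>R h)) has_derivative (\<lambda>t. id (t *\<^sub>R h))) (at 0)"
      by (rule has_derivative_compose)
    then show ?thesis by (simp add: c_def)
  qed
  have "open ((\<lambda>t :: real. p + t *\<^sub>R h) -` V')"
    by (intro open_vimage inv continuous_intros)
  moreover have "0 \<in> (\<lambda>t :: real. p + t *\<^sub>R h) -` V'" using inv(5) Fp by simp
  ultimately have T: "open ((\<lambda>t :: real. p + t *\<^sub>R h) -` V')" "0 \<in> (\<lambda>t :: real. p + t *\<^sub>R h) -` V'" .
  have f_c: "f (c t) = 0" if "t \<in> (\<lambda>t :: real. p + t *\<^sub>R h) -` V'" for t
  proof -
    have t: "p + t *\<^sub>R h \<in> V'" using that by simp
    have "c t \<in> U'" using homeomorphism_image2 [OF inv(6)] t by (auto simp: c_def)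
    then have ctW: "c t \<in> W" using inv(2) by blast
    have "F (c t) = p + t *\<^sub>R h" unfolding c_def using homeomorphism_apply2 [OF inv(6) t] .
    then have "r i (c t) = 0" if "i < d" for i
      using rF [OF that, of "c t"] h [OF that] linear_scale [OF Dlin(1) [OF that pV], of t h] by (simp add: D_def)
    then have "c t \<in> M" using M_V ctW W(2) by blast
    then show ?thesis using f0 ctW by blast
  qed
  have "(f has_derivative frechet_derivative f (at p)) (at (c 0))"
    using f gp by (simp add: c_def frechet_derivative_works)
  then have "((\<lambda>t. f (c t)) has_derivative (\<lambda>t. frechet_derivative f (at p) (t *\<^sub>R h))) (at 0)"
    using c' by (rule has_derivative_compose [rotated])
  moreover have "((\<lambda>t. f (c t)) has_derivative (\<lambda>t. 0)) (at 0)"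
    by (rule has_derivative_transform_within_open [OF has_derivative_const T]) (simp add: f_c)
  ultimately have "(\<lambda>t :: real. frechet_derivative f (at p) (t *\<^sub>R h)) = (\<lambda>t. 0)"
    by (rule has_derivative_unique)
  from fun_cong [OF this, of 1] show ?thesis by simp
qed

text \<open>A complex vector acts as a combination of two real directions \<open>h1\<close> and
  \<open>h2\<close>. Since the \<open>r j\<close> are real, each of the two directions is tangent to
  M by itself.\<close>

lemma vf_apply_vanishes_on_M:
  assumes W: "open W" "W \<subseteq> V" and p: "p \<in> M" "p \<in> W"
    and f: "f differentiable (at p)" and f0: "\<And>q. q \<in> M \<inter> W \<Longrightarrow> f q = 0"
    and X: "\<And>j. j < d \<Longrightarrow> vf_apply X (R j) p = 0"
  shows "vf_apply X f p = 0"
proof -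
  have pV: "p \<in> V" using p W by blast
  obtain h1 h2 where h: "\<And>f :: complex ^ 'N \<Rightarrow> complex. \<And>p'. f differentiable (at p') \<Longrightarrow>
    (\<Sum>v\<in>UNIV. X p $ v * wirtinger v f p') = frechet_derivative f (at p') h1 + \<i> * frechet_derivative f (at p') h2"
    using vf_apply_real_directions [of "X p"] by blast
  have "frechet_derivative (r j) (at p) h1 = 0 \<and> frechet_derivative (r j) (at p) h2 = 0" if "j < d" for j
  proof -
    have "of_real (frechet_derivative (r j) (at p) h1) + \<i> * of_real (frechet_derivative (r j) (at p) h2) = 0"
      using X [OF that] h [OF smooth_on_differentiable [OF smooth_R [OF that] pV]]
      by (simp add: vf_apply_def frechet_R [OF that pV])
    then show ?thesis by (simp add: complex_eq_iff)
  qed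
  then have "frechet_derivative f (at p) h1 = 0" "frechet_derivative f (at p) h2 = 0"
    using derivative_vanishes_on_tangent [OF W p f f0] by blast+
  then show ?thesis using h [OF f] by (simp add: vf_apply_def)
qed

text \<open>The members of the Lie algebra live on neighbourhoods of their own; keeping
  \<open>W\<close> explicit allows shrinking to a common one before brackets are taken. The type is
  not recorded, as brackets do not preserve it.\<close>

definition tangent_near_0 :: "(complex ^ 'N) set \<Rightarrow> 'N cvf \<Rightarrow> bool"
  where "tangent_near_0 W X \<longleftrightarrow> open W \<and> 0 \<in> W \<and> W \<subseteq> V \<and> smooth_on W X \<and>
    (\<forall>p\<in>M \<inter> W. \<forall>j<d. vf_apply X (R j) p = 0)"

lemma tangent_near_0_subset: "tangent_near_0 W X \<Longrightarrow> open W' \<Longrightarrow> 0 \<in> W' \<Longrightarrow> W' \<subseteq> W \<Longrightarrow> tangent_near_0 W' X"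
  unfolding tangent_near_0_def using smooth_on_subset by blast

lemma tangent_near_0_Int:
  assumes "tangent_near_0 W1 X" "tangent_near_0 W2 Y"
  shows "tangent_near_0 (W1 \<inter> W2) X" "tangent_near_0 (W1 \<inter> W2) Y"
  using assms tangent_near_0_subset [OF assms(1), of "W1 \<inter> W2"] tangent_near_0_subset [OF assms(2), of "W1 \<inter> W2"]
  unfolding tangent_near_0_def by blast+

text \<open>\<open>Y\<close> turns \<open>R j\<close> into a function that vanishes on M, and the
  tangent field \<open>X\<close> annihilates such functions along M; likewise with the roles
  exchanged.\<close>

lemma tangent_near_0_bracket:
  assumes "tangent_near_0 W X" "tangent_near_0 W Y"
  shows "tangent_near_0 W (lie_bracket X Y)"
proof -
  interpret nbhd W using assms by unfold_locales (auto simp: tangent_near_0_def)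
  have WV: "W \<subseteq> V" and X: "smooth_on W X" "\<And>p j. p \<in> M \<inter> W \<Longrightarrow> j < d \<Longrightarrow> vf_apply X (R j) p = 0"
    and Y: "smooth_on W Y" "\<And>p j. p \<in> M \<inter> W \<Longrightarrow> j < d \<Longrightarrow> vf_apply Y (R j) p = 0"
    using assms by (auto simp: tangent_near_0_def)
  have "vf_apply (lie_bracket X Y) (R j) p = 0" if p: "p \<in> M \<inter> W" and j: "j < d" for p j
  proof -
    have R: "smooth_on W (R j)" using smooth_on_subset [OF smooth_R [OF j] WV] .
    have pW: "p \<in> M" "p \<in> W" using p by auto
    have "vf_apply X (vf_apply Y (R j)) p = 0"
      by (rule vf_apply_vanishes_on_M [OF openU WV pW smooth_on_differentiable [OF smooth_on_vf_apply [OF Y(1) R] pW(2)]])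
        (use X(2) Y(2) p j in auto)
    moreover have "vf_apply Y (vf_apply X (R j)) p = 0"
      by (rule vf_apply_vanishes_on_M [OF openU WV pW smooth_on_differentiable [OF smooth_on_vf_apply [OF X(1) R] pW(2)]])
        (use X(2) Y(2) p j in auto)
    ultimately show ?thesis using vf_apply_lie_bracket [OF X(1) Y(1) R pW(2)] by simp
  qed
  then show ?thesis
    using assms smooth_on_lie_bracket [OF X(1) Y(1)] by (auto simp: tangent_near_0_def)
qed

lemma CR_lie_algebra_tangent:
  assumes "X \<in> CR_lie_algebra M d r"
  shows "\<exists>W. tangent_near_0 W X"
  using assms
proof induction
  case (gen_10 X)
  then obtain W where "open W" "0 \<in> W" "smooth_on W X" "\<forall>p\<in>M \<inter> W. \<forall>j<d. vf_apply X (R j) p = 0"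
    unfolding CR_field_10_def by blast
  then show ?case using smooth_on_subset [of W X "W \<inter> V"] openV zeroV
    by (intro exI [of _ "W \<inter> V"]) (auto simp: tangent_near_0_def)
next
  case (gen_01 X)
  then obtain W where "open W" "0 \<in> W" "smooth_on W X" "\<forall>p\<in>M \<inter> W. \<forall>j<d. vf_apply X (R j) p = 0"
    unfolding CR_field_01_def by blast
  then show ?case using smooth_on_subset [of W X "W \<inter> V"] openV zeroV
    by (intro exI [of _ "W \<inter> V"]) (auto simp: tangent_near_0_def)
next
  case (add X Y)
  then obtain W1 W2 where "tangent_near_0 W1 X" "tangent_near_0 W2 Y" by blast
  then have "tangent_near_0 (W1 \<inter> W2) X" "tangent_near_0 (W1 \<inter> W2) Y"
    by (rule tangent_near_0_Int)+
  then have "tangent_near_0 (W1 \<inter> W2) (\<lambda>p. X p + Y p)"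
    by (auto simp: tangent_near_0_def vf_apply_def distrib_right sum.distrib intro: smooth_on_add)
  then show ?case by blast
next
  case (scale X c)
  then obtain W where W: "tangent_near_0 W X" by blast
  have "smooth_on W (\<lambda>p. c *s X p)"
    using W by (subst smooth_on_vec) (auto simp: tangent_near_0_def smooth_on_vec intro!: smooth_on_mult)
  then have "tangent_near_0 W (\<lambda>p. c *s X p)"
    using W by (auto simp: tangent_near_0_def vf_apply_def sum_distrib_left [symmetric] mult.assoc)
  then show ?case by blast
next
  case (bracket X Y)
  then obtain W1 W2 where "tangent_near_0 W1 X" "tangent_near_0 W2 Y" by blast
  then have "tangent_near_0 (W1 \<inter> W2) X" "tangent_near_0 (W1 \<inter> W2) Y"
    by (rule tangent_near_0_Int)+
  then show ?case using tangent_near_0_bracket by blast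
qed

end

section \<open>Passing to Taylor series\<close>

lemma (in nbhd) taylor_vf_add:
  assumes "smooth_on U X" "smooth_on U Y"
  shows "taylor_vf (\<lambda>p. X p + Y p) v = taylor_vf X v + taylor_vf Y v"
  using assms unfolding smooth_on_vec [OF openU] by (simp add: taylor_vf_def taylor_add)

lemma (in nbhd) taylor_vf_scale:
  assumes "smooth_on U X"
  shows "taylor_vf (\<lambda>p. c *s X p) v = mconst c * taylor_vf X v"
  using assms unfolding smooth_on_vec [OF openU] by (simp add: taylor_vf_def taylor_mult taylor_const)

lemma mstar_mconst [simp]: "mstar (mconst c) = mconst (cnj c)"
  by (simp add: mstar_def)

lemma mstar_diff [simp]: "mstar (f - g) = mstar f - mstar g"
  by (simp add: mstar_def conj_subst.mcomp_diff)

lemma vbracket_mstar: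
  assumes "\<And>v. y' v = mstar (y (conj_index v))" "\<And>v. z' v = mstar (z (conj_index v))"
  shows "vbracket UNIV y' z' v = mstar (vbracket UNIV y z (conj_index v))"
proof -
  have "y' = (\<lambda>v. mstar (y (conj_index v)))" "z' = (\<lambda>v. mstar (z (conj_index v)))" using assms by auto
  then show ?thesis by (simp add: vbracket_def vderiv_mstar)
qed

lemma mord_ge_SucI:
  assumes "mcoeff f 0 = 0" "\<And>s. mord_ge k (mderiv s f)"
  shows "mord_ge (Suc k) f"
  unfolding mord_ge_def
proof (intro allI impI)
  fix m :: "'a \<Rightarrow>\<^sub>0 nat" assume m: "mdeg m < Suc k"
  show "mcoeff f m = 0"
  proof (cases "m = 0")
    case False
    then obtain m' v where m': "m = m' + unit_exp v" by (metis mdeg_pos_decomp)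
    then have "mcoeff (mderiv v f) m' = 0" using assms(2) [of v] m by (auto simp: mord_ge_def)
    then show ?thesis by (simp add: m' mcoeff_add_unit_exp)
  qed (use assms in simp)
qed

lemma vderiv_comp:
  assumes "msubst UNIV \<Phi>"
  shows "mcomp (vderiv UNIV y f) \<Phi> = (\<Sum>v\<in>UNIV. mcomp (y v) \<Phi> * mcomp (mderiv v f) \<Phi>)"
proof -
  interpret msubst UNIV \<Phi> by fact
  show ?thesis by (simp add: vderiv_def mcomp_sum mcomp_mult)
qed

context CR_frame
begin

sublocale nbhd V by unfold_locales (rule openV, rule zeroV)

definition \<rho> :: "nat \<Rightarrow> ('N + 'N) mfps" where "\<rho> j = taylor_series (R j)"

definition Ch :: "'N \<Rightarrow> 'N \<Rightarrow> ('N + 'N) mfps" where "Ch i l = taylor_series (\<lambda>p. C p $ i $ l)"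

definition ghat :: "('N + 'N \<Rightarrow> ('N + 'N) mfps) set" where "ghat = taylor_vf ` CR_lie_algebra M d r"

lemma taylor_vf_CR_add:
  assumes "X \<in> CR_lie_algebra M d r" "Y \<in> CR_lie_algebra M d r"
  shows "taylor_vf (\<lambda>p. X p + Y p) v = taylor_vf X v + taylor_vf Y v"
proof -
  obtain W1 W2 where "tangent_near_0 W1 X" "tangent_near_0 W2 Y" using assms CR_lie_algebra_tangent by blast
  from tangent_near_0_Int [OF this] show ?thesis
    by (intro nbhd.taylor_vf_add [of "W1 \<inter> W2"]) (auto simp: tangent_near_0_def nbhd_def)
qed

lemma taylor_vf_CR_scale:
  assumes "X \<in> CR_lie_algebra M d r"
  shows "taylor_vf (\<lambda>p. c *s X p) v = mconst c * taylor_vf X v"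
proof -
  obtain W where "tangent_near_0 W X" using assms CR_lie_algebra_tangent by blast
  then show ?thesis by (intro nbhd.taylor_vf_scale [of W]) (auto simp: tangent_near_0_def nbhd_def)
qed

lemma taylor_vf_CR_bracket:
  assumes "X \<in> CR_lie_algebra M d r" "Y \<in> CR_lie_algebra M d r"
  shows "taylor_vf (lie_bracket X Y) = vbracket UNIV (taylor_vf X) (taylor_vf Y)"
proof -
  obtain W1 W2 where "tangent_near_0 W1 X" "tangent_near_0 W2 Y" using assms CR_lie_algebra_tangent by blast
  from tangent_near_0_Int [OF this] show ?thesis
    by (intro nbhd.taylor_lie_bracket [of "W1 \<inter> W2"]) (auto simp: tangent_near_0_def nbhd_def)
qed

lemma ghat_bracket:
  assumes "y \<in> ghat" "z \<in> ghat" shows "vbracket UNIV y z \<in> ghat"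
proof -
  obtain X Y where XY: "X \<in> CR_lie_algebra M d r" "Y \<in> CR_lie_algebra M d r" "y = taylor_vf X" "z = taylor_vf Y"
    using assms by (auto simp: ghat_def)
  have "vbracket UNIV y z = taylor_vf (lie_bracket X Y)" by (simp only: XY taylor_vf_CR_bracket)
  then show ?thesis using XY CR_lie_algebra.bracket unfolding ghat_def by blast
qed

text \<open>With \<open>g\<close> equal to \<open>Inl\<close> or \<open>Inr\<close> this serves both
  types. Tangency survives conjugation because the \<open>r j\<close> are real.\<close>

lemma conj_vf_generator:
  assumes W: "open W" "0 \<in> W" "smooth_on W X"
    and X: "\<forall>p\<in>M \<inter> W. (\<forall>j<d. vf_apply X (R j) p = 0) \<and> (\<forall>i. X p $ g i = 0)"
  shows "\<exists>W'. open W' \<and> 0 \<in> W' \<and> smooth_on W' (conj_vf X) \<and>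
    (\<forall>p\<in>M \<inter> W'. (\<forall>j<d. vf_apply (conj_vf X) (R j) p = 0) \<and> (\<forall>i. conj_vf X p $ conj_index (g i) = 0))"
proof (intro exI [of _ "W \<inter> V"] conjI ballI allI impI)
  interpret W: nbhd "W \<inter> V" using W openV zeroV by unfold_locales auto
  show "smooth_on (W \<inter> V) (conj_vf X)"
    using W.smooth_on_conj_vf smooth_on_subset [OF W(3)] by blast
  show "vf_apply (conj_vf X) (R j) p = 0" if "p \<in> M \<inter> (W \<inter> V)" "j < d" for p j
  proof -
    have "R j = (\<lambda>p. cnj (R j p))" by (simp add: cplx_def)
    moreover have "R j differentiable (at p)" using smooth_on_differentiable [OF smooth_R] that by auto
    ultimately have "vf_apply (conj_vf X) (R j) p = cnj (vf_apply X (R j) p)" using W.vf_apply_conj_vf by metis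
    then show ?thesis using X that by auto
  qed
  show "conj_vf X p $ conj_index (g i) = 0" if "p \<in> M \<inter> (W \<inter> V)" for p i
    using X that by (auto simp: conj_vf_def)
qed (use W openV zeroV in auto)

text \<open>Conjugation exchanges the two kinds of generators and is compatible with brackets. It is
  claimed for Taylor series only, which is all that \<open>ghat\<close> remembers of a
  field.\<close>

lemma CR_lie_algebra_conj:
  assumes "X \<in> CR_lie_algebra M d r"
  shows "\<exists>Y\<in>CR_lie_algebra M d r. \<forall>v. taylor_vf Y v = mstar (taylor_vf X (conj_index v))"
  using assms
proof induction
  case (gen_10 X)
  then obtain W where W: "open W" "0 \<in> W" "smooth_on W X"
    "\<forall>p\<in>M \<inter> W. (\<forall>j<d. vf_apply X (R j) p = 0) \<and> (\<forall>i. X p $ Inr i = 0)"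
    unfolding CR_field_10_def by blast
  from conj_vf_generator [OF this] have "CR_field_01 M d r (conj_vf X)"
    unfolding CR_field_01_def by simp
  moreover have "taylor_vf (conj_vf X) v = mstar (taylor_vf X (conj_index v))" for v
    using W by (intro nbhd.taylor_conj_vf [of W]) (auto simp: nbhd_def)
  ultimately show ?case using CR_lie_algebra.gen_01 by blast
next
  case (gen_01 X)
  then obtain W where W: "open W" "0 \<in> W" "smooth_on W X"
    "\<forall>p\<in>M \<inter> W. (\<forall>j<d. vf_apply X (R j) p = 0) \<and> (\<forall>i. X p $ Inl i = 0)"
    unfolding CR_field_01_def by blast
  from conj_vf_generator [OF this] have "CR_field_10 M d r (conj_vf X)"
    unfolding CR_field_10_def by simp
  moreover have "taylor_vf (conj_vf X) v = mstar (taylor_vf X (conj_index v))" for v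
    using W by (intro nbhd.taylor_conj_vf [of W]) (auto simp: nbhd_def)
  ultimately show ?case using CR_lie_algebra.gen_10 by blast
next
  case (add X1 X2)
  then obtain Y1 Y2 where Y: "Y1 \<in> CR_lie_algebra M d r" "Y2 \<in> CR_lie_algebra M d r"
    "\<And>v. taylor_vf Y1 v = mstar (taylor_vf X1 (conj_index v))"
    "\<And>v. taylor_vf Y2 v = mstar (taylor_vf X2 (conj_index v))" by blast
  show ?case using Y add.hyps by (intro bexI [OF _ CR_lie_algebra.add [OF Y(1,2)]]) (simp add: taylor_vf_CR_add)
next
  case (scale X c)
  then obtain Y where Y: "Y \<in> CR_lie_algebra M d r" "\<And>v. taylor_vf Y v = mstar (taylor_vf X (conj_index v))" by blast
  show ?case using Y scale.hyps
    by (intro bexI [OF _ CR_lie_algebra.scale [OF Y(1), where c = "cnj c"]]) (simp add: taylor_vf_CR_scale)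
next
  case (bracket X1 X2)
  then obtain Y1 Y2 where Y: "Y1 \<in> CR_lie_algebra M d r" "Y2 \<in> CR_lie_algebra M d r"
    "\<And>v. taylor_vf Y1 v = mstar (taylor_vf X1 (conj_index v))"
    "\<And>v. taylor_vf Y2 v = mstar (taylor_vf X2 (conj_index v))" by blast
  show ?case using Y bracket.hyps
    by (intro bexI [OF _ CR_lie_algebra.bracket [OF Y(1,2)]]) (simp add: taylor_vf_CR_bracket vbracket_mstar)
qed

lemma ghat_conj: "y \<in> ghat \<Longrightarrow> (\<lambda>v. mstar (y (conj_index v))) \<in> ghat"
proof -
  assume "y \<in> ghat"
  then obtain X where "X \<in> CR_lie_algebra M d r" "y = taylor_vf X" by (auto simp: ghat_def)
  then obtain Y where "Y \<in> CR_lie_algebra M d r" "(\<lambda>v. mstar (y (conj_index v))) = taylor_vf Y"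
    using CR_lie_algebra_conj by (metis ext)
  then show ?thesis by (auto simp: ghat_def)
qed

section \<open>A frame of the fields tangent to M, and its Taylor series\<close>

definition Lvf :: "'N \<Rightarrow> 'N cvf"
  where "Lvf a = (\<lambda>p. \<chi> v. case v of Inl i \<Rightarrow> C p $ i $ a | Inr i \<Rightarrow> 0)"

text \<open>The tangent lift of the coordinate field with index \<open>Inr i\<close>: the columns
  \<open>k j\<close>, dual to the \<partial>r_j, cancel its effect on each \<open>r j\<close>. The
  lift is not of type (0,1); together with \<open>Lvf a\<close> for \<open>a \<in> A\<close> these
  fields form a frame of the complexified tangent spaces of M.\<close>

definition Tvf :: "'N \<Rightarrow> 'N cvf"
  where "Tvf i = (\<lambda>p. \<chi> v. case v of Inl m \<Rightarrow> - (\<Sum>j<d. wirtinger (Inr i) (R j) p * C p $ m $ k j)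
    | Inr i' \<Rightarrow> if i' = i then 1 else 0)"

lemma smooth_Lvf: "smooth_on V (Lvf a)"
  unfolding smooth_on_vec [OF openV]
proof
  fix v show "smooth_on V (\<lambda>p. Lvf a p $ v)" using smooth_C by (cases v) (simp_all add: Lvf_def)
qed

lemma smooth_Tvf: "smooth_on V (Tvf i)"
  unfolding smooth_on_vec [OF openV]
proof
  fix v show "smooth_on V (\<lambda>p. Tvf i p $ v)"
  proof (cases v)
    case (Inl m)
    have "smooth_on V (\<lambda>p. - (\<Sum>j<d. wirtinger (Inr i) (R j) p * C p $ m $ k j))"
      by (intro smooth_on_uminus smooth_on_sum smooth_on_mult smooth_on_wirtinger smooth_R smooth_C openV) auto
    then show ?thesis by (simp add: Inl Tvf_def)
  qed (simp add: Tvf_def)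
qed

lemma vf_apply_Lvf: "a \<in> A \<Longrightarrow> p \<in> V \<Longrightarrow> j < d \<Longrightarrow> vf_apply (Lvf a) (R j) p = 0"
  using rC [of p j a] by (auto simp: vf_apply_def Lvf_def sum_UNIV_Plus A_def mult.commute)

lemma vf_apply_Tvf:
  assumes "p \<in> V" "j < d" shows "vf_apply (Tvf i) (R j) p = 0"
proof -
  have "(\<Sum>m\<in>UNIV. (\<Sum>j'<d. wirtinger (Inr i) (R j') p * C p $ m $ k j') * wirtinger (Inl m) (R j) p)
    = (\<Sum>j'<d. wirtinger (Inr i) (R j') p * (\<Sum>m\<in>UNIV. wirtinger (Inl m) (R j) p * C p $ m $ k j'))"
    by (simp add: sum_distrib_right sum_distrib_left mult_ac) (rule sum.swap)
  also have "\<dots> = (\<Sum>j'<d. if j' = j then wirtinger (Inr i) (R j') p else 0)"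
    using assms k_inj by (intro sum.cong) (auto simp: rC inj_on_def)
  also have "\<dots> = wirtinger (Inr i) (R j) p" using assms by simp
  finally show ?thesis
    by (simp add: vf_apply_def Tvf_def sum_UNIV_Plus sum_negf if_distrib [of "\<lambda>x. x * _"] cong: if_cong)
qed

lemma tangent_Lvf: "a \<in> A \<Longrightarrow> tangent_near_0 V (Lvf a)"
  using smooth_Lvf vf_apply_Lvf openV zeroV by (auto simp: tangent_near_0_def)

lemma tangent_Tvf: "tangent_near_0 V (Tvf i)"
  using smooth_Tvf vf_apply_Tvf openV zeroV by (auto simp: tangent_near_0_def)

lemma Lvf_CR: "a \<in> A \<Longrightarrow> Lvf a \<in> CR_lie_algebra M d r"
  using smooth_Lvf vf_apply_Lvf openV zeroV
  by (intro CR_lie_algebra.gen_10) (auto simp: CR_field_10_def Lvf_def intro!: exI [of _ V])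

lemma taylor_Lvf [simp]: "taylor_vf (Lvf a) (Inl i) = Ch i a" "taylor_vf (Lvf a) (Inr i) = 0"
  by (simp_all add: taylor_vf_def Lvf_def Ch_def taylor_const)

lemma taylor_Tvf_Inr: "taylor_vf (Tvf i) (Inr i') = (if i' = i then 1 else 0)"
  by (simp add: taylor_vf_def Tvf_def taylor_const)

lemma mderiv_\<rho>: "j < d \<Longrightarrow> mderiv v (\<rho> j) = taylor_series (wirtinger v (R j))"
  unfolding \<rho>_def by (rule mderiv_taylor [OF smooth_R])

lemma taylor_Tvf_Inl: "taylor_vf (Tvf i) (Inl m) = - (\<Sum>j<d. mderiv (Inr i) (\<rho> j) * Ch m (k j))"
proof -
  have s: "smooth_on V (\<lambda>p. wirtinger (Inr i) (R j) p * C p $ m $ k j)" if "j < d" for j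
    by (intro smooth_on_mult smooth_on_wirtinger smooth_R smooth_C openV that)
  have "taylor_vf (Tvf i) (Inl m) = taylor_series (\<lambda>p. - (\<Sum>j<d. wirtinger (Inr i) (R j) p * C p $ m $ k j))"
    by (simp add: taylor_vf_def Tvf_def)
  also have "\<dots> = - (\<Sum>j<d. taylor_series (\<lambda>p. wirtinger (Inr i) (R j) p * C p $ m $ k j))"
  proof -
    have "smooth_on V (\<lambda>p. \<Sum>j<d. wirtinger (Inr i) (R j) p * C p $ m $ k j)"
      by (intro smooth_on_sum openV) (auto intro: s)
    moreover have "taylor_series (\<lambda>p. \<Sum>j<d. wirtinger (Inr i) (R j) p * C p $ m $ k j)
      = (\<Sum>j<d. taylor_series (\<lambda>p. wirtinger (Inr i) (R j) p * C p $ m $ k j))"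
      by (intro taylor_sum) (auto intro: s)
    ultimately show ?thesis by (simp add: taylor_uminus)
  qed
  also have "(\<Sum>j<d. taylor_series (\<lambda>p. wirtinger (Inr i) (R j) p * C p $ m $ k j))
    = (\<Sum>j<d. mderiv (Inr i) (\<rho> j) * Ch m (k j))"
    by (intro sum.cong refl) (simp add: taylor_mult smooth_on_wirtinger smooth_R smooth_C openV mderiv_\<rho> Ch_def)
  finally show ?thesis .
qed

lemma CB_hat: "(\<Sum>a\<in>A. Ch i a * mconst (u a $ m)) + (\<Sum>j<d. Ch i (k j) * mderiv (Inl m) (\<rho> j))
  = (if i = m then 1 else 0)"
proof -
  have s1: "smooth_on V (\<lambda>p. C p $ i $ a * u a $ m)" for a
    by (intro smooth_on_mult smooth_C openV) auto
  have s2: "smooth_on V (\<lambda>p. C p $ i $ k j * wirtinger (Inl m) (R j) p)" if "j < d" for j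
    by (intro smooth_on_mult smooth_on_wirtinger smooth_R smooth_C openV that)
  have "taylor_series (\<lambda>p. (\<Sum>a\<in>A. C p $ i $ a * u a $ m) + (\<Sum>j<d. C p $ i $ k j * wirtinger (Inl m) (R j) p))
    = taylor_series (\<lambda>p. \<Sum>a\<in>A. C p $ i $ a * u a $ m) + taylor_series (\<lambda>p. \<Sum>j<d. C p $ i $ k j * wirtinger (Inl m) (R j) p)"
    using s1 s2 by (intro taylor_add smooth_on_sum openV) auto
  also have "taylor_series (\<lambda>p. \<Sum>a\<in>A. C p $ i $ a * u a $ m) = (\<Sum>a\<in>A. Ch i a * mconst (u a $ m))"
    using s1 by (subst taylor_sum) (auto simp: taylor_mult smooth_C taylor_const Ch_def)
  also have "taylor_series (\<lambda>p. \<Sum>j<d. C p $ i $ k j * wirtinger (Inl m) (R j) p)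
    = (\<Sum>j<d. Ch i (k j) * mderiv (Inl m) (\<rho> j))"
    using s2 by (subst taylor_sum) (auto simp: taylor_mult smooth_C smooth_R openV smooth_on_wirtinger Ch_def mderiv_\<rho> intro!: sum.cong)
  also have "taylor_series (\<lambda>p. (\<Sum>a\<in>A. C p $ i $ a * u a $ m) + (\<Sum>j<d. C p $ i $ k j * wirtinger (Inl m) (R j) p))
    = taylor_series (\<lambda>p :: complex ^ 'N. if i = m then 1 else 0)"
    by (rule taylor_cong) (simp add: CB)
  finally show ?thesis by (cases "i = m") (simp_all add: taylor_const)
qed

lemma mstar_\<rho>: "j < d \<Longrightarrow> mstar (\<rho> j) = \<rho> j"
  using taylor_cnj [OF smooth_R] by (simp add: \<rho>_def cplx_def)

text \<open>Stated for an arbitrary ring homomorphism \<open>\<phi>\<close>, since it is used for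
  substitution into power series, also followed by passing to fractions or preceded by conjugation.\<close>

lemma tangent_decomp_hom:
  fixes \<phi> :: "('N + 'N) mfps \<Rightarrow> 'q :: comm_ring_1"
  assumes add: "\<And>f g. \<phi> (f + g) = \<phi> f + \<phi> g" and mult: "\<And>f g. \<phi> (f * g) = \<phi> f * \<phi> g"
    and one: "\<phi> 1 = 1"
    and w: "\<And>j. j < d \<Longrightarrow> (\<Sum>v\<in>UNIV. \<phi> (mderiv v (\<rho> j)) * w v) = 0"
  shows "w v = (\<Sum>a\<in>A. (\<Sum>m\<in>UNIV. \<phi> (mconst (u a $ m)) * w (Inl m)) * \<phi> (taylor_vf (Lvf a) v))
    + (\<Sum>i\<in>UNIV. w (Inr i) * \<phi> (taylor_vf (Tvf i) v))"
proof -
  have zero: "\<phi> 0 = 0" using add [of 0 0] by simp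
  have uminus: "\<phi> (- f) = - \<phi> f" for f using add [of f "- f"] by (simp add: zero eq_neg_iff_add_eq_0 add.commute)
  have sum: "\<phi> (sum f B) = (\<Sum>x\<in>B. \<phi> (f x))" for f :: "'z \<Rightarrow> _" and B
    by (induction B rule: infinite_finite_induct) (auto simp: zero add)
  show ?thesis
  proof (cases v)
    case (Inr i')
    have "(\<Sum>i\<in>UNIV. w (Inr i) * \<phi> (taylor_vf (Tvf i) (Inr i'))) = (\<Sum>i\<in>UNIV. if i = i' then w (Inr i) else 0)"
      by (intro sum.cong) (auto simp: taylor_Tvf_Inr one zero)
    then show ?thesis by (simp add: Inr zero)
  next
    case (Inl i)
    have tan: "(\<Sum>m\<in>UNIV. \<phi> (mderiv (Inl m) (\<rho> j)) * w (Inl m)) = - (\<Sum>i\<in>UNIV. \<phi> (mderiv (Inr i) (\<rho> j)) * w (Inr i))"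
      if "j < d" for j
      using w [OF that] unfolding sum_UNIV_Plus by (rule eq_neg_iff_add_eq_0 [THEN iffD2])
    have CBc: "(\<Sum>a\<in>A. \<phi> (Ch i a) * \<phi> (mconst (u a $ m))) + (\<Sum>j<d. \<phi> (Ch i (k j)) * \<phi> (mderiv (Inl m) (\<rho> j)))
      = (if i = m then 1 else 0)" for m
      using arg_cong [OF CB_hat [of i m], of \<phi>] by (simp add: add sum mult one zero split: if_splits)
    have "w (Inl i) = (\<Sum>m\<in>UNIV. (if i = m then 1 else 0) * w (Inl m))" by (simp add: if_distrib [of "\<lambda>x. x * _"] cong: if_cong)
    also have "\<dots> = (\<Sum>m\<in>UNIV. \<Sum>a\<in>A. \<phi> (Ch i a) * \<phi> (mconst (u a $ m)) * w (Inl m))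
        + (\<Sum>m\<in>UNIV. \<Sum>j<d. \<phi> (Ch i (k j)) * \<phi> (mderiv (Inl m) (\<rho> j)) * w (Inl m))"
      by (simp only: CBc [symmetric] distrib_right sum.distrib sum_distrib_right)
    also have "(\<Sum>m\<in>UNIV. \<Sum>a\<in>A. \<phi> (Ch i a) * \<phi> (mconst (u a $ m)) * w (Inl m))
        = (\<Sum>a\<in>A. (\<Sum>m\<in>UNIV. \<phi> (mconst (u a $ m)) * w (Inl m)) * \<phi> (taylor_vf (Lvf a) (Inl i)))"
      by (subst sum.swap) (simp add: sum_distrib_right sum_distrib_left mult_ac)
    also have "(\<Sum>m\<in>UNIV. \<Sum>j<d. \<phi> (Ch i (k j)) * \<phi> (mderiv (Inl m) (\<rho> j)) * w (Inl m))
        = (\<Sum>j<d. \<phi> (Ch i (k j)) * (\<Sum>m\<in>UNIV. \<phi> (mderiv (Inl m) (\<rho> j)) * w (Inl m)))"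
      by (subst sum.swap) (simp add: sum_distrib_left mult_ac)
    also have "\<dots> = (\<Sum>j<d. \<phi> (Ch i (k j)) * (- (\<Sum>i\<in>UNIV. \<phi> (mderiv (Inr i) (\<rho> j)) * w (Inr i))))"
      by (intro sum.cong) (simp_all add: tan)
    also have "\<dots> = (\<Sum>i'\<in>UNIV. w (Inr i') * \<phi> (taylor_vf (Tvf i') (Inl i)))"
      by (simp add: taylor_Tvf_Inl uminus sum mult sum_distrib_left sum_negf mult_ac) (rule sum.swap)
    finally show ?thesis by (simp add: Inl)
  qed
qed

lemma tangent_decomp:
  assumes \<Phi>: "msubst UNIV \<Phi>"
    and w: "\<And>j. j < d \<Longrightarrow> (\<Sum>v\<in>UNIV. mcomp (mderiv v (\<rho> j)) \<Phi> * w v) = 0"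
  shows "w v = (\<Sum>a\<in>A. (\<Sum>m\<in>UNIV. mconst (u a $ m) * w (Inl m)) * mcomp (taylor_vf (Lvf a) v) \<Phi>)
    + (\<Sum>i\<in>UNIV. w (Inr i) * mcomp (taylor_vf (Tvf i) v) \<Phi>)"
proof -
  interpret msubst UNIV \<Phi> by fact
  show ?thesis
    using tangent_decomp_hom [where \<phi> = "\<lambda>f. mcomp f \<Phi>", of w v] w by (simp add: mcomp_add mcomp_mult)
qed

text \<open>No division by the defining functions is needed: all derivatives of \<open>f\<close> along tangent fields
  vanish at \<open>0\<close>, and by \<open>tangent_decomp\<close> the derivatives of the composition are combinations of these.\<close>

lemma taylor_vanishes_on_complexification:
  assumes \<Phi>: "msubst UNIV \<Phi>" and \<rho>: "\<And>j. j < d \<Longrightarrow> mcomp (\<rho> j) \<Phi> = 0"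
    and W: "open W" "0 \<in> W" "smooth_on W f" and f0: "\<And>p. p \<in> M \<inter> W \<Longrightarrow> f p = 0"
  shows "mcomp (taylor_series f) \<Phi> = 0"
proof -
  interpret msubst UNIV \<Phi> by fact
  interpret W: nbhd "W \<inter> V" using W openV zeroV by unfold_locales auto
  have "mord_ge l (mcomp (taylor_series f) \<Phi>)"
    if "smooth_on (W \<inter> V) f" "\<And>p. p \<in> M \<inter> (W \<inter> V) \<Longrightarrow> f p = 0" for l f
    using that
  proof (induction l arbitrary: f)
    case (Suc l)
    have X: "mord_ge l (mcomp (vderiv UNIV (taylor_vf X) (taylor_series f)) \<Phi>)" if "tangent_near_0 V X" for X
    proof -
      have t: "smooth_on (W \<inter> V) X" "\<And>p j. p \<in> M \<inter> (W \<inter> V) \<Longrightarrow> j < d \<Longrightarrow> vf_apply X (R j) p = 0"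
        using that smooth_on_subset [of V X "W \<inter> V"] by (auto simp: tangent_near_0_def)
      have "vf_apply X f p = 0" if p: "p \<in> M \<inter> (W \<inter> V)" for p
        by (rule vf_apply_vanishes_on_M [where W = "W \<inter> V"])
           (use p t Suc.prems W.openU in \<open>auto intro: smooth_on_differentiable\<close>)
      then show ?thesis
        using Suc.IH [OF W.smooth_on_vf_apply [OF t(1) Suc.prems(1)]] by (simp add: W.taylor_vf_apply t Suc.prems)
    qed
    show ?case
    proof (rule mord_ge_SucI)
      show "mcoeff (mcomp (taylor_series f) \<Phi>) 0 = 0"
        using Suc.prems zeroM W.zeroU by (simp add: W.mcoeff_taylor_0)
      fix s
      define w where "w = (\<lambda>v. mderiv s (\<Phi> v))"
      have w: "(\<Sum>v\<in>UNIV. mcomp (mderiv v (\<rho> j)) \<Phi> * w v) = 0" if "j < d" for j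
        using mderiv_mcomp [of "\<rho> j" s] \<rho> [OF that] by (simp add: w_def)
      let ?F = "taylor_series f"
      let ?cL = "\<lambda>a. \<Sum>m\<in>UNIV. mconst (u a $ m) * w (Inl m)"
      have "mderiv s (mcomp ?F \<Phi>) = (\<Sum>v\<in>UNIV. mcomp (mderiv v ?F) \<Phi> * w v)"
        by (simp add: mderiv_mcomp w_def)
      also have "\<dots> = (\<Sum>v\<in>UNIV. mcomp (mderiv v ?F) \<Phi> * ((\<Sum>a\<in>A. ?cL a * mcomp (taylor_vf (Lvf a) v) \<Phi>)
          + (\<Sum>i\<in>UNIV. w (Inr i) * mcomp (taylor_vf (Tvf i) v) \<Phi>)))"
        by (intro sum.cong refl arg_cong [where f = "\<lambda>x. _ * x"] tangent_decomp [OF \<Phi> w])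
      also have "\<dots> = (\<Sum>v\<in>UNIV. \<Sum>a\<in>A. mcomp (mderiv v ?F) \<Phi> * (?cL a * mcomp (taylor_vf (Lvf a) v) \<Phi>))
          + (\<Sum>v\<in>UNIV. \<Sum>i\<in>UNIV. mcomp (mderiv v ?F) \<Phi> * (w (Inr i) * mcomp (taylor_vf (Tvf i) v) \<Phi>))"
        by (simp only: distrib_left sum.distrib sum_distrib_left)
      also have "(\<Sum>v\<in>UNIV. \<Sum>a\<in>A. mcomp (mderiv v ?F) \<Phi> * (?cL a * mcomp (taylor_vf (Lvf a) v) \<Phi>))
          = (\<Sum>a\<in>A. ?cL a * mcomp (vderiv UNIV (taylor_vf (Lvf a)) ?F) \<Phi>)"
        unfolding vderiv_comp [OF \<Phi>] by (subst sum.swap) (simp only: sum_distrib_left mult_ac)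
      also have "(\<Sum>v\<in>UNIV. \<Sum>i\<in>UNIV. mcomp (mderiv v ?F) \<Phi> * (w (Inr i) * mcomp (taylor_vf (Tvf i) v) \<Phi>))
          = (\<Sum>i\<in>UNIV. w (Inr i) * mcomp (vderiv UNIV (taylor_vf (Tvf i)) ?F) \<Phi>)"
        unfolding vderiv_comp [OF \<Phi>] by (subst sum.swap) (simp only: sum_distrib_left mult_ac)
      finally have eq: "mderiv s (mcomp ?F \<Phi>) = (\<Sum>a\<in>A. ?cL a * mcomp (vderiv UNIV (taylor_vf (Lvf a)) ?F) \<Phi>)
          + (\<Sum>i\<in>UNIV. w (Inr i) * mcomp (vderiv UNIV (taylor_vf (Tvf i)) ?F) \<Phi>)" .
      have m: "mord_ge l (a * b)" if "mord_ge l b" for a b :: "'a mfps" using mord_ge_mult [OF mord_ge_0 that, of a] by simp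
      show "mord_ge l (mderiv s (mcomp ?F \<Phi>))"
        unfolding eq by (intro mord_ge_add mord_ge_sum m X tangent_Lvf tangent_Tvf)
    qed
  qed simp
  then show ?thesis using W f0 smooth_on_subset [OF W(3), of "W \<inter> V"] by (intro mord_ge_all) auto
qed

text \<open>The derivative of \<open>R j\<close> along a field of the Lie algebra vanishes on M, so
  its Taylor series vanishes along every formal map into the complexification.\<close>

lemma ghat_tangent:
  assumes \<Phi>: "msubst UNIV \<Phi>" and \<rho>: "\<And>j. j < d \<Longrightarrow> mcomp (\<rho> j) \<Phi> = 0" and y: "y \<in> ghat" and j: "j < d"
  shows "mcomp (vderiv UNIV y (\<rho> j)) \<Phi> = 0"
proof -
  obtain X where X0: "X \<in> CR_lie_algebra M d r" "y = taylor_vf X" using y by (auto simp: ghat_def)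
  with CR_lie_algebra_tangent obtain W where X: "y = taylor_vf X" "tangent_near_0 W X" by blast
  then have W: "open W" "0 \<in> W" "W \<subseteq> V" "smooth_on W X" "\<And>p. p \<in> M \<inter> W \<Longrightarrow> vf_apply X (R j) p = 0"
    using j by (auto simp: tangent_near_0_def)
  interpret W: nbhd W using W by unfold_locales
  have R: "smooth_on W (R j)" using smooth_on_subset [OF smooth_R [OF j] W(3)] .
  have "mcomp (taylor_series (vf_apply X (R j))) \<Phi> = 0"
    by (rule taylor_vanishes_on_complexification [OF \<Phi> \<rho> W(1,2) W.smooth_on_vf_apply [OF W(4) R] W(5)])
  then show ?thesis by (simp add: W.taylor_vf_apply W R X \<rho>_def)
qed

text \<open>The type of a generator, too, is the vanishing of certain functions on M, and so it
  passes to formal maps into the complexification.\<close>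

lemma taylor_type_10:
  assumes \<Phi>: "msubst UNIV \<Phi>" and \<rho>: "\<And>j. j < d \<Longrightarrow> mcomp (\<rho> j) \<Phi> = 0"
  shows "CR_field_10 M d r X \<Longrightarrow> mcomp (taylor_vf X (Inr i)) \<Phi> = 0"
    and "CR_field_01 M d r X \<Longrightarrow> mcomp (taylor_vf X (Inl i)) \<Phi> = 0"
proof -
  have *: "mcomp (taylor_vf X v) \<Phi> = 0" if "open W" "0 \<in> W" "smooth_on W X" "\<And>p. p \<in> M \<inter> W \<Longrightarrow> X p $ v = 0" for W v
    unfolding taylor_vf_def
    by (rule taylor_vanishes_on_complexification [OF \<Phi> \<rho> that(1,2)]) (use that smooth_on_vec [OF that(1)] in auto)
  show "CR_field_10 M d r X \<Longrightarrow> mcomp (taylor_vf X (Inr i)) \<Phi> = 0"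
    "CR_field_01 M d r X \<Longrightarrow> mcomp (taylor_vf X (Inl i)) \<Phi> = 0"
    unfolding CR_field_10_def CR_field_01_def using * by blast+
qed

end

section \<open>Linear algebra over power series and their fractions\<close>

text \<open>Rank and nullity for the restriction to \<open>W\<close>: a basis of the kernel is
  extended to one of \<open>W\<close>, and the map is injective on the span of the added
  vectors.\<close>

lemma vec_dim_image_kernel:
  fixes W :: "('a :: field ^ 'q) set" and P :: "'a ^ 'q \<Rightarrow> 'a ^ 'p"
  assumes W: "vec.subspace W" and P: "Vector_Spaces.linear (*s) (*s) P"
  shows "vec.dim W = vec.dim (P ` W) + vec.dim {x \<in> W. P x = 0}"
proof -
  interpret P: Vector_Spaces.linear "(*s)" "(*s)" P by fact
  let ?K = "{x \<in> W. P x = 0}"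
  obtain B0 where B0: "B0 \<subseteq> ?K" "vec.independent B0" "?K \<subseteq> vec.span B0" "card B0 = vec.dim ?K"
    using vec.basis_exists by blast
  have "B0 \<subseteq> W" using B0 by blast
  then obtain B where B: "B0 \<subseteq> B" "B \<subseteq> W" "vec.independent B" "W \<subseteq> vec.span B"
    using vec.maximal_independent_subset_extend [of B0 W] B0(2) by metis
  have finB: "finite B" using B(3) vec.finiteI_independent by blast
  have finB0: "finite B0" using finB B(1) finite_subset by blast
  let ?B1 = "B - B0"
  have ind: "vec.independent ?B1" using B(3) vec.independent_mono by blast
  have K: "vec.span B0 \<subseteq> ?K"
  proof (rule vec.span_minimal [OF B0(1)])
    show "vec.subspace ?K" using W by (auto simp: vec.subspace_def P.add P.scale)
  qed
  have disj: "x = 0" if x: "x \<in> vec.span ?B1" "x \<in> vec.span B0" for x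
  proof -
    obtain c where c: "x = (\<Sum>b\<in>?B1. c b *s b)" using x(1) finB by (auto simp: vec.span_finite)
    obtain e where e: "x = (\<Sum>b\<in>B0. e b *s b)" using x(2) finB0 by (auto simp: vec.span_finite)
    define q where "q = (\<lambda>b. if b \<in> B0 then - e b else c b)"
    have "(\<Sum>b\<in>B. q b *s b) = (\<Sum>b\<in>?B1. q b *s b) + (\<Sum>b\<in>B0. q b *s b)"
      using sum.subset_diff [OF B(1) finB] by simp
    also have "\<dots> = x - x"
    proof -
      have "(\<Sum>b\<in>?B1. q b *s b) = x" unfolding c by (rule sum.cong) (auto simp: q_def)
      moreover have "(\<Sum>b\<in>B0. q b *s b) = - x" unfolding e by (simp add: q_def sum_negf)
      ultimately show ?thesis by simp
    qed
    finally have "\<forall>b\<in>B. q b = 0" using B(3) finB vec.dependent_finite [OF finB] by auto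
    then show "x = 0" unfolding c by (intro sum.neutral) (auto simp: q_def)
  qed
  have inj: "inj_on P (vec.span ?B1)"
  proof (rule inj_onI)
    fix x y assume xy: "x \<in> vec.span ?B1" "y \<in> vec.span ?B1" "P x = P y"
    have "vec.span ?B1 \<subseteq> W" using B(2) by (intro vec.span_minimal W) blast
    then have "x - y \<in> ?K" using xy vec.subspace_diff [OF W, of x y] by (auto simp: P.diff)
    then have "x - y \<in> vec.span B0" using B0(3) by blast
    with disj [of "x - y"] xy show "x = y" using vec.span_diff by fastforce
  qed
  have "vec.span (P ` W) = vec.span (P ` ?B1)"
  proof
    have "P b \<in> vec.span (P ` ?B1)" if "b \<in> B" for b
    proof (cases "b \<in> B0")
      case True
      then have "P b = 0" using B0(1) by blast
      then show ?thesis by (simp add: vec.span_zero)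
    qed (use that in \<open>auto intro: vec.span_base\<close>)
    then have "vec.span (P ` B) \<subseteq> vec.span (P ` ?B1)" by (intro vec.span_minimal vec.subspace_span) auto
    moreover have "P ` W \<subseteq> vec.span (P ` B)" using B(4) P.span_image [of B] by blast
    ultimately show "vec.span (P ` W) \<subseteq> vec.span (P ` ?B1)" by (intro vec.span_minimal vec.subspace_span) auto
    show "vec.span (P ` ?B1) \<subseteq> vec.span (P ` W)" using B(2) by (intro vec.span_mono) auto
  qed
  then have "vec.dim (P ` W) = vec.dim (P ` ?B1)" by (metis vec.dim_span)
  also have "\<dots> = card (P ` ?B1)"
    using P.independent_injective_image [OF ind inj] by (rule vec.dim_eq_card_independent)
  also have "\<dots> = card ?B1" using inj vec.span_superset inj_on_subset by (intro card_image) blast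
  finally have "vec.dim (P ` W) + vec.dim ?K = card ?B1 + card B0" using B0(4) by simp
  also have "\<dots> = card B" using card_Diff_subset [OF finB0 B(1)] card_mono [OF finB B(1)] by simp
  also have "\<dots> = vec.dim W" using vec.basis_card_eq_dim [OF B(2,4,3)] .
  finally show ?thesis by simp
qed

definition emb :: "'v mfps \<Rightarrow> 'v mfps fract"
  where "emb f = Fract f 1"

definition embv :: "('p :: finite \<Rightarrow> 'v mfps) \<Rightarrow> 'v mfps fract ^ 'p"
  where "embv x = (\<chi> i. emb (x i))"

lemma embv_nth [simp]: "embv x $ i = emb (x i)"
  by (simp add: embv_def)

lemma emb_simps [simp]: "emb (f + g) = emb f + emb g" "emb (f * g) = emb f * emb g" "emb 0 = 0" "emb 1 = 1"
  "emb (f - g) = emb f - emb g" "emb f = emb g \<longleftrightarrow> f = g"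
  by (simp_all add: emb_def eq_fract Zero_fract_def One_fract_def)

lemma emb_eq_0_iff [simp]: "emb f = 0 \<longleftrightarrow> f = 0"
  using emb_simps(6) [of f 0] by simp

lemma emb_sum: "emb (sum f A) = (\<Sum>x\<in>A. emb (f x))"
  by (induction A rule: infinite_finite_induct) auto

text \<open>Turns relations over the field of fractions into relations between series.\<close>

lemma common_denominator:
  assumes "finite I"
  obtains e c where "e \<noteq> 0" "\<And>b. b \<in> I \<Longrightarrow> emb e * q b = emb (c b)"
proof -
  have "\<exists>e c. e \<noteq> 0 \<and> (\<forall>b\<in>I. emb e * q b = emb (c b))"
    using assms
  proof (induction I)
    case empty show ?case by (intro exI [of _ 1]) simp
  next
    case (insert b0 I)
    then obtain e c where ec: "e \<noteq> 0" "\<And>b. b \<in> I \<Longrightarrow> emb e * q b = emb (c b)" by blast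
    obtain f g where fg: "q b0 = Fract f g" "g \<noteq> 0" by (cases "q b0") auto
    have g: "emb g * q b0 = emb f" using fg by (simp add: emb_def eq_fract mult.commute)
    show ?case
    proof (intro exI conjI ballI)
      show "e * g \<noteq> 0" using ec fg by simp
      fix b assume "b \<in> insert b0 I"
      then show "emb (e * g) * q b = emb (if b = b0 then e * f else g * c b)"
        using ec(2) g by (auto simp: mult_ac)
    qed
  qed
  then show thesis using that by blast
qed

text \<open>Independence over the ring of series, which for finite families agrees with independence
  over the fractions by clearing denominators. It is stated for families, so that a repeated member
  counts as a relation.\<close>

definition rindep :: "'b set \<Rightarrow> ('b \<Rightarrow> 'p \<Rightarrow> 'v mfps) \<Rightarrow> bool"
  where "rindep I x \<longleftrightarrow> (\<forall>c. (\<forall>p. (\<Sum>b\<in>I. c b * x b p) = 0) \<longrightarrow> (\<forall>b\<in>I. c b = 0))"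

lemma rindep_inj:
  fixes x :: "'b \<Rightarrow> 'p :: finite \<Rightarrow> 'v mfps"
  assumes "finite I" "rindep I x"
  shows "inj_on (\<lambda>b. embv (x b)) I"
proof (rule inj_onI)
  fix i j assume ij: "i \<in> I" "j \<in> I" "embv (x i) = embv (x j)"
  have eq: "x i p = x j p" for p using ij(3) by (metis emb_simps(6) embv_nth)
  show "i = j"
  proof (rule ccontr)
    assume ne: "i \<noteq> j"
    define c where "c = (\<lambda>l. if l = i then 1 else if l = j then - 1 else 0 :: 'v mfps)"
    have "(\<Sum>l\<in>I. c l * x l p) = (\<Sum>l\<in>{i, j}. c l * x l p)" for p
      using ij assms(1) by (intro sum.mono_neutral_right) (auto simp: c_def)
    then have "(\<Sum>l\<in>I. c l * x l p) = 0" for p using ne by (simp add: c_def eq)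
    then have "c i = 0" using assms(2) ij(1) unfolding rindep_def by blast
    then show False by (simp add: c_def)
  qed
qed

lemma rindep_independent:
  fixes x :: "'b \<Rightarrow> 'p :: finite \<Rightarrow> 'v mfps"
  assumes I: "finite I" and r: "rindep I x"
  shows "vec.independent ((\<lambda>b. embv (x b)) ` I)"
proof -
  have fin: "finite ((\<lambda>b. embv (x b)) ` I)" using I by simp
  have "q v = 0" if q: "(\<Sum>v\<in>(\<lambda>b. embv (x b)) ` I. q v *s v) = 0" and v: "v \<in> (\<lambda>b. embv (x b)) ` I" for q v
  proof -
    obtain b where b: "b \<in> I" "v = embv (x b)" using v by blast
    obtain e c where ec: "e \<noteq> 0" "\<And>b. b \<in> I \<Longrightarrow> emb e * q (embv (x b)) = emb (c b)"
      using common_denominator [OF I, of "\<lambda>b. q (embv (x b))"] by blast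
    have s: "(\<Sum>b\<in>I. q (embv (x b)) *s embv (x b)) = 0"
      using q by (simp add: sum.reindex [OF rindep_inj [OF I r]])
    have "(\<Sum>b\<in>I. c b * x b p) = 0" for p
    proof -
      have "emb (\<Sum>b\<in>I. c b * x b p) = (\<Sum>b\<in>I. emb e * (q (embv (x b)) * emb (x b p)))"
        unfolding emb_sum by (intro sum.cong) (auto simp: ec(2) [symmetric] mult_ac)
      also have "\<dots> = emb e * ((\<Sum>b\<in>I. q (embv (x b)) *s embv (x b)) $ p)"
        by (simp add: sum_distrib_left)
      finally show ?thesis by (simp add: s)
    qed
    then have "c b = 0" using r b(1) unfolding rindep_def by blast
    then show ?thesis using ec b by force
  qed
  then show ?thesis using vec.dependent_finite [OF fin] by blast
qed

lemma independent_rindep: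
  fixes x :: "'b \<Rightarrow> 'p :: finite \<Rightarrow> 'v mfps"
  assumes I: "finite I" and inj: "inj_on (\<lambda>b. embv (x b)) I" and ind: "vec.independent ((\<lambda>b. embv (x b)) ` I)"
  shows "rindep I x"
  unfolding rindep_def
proof (intro allI impI ballI)
  fix c b assume c: "\<forall>p. (\<Sum>b\<in>I. c b * x b p) = 0" and b: "b \<in> I"
  define q where "q = (\<lambda>v. emb (c (inv_into I (\<lambda>b. embv (x b)) v)))"
  have qx: "q (embv (x b)) = emb (c b)" if "b \<in> I" for b
    unfolding q_def using inv_into_f_f [OF inj that] by simp
  have "(\<Sum>v\<in>(\<lambda>b. embv (x b)) ` I. q v *s v) = (\<Sum>b\<in>I. emb (c b) *s embv (x b))"
    by (simp add: sum.reindex [OF inj] qx)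
  also have "\<dots> = 0"
  proof (subst vec_eq_iff, intro allI)
    fix p
    have "(\<Sum>b\<in>I. emb (c b) *s embv (x b)) $ p = emb (\<Sum>b\<in>I. c b * x b p)" by (simp add: emb_sum)
    then show "(\<Sum>b\<in>I. emb (c b) *s embv (x b)) $ p = 0 $ p" using c by simp
  qed
  finally have "\<forall>v\<in>(\<lambda>b. embv (x b)) ` I. q v = 0"
    using ind vec.dependent_finite [of "(\<lambda>b. embv (x b)) ` I"] I by auto
  then show "c b = 0" using b qx by auto
qed

lemma rindep_card_le:
  fixes x :: "'b \<Rightarrow> 'p :: finite \<Rightarrow> 'v mfps"
  assumes "finite I" "rindep I x" "\<And>b. b \<in> I \<Longrightarrow> embv (x b) \<in> W"
  shows "card I \<le> vec.dim W"
proof -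
  have "card I = card ((\<lambda>b. embv (x b)) ` I)" using card_image [OF rindep_inj [OF assms(1,2)]] by simp
  also have "\<dots> \<le> vec.dim W"
    by (rule vec.independent_card_le_dim) (use assms rindep_independent in auto)
  finally show ?thesis .
qed

lemma ex_rindep_dim:
  fixes x :: "'b \<Rightarrow> 'p :: finite \<Rightarrow> 'v mfps"
  obtains I where "I \<subseteq> X" "finite I" "rindep I x" "card I = vec.dim ((\<lambda>b. embv (x b)) ` X)"
proof -
  obtain B where B: "B \<subseteq> (\<lambda>b. embv (x b)) ` X" "vec.independent B" "card B = vec.dim ((\<lambda>b. embv (x b)) ` X)"
    using vec.basis_exists by metis
  obtain I where I: "I \<subseteq> X" "B = (\<lambda>b. embv (x b)) ` I" "inj_on (\<lambda>b. embv (x b)) I"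
    using B(1) by (meson subset_image_inj)
  have "finite B" using B(2) vec.finiteI_independent by blast
  then have "finite I" using I finite_imageD by blast
  with I B show thesis by (intro that [of I] independent_rindep) (auto simp: card_image)
qed

text \<open>Conjugation of coefficients is not linear over the fractions, but it carries relations
  to relations, and hence independent families to independent families.\<close>

lemma dim_mcnj_le:
  fixes x :: "'b \<Rightarrow> 'p :: finite \<Rightarrow> 'v mfps"
  shows "vec.dim ((\<lambda>b. embv (x b)) ` X) \<le> vec.dim ((\<lambda>b. embv (\<lambda>p. mcnj (x b p))) ` X)"
proof -
  obtain I where I: "I \<subseteq> X" "finite I" "rindep I x" "card I = vec.dim ((\<lambda>b. embv (x b)) ` X)"
    using ex_rindep_dim by blast
  have "rindep I (\<lambda>b p. mcnj (x b p))"
    unfolding rindep_def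
  proof (intro allI impI ballI)
    fix c b assume c: "\<forall>p. (\<Sum>b\<in>I. c b * mcnj (x b p)) = 0" and b: "b \<in> I"
    have "(\<Sum>b\<in>I. mcnj (c b) * x b p) = mcnj (\<Sum>b\<in>I. c b * mcnj (x b p))" for p by (simp add: mcnj_sum)
    then have "mcnj (c b) = 0"
      using I(3) [unfolded rindep_def, rule_format, of "\<lambda>b. mcnj (c b)" b] c b by simp
    then show "c b = 0" by simp
  qed
  then show ?thesis unfolding I(4) [symmetric] by (rule rindep_card_le [OF I(2)]) (use I(1) in auto)
qed

lemma dim_mcnj:
  fixes x :: "'b \<Rightarrow> 'p :: finite \<Rightarrow> 'v mfps"
  shows "vec.dim ((\<lambda>b. embv (\<lambda>p. mcnj (x b p))) ` X) = vec.dim ((\<lambda>b. embv (x b)) ` X)"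
  using dim_mcnj_le [of x X] dim_mcnj_le [of "\<lambda>b p. mcnj (x b p)" X] by simp

text \<open>Each application of \<open>c = c E\<close> raises the known order of vanishing by
  1.\<close>

lemma contraction_eq_0:
  assumes I: "finite I" and E: "\<And>i j. i \<in> I \<Longrightarrow> j \<in> I \<Longrightarrow> mcoeff (E i j) 0 = 0"
    and c: "\<And>j. j \<in> I \<Longrightarrow> c j = (\<Sum>i\<in>I. c i * E i j)" and j: "j \<in> I"
  shows "c j = 0"
proof (rule mord_ge_all)
  fix l
  show "mord_ge l (c j)" using j
  proof (induction l arbitrary: j)
    case (Suc l)
    have "mord_ge (l + 1) (\<Sum>i\<in>I. c i * E i j)"
      using Suc E by (intro mord_ge_sum mord_ge_mult) (auto simp: mord_ge_1_iff simp del: One_nat_def)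
    then show ?case using c [OF Suc.prems] by simp
  qed simp
qed

lemma dual_coefficients:
  fixes z :: "'b \<Rightarrow> complex ^ 'p"
  assumes inj: "inj_on z I" and ind: "vec.independent (z ` I)"
  obtains q where "\<And>b b'. b \<in> I \<Longrightarrow> b' \<in> I \<Longrightarrow> (\<Sum>p\<in>UNIV. q b p * z b' $ p) = (if b = b' then 1 else 0)"
proof -
  have "\<exists>q. \<forall>b'\<in>I. (\<Sum>p\<in>UNIV. q p * z b' $ p) = (if b = b' then 1 else 0)" if b: "b \<in> I" for b
  proof -
    \<comment> \<open>A functional is obtained as one coordinate of an endomorphism; any coordinate
      will do.\<close>
    define p0 :: 'p where "p0 = undefined"
    obtain g where g: "Vector_Spaces.linear (*s) (*s) g"
      "\<And>x. x \<in> z ` I \<Longrightarrow> g x = (if x = z b then axis p0 1 else 0 :: complex ^ 'p)"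
      using vec.linear_independent_extend [OF ind, of "\<lambda>x. if x = z b then axis p0 1 else 0"] by blast
    show ?thesis
    proof (intro exI ballI)
      fix b' assume b': "b' \<in> I"
      have "(\<Sum>p\<in>UNIV. matrix g $ p0 $ p * z b' $ p) = (matrix g *v z b') $ p0"
        by (simp add: matrix_vector_mult_def)
      also have "\<dots> = g (z b') $ p0" using matrix_works [OF g(1)] by simp
      also have "\<dots> = (if b = b' then 1 else 0)"
        using g(2) [of "z b'"] b b' inj by (auto simp: inj_on_def axis_def)
      finally show "(\<Sum>p\<in>UNIV. matrix g $ p0 $ p * z b' $ p) = (if b = b' then 1 else 0)" .
    qed
  qed
  then obtain q where "\<And>b. b \<in> I \<Longrightarrow> \<forall>b'\<in>I. (\<Sum>p\<in>UNIV. q b p * z b' $ p) = (if b = b' then 1 else 0)"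
    by metis
  then show thesis by (intro that [of q]) auto
qed

text \<open>Pairing with dual vectors at the origin turns a relation \<open>c\<close> into \<open>c = c E\<close> with
  \<open>E\<close> vanishing at the origin.\<close>

lemma rindep_of_constant_terms:
  fixes x :: "'b \<Rightarrow> 'p :: finite \<Rightarrow> 'v mfps"
  assumes I: "finite I" and inj: "inj_on (\<lambda>b. \<chi> p. mcoeff (x b p) 0) I"
    and ind: "vec.independent ((\<lambda>b. (\<chi> p. mcoeff (x b p) 0) :: complex ^ 'p) ` I)"
  shows "rindep I x"
  unfolding rindep_def
proof (intro allI impI)
  fix c assume c: "\<forall>p. (\<Sum>b\<in>I. c b * x b p) = 0"
  obtain q where q: "\<And>b b'. b \<in> I \<Longrightarrow> b' \<in> I \<Longrightarrow> (\<Sum>p\<in>UNIV. q b p * (\<chi> p. mcoeff (x b' p) 0) $ p) = (if b = b' then 1 else 0)"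
    using dual_coefficients [OF inj ind] by blast
  define E where "E = (\<lambda>i j. (if i = j then 1 else 0) - (\<Sum>p\<in>UNIV. mconst (q j p) * x i p))"
  show "\<forall>b\<in>I. c b = 0"
  proof
    fix j assume j: "j \<in> I"
    show "c j = 0"
    proof (rule contraction_eq_0 [OF I _ _ j, of E])
      show "mcoeff (E i j) 0 = 0" if "i \<in> I" "j \<in> I" for i j
        using q [OF that(2,1)] by (auto simp: E_def)
      show "c j = (\<Sum>i\<in>I. c i * E i j)" if j: "j \<in> I" for j
      proof -
        have "(\<Sum>i\<in>I. c i * E i j) = (\<Sum>i\<in>I. if i = j then c i else 0) - (\<Sum>i\<in>I. \<Sum>p\<in>UNIV. mconst (q j p) * (c i * x i p))"
        proof -
          have "c i * E i j = (if i = j then c i else 0) - (\<Sum>p\<in>UNIV. mconst (q j p) * (c i * x i p))" for i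
            by (cases "i = j") (simp_all add: E_def right_diff_distrib sum_distrib_left mult_ac)
          then show ?thesis by (simp only: sum_subtractf)
        qed
        also have "(\<Sum>i\<in>I. \<Sum>p\<in>UNIV. mconst (q j p) * (c i * x i p)) = (\<Sum>p\<in>UNIV. mconst (q j p) * (\<Sum>i\<in>I. c i * x i p))"
          by (subst sum.swap) (simp add: sum_distrib_left)
        also have "\<dots> = 0" using c by simp
        finally show ?thesis using I j by simp
      qed
    qed
  qed
qed

text \<open>\<open>K\<close> is \<open>1 + E + E^2 + ...\<close>, the inverse of
  \<open>1 - E\<close>; the partial sums stabilise because \<open>E\<close> has no constant
  terms.\<close>

lemma neumann_series:
  fixes E :: "'i \<Rightarrow> 'i \<Rightarrow> 'v mfps"
  assumes I: "finite I" and E: "\<And>i j. i \<in> I \<Longrightarrow> j \<in> I \<Longrightarrow> mcoeff (E i j) 0 = 0"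
    and E_in: "\<And>i j. i \<in> I \<Longrightarrow> j \<in> I \<Longrightarrow> mfps_in X (E i j)"
  obtains K where "\<And>i j. i \<in> I \<Longrightarrow> j \<in> I \<Longrightarrow> K i j = (if i = j then 1 else 0) + (\<Sum>l\<in>I. K i l * E l j)"
    "\<And>i j. i \<in> I \<Longrightarrow> j \<in> I \<Longrightarrow> mfps_in X (K i j)"
proof -
  define Kt :: "nat \<Rightarrow> 'i \<Rightarrow> 'i \<Rightarrow> 'v mfps"
    where "Kt = rec_nat (\<lambda>i j. 0) (\<lambda>_ K i j. (if i = j then 1 else 0) + (\<Sum>l\<in>I. K i l * E l j))"
  have Kt: "Kt 0 i j = 0" "Kt (Suc t) i j = (if i = j then 1 else 0) + (\<Sum>l\<in>I. Kt t i l * E l j)" for t i j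
    by (simp_all add: Kt_def)
  have Kt_in: "mfps_in X (Kt t i j)" if "i \<in> I" "j \<in> I" for t i j
    using that by (induction t arbitrary: j) (auto simp: Kt E_in intro!: mfps_in_intros)
  have step: "mord_ge t (Kt (Suc t) i j - Kt t i j)" if "i \<in> I" "j \<in> I" for t i j
    using that
  proof (induction t arbitrary: j)
    case (Suc t)
    have "Kt (Suc (Suc t)) i j - Kt (Suc t) i j = (\<Sum>l\<in>I. (Kt (Suc t) i l - Kt t i l) * E l j)"
      unfolding Kt(2) [of "Suc t"] Kt(2) [of t i j] by (simp add: left_diff_distrib sum_subtractf)
    moreover have "mord_ge (t + 1) (\<Sum>l\<in>I. (Kt (Suc t) i l - Kt t i l) * E l j)"
      using Suc E by (intro mord_ge_sum mord_ge_mult) (auto simp: mord_ge_1_iff simp del: One_nat_def)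
    ultimately show ?case by simp
  qed simp
  have stable: "mord_ge t (Kt (t + s) i j - Kt t i j)" if "i \<in> I" "j \<in> I" for t s i j
  proof (induction s)
    case (Suc s)
    have "mord_ge t ((Kt (Suc (t + s)) i j - Kt (t + s) i j) + (Kt (t + s) i j - Kt t i j))"
      using Suc mord_ge_mono [OF step [OF that, of "t + s"], of t] by (intro mord_ge_add) auto
    then show ?case by simp
  qed simp
  define K where "K = (\<lambda>i j. Abs_mfps (\<lambda>m. mcoeff (Kt (Suc (mdeg m)) i j) m))"
  have K: "mord_ge t (K i j - Kt t i j)" if ij: "i \<in> I" "j \<in> I" for t i j
    unfolding mord_ge_def
  proof (intro allI impI)
    fix m :: "'v \<Rightarrow>\<^sub>0 nat" assume "mdeg m < t"
    then obtain s where s: "t = Suc (mdeg m) + s" by (metis Suc_leI le_add_diff_inverse)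
    have "mcoeff (Kt t i j - Kt (Suc (mdeg m)) i j) m = 0"
      using stable [OF ij, of "Suc (mdeg m)" s] unfolding s mord_ge_def by blast
    then show "mcoeff (K i j - Kt t i j) m = 0" by (simp add: K_def)
  qed
  show thesis
  proof (rule that [of K])
    fix i j assume ij: "i \<in> I" "j \<in> I"
    show "mfps_in X (K i j)" using Kt_in [OF ij] by (auto simp: K_def mfps_in_def)
    have "K i j - ((if i = j then 1 else 0) + (\<Sum>l\<in>I. K i l * E l j)) = 0"
    proof (rule mord_ge_all)
      fix t
      have eq: "K i j - ((if i = j then 1 else 0) + (\<Sum>l\<in>I. K i l * E l j))
        = (K i j - Kt (Suc t) i j) - (\<Sum>l\<in>I. (K i l - Kt t i l) * E l j)"
        unfolding Kt(2) by (simp add: left_diff_distrib sum_subtractf)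
      have "mord_ge (t + 0) (\<Sum>l\<in>I. (K i l - Kt t i l) * E l j)"
        using K ij by (intro mord_ge_sum mord_ge_mult mord_ge_0) auto
      then show "mord_ge t (K i j - ((if i = j then 1 else 0) + (\<Sum>l\<in>I. K i l * E l j)))"
        unfolding eq by (intro mord_ge_diff [OF mord_ge_mono [OF K [OF ij, of "Suc t"]]]) auto
    qed
    then show "K i j = (if i = j then 1 else 0) + (\<Sum>l\<in>I. K i l * E l j)" by simp
  qed
qed

text \<open>The system reads \<open>(1 - E) y = g\<close>, and the equation for \<open>K\<close>
  says that \<open>K\<close> is a left inverse of \<open>1 - E\<close>.\<close>

lemma neumann_solve:
  fixes E :: "'i \<Rightarrow> 'i \<Rightarrow> 'v mfps"
  assumes I: "finite I"
    and K: "\<And>i j. i \<in> I \<Longrightarrow> j \<in> I \<Longrightarrow> K i j = (if i = j then 1 else 0) + (\<Sum>l\<in>I. K i l * E l j)"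
    and y: "\<And>i. i \<in> I \<Longrightarrow> y i = g i + (\<Sum>j\<in>I. E i j * y j)" and i: "i \<in> I"
  shows "y i = (\<Sum>j\<in>I. K i j * g j)"
proof -
  have "(\<Sum>j\<in>I. K i j * y j) = (\<Sum>j\<in>I. K i j * g j) + (\<Sum>j\<in>I. K i j * (\<Sum>l\<in>I. E j l * y l))"
    using y by (simp add: distrib_left sum.distrib)
  also have "(\<Sum>j\<in>I. K i j * (\<Sum>l\<in>I. E j l * y l)) = (\<Sum>l\<in>I. (\<Sum>j\<in>I. K i j * E j l) * y l)"
    by (simp add: sum_distrib_left sum_distrib_right mult.assoc) (rule sum.swap)
  also have "\<dots> = (\<Sum>l\<in>I. (K i l - (if i = l then 1 else 0)) * y l)"
    using K i by (intro sum.cong) (auto simp: algebra_simps)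
  also have "\<dots> = (\<Sum>l\<in>I. K i l * y l) - (\<Sum>l\<in>I. if l = i then y l else 0)"
    unfolding sum_subtractf [symmetric] by (intro sum.cong) (auto simp: algebra_simps)
  finally show ?thesis using I i by simp
qed

section \<open>Segre mappings\<close>

lemma vec_dim_eq_card_imp:
  fixes f :: "'b \<Rightarrow> 'a :: field ^ 'p"
  assumes "finite I" "vec.dim (f ` I) = card I"
  shows "inj_on f I" "vec.independent (f ` I)"
proof -
  have "vec.dim (f ` I) \<le> card (f ` I)" using assms(1) vec.dim_le_card [of "f ` I" "f ` I"] vec.span_superset by blast
  moreover have "card (f ` I) \<le> card I" using assms(1) by (rule card_image_le)
  ultimately have eq: "card (f ` I) = card I" "card (f ` I) = vec.dim (f ` I)" using assms(2) by auto
  show "inj_on f I" using eq(1) assms(1) eq_card_imp_inj_on by blast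
  show "vec.independent (f ` I)"
    using vec.card_eq_dim [OF subset_refl eq(2)] assms(1) vec.span_superset by blast
qed

lemma vec_span_image_finite:
  fixes f :: "'b \<Rightarrow> 'a :: field ^ 'p"
  assumes I: "finite I" and x: "x \<in> vec.span (f ` I)"
  obtains q where "x = (\<Sum>t\<in>I. q t *s f t)"
proof -
  have "vec.span (f ` I) \<subseteq> range (\<lambda>q. \<Sum>t\<in>I. q t *s f t)"
  proof (rule vec.span_minimal)
    show "f ` I \<subseteq> range (\<lambda>q. \<Sum>t\<in>I. q t *s f t)"
    proof clarify
      fix i assume i: "i \<in> I"
      show "f i \<in> range (\<lambda>q. \<Sum>t\<in>I. q t *s f t)"
      proof (rule range_eqI)
        show "f i = (\<Sum>t\<in>I. (if t = i then 1 else 0) *s f t)"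
          using I i by (simp add: if_distrib [of "\<lambda>c. c *s _"] cong: if_cong)
      qed
    qed
    show "vec.subspace (range (\<lambda>q. \<Sum>t\<in>I. q t *s f t))"
    proof (rule vec.subspaceI)
      show "0 \<in> range (\<lambda>q. \<Sum>t\<in>I. q t *s f t)" by (rule range_eqI [where x = "\<lambda>_. 0"]) simp
    next
      fix x y assume "x \<in> range (\<lambda>q. \<Sum>t\<in>I. q t *s f t)" "y \<in> range (\<lambda>q. \<Sum>t\<in>I. q t *s f t)"
      then obtain p q where "x = (\<Sum>t\<in>I. p t *s f t)" "y = (\<Sum>t\<in>I. q t *s f t)" by blast
      then show "x + y \<in> range (\<lambda>q. \<Sum>t\<in>I. q t *s f t)"
        by (intro range_eqI [where x = "\<lambda>t. p t + q t"]) (simp add: vec.scale_left_distrib sum.distrib)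
    next
      fix c x assume "x \<in> range (\<lambda>q. \<Sum>t\<in>I. q t *s f t)"
      then obtain q where "x = (\<Sum>t\<in>I. q t *s f t)" by blast
      then show "c *s x \<in> range (\<lambda>q. \<Sum>t\<in>I. q t *s f t)"
        by (intro range_eqI [where x = "\<lambda>t. c * q t"]) (simp add: vec.scale_sum_right)
    qed
  qed
  with x that show thesis by blast
qed

lemma vec_dim_le_card_image:
  fixes f :: "'b \<Rightarrow> 'a :: field ^ 'p"
  assumes "finite I" "W \<subseteq> vec.span (f ` I)" shows "vec.dim W \<le> card I"
  using vec.dim_le_card [OF assms(2)] assms(1) card_image_le [OF assms(1), of f] by simp

lemma vderiv_lincomb:
  "vderiv X (\<lambda>t. a * y t + b * z t) f = a * vderiv X y f + b * vderiv X z f"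
  "vderiv X (\<lambda>t. a * y t) f = a * vderiv X y f"
  by (simp_all add: vderiv_def distrib_right sum.distrib sum_distrib_left mult.assoc)

lemma vderiv_mcomp:
  assumes "msubst UNIV \<Phi>"
  shows "vderiv T c (mcomp F \<Phi>) = (\<Sum>v\<in>UNIV. mcomp (mderiv v F) \<Phi> * vderiv T c (\<Phi> v))"
proof -
  interpret msubst UNIV \<Phi> by fact
  have "vderiv T c (mcomp F \<Phi>) = (\<Sum>t\<in>T. \<Sum>v\<in>UNIV. c t * (mcomp (mderiv v F) \<Phi> * mderiv t (\<Phi> v)))"
    by (simp add: vderiv_def mderiv_mcomp sum_distrib_left)
  also have "\<dots> = (\<Sum>v\<in>UNIV. mcomp (mderiv v F) \<Phi> * vderiv T c (\<Phi> v))"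
    by (subst sum.swap) (simp add: vderiv_def sum_distrib_left mult_ac)
  finally show ?thesis .
qed

locale CR_segre = CR_frame +
  fixes \<gamma> :: "'a \<Rightarrow> ('a + nat) mfps"
  assumes svm: "segre_variety_mapping d r \<gamma>"
begin

definition n :: nat where "n = CARD('a) - d"

definition Xv :: "('a + nat) set" where "Xv = range Inl \<union> Inr ` {..<n}"

text \<open>The formal parametrization \<open>(\<zeta>, t) \<mapsto> (\<gamma>(\<zeta>, t), \<zeta>)\<close> of the complexification of \<open>M\<close>.\<close>

definition \<pi> :: "'a + 'a \<Rightarrow> ('a + nat) mfps" where "\<pi> = case_sum \<gamma> (\<lambda>i. mvar (Inl i))"

lemma \<pi>_simps [simp]: "\<pi> (Inl i) = \<gamma> i" "\<pi> (Inr i) = mvar (Inl i)"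
  by (simp_all add: \<pi>_def)

lemma finite_Xv [simp]: "finite Xv"
  by (simp add: Xv_def)

lemma Inl_Xv [simp]: "Inl i \<in> Xv" and Inr_Xv [simp]: "Inr b \<in> Xv \<longleftrightarrow> b < n"
  by (auto simp: Xv_def)

lemma \<gamma>_in: "mfps_in Xv (\<gamma> i)" and \<gamma>_0 [simp]: "mcoeff (\<gamma> i) 0 = 0"
  using svm by (auto simp: segre_variety_mapping_def formal_mapping_def Xv_def n_def Let_def)

lemma \<pi>_in: "mfps_in Xv (\<pi> v)" and \<pi>_0 [simp]: "mcoeff (\<pi> v) 0 = 0"
  by (cases v; simp add: \<gamma>_in mfps_in_mvar)+

sublocale pi: msubst UNIV \<pi> by unfold_locales auto

lemma \<rho>_\<pi>: "j < d \<Longrightarrow> mcomp (\<rho> j) \<pi> = 0"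
  using svm by (auto simp: segre_variety_mapping_def \<rho>_def \<pi>_def Let_def)

definition \<Gamma> :: "nat \<Rightarrow> 'a \<Rightarrow> ('a + nat) mfps" where "\<Gamma> b i = mderiv (Inr b) (\<gamma> i)"

lemma \<Gamma>_independent:
  "inj_on (\<lambda>b. \<chi> i. mcoeff (\<Gamma> b i) 0) {..<n}"
  "vec.independent ((\<lambda>b. (\<chi> i. mcoeff (\<Gamma> b i) 0) :: complex ^ 'a) ` {..<n})"
proof -
  have "vec.dim ((\<lambda>b. (\<chi> i. mcoeff (\<Gamma> b i) 0) :: complex ^ 'a) ` {..<n}) = card {..<n}"
    using svm by (simp add: segre_variety_mapping_def n_def \<Gamma>_def Let_def)
  from vec_dim_eq_card_imp [OF _ this]
  show "inj_on (\<lambda>b. \<chi> i. mcoeff (\<Gamma> b i) 0) {..<n}"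
    "vec.independent ((\<lambda>b. (\<chi> i. mcoeff (\<Gamma> b i) 0) :: complex ^ 'a) ` {..<n})" by auto
qed

definition T :: "nat \<Rightarrow> (nat \<times> nat) set" where "T lv = {1..lv} \<times> {..<n}"

lemma finite_T [simp]: "finite (T lv)"
  by (simp add: T_def)

definition sub :: "nat \<Rightarrow> 'a + nat \<Rightarrow> (nat \<times> nat) mfps"
  where "sub lv = case_sum (\<lambda>l. mcnj (segre_iter \<gamma> lv l)) (\<lambda>a. mvar (Suc lv, a))"

lemma sub_simps [simp]: "sub lv (Inl l) = mcnj (segre_iter \<gamma> lv l)" "sub lv (Inr a) = mvar (Suc lv, a)"
  by (simp_all add: sub_def)

lemma segre_iter_Suc: "segre_iter \<gamma> (Suc lv) i = mcomp (\<gamma> i) (sub lv)"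
  by (simp add: sub_def)

lemma segre_iter_in: "mfps_in (T lv) (segre_iter \<gamma> lv i) \<and> mcoeff (segre_iter \<gamma> lv i) 0 = 0"
proof (induction lv arbitrary: i)
  case (Suc lv)
  have s0: "mcoeff (sub lv w) 0 = 0" for w using Suc by (cases w) auto
  interpret s: msubst Xv "sub lv" by unfold_locales (auto simp: s0)
  have "mfps_in (T (Suc lv)) (sub lv w)" if "w \<in> Xv" for w
  proof (cases w)
    case (Inl l)
    then show ?thesis using Suc [of l]
      by (auto simp: T_def intro!: mfps_in_mcnj intro: mfps_in_mono [of "T lv"])
  qed (use that in \<open>auto simp: T_def intro: mfps_in_mvar\<close>)
  then show ?case
    unfolding segre_iter_Suc using s.mfps_in_mcomp [OF \<gamma>_in] s.mcomp_0_coeff [OF \<gamma>_in] by simp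
qed simp

lemma sub_0: "mcoeff (sub lv w) 0 = 0"
  using segre_iter_in by (cases w) auto

lemma msubst_sub: "msubst Xv (sub lv)"
  by unfold_locales (auto simp: sub_0)

text \<open>With \<open>v = segre_iter \<gamma>\<close>, this is the map \<open>(v\<^sup>l\<^sup>+\<^sup>1, cnj v\<^sup>l)\<close> into the complexification of \<open>M\<close>.\<close>

definition \<Phi> :: "nat \<Rightarrow> 'a + 'a \<Rightarrow> (nat \<times> nat) mfps"
  where "\<Phi> lv v = mcomp (\<pi> v) (sub lv)"

lemma \<Phi>_simps: "\<Phi> lv (Inl i) = segre_iter \<gamma> (Suc lv) i" "\<Phi> lv (Inr i) = mcnj (segre_iter \<gamma> lv i)"
  using msubst.mcomp_mvar [OF msubst_sub, of "Inl i" lv] by (simp_all add: \<Phi>_def sub_def)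

lemma msubst_\<Phi>: "msubst UNIV (\<Phi> lv)"
  by unfold_locales (auto simp: \<Phi>_def msubst.mcomp_0_coeff [OF msubst_sub \<pi>_in])

lemma mcomp_\<Phi>: "mcomp F (\<Phi> lv) = mcomp (mcomp F \<pi>) (sub lv)"
  unfolding \<Phi>_def [abs_def] using pi.mcomp_assoc [of Xv "sub lv" F] by (simp add: sub_0 \<pi>_in)

lemma \<rho>_\<Phi>: "j < d \<Longrightarrow> mcomp (\<rho> j) (\<Phi> lv) = 0"
  unfolding mcomp_\<Phi> by (simp add: \<rho>_\<pi> msubst.mcomp_0 [OF msubst_sub])

text \<open>The variables of level \<open>Suc lv\<close> do not occur in
  \<open>segre_iter \<gamma> lv\<close>, so they enter \<Phi> only through the argument t of
  \<gamma>.\<close>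

lemma mderiv_\<Phi>_last:
  assumes "b < n"
  shows "mderiv (Suc lv, b) (\<Phi> lv (Inl i)) = mcomp (\<Gamma> b i) (sub lv)" "mderiv (Suc lv, b) (\<Phi> lv (Inr i)) = 0"
proof -
  interpret s: msubst Xv "sub lv" by (rule msubst_sub)
  have old: "mderiv (Suc lv, b) (segre_iter \<gamma> lv l) = 0" for l
    by (rule mderiv_eq_0 [of "T lv"]) (use segre_iter_in in \<open>auto simp: T_def\<close>)
  have "mderiv (Suc lv, b) (\<Phi> lv (Inl i)) = (\<Sum>w\<in>Xv. mcomp (mderiv w (\<gamma> i)) (sub lv) * mderiv (Suc lv, b) (sub lv w))"
    by (simp add: \<Phi>_def s.mderiv_mcomp \<gamma>_in)
  also have "\<dots> = (\<Sum>w\<in>Xv. if w = Inr b then mcomp (mderiv w (\<gamma> i)) (sub lv) else 0)"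
  proof (intro sum.cong refl)
    fix w show "mcomp (mderiv w (\<gamma> i)) (sub lv) * mderiv (Suc lv, b) (sub lv w) = (if w = Inr b then mcomp (mderiv w (\<gamma> i)) (sub lv) else 0)"
      by (cases w) (auto simp: old mderiv_mvar)
  qed
  also have "\<dots> = mcomp (\<Gamma> b i) (sub lv)" using assms by (simp add: \<Gamma>_def)
  finally show "mderiv (Suc lv, b) (\<Phi> lv (Inl i)) = mcomp (\<Gamma> b i) (sub lv)" .
  show "mderiv (Suc lv, b) (\<Phi> lv (Inr i)) = 0" by (simp add: \<Phi>_simps old)
qed

lemma segre_rank_eq:
  "segre_rank d \<gamma> lv = vec.dim ((\<lambda>t. embv (\<lambda>i. mderiv t (segre_iter \<gamma> lv i))) ` T lv)"
  by (simp add: segre_rank_def formal_rank_def embv_def emb_def T_def n_def)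

section \<open>The rank is bounded below by the dimension of the Lie algebra\<close>

context
  fixes lv :: nat
begin

definition D :: "nat \<times> nat \<Rightarrow> (nat \<times> nat) mfps fract ^ ('a + 'a)"
  where "D t = embv (\<lambda>v. mderiv t (\<Phi> lv v))"

text \<open>The tangent space of the image of \<Phi> at its generic point.\<close>

definition W :: "((nat \<times> nat) mfps fract ^ ('a + 'a)) set"
  where "W = vec.span (D ` T (Suc lv))"

definition PZ :: "(nat \<times> nat) mfps fract ^ ('a + 'a) \<Rightarrow> (nat \<times> nat) mfps fract ^ 'a"
  where "PZ x = (\<chi> i. x $ Inl i)"

definition P\<zeta> :: "(nat \<times> nat) mfps fract ^ ('a + 'a) \<Rightarrow> (nat \<times> nat) mfps fract ^ 'a"
  where "P\<zeta> x = (\<chi> i. x $ Inr i)"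

text \<open>The tangent space of the complexification of M along \<Phi>. Its vectors with
  \<open>P\<zeta> x = 0\<close> are those of type (1,0), and the ones with \<open>PZ x = 0\<close>
  those of type (0,1).\<close>

definition Tan :: "((nat \<times> nat) mfps fract ^ ('a + 'a)) set"
  where "Tan = {w. \<forall>j<d. (\<Sum>v\<in>UNIV. emb (mcomp (mderiv v (\<rho> j)) (\<Phi> lv)) * w $ v) = 0}"

lemma linear_PZ: "Vector_Spaces.linear (*s) (*s) PZ" and linear_P\<zeta>: "Vector_Spaces.linear (*s) (*s) P\<zeta>"
  by (unfold_locales; simp add: PZ_def P\<zeta>_def vec_eq_iff algebra_simps)+

lemma subspace_W: "vec.subspace W"
  by (simp add: W_def)

lemma subspace_Tan: "vec.subspace Tan"
  unfolding Tan_def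
  by (rule vec.subspaceI) (auto simp: distrib_left sum.distrib mult.left_commute [of _ c for c] simp flip: sum_distrib_left)

lemma W_Tan: "W \<subseteq> Tan"
  unfolding W_def
proof (rule vec.span_minimal [OF _ subspace_Tan], clarify)
  fix t
  interpret P: msubst UNIV "\<Phi> lv" by (rule msubst_\<Phi>)
  have "(\<Sum>v\<in>UNIV. emb (mcomp (mderiv v (\<rho> j)) (\<Phi> lv)) * D t $ v) = 0" if "j < d" for j
  proof -
    have "(\<Sum>v\<in>UNIV. emb (mcomp (mderiv v (\<rho> j)) (\<Phi> lv)) * D t $ v) = emb (mderiv t (mcomp (\<rho> j) (\<Phi> lv)))"
      by (simp add: D_def P.mderiv_mcomp emb_sum)
    then show ?thesis by (simp add: \<rho>_\<Phi> that)
  qed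
  then show "D t \<in> Tan" by (simp add: Tan_def)
qed

text \<open>Without \<zeta>-components, the decomposition of a tangent vector involves only the
  fields \<open>Lvf a\<close>, of which there are \<open>n\<close>.\<close>

lemma dim_T10: "vec.dim {x \<in> Tan. P\<zeta> x = 0} \<le> n"
proof -
  interpret P: msubst UNIV "\<Phi> lv" by (rule msubst_\<Phi>)
  define L where "L = (\<lambda>a. embv (\<lambda>v. mcomp (taylor_vf (Lvf a) v) (\<Phi> lv)))"
  have "{x \<in> Tan. P\<zeta> x = 0} \<subseteq> vec.span (L ` A)"
  proof
    fix x assume x: "x \<in> {x \<in> Tan. P\<zeta> x = 0}"
    have xr: "x $ Inr i = 0" for i using x by (auto simp: P\<zeta>_def vec_eq_iff)
    define c where "c = (\<lambda>a. \<Sum>m\<in>UNIV. emb (mcomp (mconst (u a $ m)) (\<Phi> lv)) * x $ Inl m)"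
    have "x $ v = (\<Sum>a\<in>A. c a * emb (mcomp (taylor_vf (Lvf a) v) (\<Phi> lv)))" for v
      unfolding c_def
      using tangent_decomp_hom [where \<phi> = "\<lambda>f. emb (mcomp f (\<Phi> lv))" and w = "\<lambda>v. x $ v" and v = v] x xr
      by (simp add: Tan_def P.mcomp_add P.mcomp_mult)
    then have "x = (\<Sum>a\<in>A. c a *s L a)" by (simp add: vec_eq_iff L_def)
    also have "\<dots> \<in> vec.span (L ` A)" by (intro vec.span_sum vec.span_scale vec.span_base) auto
    finally show "x \<in> vec.span (L ` A)" .
  qed
  then show ?thesis using vec_dim_le_card_image [of A _ L] finite_A by (simp add: card_A n_def)
qed

text \<open>The conjugate bound: the series \<open>\<rho> j\<close> are fixed by
  \<open>mstar\<close>, so the decomposition applies along the ring homomorphism that conjugates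
  before it substitutes.\<close>

lemma dim_T01: "vec.dim {x \<in> Tan. PZ x = 0} \<le> n"
proof -
  interpret P: msubst UNIV "\<Phi> lv" by (rule msubst_\<Phi>)
  define L where "L = (\<lambda>a. embv (\<lambda>v. mcomp (mstar (taylor_vf (Lvf a) (conj_index v))) (\<Phi> lv)))"
  have "{x \<in> Tan. PZ x = 0} \<subseteq> vec.span (L ` A)"
  proof
    fix x assume x: "x \<in> {x \<in> Tan. PZ x = 0}"
    have xl: "x $ Inl i = 0" for i using x by (auto simp: PZ_def vec_eq_iff)
    define c where "c = (\<lambda>a. \<Sum>m\<in>UNIV. emb (mcomp (mstar (mconst (u a $ m))) (\<Phi> lv)) * x $ Inr m)"
    have tan: "(\<Sum>v\<in>UNIV. emb (mcomp (mstar (mderiv v (\<rho> j))) (\<Phi> lv)) * x $ conj_index v) = 0" if j: "j < d" for j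
    proof -
      have "mstar (mderiv v (\<rho> j)) = mderiv (conj_index v) (\<rho> j)" for v
        using mderiv_mstar [of "conj_index v" "\<rho> j"] by (simp add: mstar_\<rho> [OF j])
      then have "(\<Sum>v\<in>UNIV. emb (mcomp (mstar (mderiv v (\<rho> j))) (\<Phi> lv)) * x $ conj_index v)
        = (\<Sum>v\<in>UNIV. emb (mcomp (mderiv (conj_index v) (\<rho> j)) (\<Phi> lv)) * x $ conj_index v)" by simp
      also have "\<dots> = (\<Sum>v\<in>UNIV. emb (mcomp (mderiv v (\<rho> j)) (\<Phi> lv)) * x $ v)" by (rule sum_conj_index)
      finally show ?thesis using x j by (simp add: Tan_def)
    qed
    have "x $ conj_index v = (\<Sum>a\<in>A. c a * emb (mcomp (mstar (taylor_vf (Lvf a) v)) (\<Phi> lv)))" for v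
      unfolding c_def
      using tangent_decomp_hom [where \<phi> = "\<lambda>f. emb (mcomp (mstar f) (\<Phi> lv))" and w = "\<lambda>v. x $ conj_index v" and v = v, OF _ _ _ tan] xl
      by (simp add: P.mcomp_add P.mcomp_mult mstar_mconst [of 1, simplified])
    from this [of "conj_index v" for v] have "x = (\<Sum>a\<in>A. c a *s L a)" by (simp add: vec_eq_iff L_def)
    also have "\<dots> \<in> vec.span (L ` A)" by (intro vec.span_sum vec.span_scale vec.span_base) auto
    finally show "x \<in> vec.span (L ` A)" .
  qed
  then show ?thesis using vec_dim_le_card_image [of A _ L] finite_A by (simp add: card_A n_def)
qed

text \<open>The derivatives along the \<open>n\<close> variables of level \<open>Suc lv\<close> lie
  in the kernel on \<open>W\<close>, and they are independent because \<partial>\<gamma>/\<partial>t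
  has rank \<open>n\<close> at the origin. As the kernel on \<open>Tan\<close> has dimension at most
  \<open>n\<close>, the two coincide.\<close>

lemma dim_W_kernel_P\<zeta>: "vec.dim {x \<in> W. P\<zeta> x = 0} = n" "{x \<in> Tan. P\<zeta> x = 0} \<subseteq> W"
proof -
  have const: "(\<chi> i. mcoeff (mderiv (Suc lv, b) (\<Phi> lv (Inl i))) 0) = ((\<chi> i. mcoeff (\<Gamma> b i) 0) :: complex ^ 'a)"
    if "b < n" for b
  proof -
    have "mfps_in Xv (\<Gamma> b i)" for i unfolding \<Gamma>_def by (intro mfps_in_mderiv \<gamma>_in)
    then show ?thesis by (simp add: vec_eq_iff mderiv_\<Phi>_last that msubst.mcomp_0_coeff [OF msubst_sub])
  qed
  have "rindep {..<n} (\<lambda>b i. mderiv (Suc lv, b) (\<Phi> lv (Inl i)))"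
  proof (rule rindep_of_constant_terms)
    show "inj_on (\<lambda>b. \<chi> i. mcoeff (mderiv (Suc lv, b) (\<Phi> lv (Inl i))) 0) {..<n}"
      using \<Gamma>_independent(1) const unfolding inj_on_def by simp
    have "(\<lambda>b. \<chi> i. mcoeff (mderiv (Suc lv, b) (\<Phi> lv (Inl i))) 0) ` {..<n}
      = (\<lambda>b. (\<chi> i. mcoeff (\<Gamma> b i) 0) :: complex ^ 'a) ` {..<n}"
      using const by (intro image_cong) auto
    then show "vec.independent ((\<lambda>b. (\<chi> i. mcoeff (mderiv (Suc lv, b) (\<Phi> lv (Inl i))) 0) :: complex ^ 'a) ` {..<n})"
      using \<Gamma>_independent(2) by simp
  qed simp
  then have r: "rindep {..<n} (\<lambda>b v. mderiv (Suc lv, b) (\<Phi> lv v))"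
    unfolding rindep_def by blast
  have in_W: "embv (\<lambda>v. mderiv (Suc lv, b) (\<Phi> lv v)) \<in> {x \<in> W. P\<zeta> x = 0}" if "b < n" for b
  proof -
    have "D (Suc lv, b) \<in> W" unfolding W_def using that by (intro vec.span_base imageI) (auto simp: T_def)
    then show ?thesis using that by (simp add: D_def P\<zeta>_def vec_eq_iff mderiv_\<Phi>_last)
  qed
  have "n \<le> vec.dim {x \<in> W. P\<zeta> x = 0}"
    using rindep_card_le [OF _ r, of "{x \<in> W. P\<zeta> x = 0}"] in_W by simp
  moreover have sub: "{x \<in> W. P\<zeta> x = 0} \<subseteq> {x \<in> Tan. P\<zeta> x = 0}" using W_Tan by blast
  moreover from sub have "vec.dim {x \<in> W. P\<zeta> x = 0} \<le> vec.dim {x \<in> Tan. P\<zeta> x = 0}" by (rule vec.dim_subset)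
  ultimately show eq: "vec.dim {x \<in> W. P\<zeta> x = 0} = n" using dim_T10 by linarith
  interpret P: Vector_Spaces.linear "(*s)" "(*s)" P\<zeta> by (rule linear_P\<zeta>)
  have "vec.subspace {x \<in> W. P\<zeta> x = 0}" "vec.subspace {x \<in> Tan. P\<zeta> x = 0}"
    using subspace_W subspace_Tan by (auto simp: vec.subspace_def P.add P.scale)
  from vec.subspace_dim_equal [OF this sub] show "{x \<in> Tan. P\<zeta> x = 0} \<subseteq> W"
    using eq dim_T10 by auto
qed

text \<open>Rank and nullity for the projection to \<zeta>: the image of \<open>W\<close> is spanned
  by the Jacobian columns of the conjugate of \<open>segre_iter \<gamma> lv\<close>.\<close>

lemma dim_W: "vec.dim W = segre_rank d \<gamma> lv + n"
proof -
  interpret P: Vector_Spaces.linear "(*s)" "(*s)" P\<zeta> by (rule linear_P\<zeta>)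
  let ?x = "\<lambda>t. embv (\<lambda>i. mcnj (mderiv t (segre_iter \<gamma> lv i)))"
  have PD: "P\<zeta> (D t) = ?x t" for t by (simp add: P\<zeta>_def D_def vec_eq_iff \<Phi>_simps)
  have "vec.dim (P\<zeta> ` W) = vec.dim (?x ` T (Suc lv))"
    unfolding W_def P.span_image [symmetric] vec.dim_span by (simp add: image_image PD)
  also have "\<dots> = vec.dim (?x ` T lv)"
  proof (rule antisym)
    have "?x ` T (Suc lv) \<subseteq> vec.span (?x ` T lv)"
    proof clarify
      fix l b assume t: "(l, b) \<in> T (Suc lv)"
      show "?x (l, b) \<in> vec.span (?x ` T lv)"
      proof (cases "(l, b) \<in> T lv")
        case True then show ?thesis by (intro vec.span_base) auto
      next
        case False
        then have "mderiv (l, b) (segre_iter \<gamma> lv i) = 0" for i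
          using segre_iter_in by (intro mderiv_eq_0) auto
        then have "?x (l, b) = 0" by (simp add: vec_eq_iff)
        then show ?thesis by (simp add: vec.span_zero)
      qed
    qed
    then show "vec.dim (?x ` T (Suc lv)) \<le> vec.dim (?x ` T lv)" by (rule vec.dim_mono)
    show "vec.dim (?x ` T lv) \<le> vec.dim (?x ` T (Suc lv))" by (rule vec.dim_subset) (auto simp: T_def)
  qed
  also have "\<dots> = segre_rank d \<gamma> lv" unfolding segre_rank_eq by (rule dim_mcnj)
  finally show ?thesis
    using vec_dim_image_kernel [OF subspace_W linear_P\<zeta>] dim_W_kernel_P\<zeta>(1) by simp
qed

text \<open>Here the ranks have to be stable: the kernel of the projection to \<open>Z\<close> then has the full
  dimension \<open>n\<close> of the space of \<open>(0,1)\<close> vectors.\<close>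

lemma T01_subset_W:
  assumes "segre_rank d \<gamma> lv = segre_rank d \<gamma> (Suc lv)"
  shows "{x \<in> Tan. PZ x = 0} \<subseteq> W"
proof -
  interpret P: Vector_Spaces.linear "(*s)" "(*s)" PZ by (rule linear_PZ)
  have PD: "PZ (D t) = embv (\<lambda>i. mderiv t (segre_iter \<gamma> (Suc lv) i))" for t
    by (simp add: PZ_def D_def vec_eq_iff \<Phi>_simps(1))
  have "vec.dim (PZ ` W) = segre_rank d \<gamma> (Suc lv)"
    unfolding W_def P.span_image [symmetric] vec.dim_span segre_rank_eq by (simp add: image_image PD)
  then have dim: "vec.dim {x \<in> W. PZ x = 0} = n"
    using vec_dim_image_kernel [OF subspace_W linear_PZ] dim_W assms by simp
  have sub: "{x \<in> W. PZ x = 0} \<subseteq> {x \<in> Tan. PZ x = 0}" using W_Tan by blast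
  have "vec.subspace {x \<in> W. PZ x = 0}" "vec.subspace {x \<in> Tan. PZ x = 0}"
    using subspace_W subspace_Tan by (auto simp: vec.subspace_def P.add P.scale)
  from vec.subspace_dim_equal [OF this sub] show ?thesis using dim dim_T01 by auto
qed

text \<open>Up to the factor \<open>e\<close>, the field is related by \<Phi> to the field
  \<open>c\<close> on the parameter space. Free of fractions, this form lets brackets be computed
  with derivations of power series.\<close>

definition tangent_to_image :: "('a + 'a \<Rightarrow> ('a + 'a) mfps) \<Rightarrow> bool"
  where "tangent_to_image y \<longleftrightarrow>
    (\<exists>e c. e \<noteq> 0 \<and> (\<forall>v. e * mcomp (y v) (\<Phi> lv) = vderiv (T (Suc lv)) c (\<Phi> lv v)))"

lemma tangent_to_imageI:
  assumes "embv (\<lambda>v. mcomp (y v) (\<Phi> lv)) \<in> W" shows "tangent_to_image y"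
proof -
  obtain q where q: "embv (\<lambda>v. mcomp (y v) (\<Phi> lv)) = (\<Sum>t\<in>T (Suc lv). q t *s D t)"
    using vec_span_image_finite [OF finite_T assms [unfolded W_def]] by blast
  obtain e c where ec: "e \<noteq> 0" "\<And>t. t \<in> T (Suc lv) \<Longrightarrow> emb e * q t = emb (c t)"
    by (rule common_denominator [of "T (Suc lv)" q]) auto
  have "e * mcomp (y v) (\<Phi> lv) = vderiv (T (Suc lv)) c (\<Phi> lv v)" for v
  proof -
    have "emb (e * mcomp (y v) (\<Phi> lv)) = emb e * (\<Sum>t\<in>T (Suc lv). q t *s D t) $ v"
      by (simp add: q [symmetric])
    also have "\<dots> = (\<Sum>t\<in>T (Suc lv). (emb e * q t) * emb (mderiv t (\<Phi> lv v)))"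
      by (simp add: sum_distrib_left D_def mult.assoc)
    also have "\<dots> = emb (vderiv (T (Suc lv)) c (\<Phi> lv v))"
      by (simp add: ec(2) vderiv_def emb_sum)
    finally show ?thesis by (simp only: emb_simps(6))
  qed
  then show ?thesis using ec(1) unfolding tangent_to_image_def by blast
qed

lemma tangent_to_imageD:
  assumes "tangent_to_image y" shows "embv (\<lambda>v. mcomp (y v) (\<Phi> lv)) \<in> W"
proof -
  obtain e c where ec: "e \<noteq> 0" "\<And>v. e * mcomp (y v) (\<Phi> lv) = vderiv (T (Suc lv)) c (\<Phi> lv v)"
    using assms unfolding tangent_to_image_def by blast
  have "embv (\<lambda>v. mcomp (y v) (\<Phi> lv)) = inverse (emb e) *s (\<Sum>t\<in>T (Suc lv). emb (c t) *s D t)"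
  proof (subst vec_eq_iff, intro allI)
    fix v
    have "emb e * emb (mcomp (y v) (\<Phi> lv)) = (\<Sum>t\<in>T (Suc lv). emb (c t) * emb (mderiv t (\<Phi> lv v)))"
      using arg_cong [OF ec(2) [of v], of emb] by (simp add: vderiv_def emb_sum)
    then show "embv (\<lambda>v. mcomp (y v) (\<Phi> lv)) $ v = (inverse (emb e) *s (\<Sum>t\<in>T (Suc lv). emb (c t) *s D t)) $ v"
      using ec(1) by (simp add: D_def field_simps)
  qed
  also have "\<dots> \<in> W" unfolding W_def by (intro vec.span_sum vec.span_scale vec.span_base) auto
  finally show ?thesis .
qed

text \<open>Related fields have related brackets. The factors \<open>e1\<close> and
  \<open>e2\<close> are not constant, and their derivatives contribute multiples of \<open>y\<close>
  and \<open>z\<close>, which are already tangent.\<close>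

lemma tangent_to_image_bracket:
  assumes "tangent_to_image y" "tangent_to_image z"
  shows "tangent_to_image (vbracket UNIV y z)"
proof -
  interpret P: msubst UNIV "\<Phi> lv" by (rule msubst_\<Phi>)
  let ?c = "\<lambda>f. mcomp f (\<Phi> lv)" and ?d = "vderiv (T (Suc lv))"
  obtain e1 c1 where 1: "e1 \<noteq> 0" "\<And>v. e1 * ?c (y v) = ?d c1 (\<Phi> lv v)"
    using assms(1) unfolding tangent_to_image_def by blast
  obtain e2 c2 where 2: "e2 \<noteq> 0" "\<And>v. e2 * ?c (z v) = ?d c2 (\<Phi> lv v)"
    using assms(2) unfolding tangent_to_image_def by blast
  have app: "e * ?c (vderiv UNIV y F) = ?d c (?c F)" if "\<And>v. e * ?c (y v) = ?d c (\<Phi> lv v)" for e c y F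
    unfolding vderiv_comp [OF msubst_\<Phi>] vderiv_mcomp [OF msubst_\<Phi>] that [symmetric]
    by (simp add: sum_distrib_left mult_ac)
  have key: "e1 * e2 * ?c (vbracket UNIV y z v)
      = ?d (vbracket (T (Suc lv)) c1 c2) (\<Phi> lv v) - ?d c1 e2 * ?c (z v) + ?d c2 e1 * ?c (y v)" for v
  proof -
    have "?c (vbracket UNIV y z v) = ?c (vderiv UNIV y (z v)) - ?c (vderiv UNIV z (y v))"
      by (simp add: vbracket_def P.mcomp_diff)
    then have "e1 * e2 * ?c (vbracket UNIV y z v) = e2 * ?d c1 (?c (z v)) - e1 * ?d c2 (?c (y v))"
      by (simp add: right_diff_distrib app [OF 1(2), symmetric] app [OF 2(2), symmetric] mult_ac)
    moreover have "?d c1 (?d c2 (\<Phi> lv v)) = ?d c1 e2 * ?c (z v) + e2 * ?d c1 (?c (z v))"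
      by (simp add: 2(2) [symmetric] vderiv_mult)
    moreover have "?d c2 (?d c1 (\<Phi> lv v)) = ?d c2 e1 * ?c (y v) + e1 * ?d c2 (?c (y v))"
      by (simp add: 1(2) [symmetric] vderiv_mult)
    ultimately show ?thesis by (simp add: vderiv_vbracket)
  qed
  \<comment> \<open>One more factor \<open>e1 * e2\<close> turns the leftover terms of
    \<open>key\<close> in \<open>y\<close> and \<open>z\<close> into images of \<open>c1\<close> and
    \<open>c2\<close>. The factor 1 gives the expression the shape of
    \<open>vderiv_lincomb\<close>.\<close>
  define c where "c = (\<lambda>t. (e1 * e2) * vbracket (T (Suc lv)) c1 c2 t
    + 1 * ((- (?d c1 e2 * e1)) * c2 t + (?d c2 e1 * e2) * c1 t))"
  have "(e1 * e2) * (e1 * e2) * ?c (vbracket UNIV y z v) = ?d c (\<Phi> lv v)" for v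
  proof -
    have "(e1 * e2) * (e1 * e2) * ?c (vbracket UNIV y z v) = (e1 * e2) * (e1 * e2 * ?c (vbracket UNIV y z v))"
      by (simp only: mult.assoc)
    also have "\<dots> = (e1 * e2) * ?d (vbracket (T (Suc lv)) c1 c2) (\<Phi> lv v)
        - ?d c1 e2 * e1 * (e2 * ?c (z v)) + ?d c2 e1 * e2 * (e1 * ?c (y v))"
      unfolding key by (simp add: algebra_simps)
    also have "\<dots> = ?d c (\<Phi> lv v)"
      unfolding c_def 1(2) 2(2) vderiv_lincomb by simp
    finally show ?thesis .
  qed
  moreover have "(e1 * e2) * (e1 * e2) \<noteq> 0" using 1 2 by simp
  ultimately show ?thesis unfolding tangent_to_image_def by blast
qed

text \<open>The generators are vectors of pure type in \<open>Tan\<close>, hence in \<open>W\<close>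
  by the comparison of kernels, where \<open>rk\<close> enters for type (0,1).\<close>

lemma CR_lie_algebra_tangent_to_image:
  assumes rk: "segre_rank d \<gamma> lv = segre_rank d \<gamma> (Suc lv)" and X: "X \<in> CR_lie_algebra M d r"
  shows "tangent_to_image (taylor_vf X)"
  using X
proof induction
  interpret P: msubst UNIV "\<Phi> lv" by (rule msubst_\<Phi>)
  have Tan: "embv (\<lambda>v. mcomp (taylor_vf X v) (\<Phi> lv)) \<in> Tan" if "X \<in> CR_lie_algebra M d r" for X
  proof -
    have "(\<Sum>v\<in>UNIV. mcomp (mderiv v (\<rho> j)) (\<Phi> lv) * mcomp (taylor_vf X v) (\<Phi> lv)) = 0" if j: "j < d" for j
    proof -
      have "taylor_vf X \<in> ghat" using \<open>X \<in> CR_lie_algebra M d r\<close> by (auto simp: ghat_def)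
      from ghat_tangent [OF msubst_\<Phi> \<rho>_\<Phi> this j] show ?thesis
        by (simp add: vderiv_comp [OF msubst_\<Phi>] mult.commute)
    qed
    then have "(\<Sum>v\<in>UNIV. emb (mcomp (mderiv v (\<rho> j)) (\<Phi> lv)) * emb (mcomp (taylor_vf X v) (\<Phi> lv))) = 0" if "j < d" for j
      using that by (simp flip: emb_simps(2) emb_sum)
    then show ?thesis by (simp add: Tan_def)
  qed
  {
    case (gen_10 X)
    have "P\<zeta> (embv (\<lambda>v. mcomp (taylor_vf X v) (\<Phi> lv))) = 0"
      using taylor_type_10(1) [OF msubst_\<Phi> \<rho>_\<Phi> gen_10] by (simp add: P\<zeta>_def vec_eq_iff)
    then show ?case
      using dim_W_kernel_P\<zeta>(2) Tan CR_lie_algebra.gen_10 [OF gen_10] by (intro tangent_to_imageI) blast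
  next
    case (gen_01 X)
    have "PZ (embv (\<lambda>v. mcomp (taylor_vf X v) (\<Phi> lv))) = 0"
      using taylor_type_10(2) [OF msubst_\<Phi> \<rho>_\<Phi> gen_01] by (simp add: PZ_def vec_eq_iff)
    then show ?case
      using T01_subset_W [OF rk] Tan CR_lie_algebra.gen_01 [OF gen_01] by (intro tangent_to_imageI) blast
  next
    case (add X Y)
    have "embv (\<lambda>v. mcomp (taylor_vf (\<lambda>p. X p + Y p) v) (\<Phi> lv))
      = embv (\<lambda>v. mcomp (taylor_vf X v) (\<Phi> lv)) + embv (\<lambda>v. mcomp (taylor_vf Y v) (\<Phi> lv))"
      by (simp add: vec_eq_iff P.mcomp_add taylor_vf_CR_add add.hyps)
    then show ?case
      using add.IH [THEN tangent_to_imageD] vec.subspace_add [OF subspace_W] by (intro tangent_to_imageI) simp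
  next
    case (scale X c)
    have "embv (\<lambda>v. mcomp (taylor_vf (\<lambda>p. c *s X p) v) (\<Phi> lv))
      = emb (mconst c) *s embv (\<lambda>v. mcomp (taylor_vf X v) (\<Phi> lv))"
      by (simp add: vec_eq_iff P.mcomp_mult taylor_vf_CR_scale scale.hyps)
    then show ?case
      using scale.IH [THEN tangent_to_imageD] vec.subspace_scale [OF subspace_W] by (intro tangent_to_imageI) simp
  next
    case (bracket X Y)
    show ?case using tangent_to_image_bracket [OF bracket.IH] by (simp add: taylor_vf_CR_bracket bracket.hyps)
  }
qed

lemma mcoeff_taylor_vf_0:
  assumes "X \<in> CR_lie_algebra M d r" shows "mcoeff (taylor_vf X v) 0 = X 0 $ v"
proof -
  obtain W' where W': "tangent_near_0 W' X" using assms CR_lie_algebra_tangent by blast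
  then interpret W: nbhd W' by unfold_locales (auto simp: tangent_near_0_def)
  show ?thesis unfolding taylor_vf_def
    using W' by (intro W.mcoeff_taylor_0) (auto simp: tangent_near_0_def smooth_on_vec)
qed

theorem CR_lie_dim_le:
  assumes rk: "segre_rank d \<gamma> lv = segre_rank d \<gamma> (Suc lv)"
  shows "CR_lie_dim M d r \<le> segre_rank d \<gamma> lv + n"
proof -
  interpret P: msubst UNIV "\<Phi> lv" by (rule msubst_\<Phi>)
  obtain B where B: "B \<subseteq> (\<lambda>X. X 0) ` CR_lie_algebra M d r" "vec.independent B" "card B = CR_lie_dim M d r"
    unfolding CR_lie_dim_def using vec.basis_exists by metis
  obtain I where I: "I \<subseteq> CR_lie_algebra M d r" "B = (\<lambda>X. X 0) ` I" "inj_on (\<lambda>X. X 0) I"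
    using B(1) by (meson subset_image_inj)
  have "finite B" using B(2) vec.finiteI_independent by blast
  then have finI: "finite I" using I finite_imageD by blast
  have const: "(\<chi> v. mcoeff (mcomp (taylor_vf X v) (\<Phi> lv)) 0) = X 0" if "X \<in> I" for X
    using mcoeff_taylor_vf_0 that I(1) by (auto simp: vec_eq_iff)
  have "rindep I (\<lambda>X v. mcomp (taylor_vf X v) (\<Phi> lv))"
  proof (rule rindep_of_constant_terms [OF finI])
    show "inj_on (\<lambda>X. \<chi> v. mcoeff (mcomp (taylor_vf X v) (\<Phi> lv)) 0) I"
      using I(3) const by (simp cong: inj_on_cong)
    have "(\<lambda>X. \<chi> v. mcoeff (mcomp (taylor_vf X v) (\<Phi> lv)) 0) ` I = B"
      unfolding I(2) using const by (intro image_cong) auto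
    then show "vec.independent ((\<lambda>X. \<chi> v. mcoeff (mcomp (taylor_vf X v) (\<Phi> lv)) 0) ` I)" using B(2) by simp
  qed
  from rindep_card_le [OF finI this, of W] have "card I \<le> vec.dim W"
    using I(1) tangent_to_imageD [OF CR_lie_algebra_tangent_to_image [OF rk]] by blast
  moreover have "card I = CR_lie_dim M d r" using B(3) card_image [OF I(3)] I(2) by simp
  ultimately show ?thesis by (simp add: dim_W)
qed

end

end

section \<open>The rank is bounded above by the dimension of the Lie algebra\<close>

lemma mstar_conv_mcomp: "mstar f = mcomp (mcnj f) (\<lambda>v. mvar (conj_index v))"
  using conj_subst.mcnj_mcomp [of f] by (simp add: mstar_def)

lemma mstar_mstar [simp]: "mstar (mstar f) = f"
proof -
  have "mcomp (mcomp (mcnj f) (\<lambda>v. mvar (conj_index v))) (\<lambda>v. mvar (conj_index v))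
    = mcomp (mcnj f) (\<lambda>v. mcomp (mvar (conj_index v)) (\<lambda>v. mvar (conj_index v)))"
    by (rule conj_subst.mcomp_assoc [of UNIV]) auto
  also have "\<dots> = mcnj f"
    using mcomp_mvar_id [of UNIV "mcnj f"] by (simp add: conj_subst.mcomp_mvar)
  finally have "mcomp (mstar f) (\<lambda>v. mvar (conj_index v)) = mcnj f" by (simp only: mstar_conv_mcomp [of f])
  then show ?thesis by (simp add: mstar_def [of "mstar f"])
qed

lemma mset0_decomp:
  obtains g1 where "g = mset0 b g + mvar b * g1" "\<And>X. mfps_in X g \<Longrightarrow> mfps_in X g1"
proof
  define g1 where "g1 = Abs_mfps (\<lambda>m. mcoeff g (m + unit_exp b))"
  show "g = mset0 b g + mvar b * Abs_mfps (\<lambda>m. mcoeff g (m + unit_exp b))"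
    unfolding g1_def [symmetric]
  proof (rule mfps_eqI)
    fix m
    show "mcoeff g m = mcoeff (mset0 b g + mvar b * g1) m"
    proof (cases "b \<in> mkeys m")
      case True
      then obtain m' where "m = m' + unit_exp b" by (rule unit_exp_decomp)
      then show ?thesis by (simp add: mcoeff_mset0 mcoeff_mvar_mult lookup_add g1_def)
    next
      case False
      then show ?thesis by (simp add: mcoeff_mset0 mcoeff_mvar_mult in_keys_iff)
    qed
  qed
  fix X assume g: "mfps_in X g"
  show "mfps_in X (Abs_mfps (\<lambda>m. mcoeff g (m + unit_exp b)))"
    unfolding mfps_in_def
  proof (intro allI impI)
    fix m assume "mcoeff (Abs_mfps (\<lambda>m. mcoeff g (m + unit_exp b))) m \<noteq> 0"
    then have "mkeys (m + unit_exp b) \<subseteq> X" using g unfolding mfps_in_def by (metis mcoeff_Abs_mfps)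
    then show "mkeys m \<subseteq> X" by simp
  qed
qed

lemma mfps_in_mset0_same: "mfps_in X f \<Longrightarrow> mfps_in X (mset0 b f)"
  by (auto simp: mfps_in_def mcoeff_mset0)

context CR_segre
begin

text \<open>At the origin both families span the \<open>(1,0)\<close> tangent space, so the transition matrix is
  invertible there, hence invertible over the power series.\<close>

lemma L_in_span:
  obtains H where "\<And>a i. a \<in> A \<Longrightarrow> mcomp (Ch i a) \<pi> = (\<Sum>b<n. H a b * \<Gamma> b i)"
    "\<And>a b. a \<in> A \<Longrightarrow> mfps_in Xv (H a b)"
proof -
  define Cp where "Cp = (\<lambda>a i. mcomp (Ch i a) \<pi>)"
  have Cp_in: "mfps_in Xv (Cp a i)" for a i unfolding Cp_def by (rule pi.mfps_in_mcomp) (auto simp: \<pi>_in)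
  have \<Gamma>_in: "mfps_in Xv (\<Gamma> b i)" for b i unfolding \<Gamma>_def by (intro mfps_in_mderiv \<gamma>_in)
  \<comment> \<open>By \<open>tangent_decomp\<close>, pairing with the covectors \<open>u a\<close>
    yields the coefficients of \<partial>\<gamma>/\<partial>t in the frame.\<close>
  define G where "G = (\<lambda>b a. \<Sum>m\<in>UNIV. mconst (u a $ m) * \<Gamma> b m)"
  have G_in: "mfps_in Xv (G b a)" for b a unfolding G_def by (intro mfps_in_intros mfps_in_mconst \<Gamma>_in)
  have \<Gamma>: "\<Gamma> b i = (\<Sum>a\<in>A. G b a * Cp a i)" for b i
  proof -
    have tan: "(\<Sum>v\<in>UNIV. mcomp (mderiv v (\<rho> j)) \<pi> * mderiv (Inr b) (\<pi> v)) = 0" if "j < d" for j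
      using pi.mderiv_mcomp [of "\<rho> j" "Inr b"] by (simp add: \<rho>_\<pi> that)
    show ?thesis
      using tangent_decomp [OF pi.msubst_axioms tan, of "Inl i"]
      by (simp add: \<Gamma>_def G_def Cp_def mderiv_mvar)
  qed
  define \<Gamma>0 where "\<Gamma>0 = (\<lambda>b. (\<chi> i. mcoeff (\<Gamma> b i) 0) :: complex ^ 'a)"
  define C0 where "C0 = (\<lambda>a. (\<chi> i. mcoeff (Cp a i) 0) :: complex ^ 'a)"
  have \<Gamma>0: "\<Gamma>0 b = (\<Sum>a\<in>A. mcoeff (G b a) 0 *s C0 a)" for b
    by (simp add: vec_eq_iff \<Gamma>0_def C0_def \<Gamma>)
  have sub: "vec.span (\<Gamma>0 ` {..<n}) \<subseteq> vec.span (C0 ` A)"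
    by (intro vec.span_minimal vec.subspace_span image_subsetI, unfold \<Gamma>0,
        intro vec.span_sum vec.span_scale vec.span_base imageI)
  have d1: "vec.dim (vec.span (\<Gamma>0 ` {..<n})) = n"
    using \<Gamma>_independent vec.dim_eq_card_independent [of "\<Gamma>0 ` {..<n}"] card_image [of \<Gamma>0 "{..<n}"]
    by (simp add: \<Gamma>0_def)
  have d2: "vec.dim (vec.span (C0 ` A)) \<le> n"
    using vec_dim_le_card_image [of A "vec.span (C0 ` A)" C0] by (simp add: finite_A card_A n_def)
  have "vec.span (\<Gamma>0 ` {..<n}) = vec.span (C0 ` A)"
    using vec.subspace_dim_equal [OF vec.subspace_span vec.subspace_span sub] d1 d2 by simp
  then have "C0 a \<in> vec.span (\<Gamma>0 ` {..<n})" if "a \<in> A" for a using that by (simp add: vec.span_base)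
  then have "\<exists>q. C0 a = (\<Sum>b<n. q b *s \<Gamma>0 b)" if "a \<in> A" for a
    using vec_span_image_finite [of "{..<n}" "C0 a" \<Gamma>0] that by (metis finite_lessThan)
  then obtain q where q: "\<And>a. a \<in> A \<Longrightarrow> C0 a = (\<Sum>b<n. q a b *s \<Gamma>0 b)" by metis
  \<comment> \<open>Since the \<open>u a\<close> are dual to the \<open>C0 a\<close>, the matrix of
    the \<open>q a b\<close> is inverse to \<open>G\<close> at the origin; \<open>E\<close> measures
    the defect elsewhere.\<close>
  define E where "E = (\<lambda>a a'. (if a = a' then 1 else 0) - (\<Sum>b<n. mconst (q a b) * G b a'))"
  define g where "g = (\<lambda>i a. \<Sum>b<n. mconst (q a b) * \<Gamma> b i)"
  have uC0: "(\<Sum>m\<in>UNIV. u a $ m * C0 a' $ m) = (if a' = a then 1 else 0)" if "a \<in> A" for a a'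
    using uC [OF zeroV that, of a'] mcoeff_taylor_0 [OF smooth_C] by (simp add: C0_def Cp_def Ch_def)
  have E0: "mcoeff (E a a') 0 = 0" if "a \<in> A" "a' \<in> A" for a a'
  proof -
    have "(\<Sum>b<n. q a b * mcoeff (G b a') 0) = (\<Sum>b<n. \<Sum>m\<in>UNIV. u a' $ m * (q a b * \<Gamma>0 b $ m))"
      by (simp add: G_def \<Gamma>0_def sum_distrib_left mult_ac)
    also have "\<dots> = (\<Sum>m\<in>UNIV. u a' $ m * C0 a $ m)"
      by (subst sum.swap) (simp add: q [OF that(1)] sum_distrib_left)
    also have "\<dots> = (if a = a' then 1 else 0)" using uC0 [OF that(2)] by simp
    finally show ?thesis by (simp add: E_def)
  qed
  have E_in: "mfps_in Xv (E a a')" for a a' unfolding E_def by (intro mfps_in_intros mfps_in_mconst G_in) auto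
  obtain K where K: "\<And>i j. i \<in> A \<Longrightarrow> j \<in> A \<Longrightarrow> K i j = (if i = j then 1 else 0) + (\<Sum>l\<in>A. K i l * E l j)"
    "\<And>i j. i \<in> A \<Longrightarrow> j \<in> A \<Longrightarrow> mfps_in Xv (K i j)"
    using neumann_series [OF finite_A, of E Xv] E0 E_in by blast
  have "Cp a i = g i a + (\<Sum>a'\<in>A. E a a' * Cp a' i)" if "a \<in> A" for a i
  proof -
    have "g i a = (\<Sum>b<n. \<Sum>a'\<in>A. mconst (q a b) * G b a' * Cp a' i)"
      by (simp add: g_def \<Gamma> sum_distrib_left mult.assoc)
    also have "\<dots> = (\<Sum>a'\<in>A. (\<Sum>b<n. mconst (q a b) * G b a') * Cp a' i)"
      by (subst sum.swap) (simp add: sum_distrib_right)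
    finally have "g i a + (\<Sum>a'\<in>A. E a a' * Cp a' i) = (\<Sum>a'\<in>A. (if a = a' then 1 else 0) * Cp a' i)"
      unfolding E_def left_diff_distrib sum_subtractf by simp
    then show ?thesis using that finite_A by (simp add: if_distrib [of "\<lambda>x. x * _"] cong: if_cong)
  qed
  then have C: "Cp a i = (\<Sum>a'\<in>A. K a a' * g i a')" if "a \<in> A" for a i
    using neumann_solve [OF finite_A K(1), where y = "\<lambda>a. Cp a i" and g = "g i" and i = a] that by blast
  show thesis
  proof
    fix a assume a: "a \<in> A"
    show "mfps_in Xv (\<Sum>a'\<in>A. K a a' * mconst (q a' b))" for b
      using K(2) a by (intro mfps_in_intros mfps_in_mconst) auto
    show "mcomp (Ch i a) \<pi> = (\<Sum>b<n. (\<Sum>a'\<in>A. K a a' * mconst (q a' b)) * \<Gamma> b i)" for i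
    proof -
      have "(\<Sum>b<n. (\<Sum>a'\<in>A. K a a' * mconst (q a' b)) * \<Gamma> b i) = (\<Sum>a'\<in>A. K a a' * g i a')"
        by (simp add: g_def sum_distrib_left sum_distrib_right mult.assoc) (rule sum.swap)
      then show ?thesis using C [OF a, of i] by (simp add: Cp_def)
    qed
  qed
qed

text \<open>The Lie algebra is lifted through \<open>\<pi>\<close> to the series in \<open>(\<zeta>, t)\<close>, where it contains the
  derivations \<open>\<partial>/\<partial>t\<^sub>b\<close>.\<close>

definition Mod :: "('a + 'a \<Rightarrow> ('a + nat) mfps) set"
  where "Mod = {z. \<exists>I c. finite I \<and> I \<subseteq> ghat \<and> (\<forall>y\<in>I. mfps_in Xv (c y)) \<and>
    (\<forall>v. z v = (\<Sum>y\<in>I. c y * mcomp (y v) \<pi>))}"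

lemma Mod_zero: "(\<lambda>v. 0) \<in> Mod"
  unfolding Mod_def by (intro CollectI exI [of _ "{}"]) auto

lemma Mod_gen: "y \<in> ghat \<Longrightarrow> mfps_in Xv c \<Longrightarrow> (\<lambda>v. c * mcomp (y v) \<pi>) \<in> Mod"
  unfolding Mod_def by (intro CollectI exI [of _ "{y}"] exI [of _ "\<lambda>_. c"]) auto

lemma Mod_E:
  assumes "z \<in> Mod"
  obtains I c where "finite I" "I \<subseteq> ghat" "\<And>y. y \<in> I \<Longrightarrow> mfps_in Xv (c y)"
    "\<And>v. z v = (\<Sum>y\<in>I. c y * mcomp (y v) \<pi>)"
  using assms unfolding Mod_def mem_Collect_eq by (elim exE conjE) (rule that, auto)

lemma Mod_add:
  assumes z: "z \<in> Mod" and z': "z' \<in> Mod"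
  shows "(\<lambda>v. z v + z' v) \<in> Mod"
proof -
  obtain I c where I: "finite I" "I \<subseteq> ghat" "\<And>y. y \<in> I \<Longrightarrow> mfps_in Xv (c y)"
    "\<And>v. z v = (\<Sum>y\<in>I. c y * mcomp (y v) \<pi>)" using z by (rule Mod_E) (assumption | rule that)+
  obtain J e where J: "finite J" "J \<subseteq> ghat" "\<And>y. y \<in> J \<Longrightarrow> mfps_in Xv (e y)"
    "\<And>v. z' v = (\<Sum>y\<in>J. e y * mcomp (y v) \<pi>)" using z' by (rule Mod_E) (assumption | rule that)+
  define f where "f = (\<lambda>y. (if y \<in> I then c y else 0) + (if y \<in> J then e y else 0))"
  have "z v + z' v = (\<Sum>y\<in>I \<union> J. f y * mcomp (y v) \<pi>)" for v
  proof -
    have "z v = (\<Sum>y\<in>I \<union> J. (if y \<in> I then c y else 0) * mcomp (y v) \<pi>)"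
      unfolding I(4) using I J by (intro sum.mono_neutral_cong_left) auto
    moreover have "z' v = (\<Sum>y\<in>I \<union> J. (if y \<in> J then e y else 0) * mcomp (y v) \<pi>)"
      unfolding J(4) using I J by (intro sum.mono_neutral_cong_left) auto
    ultimately show ?thesis by (simp add: f_def distrib_right sum.distrib)
  qed
  moreover have "mfps_in Xv (f y)" if "y \<in> I \<union> J" for y
    using that I(3) J(3) by (auto simp: f_def intro: mfps_in_add)
  ultimately show ?thesis
    unfolding Mod_def using I J by (intro CollectI exI [of _ "I \<union> J"] exI [of _ f]) auto
qed

lemma Mod_sum: "(\<And>x. x \<in> B \<Longrightarrow> z x \<in> Mod) \<Longrightarrow> (\<lambda>v. \<Sum>x\<in>B. z x v) \<in> Mod"
  by (induction B rule: infinite_finite_induct) (auto intro: Mod_zero Mod_add)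

text \<open>Series are allowed as coefficients, so \<open>LL\<close> is a module over them; the
  derivations along t are expressed with such coefficients. At 0, the image under \<pi> of a field
  in \<open>LL\<close> still lies in the span of the values of \<open>ghat\<close>.\<close>

definition LL :: "('a + nat \<Rightarrow> ('a + nat) mfps) set"
  where "LL = {y. (\<forall>s. mfps_in Xv (y s)) \<and> (\<lambda>v. vderiv Xv y (\<pi> v)) \<in> Mod}"

lemma vderiv_comp_\<pi>:
  assumes "\<And>v. vderiv Xv y (\<pi> v) = (\<Sum>Y\<in>I. c Y * mcomp (Y v) \<pi>)"
  shows "vderiv Xv y (mcomp F \<pi>) = (\<Sum>Y\<in>I. c Y * mcomp (vderiv UNIV Y F) \<pi>)"
proof -
  have "vderiv Xv y (mcomp F \<pi>) = (\<Sum>v\<in>UNIV. \<Sum>Y\<in>I. c Y * (mcomp (Y v) \<pi> * mcomp (mderiv v F) \<pi>))"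
    unfolding vderiv_mcomp [OF pi.msubst_axioms] assms by (simp add: sum_distrib_left mult_ac)
  also have "\<dots> = (\<Sum>Y\<in>I. c Y * mcomp (vderiv UNIV Y F) \<pi>)"
    unfolding vderiv_comp [OF pi.msubst_axioms] by (subst sum.swap) (simp add: sum_distrib_left)
  finally show ?thesis .
qed

lemma LL_E:
  assumes "y \<in> LL"
  obtains I c where "finite I" "I \<subseteq> ghat" "\<And>Y. Y \<in> I \<Longrightarrow> mfps_in Xv (c Y)"
    "\<And>v. vderiv Xv y (\<pi> v) = (\<Sum>Y\<in>I. c Y * mcomp (Y v) \<pi>)"
proof -
  have "(\<lambda>v. vderiv Xv y (\<pi> v)) \<in> Mod" using assms by (simp add: LL_def)
  then show thesis by (rule Mod_E) (assumption | rule that)+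
qed

text \<open>For combinations with variable coefficients, the only terms besides the brackets in
  \<open>ghat\<close> are those in which a coefficient is differentiated, and these are combinations
  again.\<close>

lemma LL_closed_bracket:
  assumes y: "y \<in> LL" and z: "z \<in> LL"
  shows "vbracket Xv y z \<in> LL"
proof -
  obtain I c where I: "finite I" "I \<subseteq> ghat" "\<And>Y. Y \<in> I \<Longrightarrow> mfps_in Xv (c Y)"
    "\<And>v. vderiv Xv y (\<pi> v) = (\<Sum>Y\<in>I. c Y * mcomp (Y v) \<pi>)" using y by (rule LL_E) (assumption | rule that)+
  obtain J e where J: "finite J" "J \<subseteq> ghat" "\<And>Y. Y \<in> J \<Longrightarrow> mfps_in Xv (e Y)"
    "\<And>v. vderiv Xv z (\<pi> v) = (\<Sum>Y\<in>J. e Y * mcomp (Y v) \<pi>)" using z by (rule LL_E) (assumption | rule that)+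
  have yin: "mfps_in Xv (y s)" and zin: "mfps_in Xv (z s)" for s using y z by (auto simp: LL_def)
  have yz: "vderiv Xv y (vderiv Xv z (\<pi> v)) = (\<Sum>b\<in>J. vderiv Xv y (e b) * mcomp (b v) \<pi>)
      + (\<Sum>b\<in>J. \<Sum>a\<in>I. c a * e b * mcomp (vderiv UNIV a (b v)) \<pi>)" for v
    unfolding J(4) vderiv_sum vderiv_mult sum.distrib vderiv_comp_\<pi> [OF I(4)]
    by (simp add: sum_distrib_left mult_ac)
  have zy: "vderiv Xv z (vderiv Xv y (\<pi> v)) = (\<Sum>a\<in>I. vderiv Xv z (c a) * mcomp (a v) \<pi>)
      + (\<Sum>b\<in>J. \<Sum>a\<in>I. c a * e b * mcomp (vderiv UNIV b (a v)) \<pi>)" for v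
    unfolding I(4) vderiv_sum vderiv_mult sum.distrib vderiv_comp_\<pi> [OF J(4)]
    by (simp add: sum_distrib_left mult_ac) (rule sum.swap)
  have "vderiv Xv (vbracket Xv y z) (\<pi> v) = (\<Sum>b\<in>J. vderiv Xv y (e b) * mcomp (b v) \<pi>)
      + ((\<Sum>a\<in>I. (- vderiv Xv z (c a)) * mcomp (a v) \<pi>)
      + (\<Sum>b\<in>J. \<Sum>a\<in>I. c a * e b * mcomp (vbracket UNIV a b v) \<pi>))" for v
    unfolding vderiv_vbracket [OF finite_Xv] yz zy
    by (simp add: vbracket_def pi.mcomp_diff right_diff_distrib sum_subtractf sum_negf)
  moreover have "(\<lambda>v. (\<Sum>b\<in>J. vderiv Xv y (e b) * mcomp (b v) \<pi>)
      + ((\<Sum>a\<in>I. (- vderiv Xv z (c a)) * mcomp (a v) \<pi>)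
      + (\<Sum>b\<in>J. \<Sum>a\<in>I. c a * e b * mcomp (vbracket UNIV a b v) \<pi>))) \<in> Mod"
    using I(1,3) J(1,3) yin zin
    by (intro Mod_add Mod_sum Mod_gen mfps_in_uminus mfps_in_vderiv mfps_in_mult)
      (auto intro: ghat_bracket subsetD [OF I(2)] subsetD [OF J(2)])
  moreover have "mfps_in Xv (vbracket Xv y z s)" for s
    unfolding vbracket_def by (intro mfps_in_diff mfps_in_vderiv yin zin)
  ultimately show ?thesis by (simp add: LL_def)
qed

sublocale LL: formal_lie_algebra Xv LL
  by unfold_locales (auto simp: LL_closed_bracket, auto simp: LL_def)

lemma LL_add: "y \<in> LL \<Longrightarrow> z \<in> LL \<Longrightarrow> mfps_in Xv a \<Longrightarrow> (\<lambda>s. y s + a * z s) \<in> LL"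
proof -
  assume y: "y \<in> LL" and z: "z \<in> LL" and a: "mfps_in Xv a"
  obtain J e where J: "finite J" "J \<subseteq> ghat" "\<And>Y. Y \<in> J \<Longrightarrow> mfps_in Xv (e Y)"
    "\<And>v. vderiv Xv z (\<pi> v) = (\<Sum>Y\<in>J. e Y * mcomp (Y v) \<pi>)" using z by (rule LL_E) (assumption | rule that)+
  have "(\<lambda>v. \<Sum>Y\<in>J. (a * e Y) * mcomp (Y v) \<pi>) \<in> Mod"
    using J a by (intro Mod_sum Mod_gen mfps_in_mult) auto
  then have "(\<lambda>v. vderiv Xv y (\<pi> v) + (\<Sum>Y\<in>J. (a * e Y) * mcomp (Y v) \<pi>)) \<in> Mod"
    using y by (intro Mod_add) (auto simp: LL_def)
  moreover have "vderiv Xv (\<lambda>s. y s + a * z s) (\<pi> v) = vderiv Xv y (\<pi> v) + (\<Sum>Y\<in>J. (a * e Y) * mcomp (Y v) \<pi>)" for v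
    using vderiv_lincomb(1) [of Xv 1 y a z "\<pi> v"] J(4) [of v] by (simp add: sum_distrib_left mult.assoc)
  ultimately show ?thesis using y z a by (auto simp: LL_def intro!: mfps_in_add mfps_in_mult)
qed

lemma LL_zero: "(\<lambda>s. 0) \<in> LL"
  by (simp add: LL_def vderiv_def Mod_zero)

lemma LL_sum:
  "finite B \<Longrightarrow> y \<in> LL \<Longrightarrow> (\<And>x. x \<in> B \<Longrightarrow> z x \<in> LL) \<Longrightarrow> (\<And>x. x \<in> B \<Longrightarrow> mfps_in Xv (a x)) \<Longrightarrow>
    (\<lambda>s. y s + (\<Sum>x\<in>B. a x * z x s)) \<in> LL"
proof (induction B rule: finite_induct)
  case (insert x B)
  have "(\<lambda>s. (y s + (\<Sum>x\<in>B. a x * z x s)) + a x * z x s) \<in> LL"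
    using insert by (intro LL_add) auto
  then show ?case using insert by (simp add: add_ac)
qed simp

lemma vderiv_unit: "s \<in> Xv \<Longrightarrow> vderiv Xv (\<lambda>s'. if s' = s then 1 else 0) f = mderiv s f"
proof -
  assume s: "s \<in> Xv"
  have "vderiv Xv (\<lambda>s'. if s' = s then 1 else 0) f = (\<Sum>s'\<in>Xv. if s' = s then mderiv s' f else 0)"
    unfolding vderiv_def by (intro sum.cong) auto
  then show ?thesis using s by simp
qed

text \<open>The derivative of \<pi> along t is tangent and has no \<zeta>-components, so it is a
  combination of the (1,0) fields along \<pi>.\<close>

lemma LL_partial_t: "b < n \<Longrightarrow> (\<lambda>s. if s = Inr b then 1 else 0) \<in> LL"
proof -
  assume b: "b < n"
  have tan: "(\<Sum>v\<in>UNIV. mcomp (mderiv v (\<rho> j)) \<pi> * mderiv (Inr b) (\<pi> v)) = 0" if "j < d" for j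
    using pi.mderiv_mcomp [of "\<rho> j" "Inr b"] by (simp add: \<rho>_\<pi> that)
  have "mderiv (Inr b) (\<pi> v) = (\<Sum>a\<in>A. (\<Sum>m\<in>UNIV. mconst (u a $ m) * mderiv (Inr b) (\<pi> (Inl m))) * mcomp (taylor_vf (Lvf a) v) \<pi>)" for v
    using tangent_decomp [OF pi.msubst_axioms tan, of v] by (simp add: mderiv_mvar)
  moreover have "(\<lambda>v. \<Sum>a\<in>A. (\<Sum>m\<in>UNIV. mconst (u a $ m) * mderiv (Inr b) (\<pi> (Inl m))) * mcomp (taylor_vf (Lvf a) v) \<pi>) \<in> Mod"
    using Lvf_CR by (intro Mod_sum Mod_gen mfps_in_intros mfps_in_mconst \<pi>_in) (auto simp: ghat_def)
  ultimately show ?thesis using b by (simp add: LL_def vderiv_unit)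
qed

text \<open>The \<zeta>-components of \<open>y\<close> have to be those of \<open>Y\<close>. What
  then remains of \<open>Y\<close> is tangent of type (1,0), and by \<open>L_in_span\<close> it
  comes from a field in the t-directions.\<close>

lemma ghat_lift:
  assumes Y: "Y \<in> ghat"
  obtains y where "y \<in> LL" "\<And>v. vderiv Xv y (\<pi> v) = mcomp (Y v) \<pi>"
proof -
  obtain H where H: "\<And>a i. a \<in> A \<Longrightarrow> mcomp (Ch i a) \<pi> = (\<Sum>b<n. H a b * \<Gamma> b i)"
    "\<And>a b. a \<in> A \<Longrightarrow> mfps_in Xv (H a b)" by (rule L_in_span) (assumption | rule that)+
  have Y_in: "mfps_in Xv (mcomp (Y v) \<pi>)" for v by (rule pi.mfps_in_mcomp) (auto simp: \<pi>_in)
  define w where "w = (\<lambda>v. mcomp (Y v) \<pi> - (\<Sum>i\<in>UNIV. mcomp (Y (Inr i)) \<pi> * mderiv (Inl i) (\<pi> v)))"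
  have w_in: "mfps_in Xv (w v)" for v unfolding w_def by (intro mfps_in_intros Y_in \<pi>_in)
  have wr: "w (Inr i) = 0" for i
  proof -
    have "(\<Sum>i'\<in>UNIV. mcomp (Y (Inr i')) \<pi> * mderiv (Inl i') (\<pi> (Inr i))) = (\<Sum>i'\<in>UNIV. if i' = i then mcomp (Y (Inr i')) \<pi> else 0)"
      by (intro sum.cong) (auto simp: mderiv_mvar)
    then show ?thesis by (simp add: w_def)
  qed
  have tan: "(\<Sum>v\<in>UNIV. mcomp (mderiv v (\<rho> j)) \<pi> * w v) = 0" if j: "j < d" for j
  proof -
    have 1: "(\<Sum>v\<in>UNIV. mcomp (mderiv v (\<rho> j)) \<pi> * mcomp (Y v) \<pi>) = 0"
      using ghat_tangent [OF pi.msubst_axioms \<rho>_\<pi> Y j] by (simp add: vderiv_comp [OF pi.msubst_axioms] mult.commute)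
    have 2: "(\<Sum>v\<in>UNIV. mcomp (mderiv v (\<rho> j)) \<pi> * mderiv s (\<pi> v)) = 0" for s
      using pi.mderiv_mcomp [of "\<rho> j" s] by (simp add: \<rho>_\<pi> j)
    have "(\<Sum>v\<in>UNIV. mcomp (mderiv v (\<rho> j)) \<pi> * (\<Sum>i\<in>UNIV. mcomp (Y (Inr i)) \<pi> * mderiv (Inl i) (\<pi> v)))
      = (\<Sum>i\<in>UNIV. mcomp (Y (Inr i)) \<pi> * (\<Sum>v\<in>UNIV. mcomp (mderiv v (\<rho> j)) \<pi> * mderiv (Inl i) (\<pi> v)))"
      by (simp add: sum_distrib_left mult_ac) (rule sum.swap)
    then show ?thesis by (simp add: w_def right_diff_distrib sum_subtractf 1 2)
  qed
  define c where "c = (\<lambda>a. \<Sum>m\<in>UNIV. mconst (u a $ m) * w (Inl m))"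
  have c_in: "mfps_in Xv (c a)" for a unfolding c_def by (intro mfps_in_intros mfps_in_mconst w_in)
  have wl: "w (Inl i) = (\<Sum>a\<in>A. c a * mcomp (Ch i a) \<pi>)" for i
    using tangent_decomp [OF pi.msubst_axioms tan, of "Inl i"] by (simp add: wr c_def)
  define y where "y = case_sum (\<lambda>i. mcomp (Y (Inr i)) \<pi>) (\<lambda>b. \<Sum>a\<in>A. c a * H a b)"
  have y_in: "mfps_in Xv (y s)" for s
    by (cases s) (auto simp: y_def intro!: mfps_in_intros Y_in c_in H)
  have split: "vderiv Xv y f = (\<Sum>i\<in>UNIV. y (Inl i) * mderiv (Inl i) f) + (\<Sum>b<n. y (Inr b) * mderiv (Inr b) f)" for f
    unfolding vderiv_def Xv_def by (subst sum.union_disjoint) (auto simp: sum.reindex)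
  have "vderiv Xv y (\<pi> v) = mcomp (Y v) \<pi>" for v
  proof (cases v)
    case (Inl i)
    have "(\<Sum>b<n. y (Inr b) * mderiv (Inr b) (\<pi> v)) = (\<Sum>b<n. \<Sum>a\<in>A. c a * (H a b * \<Gamma> b i))"
      by (simp add: y_def Inl \<Gamma>_def sum_distrib_right mult.assoc)
    also have "\<dots> = (\<Sum>a\<in>A. c a * mcomp (Ch i a) \<pi>)"
      by (subst sum.swap) (simp add: H(1) sum_distrib_left)
    finally show ?thesis using wl [of i] unfolding split by (simp add: y_def w_def Inl diff_eq_eq add.commute)
  next
    case (Inr i)
    then show ?thesis using wr [of i] unfolding split by (simp add: y_def w_def mderiv_mvar)
  qed
  moreover from this have "y \<in> LL"
    using y_in Mod_gen [OF Y, of 1] by (simp add: LL_def)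
  ultimately show thesis using that by blast
qed

text \<open>The ideal of the formal orbit through \<open>0\<close> in the series in \<open>(Z, \<zeta>)\<close>; in contrast to its
  counterpart in \<open>(\<zeta>, t)\<close> it is visibly invariant under conjugation.\<close>

definition JS :: "('a + 'a) mfps set"
  where "JS = {F. \<forall>Ys. set Ys \<subseteq> ghat \<longrightarrow> mcoeff (viter UNIV Ys F) 0 = 0}"

text \<open>Each field of \<open>ghat\<close> has a lift in \<open>LL\<close>, so words of fields
  can be lifted letter by letter.\<close>

lemma JS_of_orbit_ideal:
  assumes "mcomp F \<pi> \<in> LL.orbit_ideal" shows "F \<in> JS"
proof -
  have "\<exists>ys. set ys \<subseteq> LL \<and> mcomp (viter UNIV Ys F) \<pi> = viter Xv ys (mcomp F \<pi>)" if "set Ys \<subseteq> ghat" for Ys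
    using that
  proof (induction Ys)
    case Nil show ?case by (intro exI [of _ "[]"]) simp
  next
    case (Cons Y Ys)
    then obtain ys where ys: "set ys \<subseteq> LL" "mcomp (viter UNIV Ys F) \<pi> = viter Xv ys (mcomp F \<pi>)" by auto
    obtain y where y: "y \<in> LL" "\<And>v. vderiv Xv y (\<pi> v) = mcomp (Y v) \<pi>" using ghat_lift [of Y] Cons.prems by auto
    have "vderiv Xv y (mcomp (viter UNIV Ys F) \<pi>) = mcomp (vderiv UNIV Y (viter UNIV Ys F)) \<pi>"
      unfolding vderiv_mcomp [OF pi.msubst_axioms] vderiv_comp [OF pi.msubst_axioms] y(2) by (simp add: mult.commute)
    then show ?case using ys y(1) by (intro exI [of _ "y # ys"]) simp
  qed
  then show ?thesis
    unfolding JS_def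
  proof (intro CollectI allI impI)
    fix Ys assume ex: "\<And>Ys. set Ys \<subseteq> ghat \<Longrightarrow> \<exists>ys. set ys \<subseteq> LL \<and> mcomp (viter UNIV Ys F) \<pi> = viter Xv ys (mcomp F \<pi>)"
      and Ys: "set Ys \<subseteq> ghat"
    obtain ys where "set ys \<subseteq> LL" "mcomp (viter UNIV Ys F) \<pi> = viter Xv ys (mcomp F \<pi>)" using ex [OF Ys] by blast
    then show "mcoeff (viter UNIV Ys F) 0 = 0"
      using assms pi.mcomp_0_coeff [of "viter UNIV Ys F"] unfolding LL.orbit_ideal_def by simp
  qed
qed

lemma JS_mstar:
  assumes F: "F \<in> JS" shows "mstar F \<in> JS"
  unfolding JS_def
proof (intro CollectI allI impI)
  fix Ys assume Ys: "set Ys \<subseteq> ghat"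
  define cj where "cj = (\<lambda>(y :: 'a + 'a \<Rightarrow> ('a + 'a) mfps) v. mstar (y (conj_index v)))"
  have cjcj: "(\<lambda>v. mstar (cj Y (conj_index v))) = Y" for Y by (rule ext) (simp add: cj_def)
  have "viter UNIV Ys (mstar F) = mstar (viter UNIV (map cj Ys) F)"
  proof (induction Ys)
    case (Cons Y Ys)
    then show ?case using vderiv_mstar [of "cj Y" "viter UNIV (map cj Ys) F"] by (simp add: cjcj)
  qed simp
  moreover have "set (map cj Ys) \<subseteq> ghat" using Ys ghat_conj by (auto simp: cj_def)
  ultimately show "mcoeff (viter UNIV Ys (mstar F)) 0 = 0" using F unfolding JS_def by simp
qed

text \<open>On series pulled back by \<pi>, a field of \<open>LL\<close> acts as a combination of
  fields of \<open>ghat\<close> with variable coefficients; the factor \<open>a\<close> in the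
  induction absorbs these.\<close>

lemma orbit_ideal_of_JS:
  assumes F: "F \<in> JS" shows "mcomp F \<pi> \<in> LL.orbit_ideal"
proof -
  have D: "vderiv UNIV Y G \<in> JS" if "G \<in> JS" "Y \<in> ghat" for G Y
    unfolding JS_def
  proof (intro CollectI allI impI)
    fix Ys assume "set Ys \<subseteq> ghat"
    then have "mcoeff (viter UNIV (Ys @ [Y]) G) 0 = 0" using that unfolding JS_def by (auto simp del: viter_simps)
    then show "mcoeff (viter UNIV Ys (vderiv UNIV Y G)) 0 = 0" by simp
  qed
  have "mcoeff (viter Xv ys (a * mcomp G \<pi>)) 0 = 0" if "set ys \<subseteq> LL" "G \<in> JS" for ys a G
    using that
  proof (induction ys arbitrary: a G rule: rev_induct)
    case Nil
    then have "mcoeff G 0 = 0" unfolding JS_def by (auto dest: spec [of _ "[]"])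
    then show ?case by simp
  next
    case (snoc y ys)
    have "y \<in> LL" using snoc.prems by simp
    then obtain I c where I: "finite I" "I \<subseteq> ghat" "\<And>Y. Y \<in> I \<Longrightarrow> mfps_in Xv (c Y)"
      "\<And>v. vderiv Xv y (\<pi> v) = (\<Sum>Y\<in>I. c Y * mcomp (Y v) \<pi>)" by (rule LL_E) (assumption | rule that)+
    have "vderiv Xv y (a * mcomp G \<pi>) = vderiv Xv y a * mcomp G \<pi> + (\<Sum>Y\<in>I. (a * c Y) * mcomp (vderiv UNIV Y G) \<pi>)"
      by (simp add: vderiv_mult vderiv_comp_\<pi> [OF I(4)] sum_distrib_left mult.assoc)
    moreover have "mcoeff (viter Xv ys (vderiv Xv y a * mcomp G \<pi>)) 0 = 0"
      "\<And>Y. Y \<in> I \<Longrightarrow> mcoeff (viter Xv ys ((a * c Y) * mcomp (vderiv UNIV Y G) \<pi>)) 0 = 0"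
      using snoc D I(2) by auto
    ultimately show ?case by (simp add: viter_add viter_sum)
  qed
  from this [of _ F 1] show ?thesis
    using F by (auto simp: LL.orbit_ideal_def \<pi>_in intro!: pi.mfps_in_mcomp)
qed

definition restrict_t :: "('a + nat) mfps \<Rightarrow> ('a + nat) mfps"
  where "restrict_t f = foldr (\<lambda>b. mset0 (Inr b)) [0..<n] f"

text \<open>The ideal is kept by \<open>orbit_ideal_mset0\<close>, because the derivations along t
  are in \<open>LL\<close>. The last clause holds since what is dropped is divisible by some
  variable t, which \<open>sub lv\<close> maps to a variable of level \<open>Suc lv\<close>.\<close>

lemma restrict_t_aux:
  assumes "set bs \<subseteq> {..<n}" "f \<in> LL.orbit_ideal"
  defines "g \<equiv> foldr (\<lambda>b. mset0 (Inr b)) bs f"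
  shows "g \<in> LL.orbit_ideal" "mfps_in (Xv - Inr ` set bs) g"
    "\<And>m. (\<forall>b\<in>set bs. mlookup m (Inr b) = 0) \<Longrightarrow> mcoeff g m = mcoeff f m"
    "\<And>lv m. (\<forall>b\<in>set bs. mlookup m (Suc lv, b) = 0) \<Longrightarrow> mcoeff (mcomp g (sub lv)) m = mcoeff (mcomp f (sub lv)) m"
proof -
  have "g \<in> LL.orbit_ideal \<and> mfps_in (Xv - Inr ` set bs) g
    \<and> (\<forall>m. (\<forall>b\<in>set bs. mlookup m (Inr b) = 0) \<longrightarrow> mcoeff g m = mcoeff f m)
    \<and> (\<forall>lv m. (\<forall>b\<in>set bs. mlookup m (Suc lv, b) = 0) \<longrightarrow> mcoeff (mcomp g (sub lv)) m = mcoeff (mcomp f (sub lv)) m)"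
    using assms(1) unfolding g_def
  proof (induction bs)
    case Nil
    then show ?case using assms(2) by (simp add: LL.orbit_ideal_def)
  next
    case (Cons b bs)
    let ?g = "foldr (\<lambda>b. mset0 (Inr b)) bs f"
    have IH: "?g \<in> LL.orbit_ideal" "mfps_in (Xv - Inr ` set bs) ?g"
      "\<And>m. (\<forall>b\<in>set bs. mlookup m (Inr b) = 0) \<Longrightarrow> mcoeff ?g m = mcoeff f m"
      "\<And>lv m. (\<forall>b\<in>set bs. mlookup m (Suc lv, b) = 0) \<Longrightarrow> mcoeff (mcomp ?g (sub lv)) m = mcoeff (mcomp f (sub lv)) m"
      using Cons by auto
    have b: "b < n" using Cons.prems by simp
    have g_in: "mfps_in Xv ?g" using IH(2) by (rule mfps_in_mono) auto
    have "mset0 (Inr b) ?g \<in> LL.orbit_ideal" using b by (intro LL.orbit_ideal_mset0 IH(1) LL_partial_t) auto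
    moreover have "mfps_in (Xv - Inr ` set (b # bs)) (mset0 (Inr b) ?g)"
      using mfps_in_mset0 [OF IH(2), of "Inr b"] by (rule mfps_in_mono) auto
    moreover have "mcoeff (mcomp (mset0 (Inr b) ?g) (sub lv)) m = mcoeff (mcomp ?g (sub lv)) m"
      if m: "mlookup m (Suc lv, b) = 0" for lv m
    proof -
      interpret s: msubst Xv "sub lv" by (rule msubst_sub)
      obtain g1 where g1: "?g = mset0 (Inr b) ?g + mvar (Inr b) * g1" "mfps_in Xv g1"
        using mset0_decomp [of ?g "Inr b"] g_in by metis
      have "mcomp ?g (sub lv) = mcomp (mset0 (Inr b) ?g) (sub lv) + mvar (Suc lv, b) * mcomp g1 (sub lv)"
        using b g_in g1(2) by (subst g1(1)) (simp add: s.mcomp_add s.mcomp_mult s.mcomp_mvar mfps_in_mset0_same mfps_in_intros)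
      then show ?thesis using m by (simp add: mcoeff_mvar_mult(2) in_keys_iff)
    qed
    ultimately show ?case using IH(3,4) by (auto simp: mcoeff_mset0)
  qed
  then show "g \<in> LL.orbit_ideal" "mfps_in (Xv - Inr ` set bs) g"
    "\<And>m. (\<forall>b\<in>set bs. mlookup m (Inr b) = 0) \<Longrightarrow> mcoeff g m = mcoeff f m"
    "\<And>lv m. (\<forall>b\<in>set bs. mlookup m (Suc lv, b) = 0) \<Longrightarrow> mcoeff (mcomp g (sub lv)) m = mcoeff (mcomp f (sub lv)) m"
    by auto
qed

lemma restrict_t:
  assumes "f \<in> LL.orbit_ideal"
  shows "restrict_t f \<in> LL.orbit_ideal" "mfps_in (range Inl) (restrict_t f)"
    "\<And>m. (\<forall>b<n. mlookup m (Inr b) = 0) \<Longrightarrow> mcoeff (restrict_t f) m = mcoeff f m"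
    "\<And>lv m. (\<forall>b<n. mlookup m (Suc lv, b) = 0) \<Longrightarrow> mcoeff (mcomp (restrict_t f) (sub lv)) m = mcoeff (mcomp f (sub lv)) m"
proof -
  have s: "set [0..<n] \<subseteq> {..<n}" by auto
  note a = restrict_t_aux [OF s assms]
  show "restrict_t f \<in> LL.orbit_ideal" using a(1) by (simp add: restrict_t_def)
  show "mfps_in (range Inl) (restrict_t f)"
    unfolding restrict_t_def using a(2) by (rule mfps_in_mono) (auto simp: Xv_def)
  show "\<And>m. (\<forall>b<n. mlookup m (Inr b) = 0) \<Longrightarrow> mcoeff (restrict_t f) m = mcoeff f m"
    unfolding restrict_t_def using a(3) by auto
  show "\<And>lv m. (\<forall>b<n. mlookup m (Suc lv, b) = 0) \<Longrightarrow> mcoeff (mcomp (restrict_t f) (sub lv)) m = mcoeff (mcomp f (sub lv)) m"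
    unfolding restrict_t_def using a(4) by auto
qed

text \<open>Extends the vanishing from series in \<zeta> to the whole ideal. A coefficient
  containing a variable of level \<open>Suc lv\<close> comes from a t-derivative, which is again in
  the ideal, at a monomial of lower degree; any other coefficient is unchanged by
  \<open>restrict_t\<close>.\<close>

lemma orbit_ideal_comp_sub:
  assumes IH: "\<And>h. h \<in> LL.orbit_ideal \<Longrightarrow> mfps_in (range Inl) h \<Longrightarrow> mcomp h (sub lv) = 0"
    and g: "g \<in> LL.orbit_ideal"
  shows "mcomp g (sub lv) = 0"
proof (rule mfps_eqI)
  fix m
  interpret s: msubst Xv "sub lv" by (rule msubst_sub)
  have "mcoeff (mcomp g (sub lv)) m = 0" if "g \<in> LL.orbit_ideal" for g
    using that
  proof (induction "mdeg m" arbitrary: m g rule: less_induct)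
    case less
    show ?case
    proof (cases "\<exists>b<n. mlookup m (Suc lv, b) \<noteq> 0")
      case True
      then obtain b where b: "b < n" "(Suc lv, b) \<in> mkeys m" by (auto simp: in_keys_iff)
      from b(2) obtain m' where m: "m = m' + unit_exp (Suc lv, b)" by (rule unit_exp_decomp)
      have g_in: "mfps_in Xv g" using less.prems by (simp add: LL.orbit_ideal_def)
      have old: "mderiv (Suc lv, b) (segre_iter \<gamma> lv l) = 0" for l
        by (rule mderiv_eq_0 [of "T lv"]) (use segre_iter_in in \<open>auto simp: T_def\<close>)
      have "mderiv (Suc lv, b) (mcomp g (sub lv)) = (\<Sum>w\<in>Xv. mcomp (mderiv w g) (sub lv) * mderiv (Suc lv, b) (sub lv w))"
        by (rule s.mderiv_mcomp [OF g_in])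
      also have "\<dots> = (\<Sum>w\<in>Xv. if w = Inr b then mcomp (mderiv w g) (sub lv) else 0)"
      proof (intro sum.cong refl)
        fix w show "mcomp (mderiv w g) (sub lv) * mderiv (Suc lv, b) (sub lv w) = (if w = Inr b then mcomp (mderiv w g) (sub lv) else 0)"
          by (cases w) (auto simp: old mderiv_mvar)
      qed
      also have "\<dots> = mcomp (mderiv (Inr b) g) (sub lv)" using b(1) by simp
      finally have "mderiv (Suc lv, b) (mcomp g (sub lv)) = mcomp (mderiv (Inr b) g) (sub lv)" .
      moreover have "mderiv (Inr b) g \<in> LL.orbit_ideal"
        using LL.orbit_ideal_vderiv [OF less.prems LL_partial_t [OF b(1)]] b(1) by (simp add: vderiv_unit)
      then have "mcoeff (mcomp (mderiv (Inr b) g) (sub lv)) m' = 0" by (intro less.hyps) (simp_all add: m)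
      ultimately show ?thesis by (simp add: m mcoeff_add_unit_exp)
    next
      case False
      then show ?thesis using restrict_t [OF less.prems] IH by (metis mcoeff_zero)
    qed
  qed
  then show "mcoeff (mcomp g (sub lv)) m = mcoeff 0 m" using g by simp
qed

text \<open>If \<open>h(\<zeta>)\<close> lies in the ideal then so does \<open>cnj h(\<gamma>(\<zeta>, t))\<close>, and with it all its Taylor
  coefficients with respect to \<open>t\<close>, to which the induction hypothesis applies.\<close>

lemma orbit_ideal_vanishes:
  "h \<in> LL.orbit_ideal \<Longrightarrow> mfps_in (range Inl) h \<Longrightarrow> mcomp h (sub lv) = 0"
proof (induction lv arbitrary: h)
  case 0
  \<comment> \<open>\<open>sub 0\<close> maps every \<zeta> to 0, so only the constant term of
    \<open>h\<close> survives, and that term is 0.\<close>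
  obtain h' where h': "\<And>v. v \<in> range Inl \<Longrightarrow> mfps_in (range Inl) (h' v)"
    "h = mconst (mcoeff h 0) + (\<Sum>v\<in>range Inl. mvar v * h' v)"
    using mfps_decomp [of "range Inl" h] 0 by auto
  have h'_in: "mfps_in Xv (h' v)" if "v \<in> range Inl" for v
    using h'(1) [OF that] by (rule mfps_in_mono) (auto simp: Xv_def)
  interpret s: msubst Xv "sub 0" by (rule msubst_sub)
  have "mcomp (\<Sum>v\<in>range Inl. mvar v * h' v) (sub 0) = (\<Sum>v\<in>range Inl. mcomp (mvar v * h' v) (sub 0))"
    by (rule s.mcomp_sum) (auto intro!: mfps_in_intros h'_in)
  also have "\<dots> = 0"
    by (intro sum.neutral ballI) (auto simp: s.mcomp_mult s.mcomp_mvar mfps_in_mvar h'_in)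
  finally have *: "mcomp (\<Sum>v\<in>range Inl. mvar v * h' v) (sub 0) = 0" .
  have "mcoeff h 0 = 0" using LL.orbit_ideal_coeff_0 [OF 0(1)] .
  then have "h = (\<Sum>v\<in>range Inl. mvar v * h' v)" using h'(2) by simp
  with * show ?case by simp
next
  case (Suc lv)
  let ?X = "range Inl :: ('a + nat) set"
  note h = Suc.prems
  \<comment> \<open>Reads \<open>h\<close> as a series in (Z, \<zeta>). The value at t is a default,
    as \<open>h\<close> contains no t.\<close>
  define \<sigma> :: "'a + nat \<Rightarrow> ('a + 'a) mfps" where "\<sigma> = case_sum (\<lambda>i. mvar (Inr i)) (\<lambda>_. 0)"
  interpret sg: msubst ?X \<sigma> by unfold_locales (auto simp: \<sigma>_def)
  define H where "H = mcomp h \<sigma>"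
  have "mcomp H \<pi> = mcomp h (\<lambda>w. mcomp (\<sigma> w) \<pi>)"
    unfolding H_def by (rule sg.mcomp_assoc [of UNIV]) (use h in auto)
  also have "\<dots> = mcomp h mvar"
    using h(2) by (rule mcomp_cong) (auto simp: \<sigma>_def pi.mcomp_mvar)
  also have "\<dots> = h" by (rule mcomp_mvar_id [OF _ h(2)]) simp
  finally have "H \<in> JS" using h(1) by (intro JS_of_orbit_ideal) simp
  then have orb: "mcomp (mstar H) \<pi> \<in> LL.orbit_ideal" by (intro orbit_ideal_of_JS JS_mstar)
  \<comment> \<open>The same with Z in place of \<zeta>, which is where conjugation moves the
    variables of \<open>H\<close>.\<close>
  define \<sigma>' :: "'a + nat \<Rightarrow> ('a + 'a) mfps" where "\<sigma>' = case_sum (\<lambda>i. mvar (Inl i)) (\<lambda>_. 0)"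
  interpret sg': msubst ?X \<sigma>' by unfold_locales (auto simp: \<sigma>'_def)
  have hc: "mfps_in ?X (mcnj h)" using h(2) by (rule mfps_in_mcnj)
  have "mcomp H (\<lambda>v. mvar (conj_index v)) = mcomp h (\<lambda>w. mcomp (\<sigma> w) (\<lambda>v. mvar (conj_index v)))"
    unfolding H_def by (rule sg.mcomp_assoc [of UNIV]) (use h in auto)
  also have "\<dots> = mcomp h \<sigma>'"
    using h(2) by (rule mcomp_cong) (auto simp: \<sigma>_def \<sigma>'_def conj_subst.mcomp_mvar)
  finally have "mstar H = mcnj (mcomp h \<sigma>')" by (simp add: mstar_def)
  also have "\<dots> = mcomp (mcnj h) (\<lambda>w. mcnj (\<sigma>' w))" by (rule sg'.mcnj_mcomp [OF h(2)])
  also have "\<dots> = mcomp (mcnj h) \<sigma>'" using hc by (rule mcomp_cong) (auto simp: \<sigma>'_def)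
  finally have mstarH: "mstar H = mcomp (mcnj h) \<sigma>'" .
  have "0 = mcomp (mcomp (mstar H) \<pi>) (sub lv)"
    using orbit_ideal_comp_sub [OF Suc.IH orb] by simp
  also have "\<dots> = mcomp (mstar H) (\<Phi> lv)" by (simp add: mcomp_\<Phi>)
  also have "\<dots> = mcomp (mcnj h) (\<lambda>w. mcomp (\<sigma>' w) (\<Phi> lv))"
    unfolding mstarH by (rule sg'.mcomp_assoc [of UNIV]) (use hc msubst.F0 [OF msubst_\<Phi>] in auto)
  \<comment> \<open>\<open>mstar H\<close> depends on Z only, and the Z-part of \<Phi> is the Segre
    mapping of level \<open>Suc lv\<close>: conjugation has raised the level by one.\<close>
  also have "\<dots> = mcomp (mcnj h) (\<lambda>w. mcnj (sub (Suc lv) w))"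
    using hc by (rule mcomp_cong) (auto simp: \<sigma>'_def msubst.mcomp_mvar [OF msubst_\<Phi>] \<Phi>_simps(1) simp del: segre_iter.simps)
  also have "\<dots> = mcnj (mcomp h (sub (Suc lv)))"
  proof -
    interpret s: msubst ?X "sub (Suc lv)" by unfold_locales (auto simp: sub_0)
    show ?thesis using s.mcnj_mcomp [OF h(2)] by simp
  qed
  finally show ?case by simp
qed

text \<open>The projection of the Lie algebra at 0 to the \<zeta>-space, expressed through the
  lifted fields.\<close>

definition Gz :: "(complex ^ 'a) set"
  where "Gz = (\<lambda>y. \<chi> i. mcoeff (y (Inl i)) 0) ` LL"

lemma subspace_Gz: "vec.subspace Gz"
proof (rule vec.subspaceI)
  show "0 \<in> Gz" unfolding Gz_def using LL_zero by (rule image_eqI [rotated]) (simp add: vec_eq_iff)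
next
  fix x y assume "x \<in> Gz" "y \<in> Gz"
  then obtain y1 y2 where "y1 \<in> LL" "x = (\<chi> i. mcoeff (y1 (Inl i)) 0)" "y2 \<in> LL" "y = (\<chi> i. mcoeff (y2 (Inl i)) 0)"
    by (auto simp: Gz_def)
  then show "x + y \<in> Gz" unfolding Gz_def
    by (intro image_eqI [OF _ LL_add [of y1 y2 1]]) (auto simp: vec_eq_iff)
next
  fix c x assume "x \<in> Gz"
  then obtain y1 where "y1 \<in> LL" "x = (\<chi> i. mcoeff (y1 (Inl i)) 0)" by (auto simp: Gz_def)
  then show "c *s x \<in> Gz" unfolding Gz_def
    by (intro image_eqI [OF _ LL_add [of "\<lambda>s. 0" y1 "mconst c"]]) (auto simp: vec_eq_iff LL_zero)
qed

text \<open>On the values at 0, the kernel of the projection to \<zeta> contains the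
  \<open>n\<close> independent vectors given by the fields \<open>Lvf a\<close>.\<close>

lemma dim_Gz: "vec.dim Gz + n \<le> CR_lie_dim M d r"
proof -
  define g0 where "g0 = vec.span ((\<lambda>X. X 0) ` CR_lie_algebra M d r)"
  define Pc :: "complex ^ ('a + 'a) \<Rightarrow> complex ^ 'a" where "Pc = (\<lambda>x. \<chi> i. x $ Inr i)"
  have lin: "Vector_Spaces.linear (*s) (*s) Pc"
    by unfold_locales (simp_all add: Pc_def vec_eq_iff algebra_simps)
  have "Gz \<subseteq> Pc ` g0"
  proof
    fix x assume "x \<in> Gz"
    then obtain y where y: "y \<in> LL" "x = (\<chi> i. mcoeff (y (Inl i)) 0)" by (auto simp: Gz_def)
    obtain I c where I: "finite I" "I \<subseteq> ghat" "\<And>Y. Y \<in> I \<Longrightarrow> mfps_in Xv (c Y)"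
      "\<And>v. vderiv Xv y (\<pi> v) = (\<Sum>Y\<in>I. c Y * mcomp (Y v) \<pi>)" using y(1) by (rule LL_E) (assumption | rule that)+
    define z where "z = (\<Sum>Y\<in>I. mcoeff (c Y) 0 *s (\<chi> v. mcoeff (Y v) 0) :: complex ^ ('a + 'a))"
    have "(\<chi> v. mcoeff (Y v) 0) \<in> g0" if "Y \<in> I" for Y
    proof -
      obtain X where X: "X \<in> CR_lie_algebra M d r" "Y = taylor_vf X" using I(2) \<open>Y \<in> I\<close> by (auto simp: ghat_def)
      then have "(\<chi> v. mcoeff (Y v) 0) = X 0" by (simp add: vec_eq_iff mcoeff_taylor_vf_0)
      then show ?thesis unfolding g0_def using X(1) by (auto intro: vec.span_base)
    qed
    then have "z \<in> g0" unfolding z_def g0_def by (intro vec.span_sum vec.span_scale) auto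
    moreover have "x = Pc z"
    proof (subst vec_eq_iff, intro allI)
      fix i
      have "vderiv Xv y (\<pi> (Inr i)) = (\<Sum>s\<in>Xv. if s = Inl i then y s else 0)"
        unfolding vderiv_def by (intro sum.cong) (auto simp: mderiv_mvar)
      then have "y (Inl i) = (\<Sum>Y\<in>I. c Y * mcomp (Y (Inr i)) \<pi>)" using I(4) [of "Inr i"] by simp
      then show "x $ i = Pc z $ i" by (simp add: y(2) Pc_def z_def)
    qed
    ultimately show "x \<in> Pc ` g0" by blast
  qed
  then have "vec.dim Gz \<le> vec.dim (Pc ` g0)" by (rule vec.dim_subset)
  moreover have "n \<le> vec.dim {x \<in> g0. Pc x = 0}"
  proof -
    let ?L = "\<lambda>a. Lvf a (0 :: complex ^ 'a)"
    have ind0: "(\<Sum>a\<in>A. q a *s ?L a) = 0 \<Longrightarrow> b \<in> A \<Longrightarrow> q b = 0" for q b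
    proof -
      assume z: "(\<Sum>a\<in>A. q a *s ?L a) = 0" and b: "b \<in> A"
      have "0 = (\<Sum>m\<in>UNIV. u b $ m * (\<Sum>a\<in>A. q a *s ?L a) $ Inl m)" by (simp add: z)
      also have "\<dots> = (\<Sum>a\<in>A. q a * (\<Sum>m\<in>UNIV. u b $ m * C 0 $ m $ a))"
        by (simp add: Lvf_def sum_distrib_left mult_ac) (rule sum.swap)
      also have "\<dots> = (\<Sum>a\<in>A. if a = b then q a else 0)" by (intro sum.cong) (auto simp: uC [OF zeroV b])
      finally show "q b = 0" using b finite_A by simp
    qed
    have inj: "inj_on ?L A"
    proof (rule inj_onI)
      fix a b assume ab: "a \<in> A" "b \<in> A" "?L a = ?L b"
      have "C 0 $ m $ a = C 0 $ m $ b" for m using arg_cong [OF ab(3), of "\<lambda>x. x $ Inl m"] by (simp add: Lvf_def)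
      then have "(\<Sum>i\<in>UNIV. u a $ i * C 0 $ i $ a) = (\<Sum>i\<in>UNIV. u a $ i * C 0 $ i $ b)" by simp
      then have "(1 :: complex) = (if b = a then 1 else 0)" unfolding uC [OF zeroV ab(1)] by simp
      then show "a = b" by (simp split: if_splits)
    qed
    have "vec.independent (?L ` A)"
    proof -
      have "\<forall>v\<in>?L ` A. q v = 0" if "(\<Sum>v\<in>?L ` A. q v *s v) = 0" for q
        using ind0 [of "\<lambda>a. q (?L a)"] that by (auto simp: sum.reindex [OF inj])
      then show ?thesis using vec.dependent_finite [of "?L ` A"] finite_A by blast
    qed
    moreover have "?L ` A \<subseteq> {x \<in> g0. Pc x = 0}"
      using Lvf_CR by (auto simp: g0_def Pc_def Lvf_def vec_eq_iff intro!: vec.span_base)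
    ultimately have "card (?L ` A) \<le> vec.dim {x \<in> g0. Pc x = 0}" by (intro vec.independent_card_le_dim)
    then show ?thesis by (simp add: card_image [OF inj] card_A n_def)
  qed
  moreover have "vec.dim g0 = vec.dim (Pc ` g0) + vec.dim {x \<in> g0. Pc x = 0}"
    by (rule vec_dim_image_kernel [OF _ lin]) (simp add: g0_def)
  ultimately show ?thesis by (simp add: g0_def CR_lie_dim_def)
qed

text \<open>The frame for Nagano's theorem comes from \<open>p\<close>: lifts of the images of the
  unit vectors in the \<zeta>-directions, and the derivations along t. Restriction to t = 0 keeps
  the \<zeta>-differential of the series obtained.\<close>

lemma orbit_ideal_differential:
  assumes \<theta>: "\<And>x. x \<in> Gz \<Longrightarrow> (\<Sum>i\<in>UNIV. \<theta> i * x $ i) = 0"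
    and p: "Vector_Spaces.linear (*s) (*s) p" "\<And>x. p x \<in> Gz" "\<And>x. x \<in> Gz \<Longrightarrow> p x = x"
  obtains h where "h \<in> LL.orbit_ideal" "mfps_in (range Inl) h" "\<And>i. mcoeff (mderiv (Inl i) h) 0 = \<theta> i"
proof -
  have "\<forall>i. \<exists>y. y \<in> LL \<and> p (axis i 1) = (\<chi> l. mcoeff (y (Inl l)) 0)" using p(2) unfolding Gz_def by blast
  then obtain Q where Q: "\<And>i. Q i \<in> LL" "\<And>i. p (axis i 1) = (\<chi> l. mcoeff (Q i (Inl l)) 0)" by metis
  define dt :: "nat \<Rightarrow> 'a + nat \<Rightarrow> ('a + nat) mfps" where "dt = (\<lambda>b s. if s = Inr b then 1 else 0)"
  \<comment> \<open>Multiples of the derivations along t are subtracted to make the constant terms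
    of \<open>P\<close> block diagonal, with block \<open>p\<close> for \<zeta> and the identity for
    t.\<close>
  define P where "P = case_sum (\<lambda>i s. Q i s + (\<Sum>b<n. mconst (- mcoeff (Q i (Inr b)) 0) * dt b s)) dt"
  have P_LL: "P s \<in> LL" if "s \<in> Xv" for s
  proof (cases s)
    case (Inl i)
    have "(\<lambda>s. Q i s + (\<Sum>b<n. mconst (- mcoeff (Q i (Inr b)) 0) * dt b s)) \<in> LL"
      by (intro LL_sum Q) (auto simp: dt_def LL_partial_t)
    then show ?thesis by (simp add: P_def Inl)
  qed (use that LL_partial_t in \<open>simp add: P_def dt_def\<close>)
  have P0: "mcoeff (P (Inl i) (Inl l)) 0 = p (axis i 1) $ l" "mcoeff (P (Inr b) (Inl l)) 0 = 0" for i l b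
    by (simp_all add: P_def dt_def Q(2))
  have P0r: "mcoeff (P (Inr b) (Inr b')) 0 = (if b' = b then 1 else 0)" for b b'
    by (simp add: P_def dt_def)
  have P0r': "mcoeff (P (Inl i) (Inr b')) 0 = 0" if "b' < n" for i b'
  proof -
    have "(\<Sum>b<n. mcoeff (Q i (Inr b)) 0 * mcoeff (dt b (Inr b')) 0) = (\<Sum>b<n. if b = b' then mcoeff (Q i (Inr b)) 0 else 0)"
      by (intro sum.cong) (auto simp: dt_def)
    then show ?thesis using that by (simp add: P_def sum_negf)
  qed
  have split: "(\<Sum>s\<in>Xv. f s) = (\<Sum>i\<in>UNIV. f (Inl i)) + (\<Sum>b<n. f (Inr b))" for f :: "'a + nat \<Rightarrow> complex"
    unfolding Xv_def by (subst sum.union_disjoint) (auto simp: sum.reindex)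
  have proj: "mcoeff (y t) 0 = (\<Sum>s\<in>Xv. mcoeff (y s) 0 * mcoeff (P s t) 0)" if y: "y \<in> LL" and t: "t \<in> Xv" for y t
  proof (cases t)
    case (Inl l)
    interpret p: Vector_Spaces.linear "(*s)" "(*s)" p by (rule p(1))
    define x :: "complex ^ 'a" where "x = (\<chi> i. mcoeff (y (Inl i)) 0)"
    have "x = (\<Sum>i\<in>UNIV. x $ i *s axis i 1)"
      by (simp add: vec_eq_iff axis_def if_distrib cong: if_cong)
    then have "p x = (\<Sum>i\<in>UNIV. x $ i *s p (axis i 1))" by (metis (no_types, lifting) p.sum p.scale sum.cong)
    moreover have "p x = x" using p(3) y by (auto simp: Gz_def x_def)
    ultimately have "x $ l = (\<Sum>i\<in>UNIV. x $ i * p (axis i 1) $ l)" by (metis (no_types, lifting) sum.cong sum_component vector_smult_component)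
    then show ?thesis by (simp add: split Inl P0 x_def)
  next
    case (Inr b')
    then have "b' < n" using t by simp
    then show ?thesis by (simp add: split Inr P0r P0r' if_distrib cong: if_cong)
  qed
  interpret F: formal_lie_algebra_frame Xv LL P
    by unfold_locales (fact P_LL, fact proj)
  have "(\<Sum>s\<in>Xv. case_sum \<theta> (\<lambda>_. 0) s * mcoeff (y s) 0) = 0" if "y \<in> LL" for y
    using \<theta> [of "\<chi> i. mcoeff (y (Inl i)) 0"] that by (auto simp: split Gz_def)
  then obtain f where f: "mfps_in Xv f" "mcoeff f 0 = 0"
    "\<And>s. s \<in> Xv \<Longrightarrow> mcoeff (mderiv s f) 0 = case_sum \<theta> (\<lambda>_. 0) s"
    "\<And>ys. set ys \<subseteq> LL \<Longrightarrow> mcoeff (viter Xv ys f) 0 = 0"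
    using F.formal_nagano [of "case_sum \<theta> (\<lambda>_. 0)"] by blast
  then have f_orb: "f \<in> LL.orbit_ideal" by (simp add: LL.orbit_ideal_def)
  show thesis
  proof
    show "restrict_t f \<in> LL.orbit_ideal" "mfps_in (range Inl) (restrict_t f)" using restrict_t [OF f_orb] by auto
    fix i
    have "mcoeff (restrict_t f) (unit_exp (Inl i)) = mcoeff f (unit_exp (Inl i))"
      by (rule restrict_t(3) [OF f_orb]) simp
    then show "mcoeff (mderiv (Inl i) (restrict_t f)) 0 = \<theta> i"
      using f(3) [of "Inl i"] by (simp add: mcoeff_mderiv)
  qed
qed

text \<open>For a projection \<open>p\<close> onto \<open>Gz\<close>, each row of
  \<open>1 - p\<close> is the differential at 0 of a series \<open>h i\<close> in the ideal. Since
  \<open>h i\<close> vanishes on the conjugate Segre mapping, differentiation yields linear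
  equations that confine the Jacobian columns to a space of dimension at most the rank of
  \<open>p\<close>.\<close>

theorem segre_rank_le: "segre_rank d \<gamma> lv + n \<le> CR_lie_dim M d r"
proof -
  obtain p where p: "p ` UNIV \<subseteq> Gz" "Vector_Spaces.linear (*s) (*s) p" "\<And>x. x \<in> Gz \<Longrightarrow> p (id x) = x"
    using vec.linear_exists_left_inverse_on [OF vec.linear_id subspace_Gz] by auto
  interpret p: Vector_Spaces.linear "(*s)" "(*s)" p by (rule p(2))
  have p_Gz: "p x \<in> Gz" and p_id: "x \<in> Gz \<Longrightarrow> p x = x" for x using p by auto
  define pc where "pc = (\<lambda>i l. p (axis l 1) $ i)"
  have p_pc: "p x $ i = (\<Sum>l\<in>UNIV. pc i l * x $ l)" for x i
  proof -
    have "(matrix p *v x) $ i = (\<Sum>l\<in>UNIV. pc i l * x $ l)"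
      by (simp add: matrix_vector_mult_def matrix_def pc_def)
    then show ?thesis by (simp only: matrix_works [OF p(2)])
  qed
  have "\<exists>h. h \<in> LL.orbit_ideal \<and> mfps_in (range Inl) h \<and>
      (\<forall>l. mcoeff (mderiv (Inl l) h) 0 = (if l = i then 1 else 0) - pc i l)" for i
  proof -
    have ann: "(\<Sum>l\<in>UNIV. ((if l = i then 1 else 0) - pc i l) * x $ l) = 0" if "x \<in> Gz" for x
    proof -
      have "(\<Sum>l\<in>UNIV. ((if l = i then 1 else 0) - pc i l) * x $ l) = x $ i - p x $ i"
        by (simp add: p_pc left_diff_distrib sum_subtractf if_distrib [of "\<lambda>c. c * _"] cong: if_cong)
      then show ?thesis using p_id [OF that] by simp
    qed
    show ?thesis
    proof (rule orbit_ideal_differential [of "\<lambda>l. (if l = i then 1 else 0) - pc i l" p])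
      fix h :: "('a + nat) mfps"
      assume "h \<in> LL.orbit_ideal" "mfps_in (range Inl) h"
        "\<And>l. mcoeff (mderiv (Inl l) h) 0 = (if l = i then 1 else 0) - pc i l"
      then show ?thesis by blast
    qed (fact ann, fact p(2), fact p_Gz, fact p_id)
  qed
  then obtain h where h: "\<And>i. h i \<in> LL.orbit_ideal" "\<And>i. mfps_in (range Inl) (h i)"
    "\<And>i l. mcoeff (mderiv (Inl l) (h i)) 0 = (if l = i then 1 else 0) - pc i l" by metis
  interpret s: msubst "range Inl" "sub lv" by unfold_locales (auto simp: sub_0)
  define \<Theta> where "\<Theta> = (\<lambda>i l. mcomp (mderiv (Inl l) (h i)) (sub lv))"
  \<comment> \<open>Along \<open>sub lv\<close> the differentials of the \<open>h i\<close> are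
    \<open>1 - p - E\<close>, with \<open>E\<close> zero at the origin, so every Jacobian column
    satisfies \<open>x = p x + E x\<close>.\<close>
  define E where "E = (\<lambda>i l. (if i = l then 1 else 0) - mconst (pc i l) - \<Theta> i l)"
  have E0: "mcoeff (E i l) 0 = 0" for i l
    by (auto simp: E_def \<Theta>_def h mfps_in_mderiv)
  have fin: "finite (UNIV :: 'a set)" by simp
  obtain K where K0: "\<And>i j. i \<in> UNIV \<Longrightarrow> j \<in> UNIV \<Longrightarrow> K i j = (if i = j then 1 else 0) + (\<Sum>l\<in>UNIV. K i l * E l j)"
    "\<And>i j. i \<in> UNIV \<Longrightarrow> j \<in> UNIV \<Longrightarrow> mfps_in UNIV (K i j)"
    using neumann_series [OF fin, of E UNIV] E0 mfps_in_UNIV by blast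
  obtain Bz where Bz: "Bz \<subseteq> Gz" "vec.independent Bz" "Gz \<subseteq> vec.span Bz" "card Bz = vec.dim Gz"
    using vec.basis_exists by blast
  have finBz: "finite Bz" using Bz(2) vec.finiteI_independent by blast
  have "\<exists>q. p (axis l 1) = (\<Sum>\<beta>\<in>Bz. q \<beta> *s \<beta>)" for l
  proof -
    have "p (axis l 1) \<in> vec.span (id ` Bz)" using p_Gz Bz(3) by auto
    from vec_span_image_finite [OF finBz this] show ?thesis by (metis (no_types, lifting) id_apply sum.cong)
  qed
  then obtain q where q: "\<And>l. p (axis l 1) = (\<Sum>\<beta>\<in>Bz. q l \<beta> *s \<beta>)" by metis
  \<comment> \<open>The solution is \<open>x = K p x\<close>, so the images under \<open>K\<close>
    of a basis of \<open>Gz\<close> span all Jacobian columns.\<close>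
  define N where "N = (\<lambda>\<beta>. embv (\<lambda>i. \<Sum>j\<in>UNIV. K i j * mconst (\<beta> $ j)))"
  have "embv (\<lambda>i. mcnj (mderiv t (segre_iter \<gamma> lv i))) \<in> vec.span (N ` Bz)" for t
  proof -
    define x where "x = (\<lambda>l. mderiv t (sub lv (Inl l)))"
    have rel: "(\<Sum>l\<in>UNIV. \<Theta> i l * x l) = 0" for i
    proof -
      have "0 = mderiv t (mcomp (h i) (sub lv))" using orbit_ideal_vanishes [OF h(1,2)] by simp
      also have "\<dots> = (\<Sum>w\<in>range Inl. mcomp (mderiv w (h i)) (sub lv) * mderiv t (sub lv w))"
        by (rule s.mderiv_mcomp [OF h(2)])
      also have "\<dots> = (\<Sum>l\<in>UNIV. \<Theta> i l * x l)" by (simp add: sum.reindex \<Theta>_def x_def)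
      finally show ?thesis by simp
    qed
    have xe: "x i = (\<Sum>l\<in>UNIV. mconst (pc i l) * x l) + (\<Sum>l\<in>UNIV. E i l * x l)" for i
      by (simp add: E_def left_diff_distrib sum_subtractf rel if_distrib [of "\<lambda>c. c * _"] cong: if_cong)
    have x: "x i = (\<Sum>j\<in>UNIV. K i j * (\<Sum>l\<in>UNIV. mconst (pc j l) * x l))" for i
    proof (rule neumann_solve [OF fin])
      show "K i j = (if i = j then 1 else 0) + (\<Sum>l\<in>UNIV. K i l * E l j)" for i j by (rule K0(1)) simp_all
      show "x i = (\<Sum>l\<in>UNIV. mconst (pc i l) * x l) + (\<Sum>j\<in>UNIV. E i j * x j)" for i by (rule xe)
    qed simp
    have pcq: "mconst (pc j l) = (\<Sum>\<beta>\<in>Bz. mconst (q l \<beta>) * mconst (\<beta> $ j))" for j l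
      by (simp add: pc_def q mconst_sum mconst_mult)
    have xb: "x i = (\<Sum>\<beta>\<in>Bz. (\<Sum>l\<in>UNIV. mconst (q l \<beta>) * x l) * (\<Sum>j\<in>UNIV. K i j * mconst (\<beta> $ j)))" for i
    proof -
      have "x i = (\<Sum>j\<in>UNIV. \<Sum>l\<in>UNIV. \<Sum>\<beta>\<in>Bz. K i j * mconst (\<beta> $ j) * (mconst (q l \<beta>) * x l))"
        by (subst x) (simp add: pcq sum_distrib_left sum_distrib_right mult_ac)
      also have "\<dots> = (\<Sum>j\<in>UNIV. \<Sum>\<beta>\<in>Bz. \<Sum>l\<in>UNIV. K i j * mconst (\<beta> $ j) * (mconst (q l \<beta>) * x l))"
        by (intro sum.cong refl) (rule sum.swap)
      also have "\<dots> = (\<Sum>\<beta>\<in>Bz. \<Sum>j\<in>UNIV. \<Sum>l\<in>UNIV. K i j * mconst (\<beta> $ j) * (mconst (q l \<beta>) * x l))"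
        by (rule sum.swap)
      also have "\<dots> = (\<Sum>\<beta>\<in>Bz. (\<Sum>l\<in>UNIV. mconst (q l \<beta>) * x l) * (\<Sum>j\<in>UNIV. K i j * mconst (\<beta> $ j)))"
        unfolding sum_product
        by (rule sum.cong [OF refl], subst sum.swap, rule sum.cong [OF refl], rule sum.cong [OF refl]) (simp only: mult_ac)
      finally show ?thesis .
    qed
    have "embv x = (\<Sum>\<beta>\<in>Bz. emb (\<Sum>l\<in>UNIV. mconst (q l \<beta>) * x l) *s N \<beta>)"
    proof (subst vec_eq_iff, intro allI)
      fix i
      have "embv x $ i = emb (\<Sum>\<beta>\<in>Bz. (\<Sum>l\<in>UNIV. mconst (q l \<beta>) * x l) * (\<Sum>j\<in>UNIV. K i j * mconst (\<beta> $ j)))"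
        unfolding embv_nth by (rule arg_cong [OF xb])
      also have "\<dots> = (\<Sum>\<beta>\<in>Bz. emb (\<Sum>l\<in>UNIV. mconst (q l \<beta>) * x l) *s N \<beta>) $ i"
        unfolding emb_sum [of _ Bz] by (simp only: N_def sum_component vector_smult_component embv_nth emb_simps)
      finally show "embv x $ i = (\<Sum>\<beta>\<in>Bz. emb (\<Sum>l\<in>UNIV. mconst (q l \<beta>) * x l) *s N \<beta>) $ i" .
    qed
    also have "\<dots> \<in> vec.span (N ` Bz)" by (intro vec.span_sum vec.span_scale vec.span_base) auto
    finally show ?thesis by (simp add: x_def)
  qed
  then have "(\<lambda>t. embv (\<lambda>i. mcnj (mderiv t (segre_iter \<gamma> lv i)))) ` T lv \<subseteq> vec.span (N ` Bz)" by auto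
  from vec_dim_le_card_image [OF finBz this] have "segre_rank d \<gamma> lv \<le> vec.dim Gz"
    unfolding dim_mcnj segre_rank_eq Bz(4) .
  then show ?thesis using dim_Gz by linarith
qed

theorem segre_rank_formula:
  assumes "segre_rank d \<gamma> lv = segre_rank d \<gamma> (Suc lv)"
  shows "int (segre_rank d \<gamma> lv) = int (CR_lie_dim M d r) + int d - int CARD('a)"
  using CR_lie_dim_le [OF assms] segre_rank_le [of lv] d_le by (simp add: n_def)

end

theorem theorem1p2:
  fixes M :: "(complex ^ 'N :: finite) set"
    and U :: "(complex ^ 'N) set"
    and r :: "nat \<Rightarrow> complex ^ 'N \<Rightarrow> real"
    and \<gamma> :: "'N \<Rightarrow> ('N + nat) mfps"
    and d k0 :: nat
    and e :: int
  assumes "smooth_submanifold d M" and "0 \<in> M"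
    and "local_defining M d 0 U r" and "generic_at_0 d r"
    and "segre_variety_mapping d r \<gamma>"
    and "1 \<le> k0" and "k0 \<le> d + 1"
    and "\<forall>j\<ge>k0. segre_rank d \<gamma> j = segre_rank d \<gamma> (j + 1)"
    and "\<forall>j. 1 \<le> j \<and> j \<le> k0 - 1 \<longrightarrow> segre_rank d \<gamma> j < segre_rank d \<gamma> (j + 1)"
    and "e = 2 * int CARD('N) - int d - int (CR_lie_dim M d r)"
  shows "int (segre_rank d \<gamma> k0) = int CARD('N) - e"
proof -
  obtain V C A k u where "CR_frame M d r V C A k u"
    using ex_CR_frame [OF assms(3,4,2)] .
  then have "CR_segre M d r V C A k u \<gamma>"
    using assms(5) by (intro CR_segre.intro CR_segre_axioms.intro)
  moreover have "segre_rank d \<gamma> k0 = segre_rank d \<gamma> (Suc k0)"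
    using assms(8) [rule_format, of k0] by (simp only: Suc_eq_plus1 order_refl)
  ultimately have "int (segre_rank d \<gamma> k0) = int (CR_lie_dim M d r) + int d - int CARD('N)"
    by (rule CR_segre.segre_rank_formula)
  then show ?thesis using assms(10) by (simp only:)
qed

end
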